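(* Let $G$ be a group and let $H\subseteq G$ be a subgroup. Then there exists a unique triangulated functor $\overline{-\rtimes G/H}:kk^G\to kk$ such that $$\overline{-\rtimes G/H}\circ j^G=j\circ\mathcal{R}(-\rtimes G/H):G\mathrm{Alg}_\ell\to kk .$$ Moreover, for every extension $\mathcal{E}:A\to B\to C$ in $G\mathrm{Alg}_\ell$ and every $uH\in G/H$, the following square in $kk$ commutes: $$\begin{array}{ccc}\Omega(C\rtimes uHu^{-1})&\xrightarrow{\ \partial_{\mathcal{E}\rtimes uHu^{-1}}\ }&A\rtimes uHu^{-1}\\ {\scriptstyle\Omega(\nu_{uH})}\downarrow\cong&&\cong\downarrow{\scriptstyle\nu_{uH}}\\ \Omega(\mathcal{R}(C\rtimes G/H))&\xrightarrow{\ \partial_{\mathcal{E}\rtimes G/H}\ }&\mathcal{R}(A\rtimes G/H)\end{array}$$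
   Context: $\ell$ is a commutative unital ring. Algebras are associative, not necessarily unital $\ell$-algebras; a $G$-algebra is an algebra with a left $G$-action by algebra automorphisms; $\otimes=\otimes_\ell$. Categories: $\mathrm{Alg}_\ell$, $G\mathrm{Alg}_\ell$. For a $G$-algebra $D$ and a subgroup $L\subseteq G$, $D\rtimes L=D\otimes\ell[L]$ with $(d\rtimes g)(d'\rtimes g')=d(g\cdot d')\rtimes gg'$. **$kk$ and $kk^G$.** An extension is a short exact sequence $A\to B\to C$ of ($G$-)algebras with an $\ell$-linear ($G$-equivariant) section. A functor $F$ is homotopy invariant if $F(A\subseteq A[t])$ is an isomorphism for all $A$. For an infinite set $X$, $F$ is $M_X$-stable if $a\mapsto e_{x,x}\otimes a$, $A\to M_XA$ (finitely supported $X\times X$-matrices), is sent to an isomorphism. A functor on $G\mathrm{Alg}_\ell$ is $G$-stable if it sends $A\otimes\mathrm{End}^F(W_1)\to A\otimes\mathrm{End}^F(W_1\oplus W_2)$ to isomorphisms, for all $A$ and all nonzero free $\ell$-modules $W_i$ with a basis of cardinality $\le\mathrm{card}(\mathbb{N}\times G)$ and a $G$-action by matrices with finitely many nonzero entries in each row and column; $\mathrm{End}^F$ denotes finitely supported matrices, with the conjugation action. A functor into a triangulated category $(\mathscr{T},\Omega)$ is excisive if it is equipped with morphisms $\partial_{\mathcal{E}}:\Omega F(C)\to F(A)$ for each extension $\mathcal{E}$, natural in extensions, making $\Omega F(C)\to F(A)\to F(B)\to F(C)$ a triangle. $j:\mathrm{Alg}_\ell\to kk$ (with boundary maps $\partial$)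 is the universal homotopy invariant, $M_{\mathbb{N}\times|G|}$-stable, excisive functor to a triangulated category, and $j^G:G\mathrm{Alg}_\ell\to kk^G$ is the universal homotopy invariant, $G$-stable, excisive one. **Crossed product with $G/H$.** A linear category is a non-unital $\ell$-linear category; an algebra is a linear category with one object. $B\rtimes G/H$ is the linear category with object set $G/H$, $\mathrm{Hom}(uH,vH)=B\otimes\ell[vHu^{-1}]$ and $(b\otimes g)\circ(\tilde b\otimes\tilde g)=b(g\cdot\tilde b)\otimes g\tilde g$. For a linear category $\mathcal{C}$, $\mathcal{A}(\mathcal{C})=\bigoplus_{x,y}\mathcal{C}(x,y)$, $T(M)=\bigoplus_{n\ge1}M^{\otimes n}$, and $\mathcal{R}(\mathcal{C})=T(\mathcal{A}(\mathcal{C}))/\langle g\otimes f-g\circ f:f,g\text{ composable}\rangle$; $\mathcal{R}$ is a functor from linear categories to algebras, with $\mathcal{R}(D)=D$ for an algebra $D$. For $uH\in G/H$, $\nu_{uH}:j(B\rtimes uHu^{-1})\to j\mathcal{R}(B\rtimes G/H)$ is the morphism of $kk$ obtained by applying $j\circ\mathcal{R}$ to the inclusion of $B\rtimes uHu^{-1}$ as the full subcategory of $B\rtimes G/H$ on the object $uH$; it is an isomorphism, natural in the $G$-algebra $B$. For an extension $\mathcal{E}:A\to B\to C$ in $G\mathrm{Alg}_\ell$ and a subgroup $L$, $\mathcal{E}\rtimes L$ is the extension $A\rtimes L\to B\rtimes L\to C\rtimes L$, with boundary $\partial_{\mathcal{E}\rtimes L}$ in $kk$; and $\partial_{\mathcal{E}\rtimes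 G/H}:=\nu_H\circ\partial_{\mathcal{E}\rtimes H}\circ\Omega(\nu_H)^{-1}$. The functor $j\mathcal{R}(-\rtimes G/H)$ is regarded as excisive with these boundary maps. The symbol $j$ is omitted in the square. *)

theory Defs
  imports "HOL-Algebra.QuotRing" "HOL-Algebra.Module" "HOL-Library.Equipollence"
begin

section \<open>Categories and functors\<close>

record ('o, 'm) cat =
  Ob :: "'o set"
  Arr :: "'m set"
  Dom :: "'m \<Rightarrow> 'o"
  Cod :: "'m \<Rightarrow> 'o"
  Id :: "'o \<Rightarrow> 'm"
  Comp :: "'m \<Rightarrow> 'm \<Rightarrow> 'm" (infixl \<open>\<cdot>\<index>\<close> 70)

definition Hom :: "('o, 'm, 'z) cat_scheme \<Rightarrow> 'o \<Rightarrow> 'o \<Rightarrow> 'm set" where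
  "Hom C X Y = {f \<in> Arr C. Dom C f = X \<and> Cod C f = Y}"

locale category =
  fixes C :: "('o, 'm, 'z) cat_scheme" (structure)
  assumes Dom_Ob: "f \<in> Arr C \<Longrightarrow> Dom C f \<in> Ob C"
    and Cod_Ob: "f \<in> Arr C \<Longrightarrow> Cod C f \<in> Ob C"
    and Id_Hom: "X \<in> Ob C \<Longrightarrow> Id C X \<in> Hom C X X"
    and Comp_Hom: "\<lbrakk>f \<in> Hom C X Y; g \<in> Hom C Y Z\<rbrakk> \<Longrightarrow> g \<cdot> f \<in> Hom C X Z"
    and Comp_Id: "f \<in> Hom C X Y \<Longrightarrow> f \<cdot> Id C X = f"
    and Id_Comp: "f \<in> Hom C X Y \<Longrightarrow> Id C Y \<cdot> f = f"
    and Comp_assoc: "\<lbrakk>f \<in> Hom C W X; g \<in> Hom C X Y; h \<in> Hom C Y Z\<rbrakk> \<Longrightarrow> (h \<cdot> g) \<cdot> f = h \<cdot> (g \<cdot> f)"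

definition inverse_arrows :: "('o, 'm, 'z) cat_scheme \<Rightarrow> 'm \<Rightarrow> 'm \<Rightarrow> bool" where
  "inverse_arrows C f g \<longleftrightarrow> f \<in> Arr C \<and> g \<in> Hom C (Cod C f) (Dom C f) \<and>
     g \<cdot>\<^bsub>C\<^esub> f = Id C (Dom C f) \<and> f \<cdot>\<^bsub>C\<^esub> g = Id C (Cod C f)"

definition iso_arrow :: "('o, 'm, 'z) cat_scheme \<Rightarrow> 'm \<Rightarrow> bool" where
  "iso_arrow C f \<longleftrightarrow> (\<exists>g. inverse_arrows C f g)"

definition inv_arr :: "('o, 'm, 'z) cat_scheme \<Rightarrow> 'm \<Rightarrow> 'm" where
  "inv_arr C f = (THE g. inverse_arrows C f g)"

record ('o, 'm, 'p, 'n) func =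
  on_ob :: "'o \<Rightarrow> 'p"
  on_arr :: "'m \<Rightarrow> 'n"

definition is_functor ::
  "('o, 'm, 'z) cat_scheme \<Rightarrow> ('p, 'n, 'y) cat_scheme \<Rightarrow> ('o, 'm, 'p, 'n) func \<Rightarrow> bool" where
  "is_functor C D F \<longleftrightarrow> category C \<and> category D \<and>
     (\<forall>X\<in>Ob C. on_ob F X \<in> Ob D) \<and>
     (\<forall>f\<in>Arr C. on_arr F f \<in> Hom D (on_ob F (Dom C f)) (on_ob F (Cod C f))) \<and>
     (\<forall>X\<in>Ob C. on_arr F (Id C X) = Id D (on_ob F X)) \<and>
     (\<forall>f\<in>Arr C. \<forall>g\<in>Arr C. Cod C f = Dom C g \<longrightarrow>
        on_arr F (g \<cdot>\<^bsub>C\<^esub> f) = on_arr F g \<cdot>\<^bsub>D\<^esub> on_arr F f)"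

text \<open>Equality of functors out of \<open>C\<close>: HOL functions are total, so only the values on objects
  and arrows of \<open>C\<close> are compared.\<close>

definition func_eq ::
  "('o, 'm, 'z) cat_scheme \<Rightarrow> ('o, 'm, 'p, 'n) func \<Rightarrow> ('o, 'm, 'p, 'n) func \<Rightarrow> bool" where
  "func_eq C F F' \<longleftrightarrow> (\<forall>X\<in>Ob C. on_ob F X = on_ob F' X) \<and> (\<forall>f\<in>Arr C. on_arr F f = on_arr F' f)"

definition func_comp ::
  "('p, 'n, 'q, 'l) func \<Rightarrow> ('o, 'm, 'p, 'n) func \<Rightarrow> ('o, 'm, 'q, 'l) func" (infixl \<open>\<circ>\<^sub>F\<close> 55) where
  "F \<circ>\<^sub>F F' = \<lparr>on_ob = on_ob F \<circ> on_ob F', on_arr = on_arr F \<circ> on_arr F'\<rparr>"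


section \<open>Triangulated categories\<close>

text \<open>Triangles are written with the loop functor: \<open>(f, g, h) \<in> Tri T\<close> stands for the
  distinguished triangle \<open>\<Omega> C \<rightarrow> A \<rightarrow> B \<rightarrow> C\<close> with arrows \<open>f\<close>, \<open>g\<close>, \<open>h\<close>.
  \<open>hadd\<close> is the addition of parallel arrows and \<open>hzero X Y\<close> the zero arrow from \<open>X\<close> to \<open>Y\<close>.\<close>

record ('o, 'm) tricat = "('o, 'm) cat" +
  hadd :: "'m \<Rightarrow> 'm \<Rightarrow> 'm"
  hzero :: "'o \<Rightarrow> 'o \<Rightarrow> 'm"
  Loop :: "('o, 'm, 'o, 'm) func"
  Tri :: "('m \<times> 'm \<times> 'm) set"

abbreviation \<Omega>\<^sub>o :: "('o, 'm, 'z) tricat_scheme \<Rightarrow> 'o \<Rightarrow> 'o" where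
  "\<Omega>\<^sub>o T \<equiv> on_ob (Loop T)"

abbreviation \<Omega>\<^sub>a :: "('o, 'm, 'z) tricat_scheme \<Rightarrow> 'm \<Rightarrow> 'm" where
  "\<Omega>\<^sub>a T \<equiv> on_arr (Loop T)"

definition hom_group :: "('o, 'm, 'z) tricat_scheme \<Rightarrow> 'o \<Rightarrow> 'o \<Rightarrow> 'm monoid" where
  "hom_group T X Y = \<lparr>carrier = Hom T X Y, mult = hadd T, one = hzero T X Y\<rparr>"

definition hneg :: "('o, 'm, 'z) tricat_scheme \<Rightarrow> 'm \<Rightarrow> 'm" where
  "hneg T f = inv\<^bsub>hom_group T (Dom T f) (Cod T f)\<^esub> f"

definition is_zero_ob :: "('o, 'm, 'z) tricat_scheme \<Rightarrow> 'o \<Rightarrow> bool" where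
  "is_zero_ob T Z \<longleftrightarrow> Z \<in> Ob T \<and>
     (\<forall>X\<in>Ob T. Hom T X Z = {hzero T X Z} \<and> Hom T Z X = {hzero T Z X})"

definition additive_on_arrows ::
  "('o, 'm, 'z) tricat_scheme \<Rightarrow> ('p, 'n, 'y) tricat_scheme \<Rightarrow> ('o, 'm, 'p, 'n) func \<Rightarrow> bool" where
  "additive_on_arrows S T F \<longleftrightarrow> (\<forall>X\<in>Ob S. \<forall>Y\<in>Ob S. \<forall>f\<in>Hom S X Y. \<forall>g\<in>Hom S X Y.
     on_arr F (hadd S f g) = hadd T (on_arr F f) (on_arr F g))"

locale additive_category = category T for T :: "('o, 'm, 'z) tricat_scheme" (structure) +
  assumes hom_comm_group: "\<lbrakk>X \<in> Ob T; Y \<in> Ob T\<rbrakk> \<Longrightarrow> comm_group (hom_group T X Y)"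
    and Comp_hadd_right: "\<lbrakk>f \<in> Hom T X Y; f' \<in> Hom T X Y; g \<in> Hom T Y Z\<rbrakk>
      \<Longrightarrow> g \<cdot> hadd T f f' = hadd T (g \<cdot> f) (g \<cdot> f')"
    and Comp_hadd_left: "\<lbrakk>f \<in> Hom T X Y; g \<in> Hom T Y Z; g' \<in> Hom T Y Z\<rbrakk>
      \<Longrightarrow> hadd T g g' \<cdot> f = hadd T (g \<cdot> f) (g' \<cdot> f)"
    and ex_zero_ob: "\<exists>Z. is_zero_ob T Z"
    and ex_biproduct: "\<lbrakk>X \<in> Ob T; Y \<in> Ob T\<rbrakk> \<Longrightarrow>
      \<exists>P\<in>Ob T. \<exists>i\<in>Hom T X P. \<exists>i'\<in>Hom T Y P. \<exists>p\<in>Hom T P X. \<exists>p'\<in>Hom T P Y.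
        p \<cdot> i = Id T X \<and> p' \<cdot> i' = Id T Y \<and> p \<cdot> i' = hzero T Y X \<and> p' \<cdot> i = hzero T X Y \<and>
        hadd T (i \<cdot> p) (i' \<cdot> p') = Id T P"

text \<open>The loop functor is only required to be an equivalence (not an automorphism). The last five
  axioms are the usual ones of Verdier, with \<open>\<Omega>\<close> in the role of the inverse suspension.\<close>

locale triangulated = additive_category T for T :: "('o, 'm, 'z) tricat_scheme" (structure) +
  assumes Loop_functor: "is_functor T T (Loop T)"
    and Loop_additive: "additive_on_arrows T T (Loop T)"
    and Loop_fully_faithful: "\<lbrakk>X \<in> Ob T; Y \<in> Ob T\<rbrakk>
      \<Longrightarrow> bij_betw (\<Omega>\<^sub>a T) (Hom T X Y) (Hom T (\<Omega>\<^sub>o T X) (\<Omega>\<^sub>o T Y))"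
    and Loop_ess_surj: "Y \<in> Ob T \<Longrightarrow> \<exists>X\<in>Ob T. \<exists>f\<in>Hom T (\<Omega>\<^sub>o T X) Y. iso_arrow T f"
    and Tri_arrows: "(f, g, h) \<in> Tri T \<Longrightarrow> g \<in> Arr T \<and> h \<in> Arr T \<and> Cod T g = Dom T h \<and>
      f \<in> Hom T (\<Omega>\<^sub>o T (Cod T h)) (Dom T g)"
    and Tri_iso: "\<lbrakk>(f, g, h) \<in> Tri T; iso_arrow T a; iso_arrow T b; iso_arrow T c;
      Dom T a = Dom T g; Dom T b = Dom T h; Dom T c = Cod T h;
      f' \<in> Hom T (\<Omega>\<^sub>o T (Cod T c)) (Cod T a); g' \<in> Hom T (Cod T a) (Cod T b);
      h' \<in> Hom T (Cod T b) (Cod T c);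
      a \<cdot> f = f' \<cdot> \<Omega>\<^sub>a T c; b \<cdot> g = g' \<cdot> a; c \<cdot> h = h' \<cdot> b\<rbrakk> \<Longrightarrow> (f', g', h') \<in> Tri T"
    and Tri_id: "\<lbrakk>X \<in> Ob T; is_zero_ob T Z\<rbrakk>
      \<Longrightarrow> (hzero T (\<Omega>\<^sub>o T X) Z, hzero T Z X, Id T X) \<in> Tri T"
    and Tri_ex: "h \<in> Arr T \<Longrightarrow> \<exists>f g. (f, g, h) \<in> Tri T"
    and Tri_rotate: "\<lbrakk>g \<in> Arr T; h \<in> Arr T; Cod T g = Dom T h;
      f \<in> Hom T (\<Omega>\<^sub>o T (Cod T h)) (Dom T g)\<rbrakk>
      \<Longrightarrow> (f, g, h) \<in> Tri T \<longleftrightarrow> (hneg T (\<Omega>\<^sub>a T h), f, g) \<in> Tri T"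
    and Tri_morphism: "\<lbrakk>(f, g, h) \<in> Tri T; (f', g', h') \<in> Tri T;
      b \<in> Hom T (Dom T h) (Dom T h'); c \<in> Hom T (Cod T h) (Cod T h'); h' \<cdot> b = c \<cdot> h\<rbrakk>
      \<Longrightarrow> \<exists>a\<in>Hom T (Dom T g) (Dom T g'). a \<cdot> f = f' \<cdot> \<Omega>\<^sub>a T c \<and> g' \<cdot> a = b \<cdot> g"
    and Tri_octahedral: "\<lbrakk>(f\<^sub>1, g\<^sub>1, h) \<in> Tri T; (f\<^sub>2, g\<^sub>2, k) \<in> Tri T; Cod T h = Dom T k;
      (f\<^sub>3, g\<^sub>3, k \<cdot> h) \<in> Tri T\<rbrakk>
      \<Longrightarrow> \<exists>a\<in>Hom T (Dom T g\<^sub>1) (Dom T g\<^sub>3). \<exists>b\<in>Hom T (Dom T g\<^sub>3) (Dom T g\<^sub>2).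
        (f\<^sub>1 \<cdot> \<Omega>\<^sub>a T g\<^sub>2, a, b) \<in> Tri T \<and> g\<^sub>3 \<cdot> a = g\<^sub>1 \<and> g\<^sub>2 \<cdot> b = h \<cdot> g\<^sub>3 \<and>
        b \<cdot> f\<^sub>3 = f\<^sub>2 \<and> a \<cdot> f\<^sub>1 = f\<^sub>3 \<cdot> \<Omega>\<^sub>a T k"

text \<open>A triangulated functor is a pair \<open>(F, \<phi>)\<close> with \<open>\<phi> X : \<Omega> (F X) \<rightarrow> F (\<Omega> X)\<close> a natural
  isomorphism.\<close>

definition triangulated_functor ::
  "('o, 'm, 'z) tricat_scheme \<Rightarrow> ('p, 'n, 'y) tricat_scheme \<Rightarrow> ('o, 'm, 'p, 'n) func \<Rightarrow>
   ('o \<Rightarrow> 'n) \<Rightarrow> bool" where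
  "triangulated_functor S T F \<phi> \<longleftrightarrow> is_functor S T F \<and> additive_on_arrows S T F \<and>
     (\<forall>X\<in>Ob S. \<phi> X \<in> Hom T (\<Omega>\<^sub>o T (on_ob F X)) (on_ob F (\<Omega>\<^sub>o S X)) \<and> iso_arrow T (\<phi> X)) \<and>
     (\<forall>f\<in>Arr S. \<phi> (Cod S f) \<cdot>\<^bsub>T\<^esub> \<Omega>\<^sub>a T (on_arr F f) = on_arr F (\<Omega>\<^sub>a S f) \<cdot>\<^bsub>T\<^esub> \<phi> (Dom S f)) \<and>
     (\<forall>(f, g, h)\<in>Tri S. (on_arr F f \<cdot>\<^bsub>T\<^esub> \<phi> (Cod S h), on_arr F g, on_arr F h) \<in> Tri T)"


section \<open>Excisive functors and their universal property\<close>

text \<open>Here \<open>E\<close> is a class of extensions in a category \<open>C\<close>; the extension \<open>A \<rightarrow> B \<rightarrow> C\<close> is the pair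
  \<open>(i, p)\<close> of its two arrows, and \<open>d (i, p)\<close> is its boundary map.\<close>

definition excisive ::
  "('a, 'f, 'z) cat_scheme \<Rightarrow> ('f \<times> 'f) set \<Rightarrow> ('o, 'm, 'y) tricat_scheme \<Rightarrow>
   ('a, 'f, 'o, 'm) func \<Rightarrow> ('f \<times> 'f \<Rightarrow> 'm) \<Rightarrow> bool" where
  "excisive C E T F d \<longleftrightarrow> is_functor C T F \<and>
     (\<forall>(i, p)\<in>E. d (i, p) \<in> Hom T (\<Omega>\<^sub>o T (on_ob F (Cod C p))) (on_ob F (Dom C i)) \<and>
        (d (i, p), on_arr F i, on_arr F p) \<in> Tri T) \<and>
     (\<forall>(i, p)\<in>E. \<forall>(i', p')\<in>E. \<forall>a b c.
        a \<in> Hom C (Dom C i) (Dom C i') \<and> b \<in> Hom C (Cod C i) (Cod C i') \<and>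
        c \<in> Hom C (Cod C p) (Cod C p') \<and> i' \<cdot>\<^bsub>C\<^esub> a = b \<cdot>\<^bsub>C\<^esub> i \<and> p' \<cdot>\<^bsub>C\<^esub> b = c \<cdot>\<^bsub>C\<^esub> p \<longrightarrow>
        on_arr F a \<cdot>\<^bsub>T\<^esub> d (i, p) = d (i', p') \<cdot>\<^bsub>T\<^esub> \<Omega>\<^sub>a T (on_arr F c))"

text \<open>\<open>(F', \<phi>)\<close> is a triangulated functor with \<open>F' \<circ> J = F\<close> as excisive functors: \<open>F'\<close> carries the
  boundary maps \<open>dJ\<close> of \<open>J\<close> to the boundary maps \<open>d\<close> of \<open>F\<close>.\<close>

definition triangulated_extension ::
  "('a, 'f, 'z) cat_scheme \<Rightarrow> ('f \<times> 'f) set \<Rightarrow>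
   ('p, 'n, 'x) tricat_scheme \<Rightarrow> ('a, 'f, 'p, 'n) func \<Rightarrow> ('f \<times> 'f \<Rightarrow> 'n) \<Rightarrow>
   ('o, 'm, 'y) tricat_scheme \<Rightarrow> ('a, 'f, 'o, 'm) func \<Rightarrow> ('f \<times> 'f \<Rightarrow> 'm) \<Rightarrow>
   ('p, 'n, 'o, 'm) func \<Rightarrow> ('p \<Rightarrow> 'm) \<Rightarrow> bool" where
  "triangulated_extension C E S J dJ T F d F' \<phi> \<longleftrightarrow>
     triangulated_functor S T F' \<phi> \<and> func_eq C (F' \<circ>\<^sub>F J) F \<and>
     (\<forall>(i, p)\<in>E. on_arr F' (dJ (i, p)) \<cdot>\<^bsub>T\<^esub> \<phi> (on_ob J (Cod C p)) = d (i, p))"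

text \<open>\<open>P T F\<close> is the additional requirement (homotopy invariance and stability) on excisive
  functors \<open>F : C \<rightarrow> T\<close>. The types \<open>'o\<close> and \<open>'m\<close> of objects and arrows serve as the universe in
  which the test categories \<open>T\<close> of the universal property live.\<close>

definition universal_excisive ::
  "('a, 'f, 'z) cat_scheme \<Rightarrow> ('f \<times> 'f) set \<Rightarrow>
   (('o, 'm) tricat \<Rightarrow> ('a, 'f, 'o, 'm) func \<Rightarrow> bool) \<Rightarrow>
   ('o, 'm) tricat \<Rightarrow> ('a, 'f, 'o, 'm) func \<Rightarrow> ('f \<times> 'f \<Rightarrow> 'm) \<Rightarrow> bool" where
  "universal_excisive C E P S J dJ \<longleftrightarrow>
     triangulated S \<and> excisive C E S J dJ \<and> P S J \<and>
     (\<forall>T F d. triangulated T \<and> excisive C E T F d \<and> P T F \<longrightarrow>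
        (\<exists>F' \<phi>. triangulated_extension C E S J dJ T F d F' \<phi> \<and>
           (\<forall>F'' \<psi>. triangulated_extension C E S J dJ T F d F'' \<psi> \<longrightarrow>
              func_eq S F'' F' \<and> (\<forall>X\<in>Ob S. \<psi> X = \<phi> X))))"


section \<open>Algebras and \<open>G\<close>-algebras\<close>

text \<open>Algebras reuse the record of \<^theory>\<open>HOL-Algebra.Module\<close>; its field \<^const>\<open>one\<close> is ignored, and
  is left \<open>undefined\<close> in the constructions below.\<close>

locale nu_algebra = Module.module R A for R (structure) and A (structure) +
  assumes mult_closed: "\<lbrakk>a \<in> carrier A; b \<in> carrier A\<rbrakk> \<Longrightarrow> a \<otimes>\<^bsub>A\<^esub> b \<in> carrier A"
    and mult_assoc: "\<lbrakk>a \<in> carrier A; b \<in> carrier A; c \<in> carrier A\<rbrakk>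
      \<Longrightarrow> (a \<otimes>\<^bsub>A\<^esub> b) \<otimes>\<^bsub>A\<^esub> c = a \<otimes>\<^bsub>A\<^esub> (b \<otimes>\<^bsub>A\<^esub> c)"
    and mult_l_distr: "\<lbrakk>a \<in> carrier A; b \<in> carrier A; c \<in> carrier A\<rbrakk>
      \<Longrightarrow> (a \<oplus>\<^bsub>A\<^esub> b) \<otimes>\<^bsub>A\<^esub> c = a \<otimes>\<^bsub>A\<^esub> c \<oplus>\<^bsub>A\<^esub> b \<otimes>\<^bsub>A\<^esub> c"
    and mult_r_distr: "\<lbrakk>a \<in> carrier A; b \<in> carrier A; c \<in> carrier A\<rbrakk>
      \<Longrightarrow> a \<otimes>\<^bsub>A\<^esub> (b \<oplus>\<^bsub>A\<^esub> c) = a \<otimes>\<^bsub>A\<^esub> b \<oplus>\<^bsub>A\<^esub> a \<otimes>\<^bsub>A\<^esub> c"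
    and smult_mult_left: "\<lbrakk>r \<in> carrier R; a \<in> carrier A; b \<in> carrier A\<rbrakk>
      \<Longrightarrow> (r \<odot>\<^bsub>A\<^esub> a) \<otimes>\<^bsub>A\<^esub> b = r \<odot>\<^bsub>A\<^esub> (a \<otimes>\<^bsub>A\<^esub> b)"
    and smult_mult_right: "\<lbrakk>r \<in> carrier R; a \<in> carrier A; b \<in> carrier A\<rbrakk>
      \<Longrightarrow> a \<otimes>\<^bsub>A\<^esub> (r \<odot>\<^bsub>A\<^esub> b) = r \<odot>\<^bsub>A\<^esub> (a \<otimes>\<^bsub>A\<^esub> b)"

definition linear_maps ::
  "('k, 'r) ring_scheme \<Rightarrow> ('k, 'a, 'x) module_scheme \<Rightarrow> ('k, 'b, 'y) module_scheme \<Rightarrow> ('a \<Rightarrow> 'b) set" where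
  "linear_maps R A B = {f \<in> carrier A \<rightarrow>\<^sub>E carrier B.
     (\<forall>a\<in>carrier A. \<forall>b\<in>carrier A. f (a \<oplus>\<^bsub>A\<^esub> b) = f a \<oplus>\<^bsub>B\<^esub> f b) \<and>
     (\<forall>r\<in>carrier R. \<forall>a\<in>carrier A. f (r \<odot>\<^bsub>A\<^esub> a) = r \<odot>\<^bsub>B\<^esub> f a)}"

definition alg_homs ::
  "('k, 'r) ring_scheme \<Rightarrow> ('k, 'a, 'x) module_scheme \<Rightarrow> ('k, 'b, 'y) module_scheme \<Rightarrow> ('a \<Rightarrow> 'b) set" where
  "alg_homs R A B = {f \<in> linear_maps R A B.
     \<forall>a\<in>carrier A. \<forall>b\<in>carrier A. f (a \<otimes>\<^bsub>A\<^esub> b) = f a \<otimes>\<^bsub>B\<^esub> f b}"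

record ('k, 'a, 'g) galg = "('k, 'a) module" +
  gact :: "'g \<Rightarrow> 'a \<Rightarrow> 'a"

locale g_algebra = nu_algebra R A + group G
  for R (structure) and G (structure) and A :: "('k, 'a, 'g, 'z) galg_scheme" (structure) +
  assumes gact_hom: "g \<in> carrier G \<Longrightarrow> restrict (gact A g) (carrier A) \<in> alg_homs R A A"
    and gact_one: "a \<in> carrier A \<Longrightarrow> gact A \<one>\<^bsub>G\<^esub> a = a"
    and gact_mult: "\<lbrakk>g \<in> carrier G; h \<in> carrier G; a \<in> carrier A\<rbrakk>
      \<Longrightarrow> gact A (g \<otimes>\<^bsub>G\<^esub> h) a = gact A g (gact A h a)"

definition equivariant ::
  "('g, 's) monoid_scheme \<Rightarrow> ('k, 'a, 'g) galg \<Rightarrow> ('k, 'b, 'g) galg \<Rightarrow> ('a \<Rightarrow> 'b) \<Rightarrow> bool" where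
  "equivariant G A B f \<longleftrightarrow> (\<forall>g\<in>carrier G. \<forall>a\<in>carrier A. f (gact A g a) = gact B g (f a))"

text \<open>An arrow \<open>A \<rightarrow> B\<close> of a concrete category is a triple \<open>(A, B, f)\<close> with \<open>f\<close> extensional on the
  carrier of \<open>A\<close>.\<close>

type_synonym ('a, 'u) carr = "'a \<times> 'a \<times> ('u \<Rightarrow> 'u)"

abbreviation fn :: "('a, 'u) carr \<Rightarrow> 'u \<Rightarrow> 'u" where
  "fn f \<equiv> snd (snd f)"

definition concrete_cat ::
  "('u, 'z) partial_object_scheme set \<Rightarrow>
   (('u, 'z) partial_object_scheme \<Rightarrow> ('u, 'z) partial_object_scheme \<Rightarrow> ('u \<Rightarrow> 'u) set) \<Rightarrow>
   (('u, 'z) partial_object_scheme, (('u, 'z) partial_object_scheme, 'u) carr) cat" where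
  "concrete_cat Obs Homs = \<lparr>
     Ob = Obs,
     Arr = {(A, B, f). A \<in> Obs \<and> B \<in> Obs \<and> f \<in> Homs A B},
     Dom = fst,
     Cod = fst \<circ> snd,
     Id = (\<lambda>A. (A, A, restrict id (carrier A))),
     Comp = (\<lambda>(_, C, g) (A, _, f). (A, C, compose (carrier A) g f))\<rparr>"

text \<open>The type \<open>'u\<close> is a universe: the objects are the algebras with carrier a subset of \<open>'u\<close>.\<close>

definition Alg :: "('k, 'r) ring_scheme \<Rightarrow> (('k, 'u) module, (('k, 'u) module, 'u) carr) cat" where
  "Alg R = concrete_cat {A. nu_algebra R A} (alg_homs R)"

definition GAlg :: "('k, 'r) ring_scheme \<Rightarrow> ('g, 's) monoid_scheme \<Rightarrow>
    (('k, 'u, 'g) galg, (('k, 'u, 'g) galg, 'u) carr) cat" where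
  "GAlg R G = concrete_cat {A. g_algebra R G A} (\<lambda>A B. {f \<in> alg_homs R A B. equivariant G A B f})"

definition short_exact ::
  "(('k, 'u, 'z) module_scheme, 'u) carr \<Rightarrow> (('k, 'u, 'z) module_scheme, 'u) carr \<Rightarrow> bool" where
  "short_exact = (\<lambda>(A, B, i) (B', C, p). B = B' \<and> inj_on i (carrier A) \<and>
     i ` carrier A = {b \<in> carrier B. p b = \<zero>\<^bsub>C\<^esub>} \<and> p ` carrier B = carrier C)"

definition Alg_ext :: "('k, 'r) ring_scheme \<Rightarrow>
    ((('k, 'u) module, 'u) carr \<times> (('k, 'u) module, 'u) carr) set" where
  "Alg_ext R = {(i, p). i \<in> Arr (Alg R) \<and> p \<in> Arr (Alg R) \<and> short_exact i p \<and>
     (\<exists>s\<in>linear_maps R (Cod (Alg R) p) (Dom (Alg R) p).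
        \<forall>c\<in>carrier (Cod (Alg R) p). fn p (s c) = c)}"

definition GAlg_ext :: "('k, 'r) ring_scheme \<Rightarrow> ('g, 's) monoid_scheme \<Rightarrow>
    ((('k, 'u, 'g) galg, 'u) carr \<times> (('k, 'u, 'g) galg, 'u) carr) set" where
  "GAlg_ext R G = {(i, p). i \<in> Arr (GAlg R G) \<and> p \<in> Arr (GAlg R G) \<and> short_exact i p \<and>
     (\<exists>s\<in>linear_maps R (Cod (GAlg R G) p) (Dom (GAlg R G) p).
        equivariant G (Cod (GAlg R G) p) (Dom (GAlg R G) p) s \<and>
        (\<forall>c\<in>carrier (Cod (GAlg R G) p). fn p (s c) = c))}"


section \<open>Copies inside the universe\<close>

text \<open>The constructions below (polynomials, matrices, crossed products, \<open>\<R>\<close>) produce algebras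
  whose elements have other types than \<open>'u\<close>; they are brought back into the universe by a fixed
  choice, for each carrier set \<open>S\<close>, of an injection \<open>S \<rightarrow> 'u\<close>. Such an injection exists for all of
  them as soon as \<open>'u\<close> is infinite and at least as large as the ground ring and the group.\<close>

definition copy_map :: "'b set \<Rightarrow> 'b \<Rightarrow> 'u" where
  "copy_map S = (SOME f. inj_on f S)"

definition copy_alg :: "('k, 'b, 'z) module_scheme \<Rightarrow> ('k, 'u) module" where
  "copy_alg A =
     (let c = copy_map (carrier A); c' = inv_into (carrier A) c in
      \<lparr>carrier = c ` carrier A,
       mult = (\<lambda>x y. c (c' x \<otimes>\<^bsub>A\<^esub> c' y)),
       one = undefined,
       zero = c \<zero>\<^bsub>A\<^esub>,
       add = (\<lambda>x y. c (c' x \<oplus>\<^bsub>A\<^esub> c' y)),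
       smult = (\<lambda>r x. c (r \<odot>\<^bsub>A\<^esub> c' x))\<rparr>)"

definition copy_galg :: "('k, 'b, 'g) galg \<Rightarrow> ('k, 'u, 'g) galg" where
  "copy_galg A = module.extend (copy_alg A)
     (galg.fields (\<lambda>g x. copy_map (carrier A) (gact A g (inv_into (carrier A) (copy_map (carrier A)) x))))"

definition copy_fun :: "('k, 'b, 'y) module_scheme \<Rightarrow> ('k, 'c, 'z) module_scheme \<Rightarrow> ('b \<Rightarrow> 'c) \<Rightarrow> 'u \<Rightarrow> 'u" where
  "copy_fun A B f = restrict (\<lambda>x. copy_map (carrier B) (f (inv_into (carrier A) (copy_map (carrier A)) x)))
     (copy_map (carrier A) ` carrier A)"

definition copy_arr :: "('k, 'b) module \<Rightarrow> ('k, 'c) module \<Rightarrow> ('b \<Rightarrow> 'c) \<Rightarrow> (('k, 'u) module, 'u) carr" where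
  "copy_arr A B f = (copy_alg A, copy_alg B, copy_fun A B f)"

definition copy_garr :: "('k, 'b, 'g) galg \<Rightarrow> ('k, 'c, 'g) galg \<Rightarrow> ('b \<Rightarrow> 'c) \<Rightarrow> (('k, 'u, 'g) galg, 'u) carr" where
  "copy_garr A B f = (copy_galg A, copy_galg B, copy_fun A B f)"

text \<open>The arrow \<open>A \<rightarrow> copy B\<close> given by \<open>f : A \<rightarrow> B\<close>, where \<open>A\<close> already lives in the universe.\<close>

definition into_copy :: "('k, 'u) module \<Rightarrow> ('k, 'c) module \<Rightarrow> ('u \<Rightarrow> 'c) \<Rightarrow> (('k, 'u) module, 'u) carr" where
  "into_copy A B f = (A, copy_alg B, restrict (copy_map (carrier B) \<circ> f) (carrier A))"

definition into_gcopy :: "('k, 'u, 'g) galg \<Rightarrow> ('k, 'c, 'g) galg \<Rightarrow> ('u \<Rightarrow> 'c) \<Rightarrow> (('k, 'u, 'g) galg, 'u) carr" where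
  "into_gcopy A B f = (A, copy_galg B, restrict (copy_map (carrier B) \<circ> f) (carrier A))"


section \<open>Homotopy invariance and stability\<close>

definition fin_fun :: "'x set \<Rightarrow> ('a, 'z) ring_scheme \<Rightarrow> ('x \<Rightarrow> 'a) set" where
  "fin_fun S A = {\<phi>. (\<forall>x\<in>S. \<phi> x \<in> carrier A) \<and> (\<forall>x. x \<notin> S \<longrightarrow> \<phi> x = \<zero>\<^bsub>A\<^esub>) \<and>
     finite {x. \<phi> x \<noteq> \<zero>\<^bsub>A\<^esub>}}"

text \<open>The module \<open>A \<otimes> \<ell>[S]\<close>, as finitely supported functions \<open>S \<rightarrow> A\<close>, with a given product \<open>m\<close>.\<close>

definition fs_alg :: "'x set \<Rightarrow> ('k, 'a, 'z) module_scheme \<Rightarrow>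
    (('x \<Rightarrow> 'a) \<Rightarrow> ('x \<Rightarrow> 'a) \<Rightarrow> 'x \<Rightarrow> 'a) \<Rightarrow> ('k, 'x \<Rightarrow> 'a) module" where
  "fs_alg S A m = \<lparr>carrier = fin_fun S A, mult = m, one = undefined, zero = (\<lambda>x. \<zero>\<^bsub>A\<^esub>),
     add = (\<lambda>\<phi> \<psi> x. \<phi> x \<oplus>\<^bsub>A\<^esub> \<psi> x), smult = (\<lambda>r \<phi> x. r \<odot>\<^bsub>A\<^esub> \<phi> x)\<rparr>"

definition poly_alg :: "('k, 'a, 'z) module_scheme \<Rightarrow> ('k, nat \<Rightarrow> 'a) module" where
  "poly_alg A = fs_alg UNIV A (\<lambda>\<phi> \<psi> n. \<Oplus>\<^bsub>A\<^esub>i\<in>{..n}. \<phi> i \<otimes>\<^bsub>A\<^esub> \<psi> (n - i))"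

definition poly_galg :: "('k, 'a, 'g) galg \<Rightarrow> ('k, nat \<Rightarrow> 'a, 'g) galg" where
  "poly_galg A = module.extend (poly_alg A) (galg.fields (\<lambda>g \<phi> n. gact A g (\<phi> n)))"

definition poly_const :: "('a, 'z) ring_scheme \<Rightarrow> 'a \<Rightarrow> nat \<Rightarrow> 'a" where
  "poly_const A a n = (if n = 0 then a else \<zero>\<^bsub>A\<^esub>)"

definition homotopy_invariant :: "('k, 'r) ring_scheme \<Rightarrow> ('o, 'm, 'z) tricat_scheme \<Rightarrow>
    (('k, 'u) module, (('k, 'u) module, 'u) carr, 'o, 'm) func \<Rightarrow> bool" where
  "homotopy_invariant R T F \<longleftrightarrow>
     (\<forall>A\<in>Ob (Alg R). iso_arrow T (on_arr F (into_copy A (poly_alg A) (poly_const A))))"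

definition G_homotopy_invariant ::
  "('k, 'r) ring_scheme \<Rightarrow> ('g, 's) monoid_scheme \<Rightarrow> ('o, 'm, 'z) tricat_scheme \<Rightarrow>
   (('k, 'u, 'g) galg, (('k, 'u, 'g) galg, 'u) carr, 'o, 'm) func \<Rightarrow> bool" where
  "G_homotopy_invariant R G T F \<longleftrightarrow>
     (\<forall>A\<in>Ob (GAlg R G). iso_arrow T (on_arr F (into_gcopy A (poly_galg A) (poly_const A))))"

definition mat_alg :: "'x set \<Rightarrow> ('k, 'a, 'z) module_scheme \<Rightarrow> ('k, 'x \<times> 'x \<Rightarrow> 'a) module" where
  "mat_alg X A = fs_alg (X \<times> X) A
     (\<lambda>M N (x, z). \<Oplus>\<^bsub>A\<^esub>y\<in>{y. M (x, y) \<noteq> \<zero>\<^bsub>A\<^esub>}. M (x, y) \<otimes>\<^bsub>A\<^esub> N (y, z))"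

definition corner :: "('a, 'z) ring_scheme \<Rightarrow> 'x \<Rightarrow> 'a \<Rightarrow> 'x \<times> 'x \<Rightarrow> 'a" where
  "corner A x a = (\<lambda>p. if p = (x, x) then a else \<zero>\<^bsub>A\<^esub>)"

definition matrix_stable :: "('k, 'r) ring_scheme \<Rightarrow> 'x set \<Rightarrow> ('o, 'm, 'z) tricat_scheme \<Rightarrow>
    (('k, 'u) module, (('k, 'u) module, 'u) carr, 'o, 'm) func \<Rightarrow> bool" where
  "matrix_stable R X T F \<longleftrightarrow>
     (\<forall>A\<in>Ob (Alg R). \<forall>x\<in>X. iso_arrow T (on_arr F (into_copy A (mat_alg X A) (corner A x))))"

text \<open>A free module with basis \<open>X\<close> and a \<open>G\<close>-action is given by the matrices \<open>\<rho> g\<close> of the action: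
  \<open>g y = (\<Sum>x\<in>X. \<rho> g x y * x)\<close> for \<open>y \<in> X\<close>.\<close>

definition is_rep :: "('k, 'r) ring_scheme \<Rightarrow> ('g, 's) monoid_scheme \<Rightarrow> 'x set \<Rightarrow>
    ('g \<Rightarrow> 'x \<Rightarrow> 'x \<Rightarrow> 'k) \<Rightarrow> bool" where
  "is_rep R G X \<rho> \<longleftrightarrow>
     (\<forall>g\<in>carrier G. \<forall>x\<in>X. \<forall>y\<in>X. \<rho> g x y \<in> carrier R) \<and>
     (\<forall>g\<in>carrier G. \<forall>x\<in>X. finite {y\<in>X. \<rho> g x y \<noteq> \<zero>\<^bsub>R\<^esub>} \<and> finite {y\<in>X. \<rho> g y x \<noteq> \<zero>\<^bsub>R\<^esub>}) \<and>
     (\<forall>x\<in>X. \<forall>y\<in>X. \<rho> \<one>\<^bsub>G\<^esub> x y = (if x = y then \<one>\<^bsub>R\<^esub> else \<zero>\<^bsub>R\<^esub>)) \<and>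
     (\<forall>g\<in>carrier G. \<forall>h\<in>carrier G. \<forall>x\<in>X. \<forall>z\<in>X.
        \<rho> (g \<otimes>\<^bsub>G\<^esub> h) x z = (\<Oplus>\<^bsub>R\<^esub>y\<in>{y\<in>X. \<rho> g x y \<noteq> \<zero>\<^bsub>R\<^esub>}. \<rho> g x y \<otimes>\<^bsub>R\<^esub> \<rho> h y z))"

fun rep_sum :: "('k, 'r) ring_scheme \<Rightarrow> ('g \<Rightarrow> 'x \<Rightarrow> 'x \<Rightarrow> 'k) \<Rightarrow> ('g \<Rightarrow> 'y \<Rightarrow> 'y \<Rightarrow> 'k) \<Rightarrow>
    'g \<Rightarrow> 'x + 'y \<Rightarrow> 'x + 'y \<Rightarrow> 'k" where
  "rep_sum R \<rho> \<sigma> g (Inl x) (Inl x') = \<rho> g x x'"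
| "rep_sum R \<rho> \<sigma> g (Inr y) (Inr y') = \<sigma> g y y'"
| "rep_sum R \<rho> \<sigma> g (Inl x) (Inr y) = \<zero>\<^bsub>R\<^esub>"
| "rep_sum R \<rho> \<sigma> g (Inr y) (Inl x) = \<zero>\<^bsub>R\<^esub>"

text \<open>\<open>A \<otimes> End\<^sup>F(W)\<close>, with the diagonal action \<open>g (a \<otimes> e) = g a \<otimes> \<rho>(g) e \<rho>(g)\<^sup>-\<^sup>1\<close>.\<close>

definition end_galg :: "('g, 's) monoid_scheme \<Rightarrow> ('k, 'r) ring_scheme \<Rightarrow> 'x set \<Rightarrow>
    ('g \<Rightarrow> 'x \<Rightarrow> 'x \<Rightarrow> 'k) \<Rightarrow> ('k, 'a, 'g) galg \<Rightarrow> ('k, 'x \<times> 'x \<Rightarrow> 'a, 'g) galg" where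
  "end_galg G R X \<rho> A = module.extend (mat_alg X A) (galg.fields (\<lambda>g M (x, y).
     if x \<in> X \<and> y \<in> X
     then \<Oplus>\<^bsub>A\<^esub>q\<in>{q. M q \<noteq> \<zero>\<^bsub>A\<^esub>}.
            (\<rho> g x (fst q) \<otimes>\<^bsub>R\<^esub> \<rho> (inv\<^bsub>G\<^esub> g) (snd q) y) \<odot>\<^bsub>A\<^esub> gact A g (M q)
     else \<zero>\<^bsub>A\<^esub>))"

fun end_incl :: "('a, 'z) ring_scheme \<Rightarrow> ('x \<times> 'x \<Rightarrow> 'a) \<Rightarrow> ('x + 'y) \<times> ('x + 'y) \<Rightarrow> 'a" where
  "end_incl A M (Inl x, Inl x') = M (x, x')"
| "end_incl A M (Inr y, q) = \<zero>\<^bsub>A\<^esub>"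
| "end_incl A M (Inl x, Inr y) = \<zero>\<^bsub>A\<^esub>"

text \<open>Bases of cardinality at most \<open>card (\<nat> \<times> G)\<close> are, up to renaming, subsets of the type
  \<open>nat \<times> 'g\<close>.\<close>

definition G_stable ::
  "('k, 'r) ring_scheme \<Rightarrow> ('g, 's) monoid_scheme \<Rightarrow> ('o, 'm, 'z) tricat_scheme \<Rightarrow>
   (('k, 'u, 'g) galg, (('k, 'u, 'g) galg, 'u) carr, 'o, 'm) func \<Rightarrow> bool" where
  "G_stable R G T F \<longleftrightarrow>
     (\<forall>A\<in>Ob (GAlg R G :: (('k, 'u, 'g) galg, (('k, 'u, 'g) galg, 'u) carr) cat).
      \<forall>(X :: (nat \<times> 'g) set) (Y :: (nat \<times> 'g) set) \<rho> \<sigma>.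
        X \<noteq> {} \<and> Y \<noteq> {} \<and>
        X \<lesssim> (UNIV :: nat set) \<times> carrier G \<and> Y \<lesssim> (UNIV :: nat set) \<times> carrier G \<and>
        is_rep R G X \<rho> \<and> is_rep R G Y \<sigma> \<longrightarrow>
        iso_arrow T (on_arr F (copy_garr (end_galg G R X \<rho> A)
          (end_galg G R (Inl ` X \<union> Inr ` Y) (rep_sum R \<rho> \<sigma>) A) (end_incl A))))"

definition is_kk :: "('k, 'r) ring_scheme \<Rightarrow> ('g, 's) monoid_scheme \<Rightarrow> ('o, 'm) tricat \<Rightarrow>
    (('k, 'u) module, (('k, 'u) module, 'u) carr, 'o, 'm) func \<Rightarrow>
    ((('k, 'u) module, 'u) carr \<times> (('k, 'u) module, 'u) carr \<Rightarrow> 'm) \<Rightarrow> bool" where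
  "is_kk R G = universal_excisive (Alg R) (Alg_ext R)
     (\<lambda>T F. homotopy_invariant R T F \<and> matrix_stable R ((UNIV :: nat set) \<times> carrier G) T F)"

definition is_kkG :: "('k, 'r) ring_scheme \<Rightarrow> ('g, 's) monoid_scheme \<Rightarrow> ('o, 'm) tricat \<Rightarrow>
    (('k, 'u, 'g) galg, (('k, 'u, 'g) galg, 'u) carr, 'o, 'm) func \<Rightarrow>
    ((('k, 'u, 'g) galg, 'u) carr \<times> (('k, 'u, 'g) galg, 'u) carr \<Rightarrow> 'm) \<Rightarrow> bool" where
  "is_kkG R G = universal_excisive (GAlg R G) (GAlg_ext R G)
     (\<lambda>T F. G_homotopy_invariant R G T F \<and> G_stable R G T F)"


section \<open>Linear categories and the functor \<open>\<R>\<close>\<close>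

text \<open>Only the module structure of \<open>LHom C x y\<close> is used; \<open>LComp C x y z g f\<close> is the composite of
  \<open>f : x \<rightarrow> y\<close> and \<open>g : y \<rightarrow> z\<close>.\<close>

record ('k, 'c, 'a) lincat =
  LOb :: "'c set"
  LHom :: "'c \<Rightarrow> 'c \<Rightarrow> ('k, 'a) module"
  LComp :: "'c \<Rightarrow> 'c \<Rightarrow> 'c \<Rightarrow> 'a \<Rightarrow> 'a \<Rightarrow> 'a"

definition alg_lincat :: "('k, 'a) module \<Rightarrow> ('k, unit, 'a) lincat" where
  "alg_lincat D = \<lparr>LOb = {()}, LHom = (\<lambda>_ _. D), LComp = (\<lambda>_ _ _. mult D)\<rparr>"

definition total_mod :: "('k, 'c, 'a) lincat \<Rightarrow> ('k, 'c \<times> 'c \<Rightarrow> 'a) module" where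
  "total_mod C = (let I = LOb C \<times> LOb C; M = (\<lambda>(x, y). LHom C x y) in
     \<lparr>carrier = {\<phi> \<in> (\<Pi>\<^sub>E p\<in>I. carrier (M p)). finite {p\<in>I. \<phi> p \<noteq> \<zero>\<^bsub>M p\<^esub>}},
      mult = undefined, one = undefined,
      zero = (\<lambda>p\<in>I. \<zero>\<^bsub>M p\<^esub>),
      add = (\<lambda>\<phi> \<psi>. \<lambda>p\<in>I. \<phi> p \<oplus>\<^bsub>M p\<^esub> \<psi> p),
      smult = (\<lambda>r \<phi>. \<lambda>p\<in>I. r \<odot>\<^bsub>M p\<^esub> \<phi> p)\<rparr>)"

definition single :: "('k, 'c, 'a) lincat \<Rightarrow> 'c \<Rightarrow> 'c \<Rightarrow> 'a \<Rightarrow> 'c \<times> 'c \<Rightarrow> 'a" where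
  "single C x y f = (\<lambda>p\<in>LOb C \<times> LOb C. if p = (x, y) then f else \<zero>\<^bsub>LHom C (fst p) (snd p)\<^esub>)"

definition quot_alg :: "('k, 'a) module \<Rightarrow> 'a set \<Rightarrow> ('k, 'a set) module" where
  "quot_alg A I = \<lparr>carrier = a_rcosets\<^bsub>A\<^esub> I, mult = rcoset_mult A I, one = undefined, zero = I,
     add = set_add A, smult = (\<lambda>r U. \<Union>a\<in>U. I +>\<^bsub>A\<^esub> (r \<odot>\<^bsub>A\<^esub> a))\<rparr>"

definition lin_span :: "('k, 'r) ring_scheme \<Rightarrow> ('k, 'a) module \<Rightarrow> 'a set \<Rightarrow> 'a set" where
  "lin_span R A S = \<Inter>{N. submodule N R A \<and> S \<subseteq> N}"

definition alg_ideal :: "('k, 'r) ring_scheme \<Rightarrow> ('k, 'a) module \<Rightarrow> 'a set \<Rightarrow> bool" where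
  "alg_ideal R A I \<longleftrightarrow> submodule I R A \<and>
     (\<forall>a\<in>carrier A. \<forall>x\<in>I. a \<otimes>\<^bsub>A\<^esub> x \<in> I \<and> x \<otimes>\<^bsub>A\<^esub> a \<in> I)"

definition gen_ideal :: "('k, 'r) ring_scheme \<Rightarrow> ('k, 'a) module \<Rightarrow> 'a set \<Rightarrow> 'a set" where
  "gen_ideal R A S = \<Inter>{I. alg_ideal R A I \<and> S \<subseteq> I}"

text \<open>The free module on the nonempty words in \<open>carrier M\<close>, multiplied by concatenation. Its
  quotient by the multilinearity relations in each letter is, word length by word length, the
  direct sum of the tensor powers \<open>M\<^sup>\<otimes>\<^sup>n\<close> for \<open>n \<ge> 1\<close>.\<close>

definition word_alg :: "('k, 'r) ring_scheme \<Rightarrow> 'a set \<Rightarrow> ('k, 'a list \<Rightarrow> 'k) module" where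
  "word_alg R S = \<lparr>carrier = fin_fun (lists S - {[]}) R,
     mult = (\<lambda>\<phi> \<psi> w. \<Oplus>\<^bsub>R\<^esub>n\<in>{1..<length w}. \<phi> (take n w) \<otimes>\<^bsub>R\<^esub> \<psi> (drop n w)),
     one = undefined, zero = (\<lambda>w. \<zero>\<^bsub>R\<^esub>),
     add = (\<lambda>\<phi> \<psi> w. \<phi> w \<oplus>\<^bsub>R\<^esub> \<psi> w), smult = (\<lambda>r \<phi> w. r \<otimes>\<^bsub>R\<^esub> \<phi> w)\<rparr>"

definition word :: "('k, 'r) ring_scheme \<Rightarrow> 'a list \<Rightarrow> 'a list \<Rightarrow> 'k" where
  "word R w = (\<lambda>v. if v = w then \<one>\<^bsub>R\<^esub> else \<zero>\<^bsub>R\<^esub>)"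

definition multilinear_rels :: "('k, 'r) ring_scheme \<Rightarrow> ('k, 'a) module \<Rightarrow> ('a list \<Rightarrow> 'k) set" where
  "multilinear_rels R M = (let W = word_alg R (carrier M) in
     {word R (u @ (a \<oplus>\<^bsub>M\<^esub> b) # v) \<ominus>\<^bsub>W\<^esub> (word R (u @ a # v) \<oplus>\<^bsub>W\<^esub> word R (u @ b # v)) | u a b v.
        u \<in> lists (carrier M) \<and> v \<in> lists (carrier M) \<and> a \<in> carrier M \<and> b \<in> carrier M} \<union>
     {word R (u @ (r \<odot>\<^bsub>M\<^esub> a) # v) \<ominus>\<^bsub>W\<^esub> (r \<odot>\<^bsub>W\<^esub> word R (u @ a # v)) | u r a v.
        u \<in> lists (carrier M) \<and> v \<in> lists (carrier M) \<and> r \<in> carrier R \<and> a \<in> carrier M})"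

definition tensor_alg :: "('k, 'r) ring_scheme \<Rightarrow> ('k, 'a) module \<Rightarrow> ('k, ('a list \<Rightarrow> 'k) set) module" where
  "tensor_alg R M = quot_alg (word_alg R (carrier M))
     (lin_span R (word_alg R (carrier M)) (multilinear_rels R M))"

definition tensor_word :: "('k, 'r) ring_scheme \<Rightarrow> ('k, 'a) module \<Rightarrow> 'a list \<Rightarrow> ('a list \<Rightarrow> 'k) set" where
  "tensor_word R M w =
     lin_span R (word_alg R (carrier M)) (multilinear_rels R M) +>\<^bsub>word_alg R (carrier M)\<^esub> word R w"

definition comp_ideal :: "('k, 'r) ring_scheme \<Rightarrow> ('k, 'c, 'a) lincat \<Rightarrow> (('c \<times> 'c \<Rightarrow> 'a) list \<Rightarrow> 'k) set set" where
  "comp_ideal R C = gen_ideal R (tensor_alg R (total_mod C))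
     {tensor_word R (total_mod C) [single C y z g, single C x y f]
        \<ominus>\<^bsub>tensor_alg R (total_mod C)\<^esub> tensor_word R (total_mod C) [single C x z (LComp C x y z g f)]
      | x y z f g. x \<in> LOb C \<and> y \<in> LOb C \<and> z \<in> LOb C \<and>
          f \<in> carrier (LHom C x y) \<and> g \<in> carrier (LHom C y z)}"

type_synonym ('k, 'c, 'a) \<R>_elem = "(('c \<times> 'c \<Rightarrow> 'a) list \<Rightarrow> 'k) set set"

definition \<R>_alg :: "('k, 'r) ring_scheme \<Rightarrow> ('k, 'c, 'a) lincat \<Rightarrow> ('k, ('k, 'c, 'a) \<R>_elem) module" where
  "\<R>_alg R C = quot_alg (tensor_alg R (total_mod C)) (comp_ideal R C)"

definition \<R>_gen :: "('k, 'r) ring_scheme \<Rightarrow> ('k, 'c, 'a) lincat \<Rightarrow> 'c \<Rightarrow> 'c \<Rightarrow> 'a \<Rightarrow> ('k, 'c, 'a) \<R>_elem" where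
  "\<R>_gen R C x y f =
     comp_ideal R C +>\<^bsub>tensor_alg R (total_mod C)\<^esub> tensor_word R (total_mod C) [single C x y f]"

text \<open>\<open>\<R>\<close> on a linear functor \<open>C \<rightarrow> D\<close>, given by \<open>F\<close> on objects and by \<open>\<theta> x y\<close> on \<open>LHom C x y\<close>:
  the algebra homomorphism induced by \<open>f \<mapsto> \<theta> x y f\<close> on generators.\<close>

definition \<R>_map :: "('k, 'r) ring_scheme \<Rightarrow> ('k, 'c, 'a) lincat \<Rightarrow> ('k, 'd, 'b) lincat \<Rightarrow>
    ('c \<Rightarrow> 'd) \<Rightarrow> ('c \<Rightarrow> 'c \<Rightarrow> 'a \<Rightarrow> 'b) \<Rightarrow> ('k, 'c, 'a) \<R>_elem \<Rightarrow> ('k, 'd, 'b) \<R>_elem" where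
  "\<R>_map R C D F \<theta> = (THE \<Theta>. \<Theta> \<in> alg_homs R (\<R>_alg R C) (\<R>_alg R D) \<and>
     (\<forall>x\<in>LOb C. \<forall>y\<in>LOb C. \<forall>f\<in>carrier (LHom C x y).
        \<Theta> (\<R>_gen R C x y f) = \<R>_gen R D (F x) (F y) (\<theta> x y f)))"

text \<open>The canonical isomorphism \<open>D \<rightarrow> \<R>(D)\<close> for an algebra \<open>D\<close>.\<close>

definition \<R>_can :: "('k, 'r) ring_scheme \<Rightarrow> ('k, 'a) module \<Rightarrow> 'a \<Rightarrow> ('k, unit, 'a) \<R>_elem" where
  "\<R>_can R D = \<R>_gen R (alg_lincat D) () ()"


section \<open>Crossed products\<close>

text \<open>The product determined by \<open>(b \<otimes> g) (b' \<otimes> g') = b (g b') \<otimes> g g'\<close>, elements being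
  finitely supported functions \<open>\<phi>\<close> on (a subset of) \<open>G\<close>.\<close>

definition crossed_mult :: "('g, 's) monoid_scheme \<Rightarrow> ('k, 'a, 'g) galg \<Rightarrow> ('g \<Rightarrow> 'a) \<Rightarrow> ('g \<Rightarrow> 'a) \<Rightarrow> 'g \<Rightarrow> 'a" where
  "crossed_mult G B \<phi> \<psi> k = (if k \<in> carrier G
     then \<Oplus>\<^bsub>B\<^esub>g\<in>{g. \<phi> g \<noteq> \<zero>\<^bsub>B\<^esub>}. \<phi> g \<otimes>\<^bsub>B\<^esub> gact B g (\<psi> (inv\<^bsub>G\<^esub> g \<otimes>\<^bsub>G\<^esub> k))
     else \<zero>\<^bsub>B\<^esub>)"

definition crossed :: "('g, 's) monoid_scheme \<Rightarrow> 'g set \<Rightarrow> ('k, 'a, 'g) galg \<Rightarrow> ('k, 'g \<Rightarrow> 'a) module" where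
  "crossed G L B = fs_alg L B (crossed_mult G B)"

definition crossed_arr :: "('g, 's) monoid_scheme \<Rightarrow> 'g set \<Rightarrow> (('k, 'u, 'g) galg, 'u) carr \<Rightarrow>
    (('k, 'u) module, 'u) carr" where
  "crossed_arr G L = (\<lambda>(A, B, f). copy_arr (crossed G L A) (crossed G L B) ((\<circ>) f))"

definition crossed_ext :: "('g, 's) monoid_scheme \<Rightarrow> 'g set \<Rightarrow>
    (('k, 'u, 'g) galg, 'u) carr \<times> (('k, 'u, 'g) galg, 'u) carr \<Rightarrow>
    (('k, 'u) module, 'u) carr \<times> (('k, 'u) module, 'u) carr" where
  "crossed_ext G L = map_prod (crossed_arr G L) (crossed_arr G L)"

text \<open>For left cosets \<open>x = uH\<close> and \<open>y = vH\<close>, the product set \<open>y x\<^sup>-\<^sup>1\<close> is \<open>vHu\<^sup>-\<^sup>1\<close>.\<close>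

definition crossed_cat :: "('g, 's) monoid_scheme \<Rightarrow> 'g set \<Rightarrow> ('k, 'a, 'g) galg \<Rightarrow>
    ('k, 'g set, 'g \<Rightarrow> 'a) lincat" where
  "crossed_cat G H B = \<lparr>LOb = (\<lambda>u. u <#\<^bsub>G\<^esub> H) ` carrier G,
     LHom = (\<lambda>x y. fs_alg (y <#>\<^bsub>G\<^esub> set_inv\<^bsub>G\<^esub> x) B undefined),
     LComp = (\<lambda>x y z. crossed_mult G B)\<rparr>"

definition \<R>_crossed :: "('k, 'r) ring_scheme \<Rightarrow> ('g, 's) monoid_scheme \<Rightarrow> 'g set \<Rightarrow>
    (('k, 'u, 'g) galg, (('k, 'u, 'g) galg, 'u) carr, ('k, 'u) module, (('k, 'u) module, 'u) carr) func" where
  "\<R>_crossed R G H = \<lparr>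
     on_ob = (\<lambda>B. copy_alg (\<R>_alg R (crossed_cat G H B))),
     on_arr = (\<lambda>(A, B, f). copy_arr (\<R>_alg R (crossed_cat G H A)) (\<R>_alg R (crossed_cat G H B))
       (\<R>_map R (crossed_cat G H A) (crossed_cat G H B) id (\<lambda>x y. (\<circ>) f)))\<rparr>"

definition conj_subgroup :: "('g, 's) monoid_scheme \<Rightarrow> 'g set \<Rightarrow> 'g \<Rightarrow> 'g set" where
  "conj_subgroup G H u = u <#\<^bsub>G\<^esub> H #>\<^bsub>G\<^esub> inv\<^bsub>G\<^esub> u"

text \<open>The morphism \<open>\<nu>\<close> at the object \<open>uH\<close>; it depends on \<open>u\<close> only through \<open>uH\<close>.\<close>

definition nu_arr :: "('k, 'r) ring_scheme \<Rightarrow> ('g, 's) monoid_scheme \<Rightarrow> 'g set \<Rightarrow> 'g \<Rightarrow>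
    ('k, 'u, 'g) galg \<Rightarrow> (('k, 'u) module, 'u) carr" where
  "nu_arr R G H u B = (let D = crossed G (conj_subgroup G H u) B in
     copy_arr D (\<R>_alg R (crossed_cat G H B))
       (\<R>_map R (alg_lincat D) (crossed_cat G H B) (\<lambda>_. u <#\<^bsub>G\<^esub> H) (\<lambda>_ _. id) \<circ> \<R>_can R D))"

definition nu :: "('k, 'r) ring_scheme \<Rightarrow> ('g, 's) monoid_scheme \<Rightarrow> 'g set \<Rightarrow>
    (('k, 'u) module, (('k, 'u) module, 'u) carr, 'o, 'm) func \<Rightarrow> 'g \<Rightarrow> ('k, 'u, 'g) galg \<Rightarrow> 'm" where
  "nu R G H j u B = on_arr j (nu_arr R G H u B)"

definition crossed_boundary :: "('k, 'r) ring_scheme \<Rightarrow> ('g, 's) monoid_scheme \<Rightarrow> 'g set \<Rightarrow>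
    ('o, 'm, 'z) tricat_scheme \<Rightarrow> (('k, 'u) module, (('k, 'u) module, 'u) carr, 'o, 'm) func \<Rightarrow>
    ((('k, 'u) module, 'u) carr \<times> (('k, 'u) module, 'u) carr \<Rightarrow> 'm) \<Rightarrow>
    (('k, 'u, 'g) galg, 'u) carr \<times> (('k, 'u, 'g) galg, 'u) carr \<Rightarrow> 'm" where
  "crossed_boundary R G H kk j d = (\<lambda>(i, p).
     nu R G H j \<one>\<^bsub>G\<^esub> (Dom (GAlg R G) i) \<cdot>\<^bsub>kk\<^esub> d (crossed_ext G H (i, p)) \<cdot>\<^bsub>kk\<^esub>
     inv_arr kk (\<Omega>\<^sub>a kk (nu R G H j \<one>\<^bsub>G\<^esub> (Cod (GAlg R G) p))))"

end

theory Submission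
  imports Defs
begin

text \<open>Everything reduces to elementary homotopies. If \<open>a\<^sub>i\<^sub>j\<close> is a \<open>2 \<times> 2\<close> system of matrix units of maps
  \<open>A \<rightarrow> B\<close>, i.e. \<open>a\<^sub>i\<^sub>j(x) a\<^sub>k\<^sub>l(y) = \<delta>\<^sub>j\<^sub>k a\<^sub>i\<^sub>l(xy)\<close>, then straight line segments join \<open>a\<^sub>0\<^sub>0\<close> and \<open>a\<^sub>1\<^sub>1\<close>
  through \<open>a\<^sub>0\<^sub>0 + a\<^sub>1\<^sub>0\<close> and \<open>a\<^sub>0\<^sub>1 + a\<^sub>1\<^sub>1\<close>, so \<open>j a\<^sub>0\<^sub>0 = j a\<^sub>1\<^sub>1\<close>. Three instances give: corners
  \<open>D \<rightarrow> M\<^sub>X D\<close> are isomorphisms in \<open>kk\<close> for all nonempty \<open>X\<close> of cardinality at most \<open>\<nat> \<times> G\<close>; so are the \<open>\<nu>\<^bsub>uH\<^esub>\<close>, with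
  inverse \<open>f \<mapsto> e\<^sub>y\<^sub>x \<otimes> \<tau>\<^sub>y\<^sup>-\<^sup>1 f \<tau>\<^sub>x\<close> into \<open>M\<^sub>\<nat>\<^sub>\<times>\<^sub>G (B \<rtimes> uHu\<^sup>-\<^sup>1)\<close>; and \<open>\<nu>\<^bsub>uH\<^esub>\<close> composed with conjugation by \<open>u\<close>
  is \<open>\<nu>\<^sub>H\<close>. Since conjugation is natural in \<open>B\<close>, it is compatible with boundary maps, which is the square. Through
  \<open>\<nu>\<^sub>H\<close> the functor \<open>j \<R>(- \<rtimes> G/H)\<close> inherits excision and homotopy invariance from \<open>j(- \<rtimes> H)\<close>; its
  \<open>G\<close>-stability follows from the isomorphism \<open>(A \<otimes> End W) \<rtimes> H \<cong> M\<^sub>X (A \<rtimes> H)\<close>, \<open>M \<rtimes> h \<mapsto> M \<rho>(h) \<rtimes> h\<close>.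
  The universal property of \<open>j\<^sup>G\<close> then applies.\<close>

section \<open>Isomorphisms\<close>

text \<open>The obstacle is that \<open>\<R>(C)\<close> is not the direct sum of the Hom modules:
  products of non-composable arrows need not vanish in it. It does not split like a matrix algebra,
  and maps out of it, homotopies included, can only be prescribed on generators, with conditions on
  composable pairs. A segment from u to w between homomorphisms is multiplicative as soon as its
  coefficient of t^2, the product of (w - u)(x) and (w - u)(y), vanishes. Algebras have no unit, so
  neither matrix units nor the arrow u : H \<rightarrow> uH are elements; they occur as systems of
  maps and as multipliers, and segments through column sums take the place of rotations by
  invertible matrices. Invertibility in kk mostly comes from two-of-six arguments, which spare the
  computation of a two-sided inverse. The index set \<nat> \<times> G is infinite, so a copy of a
  smaller index set can be made to leave an index free, and two corners to be compared fit into one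
  matrix algebra. Algebras whose elements have other types than the universe enter through copies,
  which exist by cardinal bounds; \<open>J\<close> hides this.\<close>

lemma Hom_Arr: "f \<in> Hom C X Y \<Longrightarrow> f \<in> Arr C"
  and Hom_Dom: "f \<in> Hom C X Y \<Longrightarrow> Dom C f = X"
  and Hom_Cod: "f \<in> Hom C X Y \<Longrightarrow> Cod C f = Y"
  by (simp_all add: Hom_def)

context category
begin

lemma inverse_arrowsI:
  "\<lbrakk>f \<in> Hom C X Y; g \<in> Hom C Y X; g \<cdot> f = Id C X; f \<cdot> g = Id C Y\<rbrakk> \<Longrightarrow> inverse_arrows C f g"
  by (simp add: inverse_arrows_def Hom_def)

lemma inverse_arrowsD:
  assumes "inverse_arrows C f g" "f \<in> Hom C X Y"
  shows "g \<in> Hom C Y X" "g \<cdot> f = Id C X" "f \<cdot> g = Id C Y"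
  using assms by (auto simp add: inverse_arrows_def Hom_def)

lemma Hom_Ob:
  assumes "f \<in> Hom C X Y"
  shows "X \<in> Ob C" "Y \<in> Ob C"
  using assms Dom_Ob Cod_Ob by (auto simp: Hom_def)

lemma left_inverse_eq_right_inverse:
  assumes "f \<in> Hom C X Y" "g \<in> Hom C Y X" "h \<in> Hom C Y X" "g \<cdot> f = Id C X" "f \<cdot> h = Id C Y"
  shows "g = h"
proof -
  have "g = g \<cdot> (f \<cdot> h)" using assms Comp_Id by simp
  also have "\<dots> = (g \<cdot> f) \<cdot> h" using assms Comp_assoc by metis
  also have "\<dots> = h" using assms Id_Comp by simp
  finally show ?thesis .
qed

lemma inv_arr_inverse:
  assumes "iso_arrow C f"
  shows "inverse_arrows C f (inv_arr C f)"
proof -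
  obtain g where g: "inverse_arrows C f g" using assms by (auto simp: iso_arrow_def)
  have f: "f \<in> Hom C (Dom C f) (Cod C f)" using g by (simp add: inverse_arrows_def Hom_def)
  have "g' = g" if "inverse_arrows C f g'" for g'
    using left_inverse_eq_right_inverse[OF f] inverse_arrowsD[OF g f] inverse_arrowsD[OF that f]
    by blast
  with g show ?thesis unfolding inv_arr_def by (rule theI)
qed

lemma inv_arrD:
  assumes "iso_arrow C f" "f \<in> Hom C X Y"
  shows "inv_arr C f \<in> Hom C Y X" "inv_arr C f \<cdot> f = Id C X" "f \<cdot> inv_arr C f = Id C Y"
  using inverse_arrowsD[OF inv_arr_inverse[OF assms(1)] assms(2)] .

lemma iso_arrowI:
  "\<lbrakk>f \<in> Hom C X Y; g \<in> Hom C Y X; g \<cdot> f = Id C X; f \<cdot> g = Id C Y\<rbrakk> \<Longrightarrow> iso_arrow C f"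
  unfolding iso_arrow_def using inverse_arrowsI by blast

lemma iso_arrow_inv_arr:
  assumes "iso_arrow C f" "f \<in> Hom C X Y"
  shows "iso_arrow C (inv_arr C f)"
  using iso_arrowI[of "inv_arr C f" Y X f] inv_arrD[OF assms] assms(2) by blast

lemma Comp_inv_arr_cancel:
  assumes "iso_arrow C f" "f \<in> Hom C X Y" "g \<in> Hom C Y Z"
  shows "(g \<cdot> f) \<cdot> inv_arr C f = g"
  using assms inv_arrD[OF assms(1,2)] Comp_assoc Comp_Id by metis

lemma Comp_inv_arr_cancel':
  assumes "iso_arrow C f" "f \<in> Hom C X Y" "g \<in> Hom C X Z"
  shows "(g \<cdot> inv_arr C f) \<cdot> f = g"
  using assms inv_arrD[OF assms(1,2)] Comp_assoc Comp_Id by metis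

lemma inv_arr_Comp_cancel:
  assumes "iso_arrow C f" "f \<in> Hom C X Y" "g \<in> Hom C Z X"
  shows "inv_arr C f \<cdot> (f \<cdot> g) = g"
  using Comp_assoc[OF assms(3,2) inv_arrD(1)[OF assms(1,2)]] inv_arrD[OF assms(1,2)] Id_Comp[OF assms(3)] by simp

lemma inv_arr_Comp_cancel':
  assumes "iso_arrow C f" "f \<in> Hom C X Y" "g \<in> Hom C Z Y"
  shows "f \<cdot> (inv_arr C f \<cdot> g) = g"
  using Comp_assoc[OF assms(3) inv_arrD(1)[OF assms(1,2)] assms(2)] inv_arrD[OF assms(1,2)] Id_Comp[OF assms(3)]
      by simp

lemma iso_arrow_epi:
  assumes "iso_arrow C f" "f \<in> Hom C X Y" "g \<in> Hom C Y Z" "g' \<in> Hom C Y Z" "g \<cdot> f = g' \<cdot> f"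
  shows "g = g'"
  using Comp_inv_arr_cancel[OF assms(1-3), unfolded assms(5)] Comp_inv_arr_cancel[OF assms(1,2,4)]
  by (rule trans[OF sym])

lemma iso_arrow_mono:
  assumes "iso_arrow C f" "f \<in> Hom C X Y" "g \<in> Hom C Z X" "g' \<in> Hom C Z X" "f \<cdot> g = f \<cdot> g'"
  shows "g = g'"
  using inv_arr_Comp_cancel[OF assms(1-3), unfolded assms(5)] inv_arr_Comp_cancel[OF assms(1,2,4)]
  by (rule trans[OF sym])

lemma iso_arrow_Comp:
  assumes f: "f \<in> Hom C X Y" "iso_arrow C f" and g: "g \<in> Hom C Y Z" "iso_arrow C g"
  shows "iso_arrow C (g \<cdot> f)"
proof (rule iso_arrowI[of _ X Z "inv_arr C f \<cdot> inv_arr C g"])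
  note fi = inv_arrD[OF f(2,1)] and gi = inv_arrD[OF g(2,1)]
  show "g \<cdot> f \<in> Hom C X Z" using f g Comp_Hom by blast
  show "inv_arr C f \<cdot> inv_arr C g \<in> Hom C Z X" using fi gi Comp_Hom by blast
  have "inv_arr C f \<cdot> inv_arr C g \<cdot> (g \<cdot> f) = inv_arr C f \<cdot> (inv_arr C g \<cdot> (g \<cdot> f))"
    using Comp_assoc[OF _ gi(1) fi(1)] Comp_Hom[OF f(1) g(1)] by blast
  then show "inv_arr C f \<cdot> inv_arr C g \<cdot> (g \<cdot> f) = Id C X"
    using inv_arr_Comp_cancel[OF g(2,1) f(1)] fi by simp
  have "g \<cdot> f \<cdot> (inv_arr C f \<cdot> inv_arr C g) = g \<cdot> (f \<cdot> (inv_arr C f \<cdot> inv_arr C g))"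
    using Comp_assoc[OF _ f(1) g(1)] Comp_Hom[OF gi(1) fi(1)] by blast
  then show "g \<cdot> f \<cdot> (inv_arr C f \<cdot> inv_arr C g) = Id C Z"
    using inv_arr_Comp_cancel'[OF f(2,1) gi(1)] gi by simp
qed

lemma iso_arrow_Comp_cancel_right:
  assumes "f \<in> Hom C X Y" "iso_arrow C f" "g \<in> Hom C Y Z" "iso_arrow C (g \<cdot> f)"
  shows "iso_arrow C g"
  using iso_arrow_Comp[OF inv_arrD(1)[OF assms(2,1)] iso_arrow_inv_arr[OF assms(2,1)]
      Comp_Hom[OF assms(1,3)] assms(4)]
    Comp_inv_arr_cancel[OF assms(2,1,3)] by simp

lemma iso_arrow_Comp_cancel_left:
  assumes "f \<in> Hom C X Y" "g \<in> Hom C Y Z" "iso_arrow C g" "iso_arrow C (g \<cdot> f)"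
  shows "iso_arrow C f"
  using iso_arrow_Comp[OF Comp_Hom[OF assms(1,2)] assms(4) inv_arrD(1)[OF assms(3,2)]
      iso_arrow_inv_arr[OF assms(3,2)]]
    inv_arr_Comp_cancel[OF assms(3,2,1)] by simp

text \<open>\<open>g\<close> has the right inverse \<open>f \<cdot> inv_arr C (g \<cdot> f)\<close>
  and the left inverse \<open>inv_arr C (h \<cdot> g) \<cdot> h\<close>. These coincide, so
  \<open>g\<close> is invertible, and then \<open>f\<close> is. It serves for maps \<open>f\<close>
  that only become invertible visibly after passing to matrix algebras.\<close>

lemma iso_arrow_two_of_six:
  assumes f: "f \<in> Hom C X Y" and g: "g \<in> Hom C Y Z" and h: "h \<in> Hom C Z W"
    and gf: "iso_arrow C (g \<cdot> f)" and hg: "iso_arrow C (h \<cdot> g)"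
  shows "iso_arrow C f"
proof -
  note gf' = inv_arrD[OF gf Comp_Hom[OF f g]] and hg' = inv_arrD[OF hg Comp_Hom[OF g h]]
  let ?r = "f \<cdot> inv_arr C (g \<cdot> f)" and ?l = "inv_arr C (h \<cdot> g) \<cdot> h"
  have r: "?r \<in> Hom C Z Y" "g \<cdot> ?r = Id C Z"
    using Comp_Hom[OF gf'(1) f] gf' Comp_assoc[OF gf'(1) f g] by simp_all
  have l: "?l \<in> Hom C Z Y" "?l \<cdot> g = Id C Y"
    using Comp_Hom[OF h hg'(1)] hg' Comp_assoc[OF g h hg'(1)] by simp_all
  have "?l = ?r" using left_inverse_eq_right_inverse[OF g l(1) r(1) l(2) r(2)] .
  then have "iso_arrow C g" using iso_arrowI[OF g l(1) l(2)] r by simp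
  then show ?thesis using iso_arrow_Comp_cancel_left f g gf by blast
qed

end

section \<open>Functors and isomorphisms\<close>

lemma is_functor_Hom:
  assumes "is_functor C D F" "f \<in> Hom C X Y"
  shows "on_arr F f \<in> Hom D (on_ob F X) (on_ob F Y)"
  using assms by (auto simp: is_functor_def Hom_def)

lemma is_functor_Comp:
  assumes "is_functor C D F" "f \<in> Hom C X Y" "g \<in> Hom C Y Z"
  shows "on_arr F (g \<cdot>\<^bsub>C\<^esub> f) = on_arr F g \<cdot>\<^bsub>D\<^esub> on_arr F f"
  using assms by (auto simp: is_functor_def Hom_def)

lemma is_functor_Id:
  "\<lbrakk>is_functor C D F; X \<in> Ob C\<rbrakk> \<Longrightarrow> on_arr F (Id C X) = Id D (on_ob F X)"
  by (simp add: is_functor_def)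

lemma is_functor_func_comp:
  assumes "is_functor C D F" "is_functor D E F'"
  shows "is_functor C E (F' \<circ>\<^sub>F F)"
  using assms unfolding is_functor_def func_comp_def Hom_def by auto

lemma iso_arrow_functor:
  assumes F: "is_functor C D F" and f: "iso_arrow C f"
  shows "iso_arrow D (on_arr F f)"
proof -
  interpret C: category C using F by (simp add: is_functor_def)
  interpret D: category D using F by (simp add: is_functor_def)
  have fh: "f \<in> Hom C (Dom C f) (Cod C f)"
    using f by (auto simp: iso_arrow_def inverse_arrows_def Hom_def)
  note fi = C.inv_arrD[OF f fh]
  show ?thesis
    using D.iso_arrowI[OF is_functor_Hom[OF F fh] is_functor_Hom[OF F fi(1)]]
      is_functor_Comp[OF F fh fi(1)] is_functor_Comp[OF F fi(1) fh] fi
      is_functor_Id[OF F] C.Hom_Ob[OF fh] by simp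
qed

section \<open>Linear maps and algebra homomorphisms\<close>

text \<open>Unlike \<open>linear_maps\<close>, this asks for no extensionality, so that maps written
  as terms compose without being restricted each time; \<open>nu_hom\<close> stands in the same
  relation to \<open>alg_homs\<close>.\<close>

definition lin_map ::
  "('k, 'r) ring_scheme \<Rightarrow> ('k, 'a, 'x) module_scheme \<Rightarrow> ('k, 'b, 'y) module_scheme \<Rightarrow> ('a \<Rightarrow> 'b) \<Rightarrow> bool" where
  "lin_map R A B f \<longleftrightarrow> (\<forall>a\<in>carrier A. f a \<in> carrier B) \<and>
     (\<forall>a\<in>carrier A. \<forall>b\<in>carrier A. f (a \<oplus>\<^bsub>A\<^esub> b) = f a \<oplus>\<^bsub>B\<^esub> f b) \<and>
     (\<forall>r\<in>carrier R. \<forall>a\<in>carrier A. f (r \<odot>\<^bsub>A\<^esub> a) = r \<odot>\<^bsub>B\<^esub> f a)"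

definition nu_hom ::
  "('k, 'r) ring_scheme \<Rightarrow> ('k, 'a, 'x) module_scheme \<Rightarrow> ('k, 'b, 'y) module_scheme \<Rightarrow> ('a \<Rightarrow> 'b) \<Rightarrow> bool" where
  "nu_hom R A B f \<longleftrightarrow> lin_map R A B f \<and>
     (\<forall>a\<in>carrier A. \<forall>b\<in>carrier A. f (a \<otimes>\<^bsub>A\<^esub> b) = f a \<otimes>\<^bsub>B\<^esub> f b)"

lemma lin_mapI:
  assumes "\<And>a. a \<in> carrier A \<Longrightarrow> f a \<in> carrier B"
    and "\<And>a b. \<lbrakk>a \<in> carrier A; b \<in> carrier A\<rbrakk> \<Longrightarrow> f (a \<oplus>\<^bsub>A\<^esub> b) = f a \<oplus>\<^bsub>B\<^esub> f b"
    and "\<And>r a. \<lbrakk>r \<in> carrier R; a \<in> carrier A\<rbrakk> \<Longrightarrow> f (r \<odot>\<^bsub>A\<^esub> a) = r \<odot>\<^bsub>B\<^esub> f a"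
  shows "lin_map R A B f"
  using assms by (simp add: lin_map_def)

lemma lin_mapD:
  assumes "lin_map R A B f"
  shows "a \<in> carrier A \<Longrightarrow> f a \<in> carrier B"
    and "\<lbrakk>a \<in> carrier A; b \<in> carrier A\<rbrakk> \<Longrightarrow> f (a \<oplus>\<^bsub>A\<^esub> b) = f a \<oplus>\<^bsub>B\<^esub> f b"
    and "\<lbrakk>r \<in> carrier R; a \<in> carrier A\<rbrakk> \<Longrightarrow> f (r \<odot>\<^bsub>A\<^esub> a) = r \<odot>\<^bsub>B\<^esub> f a"
  using assms by (simp_all add: lin_map_def)

lemma nu_homI:
  assumes "lin_map R A B f"
    and "\<And>a b. \<lbrakk>a \<in> carrier A; b \<in> carrier A\<rbrakk> \<Longrightarrow> f (a \<otimes>\<^bsub>A\<^esub> b) = f a \<otimes>\<^bsub>B\<^esub> f b"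
  shows "nu_hom R A B f"
  using assms by (simp add: nu_hom_def)

lemma nu_homD:
  assumes "nu_hom R A B f"
  shows "lin_map R A B f"
    and "\<lbrakk>a \<in> carrier A; b \<in> carrier A\<rbrakk> \<Longrightarrow> f (a \<otimes>\<^bsub>A\<^esub> b) = f a \<otimes>\<^bsub>B\<^esub> f b"
    and "a \<in> carrier A \<Longrightarrow> f a \<in> carrier B"
    and "\<lbrakk>a \<in> carrier A; b \<in> carrier A\<rbrakk> \<Longrightarrow> f (a \<oplus>\<^bsub>A\<^esub> b) = f a \<oplus>\<^bsub>B\<^esub> f b"
    and "\<lbrakk>r \<in> carrier R; a \<in> carrier A\<rbrakk> \<Longrightarrow> f (r \<odot>\<^bsub>A\<^esub> a) = r \<odot>\<^bsub>B\<^esub> f a"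
  using assms by (simp_all add: nu_hom_def lin_map_def)

lemma lin_map_comp: "\<lbrakk>lin_map R A B f; lin_map R B C g\<rbrakk> \<Longrightarrow> lin_map R A C (g \<circ> f)"
  by (simp add: lin_map_def)

lemma nu_hom_comp: "\<lbrakk>nu_hom R A B f; nu_hom R B C g\<rbrakk> \<Longrightarrow> nu_hom R A C (g \<circ> f)"
  by (simp add: nu_hom_def lin_map_def)

lemma lin_map_id: "lin_map R A A id"
  by (simp add: lin_map_def)

lemma nu_hom_id: "nu_hom R A A id"
  by (simp add: nu_hom_def lin_map_def)

lemma lin_map_cong:
  assumes "Module.module R A" and "\<And>a. a \<in> carrier A \<Longrightarrow> f a = g a"
  shows "lin_map R A B f \<longleftrightarrow> lin_map R A B g"
proof -
  interpret A: Module.module R A by fact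
  show ?thesis using assms(2) by (simp add: lin_map_def)
qed

lemma nu_hom_cong:
  assumes "nu_algebra R A" and "\<And>a. a \<in> carrier A \<Longrightarrow> f a = g a"
  shows "nu_hom R A B f \<longleftrightarrow> nu_hom R A B g"
proof -
  interpret A: nu_algebra R A by fact
  show ?thesis using assms(2) lin_map_cong[OF A.module_axioms, where f = f and g = g and B = B]
    by (simp add: nu_hom_def A.mult_closed)
qed

lemma nu_algebra_module: "nu_algebra R A \<Longrightarrow> Module.module R A"
  by (rule nu_algebra.axioms(1))

lemma module_abelian_group: "Module.module R A \<Longrightarrow> abelian_group A"
  by (rule module.axioms(2))

lemma abelian_group_hom_zero:
  assumes "abelian_group A" "abelian_group B" "\<And>a. a \<in> carrier A \<Longrightarrow> f a \<in> carrier B"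
    and "\<And>a b. \<lbrakk>a \<in> carrier A; b \<in> carrier A\<rbrakk> \<Longrightarrow> f (a \<oplus>\<^bsub>A\<^esub> b) = f a \<oplus>\<^bsub>B\<^esub> f b"
  shows "f \<zero>\<^bsub>A\<^esub> = \<zero>\<^bsub>B\<^esub>"
proof -
  interpret A: abelian_group A by fact
  interpret B: abelian_group B by fact
  have "f \<zero>\<^bsub>A\<^esub> \<oplus>\<^bsub>B\<^esub> f \<zero>\<^bsub>A\<^esub> = f \<zero>\<^bsub>A\<^esub>" using assms(4)[of "\<zero>\<^bsub>A\<^esub>" "\<zero>\<^bsub>A\<^esub>"] by simp
  then show ?thesis using assms(3) by (metis A.zero_closed B.add.l_cancel_one')
qed

lemma lin_map_zero:
  assumes "Module.module R A" "Module.module R B" "lin_map R A B f"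
  shows "f \<zero>\<^bsub>A\<^esub> = \<zero>\<^bsub>B\<^esub>"
  by (rule abelian_group_hom_zero[OF module_abelian_group[OF assms(1)] module_abelian_group[OF assms(2)]])
    (simp_all add: lin_mapD[OF assms(3)])

lemma lin_map_minus:
  assumes "Module.module R A" "Module.module R B" "lin_map R A B f" "a \<in> carrier A"
  shows "f (\<ominus>\<^bsub>A\<^esub> a) = \<ominus>\<^bsub>B\<^esub> f a"
proof -
  interpret A: Module.module R A by fact
  interpret B: Module.module R B by fact
  have "f (\<ominus>\<^bsub>A\<^esub> a) \<oplus>\<^bsub>B\<^esub> f a = \<zero>\<^bsub>B\<^esub>"
    using lin_mapD(2)[OF assms(3), of "\<ominus>\<^bsub>A\<^esub> a" a] assms(4) lin_map_zero[OF assms(1-3)]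
    by (simp add: A.l_neg)
  then show ?thesis using lin_mapD(1)[OF assms(3)] assms(4) by (simp add: B.minus_equality)
qed

lemma lin_map_diff:
  assumes "Module.module R A" "Module.module R B" "lin_map R A B f" "a \<in> carrier A" "b \<in> carrier A"
  shows "f (a \<ominus>\<^bsub>A\<^esub> b) = f a \<ominus>\<^bsub>B\<^esub> f b"
proof -
  interpret A: Module.module R A by fact
  interpret B: Module.module R B by fact
  show ?thesis using assms lin_mapD[OF assms(3)] lin_map_minus[OF assms(1-3)]
    by (simp add: a_minus_def)
qed

lemma lin_map_finsum:
  assumes "Module.module R A" "Module.module R B" "lin_map R A B f" "finite S" "\<phi> \<in> S \<rightarrow> carrier A"
  shows "f (finsum A \<phi> S) = finsum B (f \<circ> \<phi>) S"
proof -
  interpret A: Module.module R A by fact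
  interpret B: Module.module R B by fact
  show ?thesis using assms(4,5)
  proof (induction S)
    case empty
    then show ?case using lin_map_zero[OF assms(1-3)] by simp
  next
    case (insert x S)
    then have *: "\<phi> \<in> S \<rightarrow> carrier A" "\<phi> x \<in> carrier A" by auto
    then have **: "f \<circ> \<phi> \<in> S \<rightarrow> carrier B" "(f \<circ> \<phi>) x \<in> carrier B"
      using lin_mapD(1)[OF assms(3)] by (auto simp: Pi_iff)
    then show ?case using insert * lin_mapD(2)[OF assms(3), of "\<phi> x" "finsum A \<phi> S"]
      B.finsum_insert[OF insert.hyps(1,2) **] by simp
  qed
qed

lemma alg_homs_nu_hom: "f \<in> alg_homs R A B \<Longrightarrow> nu_hom R A B f"
  by (auto simp: alg_homs_def linear_maps_def nu_hom_def lin_map_def)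

lemma linear_maps_lin_map: "f \<in> linear_maps R A B \<Longrightarrow> lin_map R A B f"
  by (auto simp: linear_maps_def lin_map_def)

lemma alg_homs_ext: "f \<in> alg_homs R A B \<Longrightarrow> f \<in> extensional (carrier A)"
  by (auto simp: alg_homs_def linear_maps_def PiE_def)

lemma restrict_linear_maps:
  assumes "Module.module R A" "lin_map R A B f"
  shows "restrict f (carrier A) \<in> linear_maps R A B"
proof -
  interpret A: Module.module R A by fact
  show ?thesis using assms(2) by (auto simp: linear_maps_def lin_map_def)
qed

lemma restrict_alg_homs:
  assumes "nu_algebra R A" "nu_hom R A B f"
  shows "restrict f (carrier A) \<in> alg_homs R A B"
proof -
  interpret A: nu_algebra R A by fact
  show ?thesis using assms(2) restrict_linear_maps[OF A.module_axioms, of B f]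
    by (simp add: alg_homs_def nu_hom_def A.mult_closed)
qed

context nu_algebra
begin

lemma mult_zero_left: "a \<in> carrier A \<Longrightarrow> \<zero>\<^bsub>A\<^esub> \<otimes>\<^bsub>A\<^esub> a = \<zero>\<^bsub>A\<^esub>"
  using abelian_group_hom_zero[of A A "\<lambda>x. x \<otimes>\<^bsub>A\<^esub> a"] module_abelian_group[OF module_axioms]
  by (simp add: mult_closed mult_l_distr)

lemma mult_zero_right: "a \<in> carrier A \<Longrightarrow> a \<otimes>\<^bsub>A\<^esub> \<zero>\<^bsub>A\<^esub> = \<zero>\<^bsub>A\<^esub>"
  using abelian_group_hom_zero[of A A "\<lambda>x. a \<otimes>\<^bsub>A\<^esub> x"] module_abelian_group[OF module_axioms]
  by (simp add: mult_closed mult_r_distr)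

lemma lin_map_mult_right: "a \<in> carrier A \<Longrightarrow> lin_map R A A (\<lambda>x. x \<otimes>\<^bsub>A\<^esub> a)"
  by (simp add: lin_map_def mult_closed mult_l_distr smult_mult_left)

lemma lin_map_mult_left: "a \<in> carrier A \<Longrightarrow> lin_map R A A (\<lambda>x. a \<otimes>\<^bsub>A\<^esub> x)"
  by (simp add: lin_map_def mult_closed mult_r_distr smult_mult_right)

lemma mult_diff_left:
  "\<lbrakk>a \<in> carrier A; b \<in> carrier A; c \<in> carrier A\<rbrakk> \<Longrightarrow>
    (a \<ominus>\<^bsub>A\<^esub> b) \<otimes>\<^bsub>A\<^esub> c = a \<otimes>\<^bsub>A\<^esub> c \<ominus>\<^bsub>A\<^esub> b \<otimes>\<^bsub>A\<^esub> c"
  using lin_map_diff[OF module_axioms module_axioms lin_map_mult_right] by simp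

lemma mult_diff_right:
  "\<lbrakk>a \<in> carrier A; b \<in> carrier A; c \<in> carrier A\<rbrakk> \<Longrightarrow>
    c \<otimes>\<^bsub>A\<^esub> (a \<ominus>\<^bsub>A\<^esub> b) = c \<otimes>\<^bsub>A\<^esub> a \<ominus>\<^bsub>A\<^esub> c \<otimes>\<^bsub>A\<^esub> b"
  using lin_map_diff[OF module_axioms module_axioms lin_map_mult_left] by simp

end

lemma inverse_nu_hom:
  assumes A: "nu_algebra R A" and f: "nu_hom R A B f" and b: "bij_betw f (carrier A) (carrier B)"
  shows "nu_hom R B A (inv_into (carrier A) f)"
proof -
  interpret A: nu_algebra R A by fact
  let ?g = "inv_into (carrier A) f"
  have c: "?g y \<in> carrier A" "f (?g y) = y" if "y \<in> carrier B" for y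
    using that b by (auto simp: bij_betw_def inv_into_into f_inv_into_f)
  have i: "?g (f x) = x" if "x \<in> carrier A" for x
    using that b by (auto simp: bij_betw_def)
  show ?thesis
  proof (intro nu_homI lin_mapI)
    fix x y assume xy: "x \<in> carrier B" "y \<in> carrier B"
    then show "?g (x \<oplus>\<^bsub>B\<^esub> y) = ?g x \<oplus>\<^bsub>A\<^esub> ?g y"
      using nu_homD(4)[OF f, of "?g x" "?g y"] i[of "?g x \<oplus>\<^bsub>A\<^esub> ?g y"] by (simp add: c)
    show "?g (x \<otimes>\<^bsub>B\<^esub> y) = ?g x \<otimes>\<^bsub>A\<^esub> ?g y"
      using xy nu_homD(2)[OF f, of "?g x" "?g y"] i[of "?g x \<otimes>\<^bsub>A\<^esub> ?g y"] by (simp add: c A.mult_closed)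
  next
    fix r y assume "r \<in> carrier R" "y \<in> carrier B"
    then show "?g (r \<odot>\<^bsub>B\<^esub> y) = r \<odot>\<^bsub>A\<^esub> ?g y"
      using nu_homD(5)[OF f, of r "?g y"] i[of "r \<odot>\<^bsub>A\<^esub> ?g y"] by (simp add: c)
  qed (simp add: c)
qed

section \<open>Finitely supported functions\<close>

text \<open>The elementary tensor of \<open>a\<close> with the basis element \<open>s\<close>.
  Corners, constant polynomials and words are all of this form.\<close>

definition fsingle :: "('a, 'z) ring_scheme \<Rightarrow> 'x \<Rightarrow> 'a \<Rightarrow> 'x \<Rightarrow> 'a" where
  "fsingle A s a = (\<lambda>t. if t = s then a else \<zero>\<^bsub>A\<^esub>)"

lemma fs_alg_simps [simp]:
  "carrier (fs_alg S A m) = fin_fun S A" "mult (fs_alg S A m) = m" "zero (fs_alg S A m) = (\<lambda>x. \<zero>\<^bsub>A\<^esub>)"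
  "add (fs_alg S A m) = (\<lambda>\<phi> \<psi> x. \<phi> x \<oplus>\<^bsub>A\<^esub> \<psi> x)" "smult (fs_alg S A m) = (\<lambda>r \<phi> x. r \<odot>\<^bsub>A\<^esub> \<phi> x)"
  by (simp_all add: fs_alg_def)

lemma corner_fsingle: "corner A x a = fsingle A (x, x) a"
  by (simp add: corner_def fsingle_def)

lemma poly_const_fsingle: "poly_const A a = fsingle A 0 a"
  by (simp add: poly_const_def fsingle_def fun_eq_iff)

lemma word_fsingle: "word R w = fsingle R w \<one>\<^bsub>R\<^esub>"
  by (simp add: word_def fsingle_def)

lemma fin_fun_mono: "\<lbrakk>\<phi> \<in> fin_fun S A; S \<subseteq> T; \<zero>\<^bsub>A\<^esub> \<in> carrier A\<rbrakk> \<Longrightarrow> \<phi> \<in> fin_fun T A"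
  by (auto simp: fin_fun_def)

lemma fin_fun_support: "\<phi> \<in> fin_fun S A \<Longrightarrow> {x. \<phi> x \<noteq> \<zero>\<^bsub>A\<^esub>} \<subseteq> S"
  by (auto simp: fin_fun_def)

lemma fin_fun_finite: "\<phi> \<in> fin_fun S A \<Longrightarrow> finite {x. \<phi> x \<noteq> \<zero>\<^bsub>A\<^esub>}"
  by (simp add: fin_fun_def)

lemma fin_fun_restrict_support:
  "\<lbrakk>\<phi> \<in> fin_fun T A; \<And>x. x \<notin> S \<Longrightarrow> \<phi> x = \<zero>\<^bsub>A\<^esub>; \<zero>\<^bsub>A\<^esub> \<in> carrier A\<rbrakk> \<Longrightarrow> \<phi> \<in> fin_fun S A"
  unfolding fin_fun_def mem_Collect_eq by metis

context abelian_group
begin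

lemma fin_fun_carrier: "\<phi> \<in> fin_fun S G \<Longrightarrow> \<phi> x \<in> carrier G"
  by (cases "x \<in> S") (auto simp: fin_fun_def)

lemma fsingle_zero [simp]: "fsingle G s \<zero> = (\<lambda>x. \<zero>)"
  by (auto simp: fsingle_def)

lemma fsingle_closed: "\<lbrakk>s \<in> S; a \<in> carrier G\<rbrakk> \<Longrightarrow> fsingle G s a \<in> fin_fun S G"
  by (auto simp: fsingle_def fin_fun_def)

lemma fsingle_add: "\<lbrakk>a \<in> carrier G; b \<in> carrier G\<rbrakk> \<Longrightarrow>
    fsingle G s (a \<oplus> b) = (\<lambda>x. fsingle G s a x \<oplus> fsingle G s b x)"
  by (auto simp: fsingle_def)

lemma zero_fin_fun: "(\<lambda>x. \<zero>) \<in> fin_fun S G"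
  by (simp add: fin_fun_def)

lemma add_fin_fun:
  assumes "\<phi> \<in> fin_fun S G" "\<psi> \<in> fin_fun S G"
  shows "(\<lambda>x. \<phi> x \<oplus> \<psi> x) \<in> fin_fun S G"
proof -
  have "{x. \<phi> x \<oplus> \<psi> x \<noteq> \<zero>} \<subseteq> {x. \<phi> x \<noteq> \<zero>} \<union> {x. \<psi> x \<noteq> \<zero>}" by auto
  then have "finite {x. \<phi> x \<oplus> \<psi> x \<noteq> \<zero>}"
    by (rule finite_subset) (use assms in \<open>simp add: fin_fun_def\<close>)
  then show ?thesis using assms by (auto simp: fin_fun_def)
qed

text \<open>Induction over a finite set \<open>F\<close> containing the support, splitting off the
  value at one point. \<open>F\<close> may contain points outside \<open>S\<close>; there the
  function vanishes and the point is simply dropped.\<close>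

lemma fin_fun_induct [consumes 1, case_names zero single add]:
  assumes \<phi>: "\<phi> \<in> fin_fun S G"
    and "P (\<lambda>x. \<zero>)"
    and P1: "\<And>s a. \<lbrakk>s \<in> S; a \<in> carrier G\<rbrakk> \<Longrightarrow> P (fsingle G s a)"
    and P2: "\<And>\<phi> \<psi>. \<lbrakk>\<phi> \<in> fin_fun S G; \<psi> \<in> fin_fun S G; P \<phi>; P \<psi>\<rbrakk> \<Longrightarrow> P (\<lambda>x. \<phi> x \<oplus> \<psi> x)"
  shows "P \<phi>"
proof -
  have "\<forall>\<phi>. \<phi> \<in> fin_fun S G \<longrightarrow> {x. \<phi> x \<noteq> \<zero>} \<subseteq> F \<longrightarrow> P \<phi>" if "finite F" for F
    using that
  proof (induction F)
    case empty
    have "\<phi> = (\<lambda>x. \<zero>)" if "{x. \<phi> x \<noteq> \<zero>} \<subseteq> {}" for \<phi> :: "'c \<Rightarrow> 'a" using that by auto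
    with assms(2) show ?case by blast
  next
    case (insert s F)
    show ?case
    proof (intro allI impI)
      fix \<phi> assume f: "\<phi> \<in> fin_fun S G" "{x. \<phi> x \<noteq> \<zero>} \<subseteq> insert s F"
      show "P \<phi>"
      proof (cases "s \<in> S")
        case True
        let ?\<psi> = "\<phi>(s := \<zero>)"
        have "{x. ?\<psi> x \<noteq> \<zero>} \<subseteq> {x. \<phi> x \<noteq> \<zero>}" by auto
        then have "finite {x. ?\<psi> x \<noteq> \<zero>}" using fin_fun_finite[OF f(1)] by (rule finite_subset)
        then have \<psi>: "?\<psi> \<in> fin_fun S G"
          using f(1) by (auto simp: fin_fun_def)
        have "{x. ?\<psi> x \<noteq> \<zero>} \<subseteq> F" using f(2) by auto
        then have "P ?\<psi>" using insert.IH \<psi> by blast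
        moreover have "\<phi> = (\<lambda>x. fsingle G s (\<phi> s) x \<oplus> ?\<psi> x)"
          using fin_fun_carrier[OF f(1)] by (auto simp: fsingle_def)
        ultimately show ?thesis
          using P2[OF fsingle_closed[OF True] \<psi> P1[OF True], of "\<phi> s"] fin_fun_carrier[OF f(1)] by simp
      next
        case False
        then show ?thesis using insert.IH f by (auto simp: fin_fun_def)
      qed
    qed
  qed
  with \<phi> fin_fun_finite[OF \<phi>] show ?thesis by blast
qed

end

lemma module_fs_alg:
  assumes "Module.module R A"
  shows "Module.module R (fs_alg S A m)"
proof -
  interpret A: Module.module R A by fact
  note c = A.fin_fun_carrier[where S = S]
  show ?thesis
  proof (rule moduleI)
    show "abelian_group (fs_alg S A m)"
    proof (rule abelian_groupI)
      fix \<phi> assume "\<phi> \<in> carrier (fs_alg S A m)"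
      then have \<phi>: "\<phi> \<in> fin_fun S A" by simp
      have "{x. \<ominus>\<^bsub>A\<^esub> \<phi> x \<noteq> \<zero>\<^bsub>A\<^esub>} \<subseteq> {x. \<phi> x \<noteq> \<zero>\<^bsub>A\<^esub>}" by auto
      then have "finite {x. \<ominus>\<^bsub>A\<^esub> \<phi> x \<noteq> \<zero>\<^bsub>A\<^esub>}" using finite_subset fin_fun_finite[OF \<phi>] by blast
      then have "(\<lambda>x. \<ominus>\<^bsub>A\<^esub> \<phi> x) \<in> fin_fun S A"
        using \<phi> unfolding fin_fun_def by simp
      then show "\<exists>y\<in>carrier (fs_alg S A m). y \<oplus>\<^bsub>fs_alg S A m\<^esub> \<phi> = \<zero>\<^bsub>fs_alg S A m\<^esub>"
        using \<phi> by (intro bexI[of _ "\<lambda>x. \<ominus>\<^bsub>A\<^esub> \<phi> x"]) (use \<phi> in \<open>simp_all add: c A.l_neg\<close>)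
    qed (simp_all add: A.add_fin_fun A.zero_fin_fun c A.a_ac)
  next
    fix r \<phi> assume r: "r \<in> carrier R" and "\<phi> \<in> carrier (fs_alg S A m)"
    then have \<phi>: "\<phi> \<in> fin_fun S A" by simp
    have "{x. r \<odot>\<^bsub>A\<^esub> \<phi> x \<noteq> \<zero>\<^bsub>A\<^esub>} \<subseteq> {x. \<phi> x \<noteq> \<zero>\<^bsub>A\<^esub>}" using r \<phi> by auto
    then have "finite {x. r \<odot>\<^bsub>A\<^esub> \<phi> x \<noteq> \<zero>\<^bsub>A\<^esub>}" using finite_subset fin_fun_finite[OF \<phi>] by blast
    then show "r \<odot>\<^bsub>fs_alg S A m\<^esub> \<phi> \<in> carrier (fs_alg S A m)"
      using \<phi> r by (simp add: fin_fun_def)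
  qed (simp_all add: A.is_cring c A.smult_l_distr A.smult_r_distr A.smult_assoc1)
qed

lemma (in Module.module) fsingle_smult:
  "r \<in> carrier R \<Longrightarrow> (\<lambda>x. r \<odot>\<^bsub>M\<^esub> fsingle M s a x) = fsingle M s (r \<odot>\<^bsub>M\<^esub> a)"
  by (auto simp: fsingle_def)

lemma (in Module.module) smult_fin_fun:
  "\<lbrakk>r \<in> carrier R; \<phi> \<in> fin_fun S M\<rbrakk> \<Longrightarrow> (\<lambda>x. r \<odot>\<^bsub>M\<^esub> \<phi> x) \<in> fin_fun S M"
  using module.smult_closed[OF module_fs_alg[OF module_axioms]] by fastforce

lemma lin_map_fsingle:
  assumes "Module.module R A" "s \<in> S"
  shows "lin_map R A (fs_alg S A m) (fsingle A s)"
proof -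
  interpret A: Module.module R A by fact
  show ?thesis using assms(2)
    by (intro lin_mapI) (simp_all add: A.fsingle_closed A.fsingle_add A.fsingle_smult)
qed

lemma lin_map_fs_eqI:
  assumes "Module.module R A" "Module.module R B" "lin_map R (fs_alg S A m) B f" "lin_map R (fs_alg S A m) B g"
    and "\<And>s a. \<lbrakk>s \<in> S; a \<in> carrier A\<rbrakk> \<Longrightarrow> f (fsingle A s a) = g (fsingle A s a)"
    and \<phi>: "\<phi> \<in> fin_fun S A"
  shows "f \<phi> = g \<phi>"
proof -
  interpret A: Module.module R A by fact
  interpret F: Module.module R "fs_alg S A m" by (rule module_fs_alg) fact
  show ?thesis using \<phi>
  proof (induction rule: A.fin_fun_induct)
    case zero
    then show ?case using lin_map_zero[OF F.module_axioms assms(2,3)]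
        lin_map_zero[OF F.module_axioms assms(2,4)] by simp
  next
    case (add \<phi> \<psi>)
    then show ?case using lin_mapD(2)[OF assms(3), of \<phi> \<psi>] lin_mapD(2)[OF assms(4), of \<phi> \<psi>] by simp
  qed (use assms(5) in simp)
qed

definition fs_ext :: "('a, 'z) ring_scheme \<Rightarrow> ('b, 'y) ring_scheme \<Rightarrow> ('x \<Rightarrow> 'a \<Rightarrow> 'b) \<Rightarrow> ('x \<Rightarrow> 'a) \<Rightarrow> 'b" where
  "fs_ext A B \<theta> \<phi> = (\<Oplus>\<^bsub>B\<^esub>s\<in>{s. \<phi> s \<noteq> \<zero>\<^bsub>A\<^esub>}. \<theta> s (\<phi> s))"

text \<open>Points outside the support contribute \<open>\<theta> s \<zero> = \<zero>\<close>, so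
  every larger finite subset of \<open>S\<close> gives the same sum. This brings functions with
  different supports over a common index set, which additivity of \<open>fs_ext\<close>
  requires.\<close>

lemma fs_ext_superset:
  assumes A: "Module.module R A" and B: "Module.module R B"
    and \<theta>: "\<And>s. s \<in> S \<Longrightarrow> lin_map R A B (\<theta> s)"
    and \<phi>: "\<phi> \<in> fin_fun S A" and F: "finite F" "F \<subseteq> S" "{s. \<phi> s \<noteq> \<zero>\<^bsub>A\<^esub>} \<subseteq> F"
  shows "fs_ext A B \<theta> \<phi> = (\<Oplus>\<^bsub>B\<^esub>s\<in>F. \<theta> s (\<phi> s))"
proof -
  interpret A: Module.module R A by fact
  interpret B: Module.module R B by fact
  show ?thesis unfolding fs_ext_def
  proof (rule B.add.finprod_mono_neutral_cong_left[OF F(1,3)])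
    show "\<theta> i (\<phi> i) = \<zero>\<^bsub>B\<^esub>" if "i \<in> F - {s. \<phi> s \<noteq> \<zero>\<^bsub>A\<^esub>}" for i
      using that lin_map_zero[OF A B \<theta>] F(2) by auto
    show "(\<lambda>s. \<theta> s (\<phi> s)) \<in> F \<rightarrow> carrier B"
      using lin_mapD(1)[OF \<theta>] F(2) A.fin_fun_carrier[OF \<phi>] by auto
  qed simp
qed

lemma fs_ext_fsingle:
  assumes A: "Module.module R A" and B: "Module.module R B"
    and \<theta>: "\<And>s. s \<in> S \<Longrightarrow> lin_map R A B (\<theta> s)" and "s \<in> S" "a \<in> carrier A"
  shows "fs_ext A B \<theta> (fsingle A s a) = \<theta> s a"
proof -
  interpret A: Module.module R A by fact
  interpret B: Module.module R B by fact
  have "fs_ext A B \<theta> (fsingle A s a) = (\<Oplus>\<^bsub>B\<^esub>t\<in>{s}. \<theta> t (fsingle A s a t))"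
    by (rule fs_ext_superset[OF A B \<theta>, where S = S])
      (use assms A.fsingle_closed in \<open>auto simp: fsingle_def\<close>)
  then show ?thesis using lin_mapD(1)[OF \<theta>] assms by (simp add: fsingle_def)
qed

lemma lin_map_fs_ext:
  assumes A: "Module.module R A" and B: "Module.module R B"
    and \<theta>: "\<And>s. s \<in> S \<Longrightarrow> lin_map R A B (\<theta> s)"
  shows "lin_map R (fs_alg S A m) B (fs_ext A B \<theta>)"
proof -
  interpret A: Module.module R A by fact
  interpret B: Module.module R B by fact
  have sup: "fs_ext A B \<theta> \<phi> = (\<Oplus>\<^bsub>B\<^esub>s\<in>F. \<theta> s (\<phi> s))"
    if "\<phi> \<in> fin_fun S A" "finite F" "F \<subseteq> S" "{s. \<phi> s \<noteq> \<zero>\<^bsub>A\<^esub>} \<subseteq> F" for \<phi> F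
    using \<theta> that by (intro fs_ext_superset[OF A B])
  have cl: "(\<lambda>s. \<theta> s (\<phi> s)) \<in> F \<rightarrow> carrier B" if "\<phi> \<in> fin_fun S A" "F \<subseteq> S" for \<phi> F
    using that lin_mapD(1)[OF \<theta>] A.fin_fun_carrier[OF that(1)] by auto
  show ?thesis
  proof (intro lin_mapI; simp)
    fix \<phi> assume \<phi>: "\<phi> \<in> fin_fun S A"
    show "fs_ext A B \<theta> \<phi> \<in> carrier B"
      unfolding fs_ext_def using cl[OF \<phi>] fin_fun_support[OF \<phi>] by (intro B.finsum_closed) auto
    show "fs_ext A B \<theta> (\<lambda>x. r \<odot>\<^bsub>A\<^esub> \<phi> x) = r \<odot>\<^bsub>B\<^esub> fs_ext A B \<theta> \<phi>" if r: "r \<in> carrier R" for r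
    proof -
      let ?F = "{x. \<phi> x \<noteq> \<zero>\<^bsub>A\<^esub>}"
      have F: "finite ?F" "?F \<subseteq> S" using fin_fun_finite[OF \<phi>] fin_fun_support[OF \<phi>] .
      have l: "lin_map R B B (\<lambda>b. r \<odot>\<^bsub>B\<^esub> b)"
        using r by (intro lin_mapI) (auto simp: B.smult_r_distr B.smult_assoc1[symmetric] A.m_comm)
      have "fs_ext A B \<theta> (\<lambda>x. r \<odot>\<^bsub>A\<^esub> \<phi> x) = (\<Oplus>\<^bsub>B\<^esub>s\<in>?F. \<theta> s (r \<odot>\<^bsub>A\<^esub> \<phi> s))"
        by (rule sup) (use F A.smult_fin_fun[OF r \<phi>] r in auto)
      also have "\<dots> = (\<Oplus>\<^bsub>B\<^esub>s\<in>?F. ((\<lambda>b. r \<odot>\<^bsub>B\<^esub> b) \<circ> (\<lambda>s. \<theta> s (\<phi> s))) s)"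
        using F lin_mapD(1,3)[OF \<theta>] r A.fin_fun_carrier[OF \<phi>]
        by (intro B.finsum_cong') auto
      also have "\<dots> = r \<odot>\<^bsub>B\<^esub> fs_ext A B \<theta> \<phi>"
        unfolding fs_ext_def using lin_map_finsum[OF B B l F(1) cl[OF \<phi> F(2)]] by (simp only: o_def)
      finally show ?thesis .
    qed
    fix \<psi> assume \<psi>: "\<psi> \<in> fin_fun S A"
    let ?F = "{x. \<phi> x \<noteq> \<zero>\<^bsub>A\<^esub>} \<union> {x. \<psi> x \<noteq> \<zero>\<^bsub>A\<^esub>}"
    have F: "finite ?F" "?F \<subseteq> S"
      using fin_fun_finite[OF \<phi>] fin_fun_finite[OF \<psi>] fin_fun_support[OF \<phi>] fin_fun_support[OF \<psi>] by auto
    have "fs_ext A B \<theta> (\<lambda>x. \<phi> x \<oplus>\<^bsub>A\<^esub> \<psi> x) = (\<Oplus>\<^bsub>B\<^esub>s\<in>?F. \<theta> s (\<phi> s \<oplus>\<^bsub>A\<^esub> \<psi> s))"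
      by (rule sup[OF A.add_fin_fun[OF \<phi> \<psi>]]) (use F in auto)
    also have "\<dots> = (\<Oplus>\<^bsub>B\<^esub>s\<in>?F. \<theta> s (\<phi> s) \<oplus>\<^bsub>B\<^esub> \<theta> s (\<psi> s))"
      using F lin_mapD(1,2)[OF \<theta>] A.fin_fun_carrier[OF \<phi>] A.fin_fun_carrier[OF \<psi>]
      by (intro B.finsum_cong') auto
    also have "\<dots> = (\<Oplus>\<^bsub>B\<^esub>s\<in>?F. \<theta> s (\<phi> s)) \<oplus>\<^bsub>B\<^esub> (\<Oplus>\<^bsub>B\<^esub>s\<in>?F. \<theta> s (\<psi> s))"
      by (intro B.finsum_addf cl[OF \<phi> F(2)] cl[OF \<psi> F(2)])
    also have "\<dots> = fs_ext A B \<theta> \<phi> \<oplus>\<^bsub>B\<^esub> fs_ext A B \<theta> \<psi>"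
      using sup[OF \<phi> F] sup[OF \<psi> F] by auto
    finally show "fs_ext A B \<theta> (\<lambda>x. \<phi> x \<oplus>\<^bsub>A\<^esub> \<psi> x) = fs_ext A B \<theta> \<phi> \<oplus>\<^bsub>B\<^esub> fs_ext A B \<theta> \<psi>" .
  qed
qed

text \<open>Three separate maps are allowed because the identities to be checked are often not those
  of a homomorphism: a product of two different matrix units of maps is a third one, and a
  multiplier passes to one factor only. Both sides are bilinear, so the arguments are reduced to
  one-point functions one after the other.\<close>

lemma fs_mult_eqI:
  assumes A: "Module.module R A" and F: "nu_algebra R (fs_alg S A m)" and B: "nu_algebra R B"
    and f: "lin_map R (fs_alg S A m) B f" and g: "lin_map R (fs_alg S A m) B g"
    and h: "lin_map R (fs_alg S A m) B h"
    and m: "\<And>s a t b. \<lbrakk>s \<in> S; a \<in> carrier A; t \<in> S; b \<in> carrier A\<rbrakk> \<Longrightarrow>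
      h (m (fsingle A s a) (fsingle A t b)) = f (fsingle A s a) \<otimes>\<^bsub>B\<^esub> g (fsingle A t b)"
    and \<phi>: "\<phi> \<in> fin_fun S A" and \<psi>: "\<psi> \<in> fin_fun S A"
  shows "h (m \<phi> \<psi>) = f \<phi> \<otimes>\<^bsub>B\<^esub> g \<psi>"
proof -
  interpret A: Module.module R A by fact
  interpret F: nu_algebra R "fs_alg S A m" by fact
  interpret B: nu_algebra R B by fact
  have *: "h (m \<phi> (fsingle A t b)) = f \<phi> \<otimes>\<^bsub>B\<^esub> g (fsingle A t b)"
    if "t \<in> S" "b \<in> carrier A" for t b
  proof -
    have t: "fsingle A t b \<in> carrier (fs_alg S A m)" using A.fsingle_closed that by simp
    show ?thesis
      using lin_map_fs_eqI[OF A B.module_axioms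
          lin_map_comp[OF F.lin_map_mult_right[OF t] h]
          lin_map_comp[OF f B.lin_map_mult_right[OF lin_mapD(1)[OF g t]]] _ \<phi>]
        m that by simp
  qed
  have p: "\<phi> \<in> carrier (fs_alg S A m)" using \<phi> by simp
  show ?thesis
    using lin_map_fs_eqI[OF A B.module_axioms
        lin_map_comp[OF F.lin_map_mult_left[OF p] h]
        lin_map_comp[OF g B.lin_map_mult_left[OF lin_mapD(1)[OF f p]]] _ \<psi>] * by simp
qed

lemma nu_hom_fsI:
  assumes A: "Module.module R A" and F: "nu_algebra R (fs_alg S A m)" and B: "nu_algebra R B"
    and f: "lin_map R (fs_alg S A m) B f"
    and m: "\<And>s a t b. \<lbrakk>s \<in> S; a \<in> carrier A; t \<in> S; b \<in> carrier A\<rbrakk> \<Longrightarrow>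
      f (m (fsingle A s a) (fsingle A t b)) = f (fsingle A s a) \<otimes>\<^bsub>B\<^esub> f (fsingle A t b)"
  shows "nu_hom R (fs_alg S A m) B f"
  using fs_mult_eqI[where f = f and g = f and h = f, OF A F B f f f m] by (intro nu_homI[OF f]) simp

text \<open>A product on finitely supported functions is determined by its values on the functions with
  one-point support, so that associativity has to be checked for those only.\<close>

locale twisted_convolution = nu_algebra R A for R and A (structure) +
  fixes S :: "'x set" and m :: "('x \<Rightarrow> 'c) \<Rightarrow> ('x \<Rightarrow> 'c) \<Rightarrow> 'x \<Rightarrow> 'c"
    and pr :: "'x \<Rightarrow> 'x \<Rightarrow> 'x option" and \<alpha> :: "'x \<Rightarrow> 'c \<Rightarrow> 'c"
  assumes m_add_left: "\<lbrakk>\<phi> \<in> fin_fun S A; \<phi>' \<in> fin_fun S A; \<psi> \<in> fin_fun S A\<rbrakk> \<Longrightarrow>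
      m (\<lambda>x. \<phi> x \<oplus>\<^bsub>A\<^esub> \<phi>' x) \<psi> = (\<lambda>x. m \<phi> \<psi> x \<oplus>\<^bsub>A\<^esub> m \<phi>' \<psi> x)"
    and m_add_right: "\<lbrakk>\<phi> \<in> fin_fun S A; \<psi> \<in> fin_fun S A; \<psi>' \<in> fin_fun S A\<rbrakk> \<Longrightarrow>
      m \<phi> (\<lambda>x. \<psi> x \<oplus>\<^bsub>A\<^esub> \<psi>' x) = (\<lambda>x. m \<phi> \<psi> x \<oplus>\<^bsub>A\<^esub> m \<phi> \<psi>' x)"
    and m_zero_left: "\<psi> \<in> fin_fun S A \<Longrightarrow> m (\<lambda>x. \<zero>\<^bsub>A\<^esub>) \<psi> = (\<lambda>x. \<zero>\<^bsub>A\<^esub>)"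
    and m_zero_right: "\<phi> \<in> fin_fun S A \<Longrightarrow> m \<phi> (\<lambda>x. \<zero>\<^bsub>A\<^esub>) = (\<lambda>x. \<zero>\<^bsub>A\<^esub>)"
    and m_fsingle: "\<lbrakk>s \<in> S; a \<in> carrier A; t \<in> S; b \<in> carrier A\<rbrakk> \<Longrightarrow>
      m (fsingle A s a) (fsingle A t b) =
        (case pr s t of None \<Rightarrow> (\<lambda>x. \<zero>\<^bsub>A\<^esub>) | Some k \<Rightarrow> fsingle A k (a \<otimes>\<^bsub>A\<^esub> \<alpha> s b))"
    and pr_closed: "\<lbrakk>s \<in> S; t \<in> S; pr s t = Some k\<rbrakk> \<Longrightarrow> k \<in> S"
    and pr_assoc: "\<lbrakk>s \<in> S; t \<in> S; u \<in> S\<rbrakk> \<Longrightarrow>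
      Option.bind (pr s t) (\<lambda>k. pr k u) = Option.bind (pr t u) (\<lambda>k. pr s k)"
    and \<alpha>_hom: "s \<in> S \<Longrightarrow> nu_hom R A A (\<alpha> s)"
    and \<alpha>_mult: "\<lbrakk>s \<in> S; t \<in> S; pr s t = Some k; a \<in> carrier A\<rbrakk> \<Longrightarrow> \<alpha> k a = \<alpha> s (\<alpha> t a)"
begin

lemma m_fsingle_closed:
  "\<lbrakk>s \<in> S; a \<in> carrier A; t \<in> S; b \<in> carrier A\<rbrakk> \<Longrightarrow> m (fsingle A s a) (fsingle A t b) \<in> fin_fun S A"
  using pr_closed[of s t] nu_homD(3)[OF \<alpha>_hom, of s b]
  by (auto simp: m_fsingle zero_fin_fun mult_closed fsingle_closed split: option.split)

lemma m_closed:
  assumes \<phi>: "\<phi> \<in> fin_fun S A" and \<psi>: "\<psi> \<in> fin_fun S A"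
  shows "m \<phi> \<psi> \<in> fin_fun S A"
proof -
  have "m \<phi> (fsingle A t b) \<in> fin_fun S A" if t: "t \<in> S" "b \<in> carrier A" for t b
    using \<phi> by (induction rule: fin_fun_induct)
      (use t in \<open>simp_all add: m_zero_left fsingle_closed zero_fin_fun m_fsingle_closed m_add_left add_fin_fun\<close>)
  with \<psi> show ?thesis
    by (induction rule: fin_fun_induct) (use \<phi> in \<open>simp_all add: m_zero_right zero_fin_fun m_add_right add_fin_fun\<close>)
qed

lemma m_smult_fsingle:
  assumes "r \<in> carrier R" "s \<in> S" "a \<in> carrier A" "t \<in> S" "b \<in> carrier A"
  shows "m (fsingle A s (r \<odot>\<^bsub>A\<^esub> a)) (fsingle A t b) = (\<lambda>x. r \<odot>\<^bsub>A\<^esub> m (fsingle A s a) (fsingle A t b) x)"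
    and "m (fsingle A s a) (fsingle A t (r \<odot>\<^bsub>A\<^esub> b)) = (\<lambda>x. r \<odot>\<^bsub>A\<^esub> m (fsingle A s a) (fsingle A t b) x)"
  using assms nu_homD(3,5)[OF \<alpha>_hom[OF assms(2)]]
  by (auto simp: m_fsingle fsingle_smult smult_mult_left smult_mult_right split: option.split)

lemma m_smult:
  assumes r: "r \<in> carrier R" and \<phi>: "\<phi> \<in> fin_fun S A" and \<psi>: "\<psi> \<in> fin_fun S A"
  shows "m (\<lambda>x. r \<odot>\<^bsub>A\<^esub> \<phi> x) \<psi> = (\<lambda>x. r \<odot>\<^bsub>A\<^esub> m \<phi> \<psi> x)" (is ?A)
    and "m \<phi> (\<lambda>x. r \<odot>\<^bsub>A\<^esub> \<psi> x) = (\<lambda>x. r \<odot>\<^bsub>A\<^esub> m \<phi> \<psi> x)" (is ?B)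
proof -
  note c = fin_fun_carrier[OF m_closed]
  have "m (\<lambda>x. r \<odot>\<^bsub>A\<^esub> \<phi> x) (fsingle A t b) = (\<lambda>x. r \<odot>\<^bsub>A\<^esub> m \<phi> (fsingle A t b) x) \<and>
      m \<phi> (fsingle A t (r \<odot>\<^bsub>A\<^esub> b)) = (\<lambda>x. r \<odot>\<^bsub>A\<^esub> m \<phi> (fsingle A t b) x)"
    if t: "t \<in> S" "b \<in> carrier A" for t b
    using \<phi>
  proof (induction rule: fin_fun_induct)
    case zero
    then show ?case using r t by (simp add: m_zero_left fsingle_closed)
  next
    case (single s a)
    then show ?case using r t m_smult_fsingle by (simp add: fsingle_smult)
  next
    case (add \<phi> \<psi>)
    then show ?case using r t
      by (simp add: smult_r_distr fin_fun_carrier m_add_left fsingle_closed smult_fin_fun c)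
  qed
  with \<psi> have "?A \<and> ?B"
  proof (induction rule: fin_fun_induct)
    case zero
    then show ?case using r \<phi> by (simp add: m_zero_right smult_fin_fun)
  next
    case (single s a)
    then show ?case using r by (simp add: fsingle_smult)
  next
    case (add \<phi>' \<psi>)
    then show ?case using r \<phi>
      by (simp add: smult_r_distr fin_fun_carrier m_add_right smult_fin_fun c)
  qed
  then show ?A ?B by simp_all
qed

text \<open>By \<open>pr_assoc\<close> the two bracketings are either both undefined, and then both
  products vanish, or have the same index. In the second case the coefficients agree since
  \<open>\<alpha> s\<close> is multiplicative and \<open>\<alpha> k\<close> is the composite of
  \<open>\<alpha> s\<close> and \<open>\<alpha> t\<close>.\<close>

lemma m_assoc_fsingle:
  assumes s: "s \<in> S" "a \<in> carrier A" and t: "t \<in> S" "b \<in> carrier A" and u: "u \<in> S" "c \<in> carrier A"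
  shows "m (m (fsingle A s a) (fsingle A t b)) (fsingle A u c) =
    m (fsingle A s a) (m (fsingle A t b) (fsingle A u c))"
proof -
  note [simp] = nu_homD(3)[OF \<alpha>_hom] mult_closed m_fsingle fsingle_closed m_zero_left m_zero_right
    assms
  note as = pr_assoc[OF s(1) t(1) u(1)]
  show ?thesis
  proof (cases "pr s t")
    case None
    show ?thesis
    proof (cases "pr t u")
      case n: (Some k)
      then have "pr s k = None" using None as by simp
      then show ?thesis using None n pr_closed[OF t(1) u(1) n] by simp
    qed (use None in simp)
  next
    case st: (Some k)
    note kS = pr_closed[OF s(1) t(1) st]
    show ?thesis
    proof (cases "pr t u")
      case n: None
      then have "pr k u = None" using st as by simp
      then show ?thesis using st n kS by simp
    next
      case tu: (Some l)
      note lS = pr_closed[OF t(1) u(1) tu]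
      have "pr k u = pr s l" using as st tu by simp
      moreover have "a \<otimes>\<^bsub>A\<^esub> \<alpha> s b \<otimes>\<^bsub>A\<^esub> \<alpha> k c = a \<otimes>\<^bsub>A\<^esub> \<alpha> s (b \<otimes>\<^bsub>A\<^esub> \<alpha> t c)"
        using \<alpha>_mult[OF s(1) t(1) st u(2)] nu_homD(2)[OF \<alpha>_hom[OF s(1)]] by (simp add: mult_assoc)
      ultimately show ?thesis using st tu kS lS by (simp split: option.split)
    qed
  qed
qed

lemma m_assoc:
  assumes \<phi>: "\<phi> \<in> fin_fun S A" and \<psi>: "\<psi> \<in> fin_fun S A" and \<chi>: "\<chi> \<in> fin_fun S A"
  shows "m (m \<phi> \<psi>) \<chi> = m \<phi> (m \<psi> \<chi>)"
proof -
  note [simp] = m_closed fsingle_closed m_zero_left m_zero_right m_add_left m_add_right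
  have 1: "m (m \<phi> (fsingle A t b)) (fsingle A u c) = m \<phi> (m (fsingle A t b) (fsingle A u c))"
    if "t \<in> S" "b \<in> carrier A" "u \<in> S" "c \<in> carrier A" for t b u c
    using \<phi> by (induction rule: fin_fun_induct) (simp_all add: that m_assoc_fsingle)
  have 2: "m (m \<phi> \<psi>) (fsingle A u c) = m \<phi> (m \<psi> (fsingle A u c))"
    if "u \<in> S" "c \<in> carrier A" for u c
    using \<psi> by (induction rule: fin_fun_induct) (simp_all add: that 1 \<phi>)
  show ?thesis
    using \<chi> by (induction rule: fin_fun_induct) (simp_all add: 2 \<phi> \<psi>)
qed

lemma nu_algebra_fs_alg: "nu_algebra R (fs_alg S A m)"
proof -
  interpret F: Module.module R "fs_alg S A m" by (rule module_fs_alg) (rule module_axioms)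
  show ?thesis
    by unfold_locales (simp_all add: m_closed m_assoc m_add_left m_add_right m_smult)
qed

end

section \<open>Polynomials, matrices, crossed products and words\<close>

lemma (in abelian_monoid) finsum_single:
  assumes "finite S" "\<And>x. \<lbrakk>x \<in> S; x \<noteq> s\<rbrakk> \<Longrightarrow> f x = \<zero>" "s \<in> S \<Longrightarrow> f s \<in> carrier G"
  shows "finsum G f S = (if s \<in> S then f s else \<zero>)"
proof (cases "s \<in> S")
  case True
  have "finsum G f S = finsum G (\<lambda>j. if j = s then f s else \<zero>) S"
    using assms True by (intro finsum_cong') auto
  also have "\<dots> = f s"
    using add.finprod_singleton_swap[OF True assms(1), of "\<lambda>_. f s"] assms(3)[OF True] by simp
  finally show ?thesis using True by simp
next
  case False
  then have "finsum G f S = \<zero>" using assms(2) by (intro add.finprod_one_eqI) auto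
  then show ?thesis using False by simp
qed

lemma (in abelian_monoid) finsum_superset:
  assumes "finite F" "E \<subseteq> F" "\<And>x. x \<in> F - E \<Longrightarrow> f x = \<zero>" "\<And>x. x \<in> F \<Longrightarrow> f x \<in> carrier G"
  shows "finsum G f E = finsum G f F"
  using assms by (intro add.finprod_mono_neutral_cong_left) auto

lemma lin_map_fs_map:
  assumes A: "Module.module R A" and B: "Module.module R B" and f: "lin_map R A B f"
  shows "lin_map R (fs_alg S A m) (fs_alg S B m') ((\<circ>) f)"
proof -
  interpret A: Module.module R A by fact
  interpret B: Module.module R B by fact
  note z = lin_map_zero[OF A B f]
  show ?thesis
  proof (intro lin_mapI; simp)
    fix \<phi> assume \<phi>: "\<phi> \<in> fin_fun S A"
    have "{x. (f \<circ> \<phi>) x \<noteq> \<zero>\<^bsub>B\<^esub>} \<subseteq> {x. \<phi> x \<noteq> \<zero>\<^bsub>A\<^esub>}" using z by auto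
    then have "finite {x. (f \<circ> \<phi>) x \<noteq> \<zero>\<^bsub>B\<^esub>}" using fin_fun_finite[OF \<phi>] by (rule finite_subset)
    then show "f \<circ> \<phi> \<in> fin_fun S B" using \<phi> z lin_mapD(1)[OF f] by (auto simp: fin_fun_def)
    show "f \<circ> (\<lambda>x. \<phi> x \<oplus>\<^bsub>A\<^esub> \<psi> x) = (\<lambda>x. f (\<phi> x) \<oplus>\<^bsub>B\<^esub> f (\<psi> x))" if "\<psi> \<in> fin_fun S A" for \<psi>
      using A.fin_fun_carrier[OF \<phi>] A.fin_fun_carrier[OF that] lin_mapD(2)[OF f] by auto
    show "f \<circ> (\<lambda>x. r \<odot>\<^bsub>A\<^esub> \<phi> x) = (\<lambda>x. r \<odot>\<^bsub>B\<^esub> f (\<phi> x))" if "r \<in> carrier R" for r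
      using A.fin_fun_carrier[OF \<phi>] that lin_mapD(3)[OF f] by auto
  qed
qed

lemma comp_fsingle:
  assumes "Module.module R A" "Module.module R B" "lin_map R A B f"
  shows "f \<circ> fsingle A s a = fsingle B s (f a)"
  using lin_map_zero[OF assms] by (auto simp: fsingle_def)

lemma nu_hom_fs_map:
  assumes A: "twisted_convolution R A S m pr \<alpha>" and B: "twisted_convolution R B S m' pr \<alpha>'"
    and f: "nu_hom R A B f" and \<alpha>: "\<And>s a. \<lbrakk>s \<in> S; a \<in> carrier A\<rbrakk> \<Longrightarrow> f (\<alpha> s a) = \<alpha>' s (f a)"
  shows "nu_hom R (fs_alg S A m) (fs_alg S B m') ((\<circ>) f)"
proof -
  interpret A: twisted_convolution R A S m pr \<alpha> by fact
  interpret B: twisted_convolution R B S m' pr \<alpha>' by fact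
  note fl = nu_homD(1)[OF f]
  note z = lin_map_zero[OF A.module_axioms B.module_axioms fl]
  note fs = comp_fsingle[OF A.module_axioms B.module_axioms fl]
  show ?thesis
  proof (rule nu_hom_fsI[OF A.module_axioms A.nu_algebra_fs_alg B.nu_algebra_fs_alg
        lin_map_fs_map[OF A.module_axioms B.module_axioms fl]])
    fix s a t b assume st: "s \<in> S" "a \<in> carrier A" "t \<in> S" "b \<in> carrier A"
    then have "f (a \<otimes>\<^bsub>A\<^esub> \<alpha> s b) = f a \<otimes>\<^bsub>B\<^esub> \<alpha>' s (f b)"
      using \<alpha> nu_homD(2)[OF f] nu_homD(3)[OF A.\<alpha>_hom] by simp
    then show "f \<circ> m (fsingle A s a) (fsingle A t b) =
        (f \<circ> fsingle A s a) \<otimes>\<^bsub>fs_alg S B m'\<^esub> (f \<circ> fsingle A t b)"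
      using st nu_homD(3)[OF f] by (auto simp: fs A.m_fsingle B.m_fsingle z split: option.split)
  qed
qed

section \<open>Polynomials and matrices as twisted convolutions\<close>

abbreviation poly_mult :: "('a, 'z) ring_scheme \<Rightarrow> (nat \<Rightarrow> 'a) \<Rightarrow> (nat \<Rightarrow> 'a) \<Rightarrow> nat \<Rightarrow> 'a" where
  "poly_mult A \<equiv> (\<lambda>\<phi> \<psi> n. \<Oplus>\<^bsub>A\<^esub>i\<in>{..n}. \<phi> i \<otimes>\<^bsub>A\<^esub> \<psi> (n - i))"

abbreviation mat_mult ::
    "('a, 'z) ring_scheme \<Rightarrow> ('x \<times> 'x \<Rightarrow> 'a) \<Rightarrow> ('x \<times> 'x \<Rightarrow> 'a) \<Rightarrow> 'x \<times> 'x \<Rightarrow> 'a" where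
  "mat_mult A \<equiv> (\<lambda>M N (x, z). \<Oplus>\<^bsub>A\<^esub>y\<in>{y. M (x, y) \<noteq> \<zero>\<^bsub>A\<^esub>}. M (x, y) \<otimes>\<^bsub>A\<^esub> N (y, z))"

text \<open>Composition in the pair groupoid on the index type: matrix units with different inner
  indices have the product zero, encoded by \<open>None\<close>.\<close>

definition mat_pr :: "'x \<times> 'x \<Rightarrow> 'x \<times> 'x \<Rightarrow> ('x \<times> 'x) option" where
  "mat_pr p q = (if snd p = fst q then Some (fst p, snd q) else None)"

lemma poly_convolution:
  assumes "nu_algebra R A"
  shows "twisted_convolution R A UNIV (poly_mult A) (\<lambda>s t. Some (s + t)) (\<lambda>_. id)"
proof -
  interpret A: nu_algebra R A by fact
  note c = A.fin_fun_carrier[where S = "UNIV :: nat set"]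
  show ?thesis
  proof
    fix s t :: nat and a b assume ab: "a \<in> carrier A" "b \<in> carrier A"
    have "poly_mult A (fsingle A s a) (fsingle A t b) n = fsingle A (s + t) (a \<otimes>\<^bsub>A\<^esub> b) n" for n
    proof -
      have "poly_mult A (fsingle A s a) (fsingle A t b) n =
          (if s \<in> {..n} then fsingle A s a s \<otimes>\<^bsub>A\<^esub> fsingle A t b (n - s) else \<zero>\<^bsub>A\<^esub>)"
        by (rule A.finsum_single) (use ab in \<open>auto simp: fsingle_def A.mult_zero_left A.mult_zero_right
            A.mult_closed\<close>)
      then show ?thesis using ab by (auto simp: fsingle_def A.mult_zero_right)
    qed
    then show "poly_mult A (fsingle A s a) (fsingle A t b) =
        (case Some (s + t) of None \<Rightarrow> \<lambda>x. \<zero>\<^bsub>A\<^esub> | Some k \<Rightarrow> fsingle A k (a \<otimes>\<^bsub>A\<^esub> id b))" by auto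
  next
    fix \<phi> \<phi>' \<psi> assume f: "\<phi> \<in> fin_fun (UNIV :: nat set) A" "\<phi>' \<in> fin_fun (UNIV :: nat set) A"
        "\<psi> \<in> fin_fun (UNIV :: nat set) A"
    show "poly_mult A (\<lambda>x. \<phi> x \<oplus>\<^bsub>A\<^esub> \<phi>' x) \<psi> = (\<lambda>x. poly_mult A \<phi> \<psi> x \<oplus>\<^bsub>A\<^esub> poly_mult A \<phi>' \<psi> x)"
      using f by (subst A.finsum_addf[symmetric]) (auto simp: c A.mult_closed A.mult_l_distr)
    show "poly_mult A \<phi> (\<lambda>x. \<phi>' x \<oplus>\<^bsub>A\<^esub> \<psi> x) = (\<lambda>x. poly_mult A \<phi> \<phi>' x \<oplus>\<^bsub>A\<^esub> poly_mult A \<phi> \<psi> x)"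
      using f by (subst A.finsum_addf[symmetric]) (auto simp: c A.mult_closed A.mult_r_distr)
  next
    fix \<phi> assume f: "\<phi> \<in> fin_fun (UNIV :: nat set) A"
    show "poly_mult A (\<lambda>x. \<zero>\<^bsub>A\<^esub>) \<phi> = (\<lambda>x. \<zero>\<^bsub>A\<^esub>)"
      using c[OF f] by (simp add: A.mult_zero_left)
    show "poly_mult A \<phi> (\<lambda>x. \<zero>\<^bsub>A\<^esub>) = (\<lambda>x. \<zero>\<^bsub>A\<^esub>)"
      using c[OF f] by (simp add: A.mult_zero_right)
  qed (auto simp: nu_hom_id)
qed

context nu_algebra
begin

lemma mat_mult_superset:
  assumes M: "M \<in> fin_fun (X \<times> X) A" and N: "N \<in> fin_fun (X \<times> X) A"
    and F: "finite F" "{y. M (x, y) \<noteq> \<zero>\<^bsub>A\<^esub>} \<subseteq> F"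
  shows "mat_mult A M N (x, z) = (\<Oplus>\<^bsub>A\<^esub>y\<in>F. M (x, y) \<otimes>\<^bsub>A\<^esub> N (y, z))"
  unfolding prod.case
  by (rule M.finsum_superset[OF F])
    (auto simp: fin_fun_carrier[OF M] fin_fun_carrier[OF N] mult_closed mult_zero_left)

lemma mat_row_finite:
  assumes "M \<in> fin_fun (X \<times> X) A"
  shows "finite {y. M (x, y) \<noteq> \<zero>\<^bsub>A\<^esub>}"
proof -
  have "{y. M (x, y) \<noteq> \<zero>\<^bsub>A\<^esub>} \<subseteq> snd ` {p. M p \<noteq> \<zero>\<^bsub>A\<^esub>}" by force
  then show ?thesis using fin_fun_finite[OF assms] finite_surj by blast
qed

lemma mat_mult_fsingle_left:
  assumes "p \<in> X \<times> X" "a \<in> carrier A" "N \<in> fin_fun (X \<times> X) A"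
  shows "mat_mult A (fsingle A p a) N (x, z) = (if x = fst p then a \<otimes>\<^bsub>A\<^esub> N (snd p, z) else \<zero>\<^bsub>A\<^esub>)"
proof -
  have "mat_mult A (fsingle A p a) N (x, z) =
      (\<Oplus>\<^bsub>A\<^esub>y\<in>{snd p}. fsingle A p a (x, y) \<otimes>\<^bsub>A\<^esub> N (y, z))"
    by (rule mat_mult_superset) (use assms fsingle_closed[OF assms(1,2)] in \<open>auto simp: fsingle_def\<close>)
  then show ?thesis using assms fin_fun_carrier[OF assms(3)]
    by (cases p) (auto simp: fsingle_def mult_closed mult_zero_left)
qed

lemma mat_mult_fsingle_right:
  assumes "p \<in> X \<times> X" "b \<in> carrier A" and M: "M \<in> fin_fun (X \<times> X) A"
  shows "mat_mult A M (fsingle A p b) (x, z) = (if z = snd p then M (x, fst p) \<otimes>\<^bsub>A\<^esub> b else \<zero>\<^bsub>A\<^esub>)"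
proof -
  have "mat_mult A M (fsingle A p b) (x, z) =
      (\<Oplus>\<^bsub>A\<^esub>y\<in>insert (fst p) {y. M (x, y) \<noteq> \<zero>\<^bsub>A\<^esub>}. M (x, y) \<otimes>\<^bsub>A\<^esub> fsingle A p b (y, z))"
    by (rule mat_mult_superset) (use assms fsingle_closed[OF assms(1,2)] mat_row_finite[OF M] in auto)
  also have "\<dots> = M (x, fst p) \<otimes>\<^bsub>A\<^esub> fsingle A p b (fst p, z)"
    by (subst M.finsum_single[where s = "fst p"])
      (use assms fin_fun_carrier[OF M] mat_row_finite[OF M] in \<open>auto simp: fsingle_def mult_closed mult_zero_right\<close>)
  finally show ?thesis using assms fin_fun_carrier[OF M]
    by (cases p) (auto simp: fsingle_def mult_closed mult_zero_right)
qed

end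

lemma mat_convolution:
  assumes "nu_algebra R A"
  shows "twisted_convolution R A (X \<times> X) (mat_mult A) mat_pr (\<lambda>_. id)"
proof -
  interpret A: nu_algebra R A by fact
  note c = A.fin_fun_carrier[where S = "X \<times> X"]
  show ?thesis
  proof
    fix p q a b assume pq: "p \<in> X \<times> X" "a \<in> carrier A" "q \<in> X \<times> X" "b \<in> carrier A"
    have "mat_mult A (fsingle A p a) (fsingle A q b) (x, z) =
        (case mat_pr p q of None \<Rightarrow> \<lambda>x. \<zero>\<^bsub>A\<^esub> | Some k \<Rightarrow> fsingle A k (a \<otimes>\<^bsub>A\<^esub> id b)) (x, z)" for x z
      using pq A.fsingle_closed[OF pq(3,4)]
      by (subst A.mat_mult_fsingle_left[OF pq(1,2)])
        (auto simp: mat_pr_def fsingle_def A.mult_zero_right)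
    then show "mat_mult A (fsingle A p a) (fsingle A q b) =
        (case mat_pr p q of None \<Rightarrow> \<lambda>x. \<zero>\<^bsub>A\<^esub> | Some k \<Rightarrow> fsingle A k (a \<otimes>\<^bsub>A\<^esub> id
            b))" by (intro ext) (auto simp only: split_paired_all)
  next
    fix \<phi> \<phi>' \<psi> assume f: "\<phi> \<in> fin_fun (X \<times> X) A" "\<phi>' \<in> fin_fun (X \<times> X) A" "\<psi> \<in> fin_fun (X \<times> X) A"
    have "mat_mult A (\<lambda>x. \<phi> x \<oplus>\<^bsub>A\<^esub> \<phi>' x) \<psi> (x, z) = mat_mult A \<phi> \<psi> (x, z) \<oplus>\<^bsub>A\<^esub> mat_mult A \<phi>' \<psi> (x, z)" for x z
    proof -
      let ?F = "{y. \<phi> (x, y) \<noteq> \<zero>\<^bsub>A\<^esub>} \<union> {y. \<phi>' (x, y) \<noteq> \<zero>\<^bsub>A\<^esub>}"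
      have F: "finite ?F" using A.mat_row_finite[OF f(1)] A.mat_row_finite[OF f(2)] by blast
      have "mat_mult A (\<lambda>x. \<phi> x \<oplus>\<^bsub>A\<^esub> \<phi>' x) \<psi> (x, z) = (\<Oplus>\<^bsub>A\<^esub>y\<in>?F. (\<phi> (x, y) \<oplus>\<^bsub>A\<^esub> \<phi>' (x, y)) \<otimes>\<^bsub>A\<^esub> \<psi> (y, z))"
        by (rule A.mat_mult_superset[OF A.add_fin_fun[OF f(1,2)] f(3) F]) (auto simp: c)
      also have "\<dots> = (\<Oplus>\<^bsub>A\<^esub>y\<in>?F. \<phi> (x, y) \<otimes>\<^bsub>A\<^esub> \<psi> (y, z)) \<oplus>\<^bsub>A\<^esub> (\<Oplus>\<^bsub>A\<^esub>y\<in>?F. \<phi>' (x, y) \<otimes>\<^bsub>A\<^esub> \<psi> (y, z))"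
        using f by (subst A.finsum_addf[symmetric]) (auto simp: c A.mult_closed A.mult_l_distr)
      also have "\<dots> = mat_mult A \<phi> \<psi> (x, z) \<oplus>\<^bsub>A\<^esub> mat_mult A \<phi>' \<psi> (x, z)"
        using A.mat_mult_superset[OF f(1,3) F] A.mat_mult_superset[OF f(2,3) F] by auto
      finally show ?thesis .
    qed
    then show "mat_mult A (\<lambda>x. \<phi> x \<oplus>\<^bsub>A\<^esub> \<phi>' x) \<psi> = (\<lambda>x. mat_mult A \<phi> \<psi> x \<oplus>\<^bsub>A\<^esub> mat_mult A \<phi>' \<psi> x)"
      by (intro ext) (simp only: split_paired_all)
    have "mat_mult A \<phi> (\<lambda>x. \<phi>' x \<oplus>\<^bsub>A\<^esub> \<psi> x) (x, z) = mat_mult A \<phi> \<phi>' (x, z) \<oplus>\<^bsub>A\<^esub> mat_mult A \<phi> \<psi> (x, z)" for x z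
      unfolding prod.case using f by (subst A.finsum_addf[symmetric]) (auto simp: c A.mult_closed A.mult_r_distr)
    then show "mat_mult A \<phi> (\<lambda>x. \<phi>' x \<oplus>\<^bsub>A\<^esub> \<psi> x) = (\<lambda>x. mat_mult A \<phi> \<phi>' x \<oplus>\<^bsub>A\<^esub> mat_mult A \<phi> \<psi> x)"
      by (intro ext) (simp only: split_paired_all)
  next
    fix \<phi> assume f: "\<phi> \<in> fin_fun (X \<times> X) A"
    show "mat_mult A (\<lambda>x. \<zero>\<^bsub>A\<^esub>) \<phi> = (\<lambda>x. \<zero>\<^bsub>A\<^esub>)" by auto
    show "mat_mult A \<phi> (\<lambda>x. \<zero>\<^bsub>A\<^esub>) = (\<lambda>x. \<zero>\<^bsub>A\<^esub>)"
      using c[OF f] by (auto simp: A.mult_zero_right)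
  qed (auto simp: nu_hom_id mat_pr_def split: if_splits)
qed

lemma nu_algebra_poly: "nu_algebra R A \<Longrightarrow> nu_algebra R (poly_alg A)"
  unfolding poly_alg_def by (rule twisted_convolution.nu_algebra_fs_alg) (rule poly_convolution)

lemma nu_algebra_mat: "nu_algebra R A \<Longrightarrow> nu_algebra R (mat_alg X A)"
  unfolding mat_alg_def by (rule twisted_convolution.nu_algebra_fs_alg) (rule mat_convolution)

lemma nu_hom_poly_map: "\<lbrakk>nu_algebra R A; nu_algebra R B; nu_hom R A B f\<rbrakk> \<Longrightarrow>
    nu_hom R (poly_alg A) (poly_alg B) ((\<circ>) f)"
  unfolding poly_alg_def by (rule nu_hom_fs_map[OF poly_convolution poly_convolution]) auto

lemma nu_hom_mat_map: "\<lbrakk>nu_algebra R A; nu_algebra R B; nu_hom R A B f\<rbrakk> \<Longrightarrow>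
    nu_hom R (mat_alg X A) (mat_alg X B) ((\<circ>) f)"
  unfolding mat_alg_def by (rule nu_hom_fs_map[OF mat_convolution mat_convolution]) auto

section \<open>Crossed products as twisted convolutions\<close>

context g_algebra
begin

lemma gact_nu_hom: "g \<in> carrier G \<Longrightarrow> nu_hom R A A (gact A g)"
  using alg_homs_nu_hom[OF gact_hom]
    nu_hom_cong[OF nu_algebra_axioms, of "restrict (gact A g) (carrier A)" "gact A g" A] by simp

lemma gact_closed [simp]: "\<lbrakk>g \<in> carrier G; a \<in> carrier A\<rbrakk> \<Longrightarrow> gact A g a \<in> carrier A"
  using nu_homD(3)[OF gact_nu_hom] .

lemma gact_zero [simp]: "g \<in> carrier G \<Longrightarrow> gact A g \<zero>\<^bsub>A\<^esub> = \<zero>\<^bsub>A\<^esub>"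
  using lin_map_zero[OF module_axioms module_axioms nu_homD(1)[OF gact_nu_hom]] .

lemma gact_add: "\<lbrakk>g \<in> carrier G; a \<in> carrier A; b \<in> carrier A\<rbrakk> \<Longrightarrow>
    gact A g (a \<oplus>\<^bsub>A\<^esub> b) = gact A g a \<oplus>\<^bsub>A\<^esub> gact A g b"
  using nu_homD(4)[OF gact_nu_hom] .

end

lemma crossed_mult_superset:
  assumes "g_algebra R G B" and \<phi>: "\<phi> \<in> fin_fun (carrier G) B" and \<psi>: "\<psi> \<in> fin_fun (carrier G) B"
    and F: "finite F" "{g. \<phi> g \<noteq> \<zero>\<^bsub>B\<^esub>} \<subseteq> F" "F \<subseteq> carrier G" and k: "k \<in> carrier G"
  shows "crossed_mult G B \<phi> \<psi> k = (\<Oplus>\<^bsub>B\<^esub>g\<in>F. \<phi> g \<otimes>\<^bsub>B\<^esub> gact B g (\<psi> (inv\<^bsub>G\<^esub> g \<otimes>\<^bsub>G\<^esub> k)))"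
proof -
  interpret B: g_algebra R G B by fact
  note c = B.fin_fun_carrier[OF \<phi>] B.fin_fun_carrier[OF \<psi>]
  have "(\<Oplus>\<^bsub>B\<^esub>g\<in>{g. \<phi> g \<noteq> \<zero>\<^bsub>B\<^esub>}. \<phi> g \<otimes>\<^bsub>B\<^esub> gact B g (\<psi> (inv\<^bsub>G\<^esub> g \<otimes>\<^bsub>G\<^esub> k))) =
      (\<Oplus>\<^bsub>B\<^esub>g\<in>F. \<phi> g \<otimes>\<^bsub>B\<^esub> gact B g (\<psi> (inv\<^bsub>G\<^esub> g \<otimes>\<^bsub>G\<^esub> k)))"
    by (rule B.finsum_superset[OF F(1,2)]) (use c F(3) in \<open>auto simp: B.mult_closed B.mult_zero_left subsetD\<close>)
  then show ?thesis using k by (simp add: crossed_mult_def)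
qed

text \<open>The defining sum runs over the support of the left factor. Additivity on the left
  therefore needs a common finite index set for the two supports, while on the right the index set
  stays the same. Arguments outside \<open>carrier G\<close> are caught by the default value zero of
  \<open>crossed_mult\<close>.\<close>

lemma crossed_convolution:
  assumes B: "g_algebra R G B" and L: "subgroup L G"
  shows "twisted_convolution R B L (crossed_mult G B) (\<lambda>s t. Some (s \<otimes>\<^bsub>G\<^esub> t)) (gact B)"
proof -
  interpret B: g_algebra R G B by fact
  interpret L: subgroup L G by fact
  have sub: "\<phi> \<in> fin_fun (carrier G) B" if "\<phi> \<in> fin_fun L B" for \<phi>
    using fin_fun_mono[OF that L.subset] by simp
  note c = B.fin_fun_carrier[where S = L]
  note sup = crossed_mult_superset[OF B sub sub]
  show ?thesis
  proof
    fix s t a b assume st: "s \<in> L" "a \<in> carrier B" "t \<in> L" "b \<in> carrier B"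
    have "crossed_mult G B (fsingle B s a) (fsingle B t b) k = fsingle B (s \<otimes>\<^bsub>G\<^esub> t) (a \<otimes>\<^bsub>B\<^esub> gact B s b) k" for k
    proof (cases "k \<in> carrier G")
      case True
      have "crossed_mult G B (fsingle B s a) (fsingle B t b) k =
          (\<Oplus>\<^bsub>B\<^esub>g\<in>{s}. fsingle B s a g \<otimes>\<^bsub>B\<^esub> gact B g (fsingle B t b (inv\<^bsub>G\<^esub> g \<otimes>\<^bsub>G\<^esub> k)))"
        by (rule sup) (use st True B.fsingle_closed in \<open>auto simp: fsingle_def\<close>)
      moreover have "(inv\<^bsub>G\<^esub> s \<otimes>\<^bsub>G\<^esub> k = t) = (k = s \<otimes>\<^bsub>G\<^esub> t)"
        using st True by (metis B.inv_closed B.inv_solve_left L.mem_carrier)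
      ultimately show ?thesis using st
        by (auto simp: fsingle_def B.mult_closed B.mult_zero_right)
    next
      case False
      then show ?thesis using st by (auto simp: crossed_mult_def fsingle_def)
    qed
    then show "crossed_mult G B (fsingle B s a) (fsingle B t b) =
        (case Some (s \<otimes>\<^bsub>G\<^esub> t) of None \<Rightarrow> \<lambda>x. \<zero>\<^bsub>B\<^esub> | Some k \<Rightarrow> fsingle B k (a \<otimes>\<^bsub>B\<^esub> gact B s b))" by auto
  next
    fix \<phi> \<phi>' \<psi> assume f: "\<phi> \<in> fin_fun L B" "\<phi>' \<in> fin_fun L B" "\<psi> \<in> fin_fun L B"
    have "crossed_mult G B (\<lambda>x. \<phi> x \<oplus>\<^bsub>B\<^esub> \<phi>' x) \<psi> k = crossed_mult G B \<phi> \<psi> k \<oplus>\<^bsub>B\<^esub> crossed_mult G B \<phi>' \<psi> k" for k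
    proof (cases "k \<in> carrier G")
      case True
      let ?F = "{y. \<phi> y \<noteq> \<zero>\<^bsub>B\<^esub>} \<union> {y. \<phi>' y \<noteq> \<zero>\<^bsub>B\<^esub>}"
      have F: "finite ?F" "?F \<subseteq> carrier G"
        using fin_fun_finite f fin_fun_support[OF f(1)] fin_fun_support[OF f(2)] by auto
      have "crossed_mult G B (\<lambda>x. \<phi> x \<oplus>\<^bsub>B\<^esub> \<phi>' x) \<psi> k =
          (\<Oplus>\<^bsub>B\<^esub>g\<in>?F. (\<phi> g \<oplus>\<^bsub>B\<^esub> \<phi>' g) \<otimes>\<^bsub>B\<^esub> gact B g (\<psi> (inv\<^bsub>G\<^esub> g \<otimes>\<^bsub>G\<^esub> k)))"
        by (rule sup[OF B.add_fin_fun[OF f(1,2)] f(3) F(1) _ F(2) True]) (auto simp: c)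
      also have "\<dots> = (\<Oplus>\<^bsub>B\<^esub>g\<in>?F. \<phi> g \<otimes>\<^bsub>B\<^esub> gact B g (\<psi> (inv\<^bsub>G\<^esub> g \<otimes>\<^bsub>G\<^esub> k))) \<oplus>\<^bsub>B\<^esub>
          (\<Oplus>\<^bsub>B\<^esub>g\<in>?F. \<phi>' g \<otimes>\<^bsub>B\<^esub> gact B g (\<psi> (inv\<^bsub>G\<^esub> g \<otimes>\<^bsub>G\<^esub> k)))"
        using f F(2) by (subst B.finsum_addf[symmetric])
          (auto simp: c B.mult_closed B.mult_l_distr subsetD intro!: B.finsum_cong')
      also have "\<dots> = crossed_mult G B \<phi> \<psi> k \<oplus>\<^bsub>B\<^esub> crossed_mult G B \<phi>' \<psi> k"
        using sup[OF f(1,3) F(1) _ F(2) True] sup[OF f(2,3) F(1) _ F(2) True] by auto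
      finally show ?thesis .
    qed (simp add: crossed_mult_def)
    then show "crossed_mult G B (\<lambda>x. \<phi> x \<oplus>\<^bsub>B\<^esub> \<phi>' x) \<psi> = (\<lambda>x. crossed_mult G B \<phi> \<psi> x \<oplus>\<^bsub>B\<^esub> crossed_mult G B \<phi>' \<psi> x)"
      by blast
    have "crossed_mult G B \<phi> (\<lambda>x. \<phi>' x \<oplus>\<^bsub>B\<^esub> \<psi> x) k = crossed_mult G B \<phi> \<phi>' k \<oplus>\<^bsub>B\<^esub> crossed_mult G B \<phi> \<psi> k" for k
    proof (cases "k \<in> carrier G")
      case True
      have g: "g \<in> carrier G" if "\<phi> g \<noteq> \<zero>\<^bsub>B\<^esub>" for g using that fin_fun_support[OF f(1)] by auto
      let ?F = "{g. \<phi> g \<noteq> \<zero>\<^bsub>B\<^esub>}"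
      have "(\<Oplus>\<^bsub>B\<^esub>g\<in>?F. \<phi> g \<otimes>\<^bsub>B\<^esub> gact B g (\<phi>' (inv\<^bsub>G\<^esub> g \<otimes>\<^bsub>G\<^esub> k) \<oplus>\<^bsub>B\<^esub> \<psi> (inv\<^bsub>G\<^esub> g \<otimes>\<^bsub>G\<^esub> k))) =
          (\<Oplus>\<^bsub>B\<^esub>g\<in>?F. \<phi> g \<otimes>\<^bsub>B\<^esub> gact B g (\<phi>' (inv\<^bsub>G\<^esub> g \<otimes>\<^bsub>G\<^esub> k)) \<oplus>\<^bsub>B\<^esub>
            \<phi> g \<otimes>\<^bsub>B\<^esub> gact B g (\<psi> (inv\<^bsub>G\<^esub> g \<otimes>\<^bsub>G\<^esub> k)))"
        using g by (intro B.finsum_cong') (auto simp: c[OF f(1)] c[OF f(2)] c[OF f(3)] B.mult_closed B.mult_r_distr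
            B.gact_add)
      also have "\<dots> = (\<Oplus>\<^bsub>B\<^esub>g\<in>?F. \<phi> g \<otimes>\<^bsub>B\<^esub> gact B g (\<phi>' (inv\<^bsub>G\<^esub> g \<otimes>\<^bsub>G\<^esub> k))) \<oplus>\<^bsub>B\<^esub>
          (\<Oplus>\<^bsub>B\<^esub>g\<in>?F. \<phi> g \<otimes>\<^bsub>B\<^esub> gact B g (\<psi> (inv\<^bsub>G\<^esub> g \<otimes>\<^bsub>G\<^esub> k)))"
        using g by (intro B.finsum_addf) (auto simp: c[OF f(1)] c[OF f(2)] c[OF f(3)] B.mult_closed)
      finally show ?thesis using True by (simp add: crossed_mult_def)
    qed (simp add: crossed_mult_def)
    then show "crossed_mult G B \<phi> (\<lambda>x. \<phi>' x \<oplus>\<^bsub>B\<^esub> \<psi> x) = (\<lambda>x. crossed_mult G B \<phi> \<phi>' x \<oplus>\<^bsub>B\<^esub> crossed_mult G B \<phi> \<psi> x)"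
      by blast
  next
    fix \<phi> assume f: "\<phi> \<in> fin_fun L B"
    show "crossed_mult G B (\<lambda>x. \<zero>\<^bsub>B\<^esub>) \<phi> = (\<lambda>x. \<zero>\<^bsub>B\<^esub>)" by (auto simp: crossed_mult_def)
    have g: "g \<in> carrier G" if "\<phi> g \<noteq> \<zero>\<^bsub>B\<^esub>" for g using that fin_fun_support[OF f] by auto
    show "crossed_mult G B \<phi> (\<lambda>x. \<zero>\<^bsub>B\<^esub>) = (\<lambda>x. \<zero>\<^bsub>B\<^esub>)"
    proof
      fix k
      have "(\<Oplus>\<^bsub>B\<^esub>g\<in>{g. \<phi> g \<noteq> \<zero>\<^bsub>B\<^esub>}. \<phi> g \<otimes>\<^bsub>B\<^esub> gact B g \<zero>\<^bsub>B\<^esub>) = \<zero>\<^bsub>B\<^esub>"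
        using g by (intro B.add.finprod_one_eqI) (auto simp: c[OF f] B.mult_zero_right)
      then show "crossed_mult G B \<phi> (\<lambda>x. \<zero>\<^bsub>B\<^esub>) k = \<zero>\<^bsub>B\<^esub>" by (simp add: crossed_mult_def)
    qed
  qed (auto simp: B.gact_nu_hom B.m_assoc B.gact_mult)
qed

lemma nu_algebra_crossed: "\<lbrakk>g_algebra R G B; subgroup L G\<rbrakk> \<Longrightarrow> nu_algebra R (crossed G L B)"
  unfolding crossed_def by (rule twisted_convolution.nu_algebra_fs_alg) (rule crossed_convolution)

lemma nu_hom_crossed_map:
  assumes "g_algebra R G A" "g_algebra R G B" "subgroup L G" "nu_hom R A B f" "equivariant G A B f"
  shows "nu_hom R (crossed G L A) (crossed G L B) ((\<circ>) f)"
  unfolding crossed_def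
  by (rule nu_hom_fs_map[OF crossed_convolution[OF assms(1,3)] crossed_convolution[OF assms(2,3)] assms(4)])
    (use assms(5) subgroup.subset[OF assms(3)] in \<open>auto simp: equivariant_def\<close>)

section \<open>The word algebra\<close>

text \<open>Words have coefficients in the ground ring. Regarding the ring as an algebra over itself
  makes \<open>word_alg\<close> an instance of \<open>fs_alg\<close>, so that the results on twisted
  convolutions apply to it.\<close>

definition reg_mod :: "('k, 'r) ring_scheme \<Rightarrow> ('k, 'k) module" where
  "reg_mod R = \<lparr>carrier = carrier R, mult = mult R, one = one R, zero = zero R, add = add R, smult = mult R\<rparr>"

lemma reg_mod_simps [simp]:
  "carrier (reg_mod R) = carrier R" "mult (reg_mod R) = mult R" "zero (reg_mod R) = zero R"
  "add (reg_mod R) = add R" "smult (reg_mod R) = mult R"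
  by (simp_all add: reg_mod_def)

lemma fin_fun_reg_mod [simp]: "fin_fun S (reg_mod R) = fin_fun S R"
  by (simp add: fin_fun_def)

lemma fsingle_reg_mod [simp]: "fsingle (reg_mod R) = fsingle R"
  by (simp add: fsingle_def fun_eq_iff)

lemma nu_algebra_reg_mod:
  assumes "cring R"
  shows "nu_algebra R (reg_mod R)"
proof -
  interpret R: cring R by fact
  have "abelian_group (reg_mod R)"
    by (rule abelian_groupI) (auto simp: R.a_ac intro: R.l_neg R.a_inv_closed)
  then have "Module.module R (reg_mod R)"
    by (intro moduleI) (auto simp: R.l_distr R.r_distr R.m_assoc assms)
  then interpret M: Module.module R "reg_mod R" .
  show ?thesis by unfold_locales (auto simp: R.m_assoc R.l_distr R.r_distr R.m_lcomm)
qed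

abbreviation word_mult :: "('a, 'z) ring_scheme \<Rightarrow> ('b list \<Rightarrow> 'a) \<Rightarrow> ('b list \<Rightarrow> 'a) \<Rightarrow> 'b list \<Rightarrow> 'a" where
  "word_mult R \<equiv> (\<lambda>\<phi> \<psi> w. \<Oplus>\<^bsub>R\<^esub>n\<in>{1..<length w}. \<phi> (take n w) \<otimes>\<^bsub>R\<^esub> \<psi> (drop n w))"

lemma finsum_reg_mod [simp]: "finsum (reg_mod R) f S = finsum R f S"
  by (simp add: finsum_def finprod_def reg_mod_def)

lemma word_alg_fs_alg: "word_alg R S = fs_alg (lists S - {[]}) (reg_mod R) (word_mult R)"
  by (simp add: word_alg_def fs_alg_def)

lemma word_convolution:
  assumes "cring R"
  shows "twisted_convolution R (reg_mod R) (lists S - {[]}) (word_mult R) (\<lambda>u v. Some (u @ v)) (\<lambda>_. id)"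
proof -
  interpret R: cring R by fact
  interpret A: nu_algebra R "reg_mod R" by (rule nu_algebra_reg_mod) fact
  note c = R.fin_fun_carrier[where S = "lists S - {[]}"]
  show ?thesis
  proof
    fix u v a b assume uv: "u \<in> lists S - {[]}" "a \<in> carrier (reg_mod R)" "v \<in> lists S - {[]}"
        "b \<in> carrier (reg_mod R)"
    have "word_mult R (fsingle R u a) (fsingle R v b) w = fsingle R (u @ v) (a \<otimes>\<^bsub>R\<^esub> b) w" for w
    proof -
      have 1: "word_mult R (fsingle R u a) (fsingle R v b) w =
          (if length u \<in> {1..<length w} then
             fsingle R u a (take (length u) w) \<otimes>\<^bsub>R\<^esub> fsingle R v b (drop (length u) w) else \<zero>\<^bsub>R\<^esub>)"
        by (rule R.finsum_single) (use uv in \<open>auto simp: fsingle_def\<close>)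
      show ?thesis
      proof (cases "w = u @ v")
        case True
        \<comment> \<open>Both words are nonempty, so the cut between them is at neither end of
          \<open>w\<close> and does occur in the sum.\<close>
        have "length u \<in> {1..<length w}" using True uv by (cases u; cases v) auto
        then show ?thesis using True 1 by (simp add: fsingle_def)
      next
        case False
        then have "take (length u) w \<noteq> u \<or> drop (length u) w \<noteq> v" by (metis append_take_drop_id)
        then show ?thesis using False 1 uv by (auto simp: fsingle_def)
      qed
    qed
    then show "word_mult R (fsingle (reg_mod R) u a) (fsingle (reg_mod R) v b) =
        (case Some (u @ v) of None \<Rightarrow> \<lambda>x. \<zero>\<^bsub>reg_mod R\<^esub>
         | Some k \<Rightarrow> fsingle (reg_mod R) k (a \<otimes>\<^bsub>reg_mod R\<^esub> id b))" by auto
  next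
    fix \<phi> \<phi>' \<psi> assume f: "\<phi> \<in> fin_fun (lists S - {[]}) (reg_mod R)"
      "\<phi>' \<in> fin_fun (lists S - {[]}) (reg_mod R)" "\<psi> \<in> fin_fun (lists S - {[]}) (reg_mod R)"
    show "word_mult R (\<lambda>x. \<phi> x \<oplus>\<^bsub>reg_mod R\<^esub> \<phi>' x) \<psi> =
        (\<lambda>x. word_mult R \<phi> \<psi> x \<oplus>\<^bsub>reg_mod R\<^esub> word_mult R \<phi>' \<psi> x)"
      using f by (simp, subst R.finsum_addf[symmetric]) (auto simp: c R.l_distr)
    show "word_mult R \<phi> (\<lambda>x. \<phi>' x \<oplus>\<^bsub>reg_mod R\<^esub> \<psi> x) =
        (\<lambda>x. word_mult R \<phi> \<phi>' x \<oplus>\<^bsub>reg_mod R\<^esub> word_mult R \<phi> \<psi> x)"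
      using f by (simp, subst R.finsum_addf[symmetric]) (auto simp: c R.r_distr)
  next
    fix \<phi> assume f: "\<phi> \<in> fin_fun (lists S - {[]}) (reg_mod R)"
    show "word_mult R (\<lambda>x. \<zero>\<^bsub>reg_mod R\<^esub>) \<phi> = (\<lambda>x. \<zero>\<^bsub>reg_mod R\<^esub>)"
      using f c by simp
    show "word_mult R \<phi> (\<lambda>x. \<zero>\<^bsub>reg_mod R\<^esub>) = (\<lambda>x. \<zero>\<^bsub>reg_mod R\<^esub>)"
      using f c by simp
  qed (auto simp: nu_hom_id)
qed

lemma nu_algebra_word: "cring R \<Longrightarrow> nu_algebra R (word_alg R S)"
  unfolding word_alg_fs_alg by (rule twisted_convolution.nu_algebra_fs_alg) (rule word_convolution)

lemma word_mult_word:
  assumes "cring R" "u \<in> lists S - {[]}" "v \<in> lists S - {[]}"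
  shows "word R u \<otimes>\<^bsub>word_alg R S\<^esub> word R v = word R (u @ v)"
proof -
  interpret R: cring R by fact
  interpret W: twisted_convolution R "reg_mod R" "lists S - {[]}" "word_mult R" "\<lambda>u v. Some (u @ v)" "\<lambda>_. id"
    by (rule word_convolution) fact
  show ?thesis using W.m_fsingle[OF assms(2) _ assms(3), of "\<one>\<^bsub>R\<^esub>" "\<one>\<^bsub>R\<^esub>"]
    by (simp add: word_alg_fs_alg word_fsingle)
qed

section \<open>Quotient algebras\<close>

lemma (in abelian_group) diff_self: "a \<in> carrier G \<Longrightarrow> a \<ominus> a = \<zero>"
  by (simp add: minus_eq r_neg)

lemma (in abelian_group) diff_eq_zeroD: "\<lbrakk>a \<ominus> b = \<zero>; a \<in> carrier G; b \<in> carrier G\<rbrakk> \<Longrightarrow> a = b"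
  using minus_equality[of a "\<ominus> b"] by (simp add: minus_eq)

abbreviation qmap :: "('k, 'a) module \<Rightarrow> 'a set \<Rightarrow> 'a \<Rightarrow> 'a set" where
  "qmap A I a \<equiv> I +>\<^bsub>A\<^esub> a"

locale ideal_quotient = nu_algebra R A for R and A :: "('k, 'a) module" (structure) +
  fixes I :: "'a set"
  assumes ideal: "alg_ideal R A I"
begin

lemma sub: "submodule I R A" using ideal by (simp add: alg_ideal_def)

lemma absorb: "\<lbrakk>a \<in> carrier A; x \<in> I\<rbrakk> \<Longrightarrow> a \<otimes>\<^bsub>A\<^esub> x \<in> I" "\<lbrakk>a \<in> carrier A; x \<in> I\<rbrakk> \<Longrightarrow> x \<otimes>\<^bsub>A\<^esub> a \<in> I"
  using ideal by (simp_all add: alg_ideal_def)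

sublocale I: abelian_subgroup I A
  using abelian_subgroupI2[OF a_comm_group submodule.axioms(1)[OF sub]] .

lemma qmap_eq_iff:
  assumes "a \<in> carrier A" "b \<in> carrier A"
  shows "qmap A I a = qmap A I b \<longleftrightarrow> a \<ominus>\<^bsub>A\<^esub> b \<in> I"
proof
  assume "qmap A I a = qmap A I b"
  then have "a \<in> qmap A I b" using I.a_rcos_self[OF assms(1)] by simp
  then show "a \<ominus>\<^bsub>A\<^esub> b \<in> I" using I.a_rcos_module[OF assms(2,1)] by (simp add: a_minus_def)
next
  assume "a \<ominus>\<^bsub>A\<^esub> b \<in> I"
  then have "a \<in> qmap A I b" using I.a_rcos_module[OF assms(2,1)] by (simp add: a_minus_def)
  then show "qmap A I a = qmap A I b" using I.a_repr_independence'[OF _ assms(2)] by simp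
qed

lemma qmap_memD: "\<lbrakk>x \<in> qmap A I a; a \<in> carrier A\<rbrakk> \<Longrightarrow> x \<in> carrier A \<and> qmap A I x = qmap A I a"
  using I.a_repr_independence' I.a_elemrcos_carrier by blast

lemma carrier_quot: "carrier (quot_alg A I) = qmap A I ` carrier A"
  by (auto simp: quot_alg_def A_RCOSETS_def')

lemma quot_add: "\<lbrakk>a \<in> carrier A; b \<in> carrier A\<rbrakk> \<Longrightarrow>
    qmap A I a \<oplus>\<^bsub>quot_alg A I\<^esub> qmap A I b = qmap A I (a \<oplus>\<^bsub>A\<^esub> b)"
  by (simp add: quot_alg_def I.a_rcos_sum)

lemma quot_zero: "\<zero>\<^bsub>quot_alg A I\<^esub> = qmap A I \<zero>\<^bsub>A\<^esub>"
  using I.a_rcos_const[OF I.zero_closed] by (simp add: quot_alg_def)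

lemma qmap_mult_cong:
  assumes "a \<in> carrier A" "b \<in> carrier A" "a' \<in> carrier A" "b' \<in> carrier A"
    and "qmap A I a' = qmap A I a" "qmap A I b' = qmap A I b"
  shows "qmap A I (a' \<otimes>\<^bsub>A\<^esub> b') = qmap A I (a \<otimes>\<^bsub>A\<^esub> b)"
proof -
  have i: "a' \<ominus>\<^bsub>A\<^esub> a \<in> I" "b' \<ominus>\<^bsub>A\<^esub> b \<in> I" using assms qmap_eq_iff by blast+
  \<comment> \<open>One factor is changed at a time: each difference is a multiple of an element of
    \<open>I\<close>.\<close>
  have "a' \<otimes>\<^bsub>A\<^esub> b' \<ominus>\<^bsub>A\<^esub> a \<otimes>\<^bsub>A\<^esub> b' \<in> I" "a \<otimes>\<^bsub>A\<^esub> b' \<ominus>\<^bsub>A\<^esub> a \<otimes>\<^bsub>A\<^esub> b \<in> I"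
    using absorb(2)[OF assms(4) i(1)] absorb(1)[OF assms(1) i(2)] assms
    by (simp_all add: mult_diff_left mult_diff_right)
  then have "qmap A I (a' \<otimes>\<^bsub>A\<^esub> b') = qmap A I (a \<otimes>\<^bsub>A\<^esub> b')" "qmap A I (a \<otimes>\<^bsub>A\<^esub> b') = qmap A I (a \<otimes>\<^bsub>A\<^esub> b)"
    using assms by (simp_all add: qmap_eq_iff mult_closed)
  then show ?thesis by simp
qed

lemma quot_mult:
  assumes "a \<in> carrier A" "b \<in> carrier A"
  shows "qmap A I a \<otimes>\<^bsub>quot_alg A I\<^esub> qmap A I b = qmap A I (a \<otimes>\<^bsub>A\<^esub> b)"
proof -
  have "qmap A I (a' \<otimes>\<^bsub>A\<^esub> b') = qmap A I (a \<otimes>\<^bsub>A\<^esub> b)" if "a' \<in> qmap A I a" "b' \<in> qmap A I b" for a' b'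
    using qmap_memD[OF that(1) assms(1)] qmap_memD[OF that(2) assms(2)] qmap_mult_cong assms by blast
  then have "(\<Union>a'\<in>qmap A I a. \<Union>b'\<in>qmap A I b. qmap A I (a' \<otimes>\<^bsub>A\<^esub> b')) = qmap A I (a \<otimes>\<^bsub>A\<^esub> b)"
    using I.a_rcos_self[OF assms(1)] I.a_rcos_self[OF assms(2)] by blast
  then show ?thesis by (simp add: quot_alg_def rcoset_mult_def)
qed

lemma quot_smult:
  assumes "r \<in> carrier R" "a \<in> carrier A"
  shows "r \<odot>\<^bsub>quot_alg A I\<^esub> qmap A I a = qmap A I (r \<odot>\<^bsub>A\<^esub> a)"
proof -
  have "qmap A I (r \<odot>\<^bsub>A\<^esub> a') = qmap A I (r \<odot>\<^bsub>A\<^esub> a)" if "a' \<in> qmap A I a" for a'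
  proof -
    have a': "a' \<in> carrier A" "qmap A I a' = qmap A I a" using qmap_memD[OF that assms(2)] by simp_all
    then have "a' \<ominus>\<^bsub>A\<^esub> a \<in> I" using qmap_eq_iff assms by blast
    then have "r \<odot>\<^bsub>A\<^esub> (a' \<ominus>\<^bsub>A\<^esub> a) \<in> I" using submodule.smult_closed[OF sub] assms by blast
    then have "r \<odot>\<^bsub>A\<^esub> a' \<ominus>\<^bsub>A\<^esub> r \<odot>\<^bsub>A\<^esub> a \<in> I"
      using a' assms by (simp add: a_minus_def smult_r_distr smult_r_minus)
    then show ?thesis using a' assms by (simp add: qmap_eq_iff)
  qed
  then have "(\<Union>a'\<in>qmap A I a. qmap A I (r \<odot>\<^bsub>A\<^esub> a')) = qmap A I (r \<odot>\<^bsub>A\<^esub> a)"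
    using I.a_rcos_self[OF assms(2)] by blast
  then show ?thesis by (simp add: quot_alg_def)
qed

lemma qmap_closed: "a \<in> carrier A \<Longrightarrow> qmap A I a \<in> carrier (quot_alg A I)"
  by (simp add: carrier_quot)

lemma nu_algebra_quot: "nu_algebra R (quot_alg A I)"
proof -
  let ?Q = "quot_alg A I"
  note [simp] = quot_add quot_zero quot_mult quot_smult mult_closed
  have e: "\<exists>a\<in>carrier A. x = qmap A I a" if "x \<in> carrier ?Q" for x
    using that by (auto simp: carrier_quot)
  have "abelian_group ?Q"
  proof (rule abelian_groupI)
    fix x y z assume "x \<in> carrier ?Q" "y \<in> carrier ?Q" "z \<in> carrier ?Q"
    then obtain a b c where
      abc: "a \<in> carrier A" "x = qmap A I a" "b \<in> carrier A" "y = qmap A I b" "c \<in> carrier A" "z = qmap A I c"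
      using e[of x] e[of y] e[of z] by blast
    then show "x \<oplus>\<^bsub>?Q\<^esub> y \<in> carrier ?Q" "x \<oplus>\<^bsub>?Q\<^esub> y \<oplus>\<^bsub>?Q\<^esub> z = x \<oplus>\<^bsub>?Q\<^esub> (y \<oplus>\<^bsub>?Q\<^esub> z)" "x \<oplus>\<^bsub>?Q\<^esub> y = y \<oplus>\<^bsub>?Q\<^esub> x"
      "\<zero>\<^bsub>?Q\<^esub> \<oplus>\<^bsub>?Q\<^esub> x = x"
      by (simp_all add: qmap_closed M.a_ac)
    show "\<exists>y\<in>carrier ?Q. y \<oplus>\<^bsub>?Q\<^esub> x = \<zero>\<^bsub>?Q\<^esub>"
      using abc by (intro bexI[of _ "qmap A I (\<ominus>\<^bsub>A\<^esub> a)"]) (simp_all add: qmap_closed M.l_neg)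
  qed (simp add: qmap_closed)
  then have "Module.module R ?Q"
  proof (rule moduleI[OF is_cring])
    fix r s x y assume r: "r \<in> carrier R" and "x \<in> carrier ?Q"
    then obtain a where a: "a \<in> carrier A" "x = qmap A I a" using e[of x] by blast
    show "r \<odot>\<^bsub>?Q\<^esub> x \<in> carrier ?Q" using r a by (simp add: qmap_closed)
    show "(r \<oplus>\<^bsub>R\<^esub> s) \<odot>\<^bsub>?Q\<^esub> x = r \<odot>\<^bsub>?Q\<^esub> x \<oplus>\<^bsub>?Q\<^esub> s \<odot>\<^bsub>?Q\<^esub> x"
      "(r \<otimes>\<^bsub>R\<^esub> s) \<odot>\<^bsub>?Q\<^esub> x = r \<odot>\<^bsub>?Q\<^esub> (s \<odot>\<^bsub>?Q\<^esub> x)" if "s \<in> carrier R"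
      using r a that by (simp_all add: smult_l_distr smult_assoc1)
    assume "y \<in> carrier ?Q"
    then obtain b where "b \<in> carrier A" "y = qmap A I b" using e[of x] e[of y] by blast
    then show "r \<odot>\<^bsub>?Q\<^esub> (x \<oplus>\<^bsub>?Q\<^esub> y) = r \<odot>\<^bsub>?Q\<^esub> x \<oplus>\<^bsub>?Q\<^esub> r \<odot>\<^bsub>?Q\<^esub> y"
      using r a by (simp add: smult_r_distr)
  next
    fix x assume "x \<in> carrier ?Q"
    then obtain a where "a \<in> carrier A" "x = qmap A I a" using e[of x] by blast
    then show "\<one>\<^bsub>R\<^esub> \<odot>\<^bsub>?Q\<^esub> x = x" by simp
  qed
  then interpret Q: Module.module R ?Q .
  show ?thesis
  proof
    fix x y assume "x \<in> carrier ?Q" "y \<in> carrier ?Q"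
    then obtain a b where
      abc: "a \<in> carrier A" "x = qmap A I a" "b \<in> carrier A" "y = qmap A I b" using e[of x] e[of y] by blast
    then show "x \<otimes>\<^bsub>?Q\<^esub> y \<in> carrier ?Q" by (simp add: qmap_closed)
    show "r \<odot>\<^bsub>?Q\<^esub> x \<otimes>\<^bsub>?Q\<^esub> y = r \<odot>\<^bsub>?Q\<^esub> (x \<otimes>\<^bsub>?Q\<^esub> y)" "x \<otimes>\<^bsub>?Q\<^esub> (r \<odot>\<^bsub>?Q\<^esub> y) = r \<odot>\<^bsub>?Q\<^esub> (x \<otimes>\<^bsub>?Q\<^esub> y)"
      if "r \<in> carrier R" for r
      using abc that by (simp_all add: smult_mult_left smult_mult_right)
    fix z assume "z \<in> carrier ?Q"
    then obtain c where "c \<in> carrier A" "z = qmap A I c" using e[of z] by blast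
    with abc show "x \<otimes>\<^bsub>?Q\<^esub> y \<otimes>\<^bsub>?Q\<^esub> z = x \<otimes>\<^bsub>?Q\<^esub> (y \<otimes>\<^bsub>?Q\<^esub> z)"
      "(x \<oplus>\<^bsub>?Q\<^esub> y) \<otimes>\<^bsub>?Q\<^esub> z = x \<otimes>\<^bsub>?Q\<^esub> z \<oplus>\<^bsub>?Q\<^esub> y \<otimes>\<^bsub>?Q\<^esub> z"
      "x \<otimes>\<^bsub>?Q\<^esub> (y \<oplus>\<^bsub>?Q\<^esub> z) = x \<otimes>\<^bsub>?Q\<^esub> y \<oplus>\<^bsub>?Q\<^esub> x \<otimes>\<^bsub>?Q\<^esub> z"
      by (simp_all add: mult_assoc mult_l_distr mult_r_distr)
  qed
qed

lemma nu_hom_qmap: "nu_hom R A (quot_alg A I) (qmap A I)"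
  by (intro nu_homI lin_mapI) (simp_all add: qmap_closed quot_add quot_smult quot_mult)

text \<open>Elements of the quotient are cosets as sets, so the lift evaluates \<open>f\<close> at a
  chosen member. Two members differ by an element of \<open>I\<close>, where \<open>f\<close>
  vanishes, so the choice is immaterial.\<close>

lemma quot_lift:
  assumes B: "nu_algebra R B" and f: "nu_hom R A B f" and ker: "\<And>x. x \<in> I \<Longrightarrow> f x = \<zero>\<^bsub>B\<^esub>"
  obtains f' where "nu_hom R (quot_alg A I) B f'" "\<And>a. a \<in> carrier A \<Longrightarrow> f' (qmap A I a) = f a"
proof
  interpret B: nu_algebra R B by fact
  let ?f' = "\<lambda>U. f (SOME a. a \<in> U)"
  show *: "?f' (qmap A I a) = f a" if a: "a \<in> carrier A" for a
  proof -
    let ?b = "SOME b. b \<in> qmap A I a"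
    have "?b \<in> qmap A I a" using I.a_rcos_self[OF a] by (rule someI)
    then have b: "?b \<in> carrier A" "?b \<ominus>\<^bsub>A\<^esub> a \<in> I" using qmap_memD[of ?b a] a qmap_eq_iff by auto
    have "f (?b \<ominus>\<^bsub>A\<^esub> a) = f ?b \<ominus>\<^bsub>B\<^esub> f a"
      using lin_map_diff[OF module_axioms B.module_axioms nu_homD(1)[OF f] b(1) a] .
    then have "f ?b \<ominus>\<^bsub>B\<^esub> f a = \<zero>\<^bsub>B\<^esub>" using ker[OF b(2)] by simp
    then show ?thesis using B.diff_eq_zeroD[of "f ?b" "f a"] nu_homD(3)[OF f] a b by simp
  qed
  have e: "\<exists>a\<in>carrier A. x = qmap A I a" if "x \<in> carrier (quot_alg A I)" for x
    using that by (auto simp: carrier_quot)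
  show "nu_hom R (quot_alg A I) B ?f'"
  proof (intro nu_homI lin_mapI)
    fix x y assume "x \<in> carrier (quot_alg A I)" "y \<in> carrier (quot_alg A I)"
    then obtain a b where "a \<in> carrier A" "x = qmap A I a" "b \<in> carrier A" "y = qmap A I b" using e[of x] e[of y]
        by blast
    then show "?f' (x \<oplus>\<^bsub>quot_alg A I\<^esub> y) = ?f' x \<oplus>\<^bsub>B\<^esub> ?f' y" "?f' (x \<otimes>\<^bsub>quot_alg A I\<^esub> y) = ?f' x \<otimes>\<^bsub>B\<^esub> ?f' y"
      using nu_homD[OF f] by (simp_all add: quot_add quot_mult * mult_closed)
  next
    fix r x assume r: "r \<in> carrier R" and "x \<in> carrier (quot_alg A I)"
    then obtain a where "a \<in> carrier A" "x = qmap A I a" using e[of x] by blast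
    then show "?f' (r \<odot>\<^bsub>quot_alg A I\<^esub> x) = r \<odot>\<^bsub>B\<^esub> ?f' x"
      using nu_homD[OF f] r by (simp add: quot_smult *)
  next
    fix x assume "x \<in> carrier (quot_alg A I)"
    then obtain a where "a \<in> carrier A" "x = qmap A I a" using e[of x] by blast
    then show "?f' x \<in> carrier B" using nu_homD(3)[OF f] by (simp add: *)
  qed
qed

end

section \<open>Generated submodules, generated ideals and kernels\<close>

lemma submodule_Inter:
  assumes M: "Module.module R M" and "\<N> \<noteq> {}" and N: "\<And>N. N \<in> \<N> \<Longrightarrow> submodule N R M"
  shows "submodule (\<Inter>\<N>) R M"
proof -
  interpret M: Module.module R M by fact
  note E = M.submoduleE[OF N]
  have z: "\<zero>\<^bsub>M\<^esub> \<in> N" if "N \<in> \<N>" for N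
    using subgroup.one_closed[OF submodule.axioms(1)[OF N[OF that]]] by simp
  show ?thesis
  proof (rule M.submoduleI)
    show "\<Inter>\<N> \<subseteq> carrier M" using assms(2) E(1) by blast
  qed (use E z in auto)
qed

lemma submodule_lin_span:
  assumes "Module.module R M" "S \<subseteq> carrier M"
  shows "submodule (lin_span R M S) R M"
  unfolding lin_span_def
  by (rule submodule_Inter[OF assms(1)]) (use module.carrier_is_submodule[OF assms(1)] assms(2) in auto)

lemma lin_span_superset: "S \<subseteq> lin_span R M S"
  by (auto simp: lin_span_def)

lemma lin_span_minimal: "\<lbrakk>submodule N R M; S \<subseteq> N\<rbrakk> \<Longrightarrow> lin_span R M S \<subseteq> N"
  by (auto simp: lin_span_def)

lemma alg_ideal_gen_ideal:
  assumes "nu_algebra R A" "S \<subseteq> carrier A"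
  shows "alg_ideal R A (gen_ideal R A S)"
proof -
  interpret A: nu_algebra R A by fact
  have "alg_ideal R A (carrier A)"
    using A.carrier_is_submodule by (simp add: alg_ideal_def A.mult_closed)
  then show ?thesis unfolding gen_ideal_def alg_ideal_def
    using assms(2) by (intro conjI submodule_Inter[OF A.module_axioms]) auto
qed

lemma gen_ideal_superset: "S \<subseteq> gen_ideal R A S"
  by (auto simp: gen_ideal_def)

lemma gen_ideal_minimal: "\<lbrakk>alg_ideal R A I; S \<subseteq> I\<rbrakk> \<Longrightarrow> gen_ideal R A S \<subseteq> I"
  by (auto simp: gen_ideal_def)

lemma submodule_kernel:
  assumes A: "Module.module R A" and B: "Module.module R B" and f: "lin_map R A B f"
  shows "submodule {a \<in> carrier A. f a = \<zero>\<^bsub>B\<^esub>} R A"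
proof -
  interpret A: Module.module R A by fact
  interpret B: Module.module R B by fact
  show ?thesis using lin_map_zero[OF A B f] lin_map_minus[OF A B f] lin_mapD[OF f]
    by (intro A.submoduleI) auto
qed

lemma alg_ideal_kernel:
  assumes A: "nu_algebra R A" and B: "nu_algebra R B" and f: "nu_hom R A B f"
  shows "alg_ideal R A {a \<in> carrier A. f a = \<zero>\<^bsub>B\<^esub>}"
proof -
  interpret A: nu_algebra R A by fact
  interpret B: nu_algebra R B by fact
  show ?thesis unfolding alg_ideal_def
    using submodule_kernel[OF A.module_axioms B.module_axioms nu_homD(1)[OF f]]
      nu_homD(2,3)[OF f] B.mult_zero_left B.mult_zero_right by (auto simp: A.mult_closed)
qed


section \<open>The tensor algebra\<close>

context
  fixes R :: "('k, 'r) ring_scheme" and M :: "('k, 'a) module"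
  assumes M: "Module.module R M"
begin

interpretation M: Module.module R M by (rule M)

private abbreviation (input) "W \<equiv> word_alg R (carrier M)"
private abbreviation (input) "N \<equiv> lin_span R W (multilinear_rels R M)"

interpretation W: nu_algebra R W by (rule nu_algebra_word) (rule M.is_cring)

lemma word_closed: "w \<in> lists (carrier M) - {[]} \<Longrightarrow> word R w \<in> carrier W"
  by (simp add: word_alg_fs_alg word_fsingle M.R.fsingle_closed)

lemma word_smult_fsingle:
  assumes "r \<in> carrier R"
  shows "r \<odot>\<^bsub>W\<^esub> word R w = fsingle R w r"
  using assms by (auto simp: word_alg_def word_def fsingle_def)

lemma word_induct [consumes 1]:
  assumes x: "x \<in> carrier W" and P: "P \<zero>\<^bsub>W\<^esub>"
    "\<And>w r. \<lbrakk>w \<in> lists (carrier M) - {[]}; r \<in> carrier R\<rbrakk> \<Longrightarrow> P (r \<odot>\<^bsub>W\<^esub> word R w)"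
    "\<And>x y. \<lbrakk>x \<in> carrier W; y \<in> carrier W; P x; P y\<rbrakk> \<Longrightarrow> P (x \<oplus>\<^bsub>W\<^esub> y)"
  shows "P x"
proof -
  have "x \<in> fin_fun (lists (carrier M) - {[]}) R" using x by (simp add: word_alg_fs_alg)
  then show ?thesis
  proof (induction rule: M.R.fin_fun_induct)
    case (single w a)
    then show ?case using P(2)[OF single] by (simp add: word_smult_fsingle)
  next
    case (add \<phi> \<psi>)
    then show ?case using P(3)[of \<phi> \<psi>] by (simp add: word_alg_fs_alg)
  qed (use P(1) in \<open>simp add: word_alg_fs_alg\<close>)
qed

lemma multilinear_rels_add:
  "\<lbrakk>u \<in> lists (carrier M); v \<in> lists (carrier M); a \<in> carrier M; b \<in> carrier M\<rbrakk> \<Longrightarrow>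
    word R (u @ (a \<oplus>\<^bsub>M\<^esub> b) # v) \<ominus>\<^bsub>W\<^esub> (word R (u @ a # v) \<oplus>\<^bsub>W\<^esub> word R (u @ b # v)) \<in> multilinear_rels R M"
  unfolding multilinear_rels_def Let_def by blast

lemma multilinear_rels_smult:
  "\<lbrakk>u \<in> lists (carrier M); v \<in> lists (carrier M); r \<in> carrier R; a \<in> carrier M\<rbrakk> \<Longrightarrow>
    word R (u @ (r \<odot>\<^bsub>M\<^esub> a) # v) \<ominus>\<^bsub>W\<^esub> (r \<odot>\<^bsub>W\<^esub> word R (u @ a # v)) \<in> multilinear_rels R M"
  unfolding multilinear_rels_def Let_def by blast

lemma multilinear_rels_cases:
  assumes "x \<in> multilinear_rels R M"
  obtains u v a b where "u \<in> lists (carrier M)" "v \<in> lists (carrier M)" "a \<in> carrier M" "b \<in> carrier M"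
      "x = word R (u @ (a \<oplus>\<^bsub>M\<^esub> b) # v) \<ominus>\<^bsub>W\<^esub> (word R (u @ a # v) \<oplus>\<^bsub>W\<^esub> word R (u @ b # v))"
  | u v r a where "u \<in> lists (carrier M)" "v \<in> lists (carrier M)" "r \<in> carrier R" "a \<in> carrier M"
      "x = word R (u @ (r \<odot>\<^bsub>M\<^esub> a) # v) \<ominus>\<^bsub>W\<^esub> (r \<odot>\<^bsub>W\<^esub> word R (u @ a # v))"
  using assms unfolding multilinear_rels_def Let_def
  by (elim UnE CollectE exE conjE) (erule (4) that)+

lemma multilinear_rels_carrier: "multilinear_rels R M \<subseteq> carrier W"
proof
  fix x assume "x \<in> multilinear_rels R M"
  then show "x \<in> carrier W"
    by (cases rule: multilinear_rels_cases) (auto intro!: W.minus_closed W.a_closed W.smult_closed word_closed)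
qed

text \<open>Multiplying a relation by a word lengthens its prefix \<open>u\<close> or its suffix
  \<open>v\<close> and gives a relation of the same kind. This is why the linear span of the
  relations is already an ideal.\<close>

lemma word_mult_rels:
  assumes "w \<in> lists (carrier M) - {[]}" "x \<in> multilinear_rels R M"
  shows "word R w \<otimes>\<^bsub>W\<^esub> x \<in> multilinear_rels R M" "x \<otimes>\<^bsub>W\<^esub> word R w \<in> multilinear_rels R M"
proof -
  note ww = word_mult_word[OF M.is_cring, of _ "carrier M"]
  note s = W.mult_diff_left W.mult_diff_right W.mult_l_distr W.mult_r_distr W.smult_mult_left
    W.smult_mult_right ww word_closed
  have w: "w \<in> lists (carrier M)" "w \<noteq> []" "word R w \<in> carrier W" using assms(1) word_closed by auto
  have "word R w \<otimes>\<^bsub>W\<^esub> x \<in> multilinear_rels R M \<and> x \<otimes>\<^bsub>W\<^esub> word R w \<in> multilinear_rels R M"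
    using assms(2)
  proof (cases rule: multilinear_rels_cases)
    case (1 u v a b)
    show ?thesis using 1 w
      multilinear_rels_add[of "w @ u" v a b] multilinear_rels_add[of u "v @ w" a b] by (simp add: s)
  next
    case (2 u v r a)
    show ?thesis using 2 w
      multilinear_rels_smult[of "w @ u" v r a] multilinear_rels_smult[of u "v @ w" r a] by (simp add: s)
  qed
  then show "word R w \<otimes>\<^bsub>W\<^esub> x \<in> multilinear_rels R M" "x \<otimes>\<^bsub>W\<^esub> word R w \<in> multilinear_rels R M" by simp_all
qed

lemma alg_ideal_multilinear: "alg_ideal R W N"
proof -
  note N = submodule_lin_span[OF W.module_axioms multilinear_rels_carrier]
  note E = W.submoduleE[OF N]
  have z: "\<zero>\<^bsub>W\<^esub> \<in> N" using subgroup.one_closed[OF submodule.axioms(1)[OF N]] by simp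
  \<comment> \<open>The elements of \<open>N\<close> all of whose multiples stay in \<open>N\<close>
    form a submodule. It contains the relations, hence, the span being minimal, all of
    \<open>N\<close>.\<close>
  let ?J = "{x \<in> N. \<forall>a\<in>carrier W. a \<otimes>\<^bsub>W\<^esub> x \<in> N \<and> x \<otimes>\<^bsub>W\<^esub> a \<in> N}"
  have c: "x \<in> carrier W" if "x \<in> N" for x using E(1) that by blast
  have "submodule ?J R W"
  proof (rule W.submoduleI)
    fix x assume x: "x \<in> ?J"
    show "\<ominus>\<^bsub>W\<^esub> x \<in> ?J"
      using x c E(3) lin_map_minus[OF W.module_axioms W.module_axioms W.lin_map_mult_left, of _ x]
        lin_map_minus[OF W.module_axioms W.module_axioms W.lin_map_mult_right, of _ x] by simp
    show "x \<oplus>\<^bsub>W\<^esub> y \<in> ?J" if "y \<in> ?J" for y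
      using x that c E(5) by (simp add: W.mult_l_distr W.mult_r_distr)
    show "r \<odot>\<^bsub>W\<^esub> x \<in> ?J" if "r \<in> carrier R" for r
      using x that c E(4) by (simp add: W.smult_mult_left W.smult_mult_right)
  qed (use c z in \<open>auto simp: W.mult_zero_left W.mult_zero_right\<close>)
  moreover have "multilinear_rels R M \<subseteq> ?J"
  proof
    fix x assume x: "x \<in> multilinear_rels R M"
    have xN: "x \<in> N" by (rule subsetD[OF lin_span_superset x])
    have "a \<otimes>\<^bsub>W\<^esub> x \<in> N \<and> x \<otimes>\<^bsub>W\<^esub> a \<in> N" if "a \<in> carrier W" for a
      using that
    proof (induction rule: word_induct)
      case (2 w r)
      have "word R w \<otimes>\<^bsub>W\<^esub> x \<in> N" "x \<otimes>\<^bsub>W\<^esub> word R w \<in> N"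
        by (rule subsetD[OF lin_span_superset word_mult_rels(1)[OF 2(1) x]])
          (rule subsetD[OF lin_span_superset word_mult_rels(2)[OF 2(1) x]])
      then show ?case using E(4)[OF 2(2)] 2(2) word_closed[OF 2(1)] c[OF xN]
        by (simp add: W.smult_mult_left W.smult_mult_right)
    next
      case (3 a b)
      then show ?case using c[OF xN] E(5) by (simp add: W.mult_l_distr W.mult_r_distr)
    qed (use c[OF xN] z in \<open>simp add: W.mult_zero_left W.mult_zero_right\<close>)
    with xN show "x \<in> ?J" by blast
  qed
  ultimately have "N \<subseteq> ?J" by (rule lin_span_minimal)
  then show ?thesis using N by (auto simp: alg_ideal_def)
qed

interpretation T: ideal_quotient R W N
  by unfold_locales (rule alg_ideal_multilinear)

lemma nu_algebra_tensor: "nu_algebra R (tensor_alg R M)"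
  using T.nu_algebra_quot by (simp add: tensor_alg_def)

interpretation TA: nu_algebra R "tensor_alg R M" by (rule nu_algebra_tensor)

lemma nu_hom_tensor_quot: "nu_hom R W (tensor_alg R M) (qmap W N)"
  using T.nu_hom_qmap by (simp add: tensor_alg_def)

lemma carrier_tensor: "carrier (tensor_alg R M) = qmap W N ` carrier W"
  using T.carrier_quot by (simp add: tensor_alg_def)

lemma tensor_word_closed: "w \<in> lists (carrier M) - {[]} \<Longrightarrow> tensor_word R M w \<in> carrier (tensor_alg R M)"
  unfolding tensor_word_def carrier_tensor using word_closed by blast

lemma tensor_word_append:
  assumes "u \<in> lists (carrier M) - {[]}" "v \<in> lists (carrier M) - {[]}"
  shows "tensor_word R M u \<otimes>\<^bsub>tensor_alg R M\<^esub> tensor_word R M v = tensor_word R M (u @ v)"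
  using nu_homD(2)[OF nu_hom_tensor_quot word_closed[OF assms(1)] word_closed[OF assms(2)]]
    word_mult_word[OF M.is_cring assms]
  by (simp add: tensor_word_def)

lemma lin_map_tensor_letter: "lin_map R M (tensor_alg R M) (\<lambda>a. tensor_word R M [a])"
proof -
  note q = nu_homD[OF nu_hom_tensor_quot]
  have N: "x \<in> N" if "x \<in> multilinear_rels R M" for x
    using that by (rule subsetD[OF lin_span_superset])
  show ?thesis
  proof (rule lin_mapI)
    fix a assume a: "a \<in> carrier M"
    then show "tensor_word R M [a] \<in> carrier (tensor_alg R M)" using tensor_word_closed by simp
    show "tensor_word R M [a \<oplus>\<^bsub>M\<^esub> b] = tensor_word R M [a] \<oplus>\<^bsub>tensor_alg R M\<^esub> tensor_word R M [b]"
      if b: "b \<in> carrier M" for b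
    proof -
      have "qmap W N (word R [a \<oplus>\<^bsub>M\<^esub> b]) = qmap W N (word R [a] \<oplus>\<^bsub>W\<^esub> word R [b])"
        using a b N[OF multilinear_rels_add[of "[]" "[]" a b]] T.qmap_eq_iff by (simp add: word_closed)
      then show ?thesis unfolding tensor_word_def using q(4)[of "word R [a]" "word R [b]"] a b
        by (simp add: word_closed)
    qed
    show "tensor_word R M [r \<odot>\<^bsub>M\<^esub> a] = r \<odot>\<^bsub>tensor_alg R M\<^esub> tensor_word R M [a]" if r: "r \<in> carrier R" for r
    proof -
      have "qmap W N (word R [r \<odot>\<^bsub>M\<^esub> a]) = qmap W N (r \<odot>\<^bsub>W\<^esub> word R [a])"
        using a r N[OF multilinear_rels_smult[of "[]" "[]" r a]] T.qmap_eq_iff by (simp add: word_closed)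
      then show ?thesis unfolding tensor_word_def using q(5)[of r "word R [a]"] a r
        by (simp add: word_closed)
    qed
  qed
qed

text \<open>A product over nonempty lists, bracketed to the right. There is no unit to start from,
  so the list with one element is the base case and the empty list has no meaningful value.\<close>

fun prodl :: "('e, 'z) monoid_scheme \<Rightarrow> 'e list \<Rightarrow> 'e" where
  "prodl E [x] = x"
| "prodl E (x # y # ys) = x \<otimes>\<^bsub>E\<^esub> prodl E (y # ys)"
| "prodl E [] = undefined"

lemma prodl_Cons: "ys \<noteq> [] \<Longrightarrow> prodl E (x # ys) = x \<otimes>\<^bsub>E\<^esub> prodl E ys"
  by (cases ys) auto

text \<open>A word is sent to the product of the values of its letters, extended linearly to the
  free module on words. This kills the relations because the product is linear in each letter
  separately.\<close>

lemma tensor_lift: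
  assumes E: "nu_algebra R E" and t: "lin_map R M E t"
  obtains \<Theta> where "nu_hom R (tensor_alg R M) E \<Theta>" "\<And>a. a \<in> carrier M \<Longrightarrow> \<Theta> (tensor_word R M [a]) = t a"
proof -
  interpret E: nu_algebra R E by fact
  interpret A: nu_algebra R "reg_mod R" by (rule nu_algebra_reg_mod) (rule M.is_cring)
  let ?S = "lists (carrier M) - {[]}"
  define p where "p w = prodl E (map t w)" for w
  have pcl: "p w \<in> carrier E" if "w \<in> ?S" for w
    using that
  proof (induction w)
    case (Cons x w)
    then show ?case using lin_mapD(1)[OF t] by (cases "w = []") (auto simp: p_def prodl_Cons E.mult_closed)
  qed simp
  have papp: "p (u @ v) = p u \<otimes>\<^bsub>E\<^esub> p v" if "u \<in> ?S" "v \<in> ?S" for u v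
    using that(1)
  proof (induction u)
    case (Cons x w)
    then show ?case using lin_mapD(1)[OF t] pcl that(2)
      by (cases "w = []") (auto simp: p_def prodl_Cons E.mult_assoc)
  qed simp
  \<comment> \<open>Linearity in the letter between \<open>u\<close> and \<open>v\<close>: the
    letters of \<open>v\<close> multiply from the right, those of \<open>u\<close> are added one by
    one on the left.\<close>
  have plin: "lin_map R M E (\<lambda>a. p (u @ a # v))" if "u \<in> lists (carrier M)" and v: "v \<in> lists (carrier M)" for u v
    using that(1)
  proof (induction u)
    case Nil
    show ?case
    proof (cases "v = []")
      case True
      then show ?thesis using t by (simp add: p_def)
    next
      case False
      then have "p v \<in> carrier E" using v pcl by simp
      then show ?thesis using lin_map_comp[OF t E.lin_map_mult_right] False
        by (simp add: p_def prodl_Cons o_def)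
    qed
  next
    case (Cons x u)
    then have "t x \<in> carrier E" using lin_mapD(1)[OF t] by simp
    then show ?case using lin_map_comp[OF Cons.IH E.lin_map_mult_left]
      by (simp add: p_def prodl_Cons o_def)
  qed
  define P where "P = fs_ext (reg_mod R) E (\<lambda>w r. r \<odot>\<^bsub>E\<^esub> p w)"
  have th: "lin_map R (reg_mod R) E (\<lambda>r. r \<odot>\<^bsub>E\<^esub> p w)" if "w \<in> ?S" for w
    using pcl[OF that] by (intro lin_mapI) (auto simp: E.smult_l_distr E.smult_assoc1)
  have Ps: "P (fsingle (reg_mod R) w r) = r \<odot>\<^bsub>E\<^esub> p w" if "w \<in> ?S" "r \<in> carrier R" for w r
    unfolding P_def using fs_ext_fsingle[OF A.module_axioms E.module_axioms th that(1)] that(2) by simp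
  have Pl: "lin_map R W E P"
    unfolding P_def word_alg_fs_alg by (rule lin_map_fs_ext[OF A.module_axioms E.module_axioms th])
  have Pw: "P (word R w) = p w" if "w \<in> ?S" for w
    using Ps[OF that, of "\<one>\<^bsub>R\<^esub>"] pcl[OF that] by (simp add: word_fsingle)
  have Ph: "nu_hom R W E P"
    unfolding word_alg_fs_alg
  proof (rule nu_hom_fsI[OF A.module_axioms W.nu_algebra_axioms[unfolded word_alg_fs_alg] E
        Pl[unfolded word_alg_fs_alg]])
    interpret C: twisted_convolution R "reg_mod R" ?S "word_mult R" "\<lambda>u v. Some (u @ v)" "\<lambda>_. id"
      by (rule word_convolution) (rule M.is_cring)
    fix u r v s assume a: "u \<in> ?S" "r \<in> carrier (reg_mod R)" "v \<in> ?S" "s \<in> carrier (reg_mod R)"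
    then have "P (word_mult R (fsingle (reg_mod R) u r) (fsingle (reg_mod R) v s)) = (r \<otimes>\<^bsub>R\<^esub> s) \<odot>\<^bsub>E\<^esub> p (u @ v)"
      using C.m_fsingle[OF a] Ps[of "u @ v" "r \<otimes>\<^bsub>R\<^esub> s"] by simp
    also have "\<dots> = P (fsingle (reg_mod R) u r) \<otimes>\<^bsub>E\<^esub> P (fsingle (reg_mod R) v s)"
      using a pcl papp Ps by (simp add: E.smult_mult_left E.smult_mult_right E.smult_assoc1[symmetric] E.mult_closed
          M.R.m_comm)
    finally show "P (word_mult R (fsingle (reg_mod R) u r) (fsingle (reg_mod R) v s)) =
        P (fsingle (reg_mod R) u r) \<otimes>\<^bsub>E\<^esub> P (fsingle (reg_mod R) v s)" .
  qed
  have "multilinear_rels R M \<subseteq> {x \<in> carrier W. P x = \<zero>\<^bsub>E\<^esub>}"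
  proof
    fix x assume x: "x \<in> multilinear_rels R M"
    note d = lin_map_diff[OF W.module_axioms E.module_axioms Pl]
    have "P x = \<zero>\<^bsub>E\<^esub>" using x
    proof (cases rule: multilinear_rels_cases)
      case (1 u v a b)
      note l = plin[OF 1(1,2)]
      show ?thesis using 1 d lin_mapD[OF l] lin_mapD(2)[OF Pl]
        by (simp add: word_closed Pw E.diff_self)
    next
      case (2 u v r a)
      note l = plin[OF 2(1,2)]
      show ?thesis using 2 d lin_mapD[OF l] lin_mapD(3)[OF Pl]
        by (simp add: word_closed Pw E.diff_self)
    qed
    then show "x \<in> {x \<in> carrier W. P x = \<zero>\<^bsub>E\<^esub>}" using x multilinear_rels_carrier by blast
  qed
  then have "N \<subseteq> {x \<in> carrier W. P x = \<zero>\<^bsub>E\<^esub>}"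
    by (rule lin_span_minimal[OF submodule_kernel[OF W.module_axioms E.module_axioms Pl]])
  then have "\<And>x. x \<in> N \<Longrightarrow> P x = \<zero>\<^bsub>E\<^esub>" by blast
  then obtain \<Theta> where T: "nu_hom R (tensor_alg R M) E \<Theta>" "\<And>a. a \<in> carrier W \<Longrightarrow> \<Theta> (qmap W N a) = P a"
    using T.quot_lift[OF E Ph] unfolding tensor_alg_def by blast
  have "\<Theta> (tensor_word R M [a]) = t a" if "a \<in> carrier M" for a
    using that T(2)[of "word R [a]"] Pw[of "[a]"] by (simp add: tensor_word_def word_closed p_def)
  with T(1) show ?thesis by (rule that)
qed

lemma tensor_hom_eqI:
  assumes E: "nu_algebra R E" and f: "nu_hom R (tensor_alg R M) E f" and g: "nu_hom R (tensor_alg R M) E g"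
    and eq: "\<And>a. a \<in> carrier M \<Longrightarrow> f (tensor_word R M [a]) = g (tensor_word R M [a])"
    and x: "x \<in> carrier (tensor_alg R M)"
  shows "f x = g x"
proof -
  interpret E: nu_algebra R E by fact
  have w: "f (tensor_word R M w) = g (tensor_word R M w)" if "w \<in> lists (carrier M) - {[]}" for w
    using that
  proof (induction w)
    case (Cons a w)
    show ?case
    proof (cases "w = []")
      case False
      then have "tensor_word R M (a # w) = tensor_word R M [a] \<otimes>\<^bsub>tensor_alg R M\<^esub> tensor_word R M w"
        using Cons.prems tensor_word_append[of "[a]" w] by simp
      then show ?thesis using Cons False eq nu_homD(2)[OF f] nu_homD(2)[OF g] tensor_word_closed by simp
    qed (use Cons eq in simp)
  qed simp
  obtain y where y: "y \<in> carrier W" "x = qmap W N y" using x carrier_tensor by blast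
  note q = nu_homD[OF nu_hom_tensor_quot]
  have "f (qmap W N y) = g (qmap W N y)" using y(1)
  proof (induction rule: word_induct)
    case 1
    have "qmap W N \<zero>\<^bsub>W\<^esub> = \<zero>\<^bsub>tensor_alg R M\<^esub>"
      using lin_map_zero[OF W.module_axioms TA.module_axioms q(1)] .
    then show ?case using lin_map_zero[OF TA.module_axioms E.module_axioms nu_homD(1)[OF f]]
        lin_map_zero[OF TA.module_axioms E.module_axioms nu_homD(1)[OF g]] by simp
  next
    case (2 v r)
    then show ?case using q(5)[of r "word R v"] q(3)[of "word R v"] nu_homD(5)[OF f] nu_homD(5)[OF g] w[of v]
      by (simp add: word_closed tensor_word_def)
  next
    case (3 x y)
    then show ?case using q(3)[of x] q(3)[of y] q(4)[of x y] nu_homD(4)[OF f] nu_homD(4)[OF g] by simp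
  qed
  with y show ?thesis by simp
qed

end

section \<open>The universal property of \<open>\<R>\<close>\<close>

locale lin_category = cring R for R (structure) and C :: "('k, 'c, 'a) lincat" +
  assumes LHom_module: "\<lbrakk>x \<in> LOb C; y \<in> LOb C\<rbrakk> \<Longrightarrow> Module.module R (LHom C x y)"
    and LComp_closed: "\<lbrakk>x \<in> LOb C; y \<in> LOb C; z \<in> LOb C; f \<in> carrier (LHom C x y); g \<in> carrier (LHom C y z)\<rbrakk>
      \<Longrightarrow> LComp C x y z g f \<in> carrier (LHom C x z)"
begin

abbreviation "mor p \<equiv> LHom C (fst p) (snd p)"

lemma mor_module: "p \<in> LOb C \<times> LOb C \<Longrightarrow> Module.module R (mor p)"
  using LHom_module by auto

lemma total_mod_simps:
  "carrier (total_mod C) = {\<phi> \<in> (\<Pi>\<^sub>E p\<in>LOb C \<times> LOb C. carrier (mor p)).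
     finite {p\<in>LOb C \<times> LOb C. \<phi> p \<noteq> \<zero>\<^bsub>mor p\<^esub>}}"
  "zero (total_mod C) = (\<lambda>p\<in>LOb C \<times> LOb C. \<zero>\<^bsub>mor p\<^esub>)"
  "add (total_mod C) = (\<lambda>\<phi> \<psi>. \<lambda>p\<in>LOb C \<times> LOb C. \<phi> p \<oplus>\<^bsub>mor p\<^esub> \<psi> p)"
  "smult (total_mod C) = (\<lambda>r \<phi>. \<lambda>p\<in>LOb C \<times> LOb C. r \<odot>\<^bsub>mor p\<^esub> \<phi> p)"
  by (simp_all add: total_mod_def Let_def case_prod_unfold)

lemma total_app: "\<lbrakk>\<phi> \<in> carrier (total_mod C); p \<in> LOb C \<times> LOb C\<rbrakk> \<Longrightarrow> \<phi> p \<in> carrier (mor p)"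
  unfolding total_mod_simps by (auto simp: PiE_iff)

lemma total_finite: "\<phi> \<in> carrier (total_mod C) \<Longrightarrow> finite {p\<in>LOb C \<times> LOb C. \<phi> p \<noteq> \<zero>\<^bsub>mor p\<^esub>}"
  unfolding total_mod_simps by simp

lemma total_ext: "\<phi> \<in> carrier (total_mod C) \<Longrightarrow> \<phi> \<in> extensional (LOb C \<times> LOb C)"
  unfolding total_mod_simps by (simp add: PiE_iff)

lemma total_memI:
  assumes "\<And>p. p \<in> LOb C \<times> LOb C \<Longrightarrow> \<phi> p \<in> carrier (mor p)"
    and "finite F" "\<And>p. \<lbrakk>p \<in> LOb C \<times> LOb C; p \<notin> F\<rbrakk> \<Longrightarrow> \<phi> p = \<zero>\<^bsub>mor p\<^esub>"
  shows "restrict \<phi> (LOb C \<times> LOb C) \<in> carrier (total_mod C)"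
proof -
  have "{p\<in>LOb C \<times> LOb C. restrict \<phi> (LOb C \<times> LOb C) p \<noteq> \<zero>\<^bsub>mor p\<^esub>} \<subseteq> F"
    using assms(3) by auto
  then have "finite {p\<in>LOb C \<times> LOb C. restrict \<phi> (LOb C \<times> LOb C) p \<noteq> \<zero>\<^bsub>mor p\<^esub>}"
    using assms(2) by (rule finite_subset)
  moreover have "restrict \<phi> (LOb C \<times> LOb C) \<in> (\<Pi>\<^sub>E p\<in>LOb C \<times> LOb C. carrier (mor p))"
    using assms(1) by (intro restrict_PiE_iff[THEN iffD2]) blast
  ultimately show ?thesis unfolding total_mod_simps by blast
qed

text \<open>The coefficient module varies with the index \<open>p\<close>, so no single
  interpretation of the module locale covers the pointwise computations in the direct sum. The laws
  are collected here with \<open>p\<close> as a parameter.\<close>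

lemma mor_facts:
  assumes "p \<in> LOb C \<times> LOb C"
  shows "\<zero>\<^bsub>mor p\<^esub> \<in> carrier (mor p)"
    "\<lbrakk>a \<in> carrier (mor p); b \<in> carrier (mor p)\<rbrakk> \<Longrightarrow> a \<oplus>\<^bsub>mor p\<^esub> b \<in> carrier (mor p)"
    "\<lbrakk>a \<in> carrier (mor p); b \<in> carrier (mor p); c \<in> carrier (mor p)\<rbrakk> \<Longrightarrow>
      a \<oplus>\<^bsub>mor p\<^esub> b \<oplus>\<^bsub>mor p\<^esub> c = a \<oplus>\<^bsub>mor p\<^esub> (b \<oplus>\<^bsub>mor p\<^esub> c)"
    "\<lbrakk>a \<in> carrier (mor p); b \<in> carrier (mor p)\<rbrakk> \<Longrightarrow> a \<oplus>\<^bsub>mor p\<^esub> b = b \<oplus>\<^bsub>mor p\<^esub> a"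
    "a \<in> carrier (mor p) \<Longrightarrow> \<zero>\<^bsub>mor p\<^esub> \<oplus>\<^bsub>mor p\<^esub> a = a"
    "a \<in> carrier (mor p) \<Longrightarrow> a \<oplus>\<^bsub>mor p\<^esub> \<zero>\<^bsub>mor p\<^esub> = a"
    "a \<in> carrier (mor p) \<Longrightarrow> \<ominus>\<^bsub>mor p\<^esub> a \<in> carrier (mor p)"
    "a \<in> carrier (mor p) \<Longrightarrow> \<ominus>\<^bsub>mor p\<^esub> a \<oplus>\<^bsub>mor p\<^esub> a = \<zero>\<^bsub>mor p\<^esub>"
    "\<ominus>\<^bsub>mor p\<^esub> \<zero>\<^bsub>mor p\<^esub> = \<zero>\<^bsub>mor p\<^esub>"
    "\<lbrakk>r \<in> carrier R; a \<in> carrier (mor p)\<rbrakk> \<Longrightarrow> r \<odot>\<^bsub>mor p\<^esub> a \<in> carrier (mor p)"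
    "r \<in> carrier R \<Longrightarrow> r \<odot>\<^bsub>mor p\<^esub> \<zero>\<^bsub>mor p\<^esub> = \<zero>\<^bsub>mor p\<^esub>"
    "\<lbrakk>r \<in> carrier R; s \<in> carrier R; a \<in> carrier (mor p)\<rbrakk> \<Longrightarrow>
      (r \<oplus>\<^bsub>R\<^esub> s) \<odot>\<^bsub>mor p\<^esub> a = r \<odot>\<^bsub>mor p\<^esub> a \<oplus>\<^bsub>mor p\<^esub> s \<odot>\<^bsub>mor p\<^esub> a"
    "\<lbrakk>r \<in> carrier R; a \<in> carrier (mor p); b \<in> carrier (mor p)\<rbrakk> \<Longrightarrow>
      r \<odot>\<^bsub>mor p\<^esub> (a \<oplus>\<^bsub>mor p\<^esub> b) = r \<odot>\<^bsub>mor p\<^esub> a \<oplus>\<^bsub>mor p\<^esub> r \<odot>\<^bsub>mor p\<^esub> b"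
    "\<lbrakk>r \<in> carrier R; s \<in> carrier R; a \<in> carrier (mor p)\<rbrakk> \<Longrightarrow>
      (r \<otimes>\<^bsub>R\<^esub> s) \<odot>\<^bsub>mor p\<^esub> a = r \<odot>\<^bsub>mor p\<^esub> (s \<odot>\<^bsub>mor p\<^esub> a)"
    "a \<in> carrier (mor p) \<Longrightarrow> \<one>\<^bsub>R\<^esub> \<odot>\<^bsub>mor p\<^esub> a = a"
proof -
  interpret P: Module.module R "mor p" using mor_module[OF assms] .
  show "\<zero>\<^bsub>mor p\<^esub> \<in> carrier (mor p)"
    "\<lbrakk>a \<in> carrier (mor p); b \<in> carrier (mor p)\<rbrakk> \<Longrightarrow> a \<oplus>\<^bsub>mor p\<^esub> b \<in> carrier (mor p)"
    "\<lbrakk>a \<in> carrier (mor p); b \<in> carrier (mor p); c \<in> carrier (mor p)\<rbrakk> \<Longrightarrow>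
      a \<oplus>\<^bsub>mor p\<^esub> b \<oplus>\<^bsub>mor p\<^esub> c = a \<oplus>\<^bsub>mor p\<^esub> (b \<oplus>\<^bsub>mor p\<^esub> c)"
    "\<lbrakk>a \<in> carrier (mor p); b \<in> carrier (mor p)\<rbrakk> \<Longrightarrow> a \<oplus>\<^bsub>mor p\<^esub> b = b \<oplus>\<^bsub>mor p\<^esub> a"
    "a \<in> carrier (mor p) \<Longrightarrow> \<zero>\<^bsub>mor p\<^esub> \<oplus>\<^bsub>mor p\<^esub> a = a"
    "a \<in> carrier (mor p) \<Longrightarrow> a \<oplus>\<^bsub>mor p\<^esub> \<zero>\<^bsub>mor p\<^esub> = a"
    "a \<in> carrier (mor p) \<Longrightarrow> \<ominus>\<^bsub>mor p\<^esub> a \<in> carrier (mor p)"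
    "a \<in> carrier (mor p) \<Longrightarrow> \<ominus>\<^bsub>mor p\<^esub> a \<oplus>\<^bsub>mor p\<^esub> a = \<zero>\<^bsub>mor p\<^esub>"
    "\<ominus>\<^bsub>mor p\<^esub> \<zero>\<^bsub>mor p\<^esub> = \<zero>\<^bsub>mor p\<^esub>"
    "\<lbrakk>r \<in> carrier R; a \<in> carrier (mor p)\<rbrakk> \<Longrightarrow> r \<odot>\<^bsub>mor p\<^esub> a \<in> carrier (mor p)"
    "r \<in> carrier R \<Longrightarrow> r \<odot>\<^bsub>mor p\<^esub> \<zero>\<^bsub>mor p\<^esub> = \<zero>\<^bsub>mor p\<^esub>"
    "\<lbrakk>r \<in> carrier R; s \<in> carrier R; a \<in> carrier (mor p)\<rbrakk> \<Longrightarrow>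
      (r \<oplus>\<^bsub>R\<^esub> s) \<odot>\<^bsub>mor p\<^esub> a = r \<odot>\<^bsub>mor p\<^esub> a \<oplus>\<^bsub>mor p\<^esub> s \<odot>\<^bsub>mor p\<^esub> a"
    "\<lbrakk>r \<in> carrier R; a \<in> carrier (mor p); b \<in> carrier (mor p)\<rbrakk> \<Longrightarrow>
      r \<odot>\<^bsub>mor p\<^esub> (a \<oplus>\<^bsub>mor p\<^esub> b) = r \<odot>\<^bsub>mor p\<^esub> a \<oplus>\<^bsub>mor p\<^esub> r \<odot>\<^bsub>mor p\<^esub> b"
    "\<lbrakk>r \<in> carrier R; s \<in> carrier R; a \<in> carrier (mor p)\<rbrakk> \<Longrightarrow>
      (r \<otimes>\<^bsub>R\<^esub> s) \<odot>\<^bsub>mor p\<^esub> a = r \<odot>\<^bsub>mor p\<^esub> (s \<odot>\<^bsub>mor p\<^esub> a)"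
    "a \<in> carrier (mor p) \<Longrightarrow> \<one>\<^bsub>R\<^esub> \<odot>\<^bsub>mor p\<^esub> a = a"
    by (simp_all add: P.a_ac P.l_neg P.r_neg P.smult_l_distr P.smult_r_distr P.smult_assoc1)
qed

lemma module_total: "Module.module R (total_mod C)"
proof -
  let ?M = "total_mod C" and ?I = "LOb C \<times> LOb C"
  note S = total_mod_simps(2-4)
  have add: "\<phi> \<oplus>\<^bsub>?M\<^esub> \<psi> \<in> carrier ?M" if "\<phi> \<in> carrier ?M" "\<psi> \<in> carrier ?M" for \<phi> \<psi>
    unfolding S
    by (rule total_memI[where F = "{p\<in>?I. \<phi> p \<noteq> \<zero>\<^bsub>mor p\<^esub>} \<union> {p\<in>?I. \<psi> p \<noteq> \<zero>\<^bsub>mor p\<^esub>}"])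
      (use that total_app total_finite mor_facts in auto)
  have zero: "\<zero>\<^bsub>?M\<^esub> \<in> carrier ?M"
    unfolding S by (rule total_memI[where F = "{}"]) (use mor_facts in auto)
  have smult: "r \<odot>\<^bsub>?M\<^esub> \<phi> \<in> carrier ?M" if "r \<in> carrier R" "\<phi> \<in> carrier ?M" for r \<phi>
    unfolding S by (rule total_memI[where F = "{p\<in>?I. \<phi> p \<noteq> \<zero>\<^bsub>mor p\<^esub>}"])
      (use that total_app total_finite mor_facts in auto)
  have neg: "(\<lambda>p\<in>?I. \<ominus>\<^bsub>mor p\<^esub> \<phi> p) \<in> carrier ?M" if "\<phi> \<in> carrier ?M" for \<phi>
    by (rule total_memI[where F = "{p\<in>?I. \<phi> p \<noteq> \<zero>\<^bsub>mor p\<^esub>}"])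
      (use that total_app total_finite mor_facts in auto)
  have eq: "\<phi> = \<psi>" if "\<phi> \<in> carrier ?M" "\<psi> \<in> carrier ?M" "\<And>p. p \<in> ?I \<Longrightarrow> \<phi> p = \<psi> p" for \<phi> \<psi>
    using extensionalityI[OF total_ext[OF that(1)] total_ext[OF that(2)]] that(3) by blast
  have app: "(\<phi> \<oplus>\<^bsub>?M\<^esub> \<psi>) p = \<phi> p \<oplus>\<^bsub>mor p\<^esub> \<psi> p" "\<zero>\<^bsub>?M\<^esub> p = \<zero>\<^bsub>mor p\<^esub>"
    "(r \<odot>\<^bsub>?M\<^esub> \<phi>) p = r \<odot>\<^bsub>mor p\<^esub> \<phi> p" if "p \<in> ?I" for \<phi> \<psi> r p
    using that unfolding S by simp_all
  have "abelian_group ?M"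
  proof (rule abelian_groupI)
    fix \<phi> assume a: "\<phi> \<in> carrier ?M"
    show "\<exists>\<psi>\<in>carrier ?M. \<psi> \<oplus>\<^bsub>?M\<^esub> \<phi> = \<zero>\<^bsub>?M\<^esub>"
      using a by (intro bexI[OF _ neg[OF a]] eq add neg zero)
        (simp_all only: app restrict_apply' mor_facts(8)[OF _ total_app])
    show "\<zero>\<^bsub>?M\<^esub> \<oplus>\<^bsub>?M\<^esub> \<phi> = \<phi>"
      using a by (intro eq add zero) (simp_all only: app mor_facts(5)[OF _ total_app])
    fix \<psi> assume b: "\<psi> \<in> carrier ?M"
    show "\<phi> \<oplus>\<^bsub>?M\<^esub> \<psi> = \<psi> \<oplus>\<^bsub>?M\<^esub> \<phi>"
      using a b by (intro eq add) (simp_all only: app mor_facts(4)[OF _ total_app total_app])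
    fix \<chi> assume c: "\<chi> \<in> carrier ?M"
    show "\<phi> \<oplus>\<^bsub>?M\<^esub> \<psi> \<oplus>\<^bsub>?M\<^esub> \<chi> = \<phi> \<oplus>\<^bsub>?M\<^esub> (\<psi> \<oplus>\<^bsub>?M\<^esub> \<chi>)"
      using a b c by (intro eq add) (simp_all only: app mor_facts(3)[OF _ total_app total_app total_app])
  qed (use add zero in auto)
  then show ?thesis
  proof (rule moduleI[OF is_cring])
    fix r s \<phi> \<psi> assume r: "r \<in> carrier R" "\<phi> \<in> carrier ?M"
    show "(r \<oplus>\<^bsub>R\<^esub> s) \<odot>\<^bsub>?M\<^esub> \<phi> = r \<odot>\<^bsub>?M\<^esub> \<phi> \<oplus>\<^bsub>?M\<^esub> s \<odot>\<^bsub>?M\<^esub> \<phi>"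
      "(r \<otimes>\<^bsub>R\<^esub> s) \<odot>\<^bsub>?M\<^esub> \<phi> = r \<odot>\<^bsub>?M\<^esub> (s \<odot>\<^bsub>?M\<^esub> \<phi>)" if "s \<in> carrier R"
      using r that by (intro eq add smult; simp add: app mor_facts total_app del: mem_Sigma_iff)+
    show "r \<odot>\<^bsub>?M\<^esub> (\<phi> \<oplus>\<^bsub>?M\<^esub> \<psi>) = r \<odot>\<^bsub>?M\<^esub> \<phi> \<oplus>\<^bsub>?M\<^esub> r \<odot>\<^bsub>?M\<^esub> \<psi>" if "\<psi> \<in> carrier ?M"
      using r that by (intro eq add smult; simp add: app mor_facts total_app del: mem_Sigma_iff)+
  next
    fix \<phi> assume "\<phi> \<in> carrier ?M"
    then show "\<one>\<^bsub>R\<^esub> \<odot>\<^bsub>?M\<^esub> \<phi> = \<phi>"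
      by (intro eq smult; simp add: app mor_facts total_app del: mem_Sigma_iff)
  qed (rule smult)
qed

sublocale Tot: Module.module R "total_mod C" by (rule module_total)

lemma single_closed:
  assumes "x \<in> LOb C" "y \<in> LOb C" "f \<in> carrier (LHom C x y)"
  shows "single C x y f \<in> carrier (total_mod C)"
  unfolding single_def
  by (rule total_memI[where F = "{(x, y)}"]) (use assms mor_facts in auto)

lemma lin_map_single:
  assumes "x \<in> LOb C" "y \<in> LOb C"
  shows "lin_map R (LHom C x y) (total_mod C) (single C x y)"
proof -
  have z: "\<zero>\<^bsub>LHom C u v\<^esub> \<oplus>\<^bsub>LHom C u v\<^esub> \<zero>\<^bsub>LHom C u v\<^esub> = \<zero>\<^bsub>LHom C u v\<^esub>"
    "r \<in> carrier R \<Longrightarrow> r \<odot>\<^bsub>LHom C u v\<^esub> \<zero>\<^bsub>LHom C u v\<^esub> = \<zero>\<^bsub>LHom C u v\<^esub>"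
    if "u \<in> LOb C" "v \<in> LOb C" for u v r
    using mor_facts(1,5,11)[of "(u, v)"] that by auto
  show ?thesis
    by (intro lin_mapI single_closed assms)
      (auto simp: single_def total_mod_simps fun_eq_iff z)
qed

text \<open>The counterpart of \<open>fin_fun_induct\<close> for a family of modules instead of a
  single one. Elements are extensional here, so equalities are compared on the index set
  only.\<close>

lemma total_induct [consumes 1, case_names zero single add]:
  assumes \<phi>: "\<phi> \<in> carrier (total_mod C)"
    and "P \<zero>\<^bsub>total_mod C\<^esub>"
    and P1: "\<And>x y f. \<lbrakk>x \<in> LOb C; y \<in> LOb C; f \<in> carrier (LHom C x y)\<rbrakk> \<Longrightarrow> P (single C x y f)"
    and P2: "\<And>\<phi> \<psi>. \<lbrakk>\<phi> \<in> carrier (total_mod C); \<psi> \<in> carrier (total_mod C); P \<phi>; P \<psi>\<rbrakk> \<Longrightarrow> P (\<phi> \<oplus>\<^bsub>total_mod C\<^esub> \<psi>)"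
  shows "P \<phi>"
proof -
  let ?I = "LOb C \<times> LOb C"
  have "\<forall>\<phi>. \<phi> \<in> carrier (total_mod C) \<longrightarrow> {p\<in>?I. \<phi> p \<noteq> \<zero>\<^bsub>mor p\<^esub>} \<subseteq> F \<longrightarrow> P \<phi>" if "finite F" for F
    using that
  proof (induction F)
    case empty
    have "\<phi> = \<zero>\<^bsub>total_mod C\<^esub>" if "\<phi> \<in> carrier (total_mod C)" "{p\<in>?I. \<phi> p \<noteq> \<zero>\<^bsub>mor p\<^esub>} \<subseteq> {}" for \<phi>
      using that(2) by (intro extensionalityI[OF total_ext[OF that(1)] total_ext[OF Tot.zero_closed]])
        (auto simp: total_mod_simps)
    with assms(2) show ?case by blast
  next
    case (insert s F)
    show ?case
    proof (intro allI impI)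
      fix \<phi> assume f: "\<phi> \<in> carrier (total_mod C)" "{p\<in>?I. \<phi> p \<noteq> \<zero>\<^bsub>mor p\<^esub>} \<subseteq> insert s F"
      show "P \<phi>"
      proof (cases "s \<in> ?I")
        case True
        then have s: "fst s \<in> LOb C" "snd s \<in> LOb C" "\<phi> s \<in> carrier (mor s)" using total_app[OF f(1)] by auto
        let ?\<psi> = "\<lambda>p\<in>?I. if p = s then \<zero>\<^bsub>mor p\<^esub> else \<phi> p"
        have \<psi>: "?\<psi> \<in> carrier (total_mod C)"
          by (rule total_memI[where F = "{p\<in>?I. \<phi> p \<noteq> \<zero>\<^bsub>mor p\<^esub>}"])
            (use total_app[OF f(1)] total_finite[OF f(1)] mor_facts(1) in auto)
        have "{p\<in>?I. ?\<psi> p \<noteq> \<zero>\<^bsub>mor p\<^esub>} \<subseteq> F" using f(2) by auto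
        then have "P ?\<psi>" using insert.IH \<psi> by blast
        moreover have "\<phi> = single C (fst s) (snd s) (\<phi> s) \<oplus>\<^bsub>total_mod C\<^esub> ?\<psi>"
        proof (rule extensionalityI[OF total_ext[OF f(1)]])
          show "single C (fst s) (snd s) (\<phi> s) \<oplus>\<^bsub>total_mod C\<^esub> ?\<psi> \<in> extensional ?I"
            by (simp add: total_mod_simps)
          fix p assume "p \<in> ?I"
          then show "\<phi> p = (single C (fst s) (snd s) (\<phi> s) \<oplus>\<^bsub>total_mod C\<^esub> ?\<psi>) p"
            using mor_facts(5,6)[of p "\<phi> p"] total_app[OF f(1), of p]
            by (cases "p = s") (simp_all add: total_mod_simps single_def)
        qed
        ultimately show ?thesis
          using P2[OF single_closed[OF s] \<psi> P1[OF s]] by simp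
      next
        case False
        then show ?thesis using insert.IH f by auto
      qed
    qed
  qed
  with \<phi> total_finite[OF \<phi>] show ?thesis by blast
qed

text \<open>The universal property of the direct sum. As for \<open>fs_ext\<close>, the sum over the
  support is first shown to be insensitive to enlarging the finite index set, because each
  \<open>\<theta> x y\<close> kills zero.\<close>

lemma total_lift:
  assumes E: "Module.module R E"
    and \<theta>: "\<And>x y. \<lbrakk>x \<in> LOb C; y \<in> LOb C\<rbrakk> \<Longrightarrow> lin_map R (LHom C x y) E (\<theta> x y)"
  obtains t where "lin_map R (total_mod C) E t"
    "\<And>x y f. \<lbrakk>x \<in> LOb C; y \<in> LOb C; f \<in> carrier (LHom C x y)\<rbrakk> \<Longrightarrow> t (single C x y f) = \<theta> x y f"
proof
  interpret E: Module.module R E by fact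
  let ?I = "LOb C \<times> LOb C"
  let ?h = "\<lambda>\<phi> p. \<theta> (fst p) (snd p) (\<phi> p)"
  let ?t = "\<lambda>\<phi>. \<Oplus>\<^bsub>E\<^esub>p\<in>{p\<in>?I. \<phi> p \<noteq> \<zero>\<^bsub>mor p\<^esub>}. ?h \<phi> p"
  have \<theta>': "lin_map R (mor p) E (\<theta> (fst p) (snd p))" if "p \<in> ?I" for p using that \<theta> by auto
  have cl: "?h \<phi> p \<in> carrier E" if "\<phi> \<in> carrier (total_mod C)" "p \<in> ?I" for \<phi> p
    using lin_mapD(1)[OF \<theta>'[OF that(2)] total_app[OF that]] .
  have sup: "?t \<phi> = (\<Oplus>\<^bsub>E\<^esub>p\<in>F. ?h \<phi> p)"
    if "\<phi> \<in> carrier (total_mod C)" "finite F" "F \<subseteq> ?I" "{p\<in>?I. \<phi> p \<noteq> \<zero>\<^bsub>mor p\<^esub>} \<subseteq> F" for \<phi> F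
  proof (rule E.finsum_superset[OF that(2,4)])
    fix p assume p: "p \<in> F - {p\<in>?I. \<phi> p \<noteq> \<zero>\<^bsub>mor p\<^esub>}"
    then have pI: "p \<in> ?I" using that(3) by blast
    then have "\<phi> p = \<zero>\<^bsub>mor p\<^esub>" using p by blast
    then show "?h \<phi> p = \<zero>\<^bsub>E\<^esub>"
      using lin_map_zero[OF mor_module[OF pI] E.module_axioms \<theta>'[OF pI]] by simp
  qed (use that(3) cl[OF that(1)] in blast)
  show "?t (single C x y f) = \<theta> x y f" if xy: "x \<in> LOb C" "y \<in> LOb C" "f \<in> carrier (LHom C x y)" for x y f
  proof -
    have "?t (single C x y f) = (\<Oplus>\<^bsub>E\<^esub>p\<in>{(x, y)}. ?h (single C x y f) p)"
      by (rule sup[OF single_closed[OF xy]]) (use xy in \<open>auto simp: single_def\<close>)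
    then show ?thesis using xy lin_mapD(1)[OF \<theta>] by (simp add: single_def)
  qed
  show "lin_map R (total_mod C) E ?t"
  proof (rule lin_mapI)
    fix \<phi> assume a: "\<phi> \<in> carrier (total_mod C)"
    let ?F = "{p\<in>?I. \<phi> p \<noteq> \<zero>\<^bsub>mor p\<^esub>}"
    have cla: "?h \<phi> \<in> ?F \<rightarrow> carrier E" using cl[OF a] by auto
    then show "?t \<phi> \<in> carrier E" by (rule E.finsum_closed)
    show "?t (r \<odot>\<^bsub>total_mod C\<^esub> \<phi>) = r \<odot>\<^bsub>E\<^esub> ?t \<phi>" if r: "r \<in> carrier R" for r
    proof -
      have l: "lin_map R E E (\<lambda>b. r \<odot>\<^bsub>E\<^esub> b)"
        using r by (intro lin_mapI) (auto simp: E.smult_r_distr E.smult_assoc1[symmetric] m_comm)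
      have "?t (r \<odot>\<^bsub>total_mod C\<^esub> \<phi>) = (\<Oplus>\<^bsub>E\<^esub>p\<in>?F. ?h (r \<odot>\<^bsub>total_mod C\<^esub> \<phi>) p)"
        by (rule sup[OF Tot.smult_closed[OF r a] total_finite[OF a]])
          (use r mor_facts(11) in \<open>auto simp: total_mod_simps(4)\<close>)
      also have "\<dots> = (\<Oplus>\<^bsub>E\<^esub>p\<in>?F. ((\<lambda>b. r \<odot>\<^bsub>E\<^esub> b) \<circ> ?h \<phi>) p)"
      proof (rule E.finsum_cong')
        fix p assume "p \<in> ?F"
        then have p: "p \<in> ?I" by blast
        then show "?h (r \<odot>\<^bsub>total_mod C\<^esub> \<phi>) p = ((\<lambda>b. r \<odot>\<^bsub>E\<^esub> b) \<circ> ?h \<phi>) p"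
          using lin_mapD(3)[OF \<theta>'[OF p] r total_app[OF a p]] by (simp add: total_mod_simps(4))
      qed (use cl[OF a] r in auto)
      also have "\<dots> = r \<odot>\<^bsub>E\<^esub> ?t \<phi>"
        using lin_map_finsum[OF E E l total_finite[OF a] cla] by (simp only: o_def)
      finally show ?thesis .
    qed
    fix \<psi> assume b: "\<psi> \<in> carrier (total_mod C)"
    let ?F = "{p\<in>?I. \<phi> p \<noteq> \<zero>\<^bsub>mor p\<^esub>} \<union> {p\<in>?I. \<psi> p \<noteq> \<zero>\<^bsub>mor p\<^esub>}"
    have F: "finite ?F" "?F \<subseteq> ?I" using total_finite[OF a] total_finite[OF b] by auto
    have "?t (\<phi> \<oplus>\<^bsub>total_mod C\<^esub> \<psi>) = (\<Oplus>\<^bsub>E\<^esub>p\<in>?F. ?h (\<phi> \<oplus>\<^bsub>total_mod C\<^esub> \<psi>) p)"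
      by (rule sup[OF Tot.a_closed[OF a b] F]) (use mor_facts(1,5) in \<open>auto simp: total_mod_simps(3)\<close>)
    also have "\<dots> = (\<Oplus>\<^bsub>E\<^esub>p\<in>?F. ?h \<phi> p \<oplus>\<^bsub>E\<^esub> ?h \<psi> p)"
    proof (rule E.finsum_cong')
      fix p assume "p \<in> ?F"
      then have p: "p \<in> ?I" by blast
      then show "?h (\<phi> \<oplus>\<^bsub>total_mod C\<^esub> \<psi>) p = ?h \<phi> p \<oplus>\<^bsub>E\<^esub> ?h \<psi> p"
        using lin_mapD(2)[OF \<theta>'[OF p] total_app[OF a p] total_app[OF b p]] by (simp add: total_mod_simps(3))
    qed (use cl[OF a] cl[OF b] in auto)
    also have "\<dots> = (\<Oplus>\<^bsub>E\<^esub>p\<in>?F. ?h \<phi> p) \<oplus>\<^bsub>E\<^esub> (\<Oplus>\<^bsub>E\<^esub>p\<in>?F. ?h \<psi> p)"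
      by (rule E.finsum_addf) (use cl[OF a] cl[OF b] in auto)
    also have "\<dots> = ?t \<phi> \<oplus>\<^bsub>E\<^esub> ?t \<psi>" using sup[OF a F] sup[OF b F] by simp
    finally show "?t (\<phi> \<oplus>\<^bsub>total_mod C\<^esub> \<psi>) = ?t \<phi> \<oplus>\<^bsub>E\<^esub> ?t \<psi>" .
  qed
qed

lemma total_lin_eqI:
  assumes E: "Module.module R E" and f: "lin_map R (total_mod C) E f" and g: "lin_map R (total_mod C) E g"
    and eq: "\<And>x y h. \<lbrakk>x \<in> LOb C; y \<in> LOb C; h \<in> carrier (LHom C x y)\<rbrakk> \<Longrightarrow> f (single C x y h) = g (single C x y h)"
    and \<phi>: "\<phi> \<in> carrier (total_mod C)"
  shows "f \<phi> = g \<phi>"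
  using \<phi>
proof (induction rule: total_induct)
  case zero
  show ?case using lin_map_zero[OF Tot.module_axioms E f] lin_map_zero[OF Tot.module_axioms E g] by simp
next
  case (add \<phi> \<psi>)
  then show ?case using lin_mapD(2)[OF f] lin_mapD(2)[OF g] by simp
qed (rule eq)

section \<open>From the direct sum of the Hom modules to \<open>\<R>(C)\<close>\<close>

abbreviation "Ten \<equiv> tensor_alg R (total_mod C)"

sublocale Ten: nu_algebra R Ten by (rule nu_algebra_tensor) (rule module_total)

abbreviation "letter x y f \<equiv> tensor_word R (total_mod C) [single C x y f]"

lemma letter_closed: "\<lbrakk>x \<in> LOb C; y \<in> LOb C; f \<in> carrier (LHom C x y)\<rbrakk> \<Longrightarrow> letter x y f \<in> carrier Ten"
  using tensor_word_closed[OF module_total] single_closed by simp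

lemma lin_map_letter: "\<lbrakk>x \<in> LOb C; y \<in> LOb C\<rbrakk> \<Longrightarrow> lin_map R (LHom C x y) Ten (letter x y)"
  using lin_map_comp[OF lin_map_single lin_map_tensor_letter[OF module_total]] by (simp add: o_def)

lemma letter_append:
  assumes "x \<in> LOb C" "y \<in> LOb C" "z \<in> LOb C" "f \<in> carrier (LHom C x y)" "g \<in> carrier (LHom C y z)"
  shows "tensor_word R (total_mod C) [single C y z g, single C x y f] = letter y z g \<otimes>\<^bsub>Ten\<^esub> letter x y f"
  using tensor_word_append[OF module_total, of "[single C y z g]" "[single C x y f]"] assms single_closed
  by simp

definition "comp_rels = {tensor_word R (total_mod C) [single C y z g, single C x y f]
        \<ominus>\<^bsub>Ten\<^esub> tensor_word R (total_mod C) [single C x z (LComp C x y z g f)]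
      | x y z f g. x \<in> LOb C \<and> y \<in> LOb C \<and> z \<in> LOb C \<and>
          f \<in> carrier (LHom C x y) \<and> g \<in> carrier (LHom C y z)}"

lemma comp_ideal_eq: "comp_ideal R C = gen_ideal R Ten comp_rels"
  by (simp add: comp_ideal_def comp_rels_def)

lemma comp_rels_carrier: "comp_rels \<subseteq> carrier Ten"
  unfolding comp_rels_def using letter_closed LComp_closed
  by (auto simp: letter_append intro!: Ten.minus_closed Ten.mult_closed)

sublocale Q: ideal_quotient R Ten "comp_ideal R C"
  by unfold_locales (unfold comp_ideal_eq, rule alg_ideal_gen_ideal[OF Ten.nu_algebra_axioms comp_rels_carrier])

lemma nu_algebra_\<R>: "nu_algebra R (\<R>_alg R C)"
  using Q.nu_algebra_quot by (simp add: \<R>_alg_def)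

lemma nu_hom_\<R>_quot: "nu_hom R Ten (\<R>_alg R C) (qmap Ten (comp_ideal R C))"
  using Q.nu_hom_qmap by (simp add: \<R>_alg_def)

lemma \<R>_gen_qmap: "\<R>_gen R C x y f = qmap Ten (comp_ideal R C) (letter x y f)"
  by (simp add: \<R>_gen_def)

lemma lin_map_\<R>_gen: "\<lbrakk>x \<in> LOb C; y \<in> LOb C\<rbrakk> \<Longrightarrow> lin_map R (LHom C x y) (\<R>_alg R C) (\<R>_gen R C x y)"
  using lin_map_comp[OF lin_map_letter nu_homD(1)[OF nu_hom_\<R>_quot]]
  by (simp add: o_def \<R>_gen_qmap[abs_def])

lemma \<R>_gen_closed: "\<lbrakk>x \<in> LOb C; y \<in> LOb C; f \<in> carrier (LHom C x y)\<rbrakk> \<Longrightarrow>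
    \<R>_gen R C x y f \<in> carrier (\<R>_alg R C)"
  using lin_mapD(1)[OF lin_map_\<R>_gen] .

lemma \<R>_gen_comp:
  assumes "x \<in> LOb C" "y \<in> LOb C" "z \<in> LOb C" "f \<in> carrier (LHom C x y)" "g \<in> carrier (LHom C y z)"
  shows "\<R>_gen R C y z g \<otimes>\<^bsub>\<R>_alg R C\<^esub> \<R>_gen R C x y f = \<R>_gen R C x z (LComp C x y z g f)"
proof -
  note c = letter_closed[OF assms(1,2,4)] letter_closed[OF assms(2,3,5)]
    letter_closed[OF assms(1,3) LComp_closed[OF assms]]
  have "letter y z g \<otimes>\<^bsub>Ten\<^esub> letter x y f \<ominus>\<^bsub>Ten\<^esub> letter x z (LComp C x y z g f) \<in> comp_rels"
    unfolding comp_rels_def letter_append[OF assms, symmetric] by (intro CollectI exI conjI) (rule refl assms)+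
  then have "letter y z g \<otimes>\<^bsub>Ten\<^esub> letter x y f \<ominus>\<^bsub>Ten\<^esub> letter x z (LComp C x y z g f) \<in> comp_ideal R C"
    unfolding comp_ideal_eq by (rule subsetD[OF gen_ideal_superset])
  then have "qmap Ten (comp_ideal R C) (letter y z g \<otimes>\<^bsub>Ten\<^esub> letter x y f) = \<R>_gen R C x z (LComp C x y z g f)"
    using c by (simp add: Q.qmap_eq_iff Ten.mult_closed \<R>_gen_qmap)
  then show ?thesis using nu_homD(2)[OF nu_hom_\<R>_quot c(2,1)] by (simp add: \<R>_gen_qmap)
qed

text \<open>The assignment is extended to the direct sum, then to the tensor algebra, and finally
  passes to the quotient. The multiplicativity condition concerns composable pairs only; nothing is
  required of other products. This is what makes homotopies on \<open>\<R>(C)\<close>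
  accessible.\<close>

lemma \<R>_lift:
  assumes E: "nu_algebra R E"
    and \<theta>: "\<And>x y. \<lbrakk>x \<in> LOb C; y \<in> LOb C\<rbrakk> \<Longrightarrow> lin_map R (LHom C x y) E (\<theta> x y)"
    and m: "\<And>x y z f g. \<lbrakk>x \<in> LOb C; y \<in> LOb C; z \<in> LOb C; f \<in> carrier (LHom C x y); g \<in> carrier (LHom C y z)\<rbrakk>
      \<Longrightarrow> \<theta> x z (LComp C x y z g f) = \<theta> y z g \<otimes>\<^bsub>E\<^esub> \<theta> x y f"
  obtains \<Theta> where "nu_hom R (\<R>_alg R C) E \<Theta>"
    "\<And>x y f. \<lbrakk>x \<in> LOb C; y \<in> LOb C; f \<in> carrier (LHom C x y)\<rbrakk> \<Longrightarrow> \<Theta> (\<R>_gen R C x y f) = \<theta> x y f"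
proof -
  interpret E: nu_algebra R E by fact
  obtain t where t: "lin_map R (total_mod C) E t"
    "\<And>x y f. \<lbrakk>x \<in> LOb C; y \<in> LOb C; f \<in> carrier (LHom C x y)\<rbrakk> \<Longrightarrow> t (single C x y f) = \<theta> x y f"
    using total_lift[OF E.module_axioms \<theta>] by blast
  obtain T where T: "nu_hom R Ten E T" "\<And>a. a \<in> carrier (total_mod C) \<Longrightarrow> T (tensor_word R (total_mod C) [a]) = t a"
    using tensor_lift[OF module_total E t(1)] by blast
  have Tl: "T (letter x y f) = \<theta> x y f" if "x \<in> LOb C" "y \<in> LOb C" "f \<in> carrier (LHom C x y)" for x y f
    using T(2)[OF single_closed[OF that]] t(2)[OF that] by simp
  have "comp_rels \<subseteq> {a \<in> carrier Ten. T a = \<zero>\<^bsub>E\<^esub>}"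
  proof
    fix a assume a: "a \<in> comp_rels"
    then obtain x y z f g where o: "x \<in> LOb C" "y \<in> LOb C" "z \<in> LOb C" "f \<in> carrier (LHom C x y)"
        "g \<in> carrier (LHom C y z)"
      and a': "a = letter y z g \<otimes>\<^bsub>Ten\<^esub> letter x y f \<ominus>\<^bsub>Ten\<^esub> letter x z (LComp C x y z g f)"
      unfolding comp_rels_def using letter_append by auto
    note c = letter_closed[OF o(1,2,4)] letter_closed[OF o(2,3,5)] letter_closed[OF o(1,3) LComp_closed[OF o]]
    have "T a = \<theta> y z g \<otimes>\<^bsub>E\<^esub> \<theta> x y f \<ominus>\<^bsub>E\<^esub> \<theta> x z (LComp C x y z g f)"
      unfolding a' using lin_map_diff[OF Ten.module_axioms E.module_axioms nu_homD(1)[OF T(1)]] c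
        nu_homD(2)[OF T(1) c(2,1)] Tl[OF o(1,2,4)] Tl[OF o(2,3,5)] Tl[OF o(1,3) LComp_closed[OF o]]
      by (simp add: Ten.mult_closed)
    also have "\<dots> = \<zero>\<^bsub>E\<^esub>"
      using m[OF o] lin_mapD(1)[OF \<theta>[OF o(1,3)] LComp_closed[OF o]] E.diff_self by simp
    finally show "a \<in> {a \<in> carrier Ten. T a = \<zero>\<^bsub>E\<^esub>}" using a comp_rels_carrier by blast
  qed
  then have "comp_ideal R C \<subseteq> {a \<in> carrier Ten. T a = \<zero>\<^bsub>E\<^esub>}"
    unfolding comp_ideal_eq by (rule gen_ideal_minimal[OF alg_ideal_kernel[OF Ten.nu_algebra_axioms E T(1)]])
  then have "\<And>a. a \<in> comp_ideal R C \<Longrightarrow> T a = \<zero>\<^bsub>E\<^esub>" by blast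
  then obtain \<Theta> where Th: "nu_hom R (\<R>_alg R C) E \<Theta>"
    "\<And>a. a \<in> carrier Ten \<Longrightarrow> \<Theta> (qmap Ten (comp_ideal R C) a) = T a"
    using Q.quot_lift[OF E T(1)] unfolding \<R>_alg_def by blast
  show ?thesis
    by (rule that[OF Th(1)]) (simp add: \<R>_gen_qmap Th(2) letter_closed Tl)
qed

lemma \<R>_hom_eqI:
  assumes E: "nu_algebra R E" and f: "nu_hom R (\<R>_alg R C) E f" and g: "nu_hom R (\<R>_alg R C) E g"
    and eq: "\<And>x y h. \<lbrakk>x \<in> LOb C; y \<in> LOb C; h \<in> carrier (LHom C x y)\<rbrakk> \<Longrightarrow> f (\<R>_gen R C x y h) = g (\<R>_gen R C x y h)"
    and a: "a \<in> carrier (\<R>_alg R C)"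
  shows "f a = g a"
proof -
  interpret E: nu_algebra R E by fact
  let ?q = "qmap Ten (comp_ideal R C)"
  obtain b where b: "b \<in> carrier Ten" "a = ?q b" using a Q.carrier_quot by (auto simp: \<R>_alg_def)
  have fq: "nu_hom R Ten E (f \<circ> ?q)" "nu_hom R Ten E (g \<circ> ?q)"
    using nu_hom_comp[OF nu_hom_\<R>_quot f] nu_hom_comp[OF nu_hom_\<R>_quot g] .
  note l = lin_map_comp[OF lin_map_tensor_letter[OF module_total] nu_homD(1)[OF fq(1)]]
    lin_map_comp[OF lin_map_tensor_letter[OF module_total] nu_homD(1)[OF fq(2)]]
  have "(f \<circ> ?q) (tensor_word R (total_mod C) [\<phi>]) = (g \<circ> ?q) (tensor_word R (total_mod C) [\<phi>])"
    if "\<phi> \<in> carrier (total_mod C)" for \<phi>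
    using total_lin_eqI[OF E.module_axioms l _ that] eq by (simp add: \<R>_gen_qmap)
  then have "(f \<circ> ?q) b = (g \<circ> ?q) b"
    using tensor_hom_eqI[OF module_total E fq _ b(1)] by blast
  with b show ?thesis by simp
qed

end

text \<open>Justifies the definite description in \<open>\<R>_map\<close>: existence comes from
  \<open>\<R>_lift\<close>, made extensional by restriction, and uniqueness from
  \<open>\<R>_hom_eqI\<close>.\<close>

lemma \<R>_map_props:
  assumes C: "lin_category R C" and D: "lin_category R D"
    and F: "\<And>x. x \<in> LOb C \<Longrightarrow> F x \<in> LOb D"
    and \<theta>: "\<And>x y. \<lbrakk>x \<in> LOb C; y \<in> LOb C\<rbrakk> \<Longrightarrow> lin_map R (LHom C x y) (LHom D (F x) (F y)) (\<theta> x y)"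
    and m: "\<And>x y z f g. \<lbrakk>x \<in> LOb C; y \<in> LOb C; z \<in> LOb C; f \<in> carrier (LHom C x y); g \<in> carrier (LHom C y z)\<rbrakk>
      \<Longrightarrow> \<theta> x z (LComp C x y z g f) = LComp D (F x) (F y) (F z) (\<theta> y z g) (\<theta> x y f)"
  shows "nu_hom R (\<R>_alg R C) (\<R>_alg R D) (\<R>_map R C D F \<theta>)"
    and "\<lbrakk>x \<in> LOb C; y \<in> LOb C; f \<in> carrier (LHom C x y)\<rbrakk> \<Longrightarrow>
      \<R>_map R C D F \<theta> (\<R>_gen R C x y f) = \<R>_gen R D (F x) (F y) (\<theta> x y f)"
proof -
  interpret C: lin_category R C by fact
  interpret D: lin_category R D by fact
  let ?P = "\<lambda>\<Theta>. \<Theta> \<in> alg_homs R (\<R>_alg R C) (\<R>_alg R D) \<and>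
     (\<forall>x\<in>LOb C. \<forall>y\<in>LOb C. \<forall>f\<in>carrier (LHom C x y).
        \<Theta> (\<R>_gen R C x y f) = \<R>_gen R D (F x) (F y) (\<theta> x y f))"
  have l: "lin_map R (LHom C x y) (\<R>_alg R D) (\<lambda>f. \<R>_gen R D (F x) (F y) (\<theta> x y f))"
    if "x \<in> LOb C" "y \<in> LOb C" for x y
    using lin_map_comp[OF \<theta>[OF that] D.lin_map_\<R>_gen[OF F[OF that(1)] F[OF that(2)]]] by (simp add: o_def)
  have c: "\<R>_gen R D (F x) (F z) (\<theta> x z (LComp C x y z g f)) =
      \<R>_gen R D (F y) (F z) (\<theta> y z g) \<otimes>\<^bsub>\<R>_alg R D\<^esub> \<R>_gen R D (F x) (F y) (\<theta> x y f)"
    if "x \<in> LOb C" "y \<in> LOb C" "z \<in> LOb C" "f \<in> carrier (LHom C x y)" "g \<in> carrier (LHom C y z)" for x y z f g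
    using m[OF that] D.\<R>_gen_comp[OF F[OF that(1)] F[OF that(2)] F[OF that(3)]
        lin_mapD(1)[OF \<theta>[OF that(1,2)] that(4)] lin_mapD(1)[OF \<theta>[OF that(2,3)] that(5)]] by simp
  obtain \<Theta> where T: "nu_hom R (\<R>_alg R C) (\<R>_alg R D) \<Theta>"
    "\<And>x y f. \<lbrakk>x \<in> LOb C; y \<in> LOb C; f \<in> carrier (LHom C x y)\<rbrakk> \<Longrightarrow>
      \<Theta> (\<R>_gen R C x y f) = \<R>_gen R D (F x) (F y) (\<theta> x y f)"
    using C.\<R>_lift[OF D.nu_algebra_\<R>, of "\<lambda>x y f. \<R>_gen R D (F x) (F y) (\<theta> x y f)"] l c by blast
  have ex: "?P (restrict \<Theta> (carrier (\<R>_alg R C)))"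
    using restrict_alg_homs[OF C.nu_algebra_\<R> T(1)] T(2) C.\<R>_gen_closed by simp
  moreover have "\<Theta>' = restrict \<Theta> (carrier (\<R>_alg R C))" if "?P \<Theta>'" for \<Theta>'
  proof (rule extensionalityI[where A = "carrier (\<R>_alg R C)"])
    show "\<Theta>' \<in> extensional (carrier (\<R>_alg R C))" using that alg_homs_ext by blast
    fix a assume "a \<in> carrier (\<R>_alg R C)"
    then show "\<Theta>' a = restrict \<Theta> (carrier (\<R>_alg R C)) a"
      using C.\<R>_hom_eqI[OF D.nu_algebra_\<R> alg_homs_nu_hom T(1)] that T(2) by simp
  qed simp
  ultimately have "?P (\<R>_map R C D F \<theta>)"
    unfolding \<R>_map_def by (rule theI)
  then show "nu_hom R (\<R>_alg R C) (\<R>_alg R D) (\<R>_map R C D F \<theta>)"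
    "\<lbrakk>x \<in> LOb C; y \<in> LOb C; f \<in> carrier (LHom C x y)\<rbrakk> \<Longrightarrow>
      \<R>_map R C D F \<theta> (\<R>_gen R C x y f) = \<R>_gen R D (F x) (F y) (\<theta> x y f)"
    using alg_homs_nu_hom by blast+
qed

section \<open>Cardinality of the constructions\<close>

lemma lepoll_Times_infinite:
  assumes "infinite U" "S \<lesssim> U" "T \<lesssim> U"
  shows "S \<times> T \<lesssim> U"
proof -
  have "U \<times> U \<approx> U"
    using card_of_Times_same_infinite[OF assms(1)] by (simp add: eqpoll_iff_card_of_ordIso)
  then show ?thesis using lepoll_trans[OF times_lepoll_mono[OF assms(2,3)]] eqpoll_imp_lepoll by blast
qed

text \<open>Folding an injection of \<open>U \<times> U\<close> into \<open>U\<close> over a list is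
  injective on lists of a given length. Recording the length as well separates lists of different
  lengths, and the additional factor \<nat> is absorbed by the infinite set
  \<open>U\<close>.\<close>

lemma lepoll_lists_infinite:
  assumes "infinite U" "S \<lesssim> U"
  shows "lists S \<lesssim> U"
proof -
  obtain p where p: "inj_on p (U \<times> U)" "p ` (U \<times> U) \<subseteq> U"
    using lepoll_Times_infinite[OF assms(1) lepoll_refl lepoll_refl] by (auto simp: lepoll_def)
  obtain s where s: "inj_on s S" "s ` S \<subseteq> U" using assms(2) by (auto simp: lepoll_def)
  obtain u where u: "u \<in> U" using assms(1) by fastforce
  define e where "e = rec_list u (\<lambda>x xs r. p (s x, r))"
  have e_simps: "e [] = u" "e (x # xs) = p (s x, e xs)" for x xs by (simp_all add: e_def)
  have eU: "e xs \<in> U" if "xs \<in> lists S" for xs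
    using that u p(2) s(2) by (induction xs) (auto simp: e_simps image_subset_iff)
  have inj: "xs = ys" if "xs \<in> lists S" "ys \<in> lists S" "length xs = length ys" "e xs = e ys" for xs ys
    using that(3,1,2,4)
  proof (induction xs ys rule: list_induct2)
    case (Cons x xs y ys)
    then have "(s x, e xs) = (s y, e ys)"
      using inj_onD[OF p(1), of "(s x, e xs)" "(s y, e ys)"] eU s(2) by (auto simp: e_simps)
    then show ?case using Cons inj_onD[OF s(1), of x y] by auto
  qed simp
  have "inj_on (\<lambda>xs. (length xs, e xs)) (lists S)" using inj by (auto simp: inj_on_def)
  moreover have "(\<lambda>xs. (length xs, e xs)) ` lists S \<subseteq> (UNIV :: nat set) \<times> U" using eU by auto
  ultimately have "lists S \<lesssim> (UNIV :: nat set) \<times> U" unfolding lepoll_def by blast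
  also have "\<dots> \<lesssim> U"
    using lepoll_Times_infinite[OF assms(1) _ lepoll_refl] assms(1) infinite_le_lepoll by blast
  finally show ?thesis .
qed

text \<open>A function is coded by a list enumerating its graph over its support. The support is a
  parameter \<open>D\<close>, so that both functions into one module and elements of a direct sum of
  varying modules are covered.\<close>

lemma lepoll_finite_support:
  assumes U: "infinite U" "S \<lesssim> U" "T \<lesssim> U"
    and F: "\<And>\<phi>. \<phi> \<in> F \<Longrightarrow> finite (D \<phi>)" "\<And>\<phi>. \<phi> \<in> F \<Longrightarrow> D \<phi> \<subseteq> S" "\<And>\<phi> x. \<lbrakk>\<phi> \<in> F; x \<in> D \<phi>\<rbrakk> \<Longrightarrow> \<phi> x \<in> T"
    and inj: "\<And>\<phi> \<psi>. \<lbrakk>\<phi> \<in> F; \<psi> \<in> F; D \<phi> = D \<psi>; \<And>x. x \<in> D \<phi> \<Longrightarrow> \<phi> x = \<psi> x\<rbrakk> \<Longrightarrow> \<phi> = \<psi>"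
  shows "F \<lesssim> U"
proof -
  let ?gr = "\<lambda>\<phi>. (\<lambda>x. (x, \<phi> x)) ` D \<phi>"
  define l where "l \<phi> = (SOME xs. set xs = ?gr \<phi>)" for \<phi>
  have l: "set (l \<phi>) = ?gr \<phi>" if "\<phi> \<in> F" for \<phi>
    unfolding l_def by (rule someI_ex, rule finite_list) (simp add: F(1)[OF that])
  have "inj_on l F"
  proof (rule inj_onI)
    fix \<phi> \<psi> assume a: "\<phi> \<in> F" "\<psi> \<in> F" "l \<phi> = l \<psi>"
    then have g: "?gr \<phi> = ?gr \<psi>" using l by metis
    show "\<phi> = \<psi>"
    proof (rule inj[OF a(1,2)])
      have "fst ` ?gr \<phi> = fst ` ?gr \<psi>" using g by simp
      then show "D \<phi> = D \<psi>" by (simp add: image_image)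
      show "\<phi> x = \<psi> x" if "x \<in> D \<phi>" for x
      proof -
        have "(x, \<phi> x) \<in> ?gr \<psi>" using that g by blast
        then show ?thesis by auto
      qed
    qed
  qed
  moreover have "l ` F \<subseteq> lists (S \<times> T)"
  proof
    fix y assume "y \<in> l ` F"
    then obtain \<phi> where y: "\<phi> \<in> F" "y = l \<phi>" by blast
    have "set (l \<phi>) \<subseteq> S \<times> T" using l[OF y(1)] F(2,3)[OF y(1)] by auto
    then show "y \<in> lists (S \<times> T)" using y(2) by auto
  qed
  ultimately have "F \<lesssim> lists (S \<times> T)" unfolding lepoll_def by blast
  also have "\<dots> \<lesssim> U" using lepoll_lists_infinite[OF U(1) lepoll_Times_infinite[OF U]] .
  finally show ?thesis .
qed

lemma lepoll_fin_fun:
  assumes "infinite U" "S \<lesssim> U" "carrier A \<lesssim> U"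
  shows "fin_fun S A \<lesssim> U"
proof (rule lepoll_finite_support[OF assms, where D = "\<lambda>\<phi>. {x. \<phi> x \<noteq> \<zero>\<^bsub>A\<^esub>}"])
  fix \<phi> assume p: "\<phi> \<in> fin_fun S A"
  show "finite {x. \<phi> x \<noteq> \<zero>\<^bsub>A\<^esub>}" using fin_fun_finite[OF p] .
  show sub: "{x. \<phi> x \<noteq> \<zero>\<^bsub>A\<^esub>} \<subseteq> S" using fin_fun_support[OF p] .
  show "\<phi> x \<in> carrier A" if "x \<in> {x. \<phi> x \<noteq> \<zero>\<^bsub>A\<^esub>}" for x using p that sub unfolding fin_fun_def by blast
  fix \<psi> assume "{x. \<phi> x \<noteq> \<zero>\<^bsub>A\<^esub>} = {x. \<psi> x \<noteq> \<zero>\<^bsub>A\<^esub>}" "\<And>x. x \<in> {x. \<phi> x \<noteq> \<zero>\<^bsub>A\<^esub>} \<Longrightarrow> \<phi> x = \<psi> x"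
  then show "\<phi> = \<psi>" by (intro ext) (metis (mono_tags) mem_Collect_eq)
qed

text \<open>The bound is carried along the construction: direct sum, words, finitely supported
  functions on words, and two quotients, each of which is an image of the previous carrier.
  \<open>T\<close> is a common home for the Hom modules, which vary with the objects.\<close>

lemma (in lin_category) lepoll_\<R>:
  assumes U: "infinite U" "carrier R \<lesssim> U" "LOb C \<lesssim> U" "T \<lesssim> U"
    and T: "\<And>x y. \<lbrakk>x \<in> LOb C; y \<in> LOb C\<rbrakk> \<Longrightarrow> carrier (LHom C x y) \<subseteq> T"
  shows "carrier (\<R>_alg R C) \<lesssim> U"
proof -
  have "carrier (total_mod C) \<lesssim> U"
  proof (rule lepoll_finite_support[OF U(1) lepoll_Times_infinite[OF U(1,3,3)] U(4),
        where D = "\<lambda>\<phi>. {p\<in>LOb C \<times> LOb C. \<phi> p \<noteq> \<zero>\<^bsub>mor p\<^esub>}"])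
    fix \<phi> assume p: "\<phi> \<in> carrier (total_mod C)"
    show "finite {p\<in>LOb C \<times> LOb C. \<phi> p \<noteq> \<zero>\<^bsub>mor p\<^esub>}" using total_finite[OF p] .
    show "\<phi> q \<in> T" if "q \<in> {p\<in>LOb C \<times> LOb C. \<phi> p \<noteq> \<zero>\<^bsub>mor p\<^esub>}" for q
      using total_app[OF p, of q] that T[of "fst q" "snd q"] by auto
    fix \<psi> assume q: "\<psi> \<in> carrier (total_mod C)"
      "{p\<in>LOb C \<times> LOb C. \<phi> p \<noteq> \<zero>\<^bsub>mor p\<^esub>} = {p\<in>LOb C \<times> LOb C. \<psi> p \<noteq> \<zero>\<^bsub>mor p\<^esub>}"
      "\<And>x. x \<in> {p\<in>LOb C \<times> LOb C. \<phi> p \<noteq> \<zero>\<^bsub>mor p\<^esub>} \<Longrightarrow> \<phi> x = \<psi> x"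
    show "\<phi> = \<psi>"
    proof (rule extensionalityI[OF total_ext[OF p] total_ext[OF q(1)]])
      fix x assume "x \<in> LOb C \<times> LOb C"
      then show "\<phi> x = \<psi> x" using q(2,3) by (metis (mono_tags, lifting) mem_Collect_eq)
    qed
  qed blast
  then have "lists (carrier (total_mod C)) \<lesssim> U" using lepoll_lists_infinite[OF U(1)] by blast
  then have "lists (carrier (total_mod C)) - {[]} \<lesssim> U"
    using lepoll_trans[OF subset_imp_lepoll[OF Diff_subset]] by blast
  then have w: "carrier (word_alg R (carrier (total_mod C))) \<lesssim> U"
    using lepoll_fin_fun[OF U(1) _ U(2)] by (simp add: word_alg_def)
  have "carrier Ten \<lesssim> U"
    unfolding carrier_tensor[OF module_total] using lepoll_trans[OF image_lepoll w] .
  then show ?thesis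
    unfolding \<R>_alg_def Q.carrier_quot using lepoll_trans[OF image_lepoll] by blast
qed


section \<open>Copies of algebras inside the universe\<close>

text \<open>Used for copies and, with \<open>f = id\<close>, for records that are extended by an
  action.\<close>

lemma nu_algebra_transport:
  assumes A: "nu_algebra R A" and b: "bij_betw f (carrier A) (carrier B)"
    and add: "\<And>a b. \<lbrakk>a \<in> carrier A; b \<in> carrier A\<rbrakk> \<Longrightarrow> f a \<oplus>\<^bsub>B\<^esub> f b = f (a \<oplus>\<^bsub>A\<^esub> b)"
    and mul: "\<And>a b. \<lbrakk>a \<in> carrier A; b \<in> carrier A\<rbrakk> \<Longrightarrow> f a \<otimes>\<^bsub>B\<^esub> f b = f (a \<otimes>\<^bsub>A\<^esub> b)"
    and smul: "\<And>r a. \<lbrakk>r \<in> carrier R; a \<in> carrier A\<rbrakk> \<Longrightarrow> r \<odot>\<^bsub>B\<^esub> f a = f (r \<odot>\<^bsub>A\<^esub> a)"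
    and zero: "\<zero>\<^bsub>B\<^esub> = f \<zero>\<^bsub>A\<^esub>"
  shows "nu_algebra R B"
proof -
  interpret A: nu_algebra R A by fact
  have e: "\<exists>a\<in>carrier A. x = f a" if "x \<in> carrier B" for x
    using that b by (auto simp: bij_betw_def)
  have c: "f a \<in> carrier B" if "a \<in> carrier A" for a using that b by (auto simp: bij_betw_def)
  note [simp] = add mul smul zero c A.mult_closed
  have "abelian_group B"
  proof (rule abelian_groupI)
    fix x y z assume "x \<in> carrier B" "y \<in> carrier B" "z \<in> carrier B"
    then obtain a b c where "a \<in> carrier A" "x = f a" "b \<in> carrier A" "y = f b" "c \<in> carrier A" "z = f c"
      using e[of x] e[of y] e[of z] by blast
    then show "x \<oplus>\<^bsub>B\<^esub> y \<in> carrier B" "x \<oplus>\<^bsub>B\<^esub> y \<oplus>\<^bsub>B\<^esub> z = x \<oplus>\<^bsub>B\<^esub> (y \<oplus>\<^bsub>B\<^esub> z)" "x \<oplus>\<^bsub>B\<^esub> y = y \<oplus>\<^bsub>B\<^esub> x"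
      "\<zero>\<^bsub>B\<^esub> \<oplus>\<^bsub>B\<^esub> x = x"
      by (simp_all add: A.M.a_ac)
    show "\<exists>y\<in>carrier B. y \<oplus>\<^bsub>B\<^esub> x = \<zero>\<^bsub>B\<^esub>"
      using \<open>a \<in> carrier A\<close> \<open>x = f a\<close> by (intro bexI[of _ "f (\<ominus>\<^bsub>A\<^esub> a)"]) (simp_all add: A.M.l_neg)
  qed simp
  then have "Module.module R B"
  proof (rule moduleI[OF A.is_cring])
    fix r s x y assume r: "r \<in> carrier R" and "x \<in> carrier B"
    then obtain a where a: "a \<in> carrier A" "x = f a" using e[of x] by blast
    show "r \<odot>\<^bsub>B\<^esub> x \<in> carrier B" using r a by simp
    show "(r \<oplus>\<^bsub>R\<^esub> s) \<odot>\<^bsub>B\<^esub> x = r \<odot>\<^bsub>B\<^esub> x \<oplus>\<^bsub>B\<^esub> s \<odot>\<^bsub>B\<^esub> x"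
      "(r \<otimes>\<^bsub>R\<^esub> s) \<odot>\<^bsub>B\<^esub> x = r \<odot>\<^bsub>B\<^esub> (s \<odot>\<^bsub>B\<^esub> x)" if "s \<in> carrier R"
      using r a that by (simp_all add: A.smult_l_distr A.smult_assoc1)
    assume "y \<in> carrier B"
    then obtain b where "b \<in> carrier A" "y = f b" using e[of y] by blast
    then show "r \<odot>\<^bsub>B\<^esub> (x \<oplus>\<^bsub>B\<^esub> y) = r \<odot>\<^bsub>B\<^esub> x \<oplus>\<^bsub>B\<^esub> r \<odot>\<^bsub>B\<^esub> y"
      using r a by (simp add: A.smult_r_distr)
  next
    fix x assume "x \<in> carrier B"
    then obtain a where "a \<in> carrier A" "x = f a" using e[of x] by blast
    then show "\<one>\<^bsub>R\<^esub> \<odot>\<^bsub>B\<^esub> x = x" by simp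
  qed
  then interpret B: Module.module R B .
  show ?thesis
  proof
    fix x y assume "x \<in> carrier B" "y \<in> carrier B"
    then obtain a b where
      abc: "a \<in> carrier A" "x = f a" "b \<in> carrier A" "y = f b" using e[of x] e[of y] by blast
    then show "x \<otimes>\<^bsub>B\<^esub> y \<in> carrier B" by simp
    show "r \<odot>\<^bsub>B\<^esub> x \<otimes>\<^bsub>B\<^esub> y = r \<odot>\<^bsub>B\<^esub> (x \<otimes>\<^bsub>B\<^esub> y)" "x \<otimes>\<^bsub>B\<^esub> (r \<odot>\<^bsub>B\<^esub> y) = r \<odot>\<^bsub>B\<^esub> (x \<otimes>\<^bsub>B\<^esub> y)"
      if "r \<in> carrier R" for r
      using abc that by (simp_all add: A.smult_mult_left A.smult_mult_right)
    fix z assume "z \<in> carrier B"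
    then obtain c where "c \<in> carrier A" "z = f c" using e[of z] by blast
    with abc show "x \<otimes>\<^bsub>B\<^esub> y \<otimes>\<^bsub>B\<^esub> z = x \<otimes>\<^bsub>B\<^esub> (y \<otimes>\<^bsub>B\<^esub> z)"
      "(x \<oplus>\<^bsub>B\<^esub> y) \<otimes>\<^bsub>B\<^esub> z = x \<otimes>\<^bsub>B\<^esub> z \<oplus>\<^bsub>B\<^esub> y \<otimes>\<^bsub>B\<^esub> z"
      "x \<otimes>\<^bsub>B\<^esub> (y \<oplus>\<^bsub>B\<^esub> z) = x \<otimes>\<^bsub>B\<^esub> y \<oplus>\<^bsub>B\<^esub> x \<otimes>\<^bsub>B\<^esub> z"
      by (simp_all add: A.mult_assoc A.mult_l_distr A.mult_r_distr)
  qed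
qed

lemma inj_on_copy_map:
  assumes "S \<lesssim> (UNIV :: 'u set)"
  shows "inj_on (copy_map S :: 'b \<Rightarrow> 'u) S"
  unfolding copy_map_def using assms by (intro someI_ex[of "\<lambda>f. inj_on f S"]) (auto simp: lepoll_def)

lemma copy_map_inv:
  assumes "S \<lesssim> (UNIV :: 'u set)" "x \<in> S"
  shows "inv_into S (copy_map S :: 'b \<Rightarrow> 'u) (copy_map S x) = x"
  using inv_into_f_f[OF inj_on_copy_map[OF assms(1)] assms(2)] .

lemma copy_alg_simps:
  "carrier (copy_alg A) = copy_map (carrier A) ` carrier A"
  "mult (copy_alg A) = (\<lambda>x y. copy_map (carrier A)
     (inv_into (carrier A) (copy_map (carrier A)) x \<otimes>\<^bsub>A\<^esub> inv_into (carrier A) (copy_map (carrier A)) y))"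
  "zero (copy_alg A) = copy_map (carrier A) \<zero>\<^bsub>A\<^esub>"
  "add (copy_alg A) = (\<lambda>x y. copy_map (carrier A)
     (inv_into (carrier A) (copy_map (carrier A)) x \<oplus>\<^bsub>A\<^esub> inv_into (carrier A) (copy_map (carrier A)) y))"
  "smult (copy_alg A) = (\<lambda>r x. copy_map (carrier A) (r \<odot>\<^bsub>A\<^esub> inv_into (carrier A) (copy_map (carrier A)) x))"
  by (simp_all add: copy_alg_def Let_def)

lemma bij_copy_map:
  fixes A :: "('k, 'b, 'z) module_scheme"
  assumes "carrier A \<lesssim> (UNIV :: 'u set)"
  shows "bij_betw (copy_map (carrier A) :: 'b \<Rightarrow> 'u) (carrier A) (carrier (copy_alg A))"
  using inj_on_copy_map[OF assms] by (simp add: bij_betw_def copy_alg_simps)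

lemma nu_algebra_copy:
  fixes A :: "('k, 'b, 'z) module_scheme"
  assumes "nu_algebra R A" and s: "carrier A \<lesssim> (UNIV :: 'u set)"
  shows "nu_algebra R (copy_alg A :: ('k, 'u) module)"
    and "nu_hom R A (copy_alg A :: ('k, 'u) module) (copy_map (carrier A))"
proof -
  interpret A: nu_algebra R A by fact
  note inv = copy_map_inv[OF s]
  show "nu_algebra R (copy_alg A :: ('k, 'u) module)"
    by (rule nu_algebra_transport[OF assms(1) bij_copy_map[OF s]]) (simp_all add: copy_alg_simps inv)
  show "nu_hom R A (copy_alg A :: ('k, 'u) module) (copy_map (carrier A))"
    by (intro nu_homI lin_mapI) (simp_all add: copy_alg_simps inv)
qed

section \<open>The category of algebras and arrows between copies\<close>

lemma concrete_cat_simps: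
  "Ob (concrete_cat \<O> \<H>) = \<O>"
  "(A, B, f) \<in> Arr (concrete_cat \<O> \<H>) \<longleftrightarrow> A \<in> \<O> \<and> B \<in> \<O> \<and> f \<in> \<H> A B"
  "Dom (concrete_cat \<O> \<H>) (A, B, f) = A" "Cod (concrete_cat \<O> \<H>) (A, B, f) = B"
  "Id (concrete_cat \<O> \<H>) A = (A, A, restrict id (carrier A))"
  "Comp (concrete_cat \<O> \<H>) (B', C, g) (A, B, f) = (A, C, compose (carrier A) g f)"
  by (simp_all add: concrete_cat_def)

lemma Alg_simps:
  "A \<in> Ob (Alg R) \<longleftrightarrow> nu_algebra R A"
  "(A, B, f) \<in> Arr (Alg R) \<longleftrightarrow> nu_algebra R A \<and> nu_algebra R B \<and> f \<in> alg_homs R A B"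
  "Dom (Alg R) (A, B, f) = A" "Cod (Alg R) (A, B, f) = B"
  "Id (Alg R) A = (A, A, restrict id (carrier A))"
  "Comp (Alg R) (B', C, g) (A, B, f) = (A, C, compose (carrier A) g f)"
  by (simp_all add: Alg_def concrete_cat_simps)

lemma Alg_HomI:
  "\<lbrakk>nu_algebra R A; nu_algebra R B; nu_hom R A B f\<rbrakk> \<Longrightarrow> (A, B, restrict f (carrier A)) \<in> Hom (Alg R) A B"
  by (simp add: Hom_def Alg_simps restrict_alg_homs)

lemma copy_arr_Hom:
  fixes A :: "('k, 'b) module" and B :: "('k, 'c) module"
  assumes "nu_algebra R A" "nu_algebra R B" "carrier A \<lesssim> (UNIV :: 'u set)" "carrier B \<lesssim> (UNIV :: 'u set)"
    and "nu_hom R A B f"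
  shows "(copy_arr A B f :: (('k, 'u) module, 'u) carr) \<in> Hom (Alg R) (copy_alg A) (copy_alg B)"
proof -
  have h: "nu_hom R (copy_alg A :: ('k, 'u) module) (copy_alg B :: ('k, 'u) module)
      (copy_map (carrier B) \<circ> (f \<circ> inv_into (carrier A) (copy_map (carrier A))))"
    using nu_hom_comp[OF nu_hom_comp[OF inverse_nu_hom[OF assms(1) nu_algebra_copy(2)[OF assms(1,3)]
          bij_copy_map[OF assms(3)]] assms(5)] nu_algebra_copy(2)[OF assms(2,4)]] .
  show ?thesis
    using Alg_HomI[OF nu_algebra_copy(1)[OF assms(1,3)] nu_algebra_copy(1)[OF assms(2,4)] h]
    by (simp add: copy_arr_def copy_fun_def copy_alg_simps(1) o_def)
qed

lemma copy_arr_cong: "(\<And>a. a \<in> carrier A \<Longrightarrow> f a = g a) \<Longrightarrow> copy_arr A B f = copy_arr A B g"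
  by (auto simp: copy_arr_def copy_fun_def fun_eq_iff inv_into_into)

lemma copy_arr_Comp:
  fixes A :: "('k, 'b) module" and B :: "('k, 'c) module" and C :: "('k, 'd) module"
  assumes "carrier A \<lesssim> (UNIV :: 'u set)" "carrier B \<lesssim> (UNIV :: 'u set)" "\<And>a. a \<in> carrier A \<Longrightarrow> f a \<in> carrier B"
  shows "Comp (Alg R) (copy_arr B C g) (copy_arr A B f :: (('k, 'u) module, 'u) carr) = copy_arr A C (g \<circ> f)"
  using assms(3) copy_map_inv[OF assms(1)] inj_onD[OF inj_on_copy_map[OF assms(2)]]
    copy_map_inv[OF assms(2)]
  by (auto simp: copy_arr_def Alg_simps copy_alg_simps(1) copy_fun_def compose_def fun_eq_iff) metis

lemma copy_arr_id:
  fixes A :: "('k, 'b) module"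
  assumes "carrier A \<lesssim> (UNIV :: 'u set)"
  shows "(copy_arr A A id :: (('k, 'u) module, 'u) carr) = Id (Alg R) (copy_alg A)"
  using copy_map_inv[OF assms]
  by (auto simp: copy_arr_def Alg_simps copy_alg_simps(1) copy_fun_def fun_eq_iff)

text \<open>An algebra of the universe is in general different from its own copy. An arrow from the
  algebra itself factors through the canonical isomorphism to the copy, which connects
  \<open>into_copy\<close>, in which invariance is stated, with \<open>copy_arr\<close>.\<close>

lemma into_copy_eq:
  fixes A :: "('k, 'u) module" and B :: "('k, 'c) module"
  shows "into_copy A B f = Comp (Alg R) (copy_arr A B f)
    (A, copy_alg A :: ('k, 'u) module, restrict (copy_map (carrier A)) (carrier A))"
  using copy_map_inv[of "carrier A", OF subset_imp_lepoll[OF subset_UNIV]]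
  by (auto simp: into_copy_def copy_arr_def Alg_simps copy_alg_simps(1) copy_fun_def compose_def fun_eq_iff)


section \<open>Homotopies\<close>

context abelian_group
begin

lemma diff_eq_diff_iff:
  assumes [simp]: "a \<in> carrier G" "b \<in> carrier G" "c \<in> carrier G" "d \<in> carrier G"
  shows "a \<ominus> b = c \<ominus> d \<longleftrightarrow> a \<oplus> d = c \<oplus> b"
proof -
  have "(a \<ominus> b) \<oplus> (b \<oplus> d) = a \<oplus> d" by (simp add: minus_eq a_assoc r_neg1)
  moreover have "(c \<ominus> d) \<oplus> (b \<oplus> d) = c \<oplus> b" by (simp add: minus_eq a_assoc r_neg1 a_comm[of b d])
  ultimately show ?thesis using add.right_cancel[of "b \<oplus> d" "a \<ominus> b" "c \<ominus> d"] by auto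
qed

lemma diff_add_diff:
  assumes [simp]: "a \<in> carrier G" "b \<in> carrier G" "c \<in> carrier G" "d \<in> carrier G"
  shows "(a \<ominus> b) \<oplus> (c \<ominus> d) = (a \<oplus> c) \<ominus> (b \<oplus> d)"
  by (simp add: minus_eq minus_add a_ac)

end

text \<open>The segment \<open>(1 - t) u + t w\<close>.\<close>

definition line :: "('a, 'z) ring_scheme \<Rightarrow> 'a \<Rightarrow> 'a \<Rightarrow> nat \<Rightarrow> 'a" where
  "line A u w = (\<lambda>n. if n = 0 then u else if n = 1 then w \<ominus>\<^bsub>A\<^esub> u else \<zero>\<^bsub>A\<^esub>)"

text \<open>Evaluation at t = 1 is the sum of the coefficients.\<close>

definition eval_one :: "('a, 'z) ring_scheme \<Rightarrow> (nat \<Rightarrow> 'a) \<Rightarrow> 'a" where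
  "eval_one A = fs_ext A A (\<lambda>_. id)"

context nu_algebra
begin

sublocale Poly: twisted_convolution R A "UNIV :: nat set" "poly_mult A" "\<lambda>s t. Some (s + t)" "\<lambda>_. id"
  by (rule poly_convolution) (rule nu_algebra_axioms)

lemma poly_alg_simps:
  "carrier (poly_alg A) = fin_fun UNIV A" "mult (poly_alg A) = poly_mult A" "zero (poly_alg A) = (\<lambda>x. \<zero>\<^bsub>A\<^esub>)"
  "add (poly_alg A) = (\<lambda>\<phi> \<psi> x. \<phi> x \<oplus>\<^bsub>A\<^esub> \<psi> x)" "smult (poly_alg A) = (\<lambda>r \<phi> x. r \<odot>\<^bsub>A\<^esub> \<phi> x)"
  by (simp_all add: poly_alg_def)

lemma nu_hom_poly_const: "nu_hom R A (poly_alg A) (poly_const A)"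
  using lin_map_fsingle[OF module_axioms, of 0 UNIV "poly_mult A"] Poly.m_fsingle[of 0 _ 0]
  by (intro nu_homI) (simp_all add: poly_const_fsingle[abs_def] poly_alg_def)

lemma nu_hom_eval_zero: "nu_hom R (poly_alg A) A (\<lambda>\<phi>. \<phi> 0)"
  unfolding poly_alg_def
proof (rule nu_hom_fsI[OF module_axioms Poly.nu_algebra_fs_alg nu_algebra_axioms])
  show "lin_map R (fs_alg UNIV A (poly_mult A)) A (\<lambda>\<phi>. \<phi> 0)"
    by (intro lin_mapI) (auto simp: fin_fun_carrier)
  fix s t :: nat and a b assume "a \<in> carrier A" "b \<in> carrier A"
  then show "poly_mult A (fsingle A s a) (fsingle A t b) 0 = fsingle A s a 0 \<otimes>\<^bsub>A\<^esub> fsingle A t b 0"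
    using Poly.m_fsingle[of s a t b] by (simp add: fsingle_def mult_zero_left mult_zero_right mult_closed)
qed

lemma eval_one_fsingle: "a \<in> carrier A \<Longrightarrow> eval_one A (fsingle A n a) = a"
  unfolding eval_one_def by (subst fs_ext_fsingle[OF module_axioms module_axioms, where S = UNIV]) (simp_all add:
      lin_map_id)

lemma nu_hom_eval_one: "nu_hom R (poly_alg A) A (eval_one A)"
  unfolding poly_alg_def
proof (rule nu_hom_fsI[OF module_axioms Poly.nu_algebra_fs_alg nu_algebra_axioms])
  show "lin_map R (fs_alg UNIV A (poly_mult A)) A (eval_one A)"
    unfolding eval_one_def by (rule lin_map_fs_ext[OF module_axioms module_axioms lin_map_id])
  fix s t :: nat and a b assume "a \<in> carrier A" "b \<in> carrier A"
  then show "eval_one A (poly_mult A (fsingle A s a) (fsingle A t b)) = eval_one A (fsingle A s a) \<otimes>\<^bsub>A\<^esub> eval_one A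
      (fsingle A t b)"
    using Poly.m_fsingle[of s a t b] by (simp add: eval_one_fsingle mult_closed)
qed

lemma line_fsingle:
  assumes "u \<in> carrier A" "w \<in> carrier A"
  shows "line A u w = fsingle A 0 u \<oplus>\<^bsub>poly_alg A\<^esub> fsingle A (Suc 0) (w \<ominus>\<^bsub>A\<^esub> u)"
  using assms by (auto simp: line_def fsingle_def poly_alg_simps fun_eq_iff)

lemma line_closed: "\<lbrakk>u \<in> carrier A; w \<in> carrier A\<rbrakk> \<Longrightarrow> line A u w \<in> carrier (poly_alg A)"
  using add_fin_fun[OF fsingle_closed fsingle_closed, of 0 UNIV u "Suc 0" "w \<ominus>\<^bsub>A\<^esub> u"]
  by (simp add: line_fsingle poly_alg_simps)

lemma eval_one_line: "\<lbrakk>u \<in> carrier A; w \<in> carrier A\<rbrakk> \<Longrightarrow> eval_one A (line A u w) = w"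
  using nu_homD(4)[OF nu_hom_eval_one, of "fsingle A 0 u" "fsingle A (Suc 0) (w \<ominus>\<^bsub>A\<^esub> u)"]
  by (simp add: line_fsingle eval_one_fsingle poly_alg_simps fsingle_closed minus_eq a_lcomm[of u w] r_neg)

lemma lin_map_line:
  assumes u: "lin_map R B A u" and w: "lin_map R B A w"
  shows "lin_map R B (poly_alg A) (\<lambda>b. line A (u b) (w b))"
proof (rule lin_mapI)
  note c = lin_mapD[OF u] lin_mapD[OF w]
  fix a assume a: "a \<in> carrier B"
  show "line A (u a) (w a) \<in> carrier (poly_alg A)" using line_closed c a by simp
  show "line A (u (r \<odot>\<^bsub>B\<^esub> a)) (w (r \<odot>\<^bsub>B\<^esub> a)) = r \<odot>\<^bsub>poly_alg A\<^esub> line A (u a) (w a)" if "r \<in> carrier R" for r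
    using that a c by (auto simp: line_def poly_alg_simps fun_eq_iff minus_eq smult_r_distr smult_r_minus)
  show "line A (u (a \<oplus>\<^bsub>B\<^esub> b)) (w (a \<oplus>\<^bsub>B\<^esub> b)) = line A (u a) (w a) \<oplus>\<^bsub>poly_alg A\<^esub> line A (u b) (w b)"
    if "b \<in> carrier B" for b
    using that a c by (auto simp: line_def poly_alg_simps fun_eq_iff diff_add_diff)
qed

text \<open>With v = w - u and v' = w' - u', hypothesis \<open>x\<close> says exactly that v v' = 0,
  so the coefficient of t^2 in the product of the two lines vanishes. The same hypothesis turns the
  coefficient u v' + v u' of t into w w' - u u', the slope of the line on the right.\<close>

lemma line_mult:
  assumes [simp]: "u \<in> carrier A" "w \<in> carrier A" "u' \<in> carrier A" "w' \<in> carrier A"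
    and x: "u \<otimes>\<^bsub>A\<^esub> w' \<oplus>\<^bsub>A\<^esub> w \<otimes>\<^bsub>A\<^esub> u' = u \<otimes>\<^bsub>A\<^esub> u' \<oplus>\<^bsub>A\<^esub> w \<otimes>\<^bsub>A\<^esub> w'"
  shows "line A u w \<otimes>\<^bsub>poly_alg A\<^esub> line A u' w' = line A (u \<otimes>\<^bsub>A\<^esub> u') (w \<otimes>\<^bsub>A\<^esub> w')"
proof -
  interpret P: nu_algebra R "poly_alg A" by (rule nu_algebra_poly) (rule nu_algebra_axioms)
  let ?v = "w \<ominus>\<^bsub>A\<^esub> u" and ?v' = "w' \<ominus>\<^bsub>A\<^esub> u'"
  note [simp] = mult_closed
  have s: "fsingle A n a \<in> carrier (poly_alg A)" if "a \<in> carrier A" for n a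
    using that fsingle_closed[of n UNIV] by (simp add: poly_alg_simps)
  have m: "fsingle A n a \<otimes>\<^bsub>poly_alg A\<^esub> fsingle A k b = fsingle A (n + k) (a \<otimes>\<^bsub>A\<^esub> b)"
    if "a \<in> carrier A" "b \<in> carrier A" for n k a b
    using Poly.m_fsingle[of n a k b] that by (simp add: poly_alg_simps)
  have v2: "?v \<otimes>\<^bsub>A\<^esub> ?v' = \<zero>\<^bsub>A\<^esub>"
  proof -
    have "?v \<otimes>\<^bsub>A\<^esub> ?v' = (w \<otimes>\<^bsub>A\<^esub> w' \<ominus>\<^bsub>A\<^esub> u \<otimes>\<^bsub>A\<^esub> w') \<ominus>\<^bsub>A\<^esub> (w \<otimes>\<^bsub>A\<^esub> u' \<ominus>\<^bsub>A\<^esub> u \<otimes>\<^bsub>A\<^esub> u')"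
      by (simp add: mult_diff_left mult_diff_right)
    moreover have "w \<otimes>\<^bsub>A\<^esub> w' \<ominus>\<^bsub>A\<^esub> u \<otimes>\<^bsub>A\<^esub> w' = w \<otimes>\<^bsub>A\<^esub> u' \<ominus>\<^bsub>A\<^esub> u \<otimes>\<^bsub>A\<^esub> u'"
      using x by (subst diff_eq_diff_iff) (simp_all add: a_comm)
    ultimately show ?thesis using diff_self by simp
  qed
  have v1: "u \<otimes>\<^bsub>A\<^esub> ?v' \<oplus>\<^bsub>A\<^esub> ?v \<otimes>\<^bsub>A\<^esub> u' = w \<otimes>\<^bsub>A\<^esub> w' \<ominus>\<^bsub>A\<^esub> u \<otimes>\<^bsub>A\<^esub> u'"
  proof -
    have "u \<otimes>\<^bsub>A\<^esub> ?v' \<oplus>\<^bsub>A\<^esub> ?v \<otimes>\<^bsub>A\<^esub> u' =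
        (u \<otimes>\<^bsub>A\<^esub> u' \<oplus>\<^bsub>A\<^esub> w \<otimes>\<^bsub>A\<^esub> w') \<ominus>\<^bsub>A\<^esub> (u \<otimes>\<^bsub>A\<^esub> u' \<oplus>\<^bsub>A\<^esub> u \<otimes>\<^bsub>A\<^esub> u')"
      by (simp add: mult_diff_left mult_diff_right diff_add_diff x)
    also have "\<dots> = w \<otimes>\<^bsub>A\<^esub> w' \<ominus>\<^bsub>A\<^esub> u \<otimes>\<^bsub>A\<^esub> u'"
      by (subst diff_eq_diff_iff) (simp_all add: a_ac)
    finally show ?thesis .
  qed
  have "line A u w \<otimes>\<^bsub>poly_alg A\<^esub> line A u' w' =
      fsingle A 0 (u \<otimes>\<^bsub>A\<^esub> u') \<oplus>\<^bsub>poly_alg A\<^esub> fsingle A (Suc 0) (?v \<otimes>\<^bsub>A\<^esub> u') \<oplus>\<^bsub>poly_alg A\<^esub>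
      (fsingle A (Suc 0) (u \<otimes>\<^bsub>A\<^esub> ?v') \<oplus>\<^bsub>poly_alg A\<^esub> fsingle A 2 (?v \<otimes>\<^bsub>A\<^esub> ?v'))"
    by (simp add: line_fsingle P.mult_l_distr P.mult_r_distr s m numeral_2_eq_2 P.mult_closed)
  also have "\<dots> = fsingle A 0 (u \<otimes>\<^bsub>A\<^esub> u') \<oplus>\<^bsub>poly_alg A\<^esub> fsingle A (Suc 0) (?v \<otimes>\<^bsub>A\<^esub> u' \<oplus>\<^bsub>A\<^esub> u \<otimes>\<^bsub>A\<^esub> ?v')"
    by (simp add: v2 poly_alg_simps fsingle_add fun_eq_iff) (auto simp: fsingle_def)
  finally show ?thesis using v1 by (simp add: line_fsingle a_comm)
qed

text \<open>Here \<open>p\<close>, \<open>q\<close>, \<open>r\<close> stand for the values of a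
  system of matrix units at y, at x and at the product xy. Of the four terms in a product of two
  column sums, one survives in each row, so the result is the column sum of the right factor,
  whatever the column of the left one.\<close>

lemma matrix_unit_columns:
  fixes p q r :: "bool \<Rightarrow> bool \<Rightarrow> 'c"
  assumes c: "\<And>i j. p i j \<in> carrier A" "\<And>i j. q i j \<in> carrier A" "\<And>i j. r i j \<in> carrier A"
    and m: "\<And>i j k l. q i j \<otimes>\<^bsub>A\<^esub> p k l = (if j = k then r i l else \<zero>\<^bsub>A\<^esub>)"
  shows "(q False i \<oplus>\<^bsub>A\<^esub> q True i) \<otimes>\<^bsub>A\<^esub> (p False j \<oplus>\<^bsub>A\<^esub> p True j) = r False j \<oplus>\<^bsub>A\<^esub> r True j"
    and "q j j \<otimes>\<^bsub>A\<^esub> (p False j \<oplus>\<^bsub>A\<^esub> p True j) = r j j"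
    and "(q False j \<oplus>\<^bsub>A\<^esub> q True j) \<otimes>\<^bsub>A\<^esub> p j j = r False j \<oplus>\<^bsub>A\<^esub> r True j"
  by (cases i; cases j; simp add: mult_l_distr mult_r_distr mult_closed c m)+

end

section \<open>Homotopy invariant and matrix stable functors\<close>

lemma mat_alg_simps:
  "carrier (mat_alg X A) = fin_fun (X \<times> X) A" "mult (mat_alg X A) = mat_mult A" "zero (mat_alg X A) = (\<lambda>x. \<zero>\<^bsub>A\<^esub>)"
  "add (mat_alg X A) = (\<lambda>\<phi> \<psi> x. \<phi> x \<oplus>\<^bsub>A\<^esub> \<psi> x)" "smult (mat_alg X A) = (\<lambda>r \<phi> x. r \<odot>\<^bsub>A\<^esub> \<phi> x)"
  by (simp_all add: mat_alg_def)

lemma mat_fsingle_mult: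
  assumes "nu_algebra R A" "x \<in> X" "y \<in> X" "z \<in> X" "w \<in> X" "a \<in> carrier A" "b \<in> carrier A"
  shows "fsingle A (x, y) a \<otimes>\<^bsub>mat_alg X A\<^esub> fsingle A (z, w) b =
    (if y = z then fsingle A (x, w) (a \<otimes>\<^bsub>A\<^esub> b) else \<zero>\<^bsub>mat_alg X A\<^esub>)"
  using twisted_convolution.m_fsingle[OF mat_convolution[OF assms(1), of X], of "(x, y)" a "(z, w)" b] assms
  by (simp add: mat_alg_simps mat_pr_def)

lemma fsingle_mat_closed:
  "\<lbrakk>nu_algebra R A; x \<in> X; y \<in> X; a \<in> carrier A\<rbrakk> \<Longrightarrow> fsingle A (x, y) a \<in> carrier (mat_alg X A)"
  unfolding mat_alg_simps by (rule abelian_group.fsingle_closed[OF module_abelian_group[OF nu_algebra_module]]) auto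

lemma lin_map_fsingle_mat:
  "\<lbrakk>nu_algebra R A; x \<in> X; y \<in> X\<rbrakk> \<Longrightarrow> lin_map R A (mat_alg X A) (fsingle A (x, y))"
  unfolding mat_alg_def by (rule lin_map_fsingle[OF nu_algebra_module]) auto

lemma lin_map_mat_ext:
  assumes A: "nu_algebra R A" and B: "nu_algebra R B"
    and \<theta>: "\<And>x y. \<lbrakk>x \<in> X; y \<in> X\<rbrakk> \<Longrightarrow> lin_map R A B (\<theta> x y)"
  shows "\<exists>f. lin_map R (mat_alg X A) B f \<and>
    (\<forall>x\<in>X. \<forall>y\<in>X. \<forall>a\<in>carrier A. f (fsingle A (x, y) a) = \<theta> x y a)"
proof (intro exI conjI ballI)
  have t: "lin_map R A B (case_prod \<theta> p)" if "p \<in> X \<times> X" for p using \<theta> that by auto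
  note m = nu_algebra_module[OF A] nu_algebra_module[OF B]
  show "lin_map R (mat_alg X A) B (fs_ext A B (case_prod \<theta>))"
    unfolding mat_alg_def by (rule lin_map_fs_ext[OF m t])
  show "fs_ext A B (case_prod \<theta>) (fsingle A (x, y) a) = \<theta> x y a" if "x \<in> X" "y \<in> X" "a \<in> carrier A" for x y a
    using fs_ext_fsingle[OF m t, where s = "(x, y)"] that by simp
qed

lemma mat_lin_eqI:
  assumes A: "nu_algebra R A" and B: "nu_algebra R B"
    and f: "lin_map R (mat_alg X A) B f" and g: "lin_map R (mat_alg X A) B g"
    and eq: "\<And>x y a. \<lbrakk>x \<in> X; y \<in> X; a \<in> carrier A\<rbrakk> \<Longrightarrow> f (fsingle A (x, y) a) = g (fsingle A (x, y) a)"
    and M: "M \<in> carrier (mat_alg X A)"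
  shows "f M = g M"
  using lin_map_fs_eqI[OF nu_algebra_module[OF A] nu_algebra_module[OF B]
      f[unfolded mat_alg_def] g[unfolded mat_alg_def], of M] eq M
  by (auto simp: mat_alg_simps)

lemma mat_mult_eqI:
  assumes A: "nu_algebra R A" and B: "nu_algebra R B"
    and f: "lin_map R (mat_alg X A) B f" and g: "lin_map R (mat_alg X A) B g" and h: "lin_map R (mat_alg X A) B h"
    and m: "\<And>x y z w a b. \<lbrakk>x \<in> X; y \<in> X; z \<in> X; w \<in> X; a \<in> carrier A; b \<in> carrier A\<rbrakk> \<Longrightarrow>
      h (fsingle A (x, y) a \<otimes>\<^bsub>mat_alg X A\<^esub> fsingle A (z, w) b) = f (fsingle A (x, y) a) \<otimes>\<^bsub>B\<^esub> g (fsingle A (z, w) b)"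
    and M: "M \<in> carrier (mat_alg X A)" and N: "N \<in> carrier (mat_alg X A)"
  shows "h (M \<otimes>\<^bsub>mat_alg X A\<^esub> N) = f M \<otimes>\<^bsub>B\<^esub> g N"
  unfolding mat_alg_simps(2)
proof (rule fs_mult_eqI[OF nu_algebra_module[OF A] nu_algebra_mat[OF A, unfolded mat_alg_def] B
      f[unfolded mat_alg_def] g[unfolded mat_alg_def] h[unfolded mat_alg_def]])
  fix p a q b assume "p \<in> X \<times> X" "a \<in> carrier A" "q \<in> X \<times> X" "b \<in> carrier A"
  then show "h (mat_mult A (fsingle A p a) (fsingle A q b)) = f (fsingle A p a) \<otimes>\<^bsub>B\<^esub> g (fsingle A q b)"
    using m unfolding mat_alg_simps(2) by (cases p; cases q) simp
qed (use M N in \<open>simp_all add: mat_alg_simps\<close>)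

lemma nu_hom_corner:
  assumes "nu_algebra R A" "x \<in> X"
  shows "nu_hom R A (mat_alg X A) (corner A x)"
  using lin_map_fsingle_mat[OF assms(1,2,2)] mat_fsingle_mult[OF assms(1,2,2,2,2)]
  by (intro nu_homI) (simp_all add: corner_fsingle[abs_def])

lemma corner_natural:
  assumes "nu_algebra R A" "nu_algebra R B" "nu_hom R A B f"
  shows "f \<circ> corner A x a = corner B x (f a)"
  using comp_fsingle[OF nu_algebra_module[OF assms(1)] nu_algebra_module[OF assms(2)] nu_homD(1)[OF assms(3)]]
  by (simp add: corner_fsingle)

lemma poly_const_natural:
  assumes "nu_algebra R A" "nu_algebra R B" "nu_hom R A B f"
  shows "f \<circ> poly_const A a = poly_const B (f a)"
  using comp_fsingle[OF nu_algebra_module[OF assms(1)] nu_algebra_module[OF assms(2)] nu_homD(1)[OF assms(3)]]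
  by (simp add: poly_const_fsingle)

section \<open>Small algebras of arbitrary type\<close>

text \<open>\<open>Z\<close> is the index set for which \<open>j\<close> is matrix stable; it
  becomes \<nat> \<times> G in the theorem. \<open>U\<close> names the universe as a set, against
  which all cardinalities are measured.\<close>

locale stable_functor =
  fixes R :: "('k, 'r) ring_scheme" and U :: "'u set" and Z :: "'x set" and kk :: "('o, 'm) tricat"
    and j :: "(('k, 'u) module, (('k, 'u) module, 'u) carr, 'o, 'm) func"
  assumes ring: "cring R" and U: "U = UNIV" and universe: "infinite U"
    and Z_small: "Z \<lesssim> U" and Z_infinite: "infinite Z"
    and j: "is_functor (Alg R) kk j"
    and homotopy: "homotopy_invariant R kk j" and stable: "matrix_stable R Z kk j"
begin

definition sm :: "('k, 'b) module \<Rightarrow> bool" where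
  "sm A \<longleftrightarrow> nu_algebra R A \<and> carrier A \<lesssim> U"

lemma smI: "\<lbrakk>nu_algebra R A; carrier A \<lesssim> U\<rbrakk> \<Longrightarrow> sm A"
  by (simp add: sm_def)

lemma sm_alg: "sm A \<Longrightarrow> nu_algebra R A"
  by (simp add: sm_def)

lemma sm_small: "sm A \<Longrightarrow> carrier A \<lesssim> (UNIV :: 'u set)"
  by (drule sm_def[THEN iffD1]) (simp add: U)

lemma small_universe: "(S :: 'u set) \<lesssim> (UNIV :: 'u set)"
  by (rule subset_imp_lepoll) simp

lemma small_nat: "(S :: nat set) \<lesssim> U"
  using lepoll_trans[OF subset_imp_lepoll[OF subset_UNIV]] universe infinite_le_lepoll by blast

lemma sm_poly: "sm A \<Longrightarrow> sm (poly_alg A)"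
  using nu_algebra_poly[of R A] lepoll_fin_fun[OF universe small_nat, of A UNIV]
  by (simp add: sm_def poly_alg_def)

lemma sm_mat: "\<lbrakk>sm A; X \<lesssim> U\<rbrakk> \<Longrightarrow> sm (mat_alg X A)"
  using nu_algebra_mat[of R A X] lepoll_fin_fun[OF universe lepoll_Times_infinite[OF universe], of X X A]
  by (simp add: sm_def mat_alg_simps)

lemma sm_copy: "sm A \<Longrightarrow> sm (copy_alg A :: ('k, 'u) module)"
  using nu_algebra_copy(1)[OF sm_alg sm_small] by (intro smI) (simp_all add: U small_universe)

sublocale kk: category kk
  using j by (simp add: is_functor_def)

text \<open>The value of \<open>j\<close> on a homomorphism between small algebras over any element
  types, taken through their copies. Functoriality of \<open>J\<close> lets polynomial algebras,
  matrix algebras and crossed products be used as if they were objects of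
  \<open>Alg R\<close>.\<close>

definition J :: "('k, 'b) module \<Rightarrow> ('k, 'c) module \<Rightarrow> ('b \<Rightarrow> 'c) \<Rightarrow> 'm" where
  "J A B f = on_arr j (copy_arr A B f)"

definition JO :: "('k, 'b) module \<Rightarrow> 'o" where
  "JO A = on_ob j (copy_alg A)"

lemma J_Hom: "\<lbrakk>sm A; sm B; nu_hom R A B f\<rbrakk> \<Longrightarrow> J A B f \<in> Hom kk (JO A) (JO B)"
  unfolding J_def JO_def by (rule is_functor_Hom[OF j copy_arr_Hom]) (simp_all add: sm_alg sm_small)

lemma J_comp:
  assumes "sm A" "sm B" "sm C" "nu_hom R A B f" "nu_hom R B C g"
  shows "J A C (g \<circ> f) = J B C g \<cdot>\<^bsub>kk\<^esub> J A B f"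
proof -
  note h = copy_arr_Hom[OF sm_alg sm_alg sm_small sm_small]
  show ?thesis
    unfolding J_def using is_functor_Comp[OF j h[OF assms(1,2,1,2,4)] h[OF assms(2,3,2,3,5)]]
      copy_arr_Comp[OF sm_small[OF assms(1)] sm_small[OF assms(2)], of f R C g] nu_homD(3)[OF assms(4)]
    by simp
qed

lemma J_cong: "(\<And>a. a \<in> carrier A \<Longrightarrow> f a = g a) \<Longrightarrow> J A B f = J A B g"
  unfolding J_def using copy_arr_cong by metis

lemma J_id:
  assumes "sm A"
  shows "J A A id = Id kk (JO A)"
proof -
  have "(copy_alg A :: ('k, 'u) module) \<in> Ob (Alg R)" using sm_copy[OF assms] by (simp add: sm_def Alg_simps)
  then show ?thesis
    unfolding J_def JO_def using copy_arr_id[OF sm_small[OF assms]] is_functor_Id[OF j] by metis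
qed

lemma J_iso:
  assumes "sm A" "sm B" "nu_hom R A B f" "nu_hom R B A g"
    and "\<And>a. a \<in> carrier A \<Longrightarrow> g (f a) = a" "\<And>b. b \<in> carrier B \<Longrightarrow> f (g b) = b"
  shows "iso_arrow kk (J A B f)"
proof (rule kk.iso_arrowI[OF J_Hom J_Hom, of A B f g])
  show "J B A g \<cdot>\<^bsub>kk\<^esub> J A B f = Id kk (JO A)"
    using J_comp[OF assms(1,2,1,3,4)] J_id[OF assms(1)] J_cong[of A "g \<circ> f" id A] assms(5) by simp
  show "J A B f \<cdot>\<^bsub>kk\<^esub> J B A g = Id kk (JO B)"
    using J_comp[OF assms(2,1,2,4,3)] J_id[OF assms(2)] J_cong[of B "f \<circ> g" id B] assms(6) by simp
qed (use assms in auto)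

lemma J_bij:
  assumes "sm A" "sm B" "nu_hom R A B f" "bij_betw f (carrier A) (carrier B)"
  shows "iso_arrow kk (J A B f)"
  using assms(4) by (intro J_iso[OF assms(1-3) inverse_nu_hom[OF sm_alg[OF assms(1)] assms(3,4)]])
    (auto simp: bij_betw_def f_inv_into_f)

lemma iso_comp_square:
  assumes f: "f \<in> Hom kk A B" and g: "g \<in> Hom kk B D" and h: "h \<in> Hom kk A C" and k: "k \<in> Hom kk C D"
    and "g \<cdot>\<^bsub>kk\<^esub> f = k \<cdot>\<^bsub>kk\<^esub> h" and "iso_arrow kk f" "iso_arrow kk h" "iso_arrow kk k"
  shows "iso_arrow kk g"
  using kk.iso_arrow_Comp_cancel_right[OF f assms(6) g] kk.iso_arrow_Comp[OF h assms(7) k assms(8)] assms(5) by simp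

lemma iso_comp_square':
  assumes f: "f \<in> Hom kk A B" and g: "g \<in> Hom kk B D" and h: "h \<in> Hom kk A C" and k: "k \<in> Hom kk C D"
    and "g \<cdot>\<^bsub>kk\<^esub> f = k \<cdot>\<^bsub>kk\<^esub> h" and "iso_arrow kk g" "iso_arrow kk h" "iso_arrow kk k"
  shows "iso_arrow kk f"
  using kk.iso_arrow_Comp_cancel_left[OF f g assms(6)] kk.iso_arrow_Comp[OF h assms(7) k assms(8)] assms(5) by simp

text \<open>The translation between the arrows occurring in the invariance hypotheses and
  \<open>J\<close>: they differ by the image of the isomorphism from an algebra to its copy.\<close>

lemma into_copy_iso_imp:
  fixes A :: "('k, 'u) module"
  assumes "sm A" "sm B" "nu_hom R A B f"
  shows "iso_arrow kk (on_arr j (into_copy A B f)) \<longleftrightarrow> iso_arrow kk (J A B f)"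
proof -
  let ?c = "restrict (copy_map (carrier A)) (carrier A) :: 'u \<Rightarrow> 'u"
  let ?k = "(A, copy_alg A :: ('k, 'u) module, ?c)"
  note A = sm_alg[OF assms(1)] and cA = sm_alg[OF sm_copy[OF assms(1)]]
  note ch = nu_algebra_copy(2)[OF A small_universe]
  have k: "?k \<in> Hom (Alg R) A (copy_alg A)" using Alg_HomI[OF A cA ch] .
  have f: "(copy_arr A B f :: (('k, 'u) module, 'u) carr) \<in> Hom (Alg R) (copy_alg A) (copy_alg B)"
    using copy_arr_Hom[OF A sm_alg[OF assms(2)] small_universe sm_small[OF assms(2)] assms(3)] .
  interpret C: category "Alg R :: (('k, 'u) module, (('k, 'u) module, 'u) carr) cat" using j
      by (simp add: is_functor_def)
  have "iso_arrow (Alg R) ?k"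
  proof (rule C.iso_arrowI[OF k])
    let ?d = "inv_into (carrier A) (copy_map (carrier A)) :: 'u \<Rightarrow> 'u"
    let ?k' = "(copy_alg A :: ('k, 'u) module, A, restrict ?d (carrier (copy_alg A :: ('k, 'u) module)))"
    show "?k' \<in> Hom (Alg R) (copy_alg A) A"
      using Alg_HomI[OF cA A inverse_nu_hom[OF A ch bij_copy_map[OF small_universe]]] .
    show "?k' \<cdot>\<^bsub>Alg R\<^esub> ?k = Id (Alg R) A" "?k \<cdot>\<^bsub>Alg R\<^esub> ?k' = Id (Alg R) (copy_alg A)"
      using copy_map_inv[OF small_universe[of "carrier A"]]
      by (auto simp: Alg_simps compose_def fun_eq_iff copy_alg_simps(1))
  qed
  then have ik: "iso_arrow kk (on_arr j ?k)" by (rule iso_arrow_functor[OF j])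
  have eq: "on_arr j (into_copy A B f) = J A B f \<cdot>\<^bsub>kk\<^esub> on_arr j ?k"
    unfolding J_def into_copy_eq[where R = R] by (rule is_functor_Comp[OF j k f])
  show ?thesis unfolding eq
    using kk.iso_arrow_Comp[OF is_functor_Hom[OF j k] ik J_Hom[OF assms, unfolded JO_def]]
      kk.iso_arrow_Comp_cancel_right[OF is_functor_Hom[OF j k] ik J_Hom[OF assms, unfolded JO_def]] by blast
qed

text \<open>Both invariance properties are assumed for algebras inside the universe; they extend to all
  small algebras by passing to copies.\<close>

lemma J_poly_const_iso:
  assumes A: "sm A"
  shows "iso_arrow kk (J A (poly_alg A) (poly_const A))"
proof -
  let ?A = "copy_alg A :: ('k, 'u) module" and ?c = "copy_map (carrier A) :: _ \<Rightarrow> 'u"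
  note cA = sm_copy[OF A]
  note c = nu_algebra_copy(2)[OF sm_alg[OF A] sm_small[OF A]] and b = bij_copy_map[OF sm_small[OF A]]
  note d = inverse_nu_hom[OF sm_alg[OF A] c b]
  note k = nu_algebra.nu_hom_poly_const[OF sm_alg]
  have 1: "iso_arrow kk (J ?A (poly_alg ?A) (poly_const ?A))"
    using bspec[OF homotopy[unfolded homotopy_invariant_def], of ?A] sm_alg[OF cA]
    by (simp add: into_copy_iso_imp[OF cA sm_poly[OF cA] k[OF cA]] Alg_simps)
  note h = nu_hom_poly_map[OF sm_alg[OF A] sm_alg[OF cA] c]
  have 2: "iso_arrow kk (J (poly_alg A) (poly_alg ?A) ((\<circ>) ?c))"
  proof (rule J_iso[OF sm_poly[OF A] sm_poly[OF cA] h nu_hom_poly_map[OF sm_alg[OF cA] sm_alg[OF A] d]])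
    fix \<phi> assume "\<phi> \<in> carrier (poly_alg A)"
    then show "inv_into (carrier A) ?c \<circ> (?c \<circ> \<phi>) = \<phi>"
      using copy_map_inv[OF sm_small[OF A]] by (auto simp: poly_alg_def fin_fun_def)
  next
    fix \<phi> assume "\<phi> \<in> carrier (poly_alg ?A)"
    then have "\<phi> n \<in> ?c ` carrier A" for n by (auto simp: poly_alg_def fin_fun_def copy_alg_simps(1))
    then show "?c \<circ> (inv_into (carrier A) ?c \<circ> \<phi>) = \<phi>" by (auto simp: f_inv_into_f)
  qed
  have 3: "J (poly_alg A) (poly_alg ?A) ((\<circ>) ?c) \<cdot>\<^bsub>kk\<^esub> J A (poly_alg A) (poly_const A) =
      J ?A (poly_alg ?A) (poly_const ?A) \<cdot>\<^bsub>kk\<^esub> J A ?A ?c"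
    unfolding J_comp[OF A sm_poly[OF A] sm_poly[OF cA] k[OF A] h, symmetric]
      J_comp[OF A cA sm_poly[OF cA] c k[OF cA], symmetric]
    by (rule J_cong) (simp add: poly_const_natural[OF sm_alg[OF A] sm_alg[OF cA] c])
  show ?thesis
    by (rule iso_comp_square'[OF J_Hom[OF A sm_poly[OF A] k[OF A]] J_Hom[OF sm_poly[OF A] sm_poly[OF cA] h]
        J_Hom[OF A cA c] J_Hom[OF cA sm_poly[OF cA] k[OF cA]] 3 2 J_bij[OF A cA c b] 1])
qed

lemma J_corner_iso:
  assumes A: "sm A" and z: "z \<in> Z"
  shows "iso_arrow kk (J A (mat_alg Z A) (corner A z))"
proof -
  let ?A = "copy_alg A :: ('k, 'u) module" and ?c = "copy_map (carrier A) :: _ \<Rightarrow> 'u"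
  note cA = sm_copy[OF A]
  note c = nu_algebra_copy(2)[OF sm_alg[OF A] sm_small[OF A]] and b = bij_copy_map[OF sm_small[OF A]]
  note d = inverse_nu_hom[OF sm_alg[OF A] c b]
  note k = nu_hom_corner[OF sm_alg z]
  note mA = sm_mat[OF A Z_small] and mcA = sm_mat[OF cA Z_small]
  have 1: "iso_arrow kk (J ?A (mat_alg Z ?A) (corner ?A z))"
    using bspec[OF bspec[OF stable[unfolded matrix_stable_def], of ?A] z] sm_alg[OF cA]
    by (simp add: into_copy_iso_imp[OF cA mcA k[OF cA]] Alg_simps)
  note h = nu_hom_mat_map[OF sm_alg[OF A] sm_alg[OF cA] c, of Z]
  have 2: "iso_arrow kk (J (mat_alg Z A) (mat_alg Z ?A) ((\<circ>) ?c))"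
  proof (rule J_iso[OF mA mcA h nu_hom_mat_map[OF sm_alg[OF cA] sm_alg[OF A] d]])
    interpret A: nu_algebra R A by (rule sm_alg[OF A])
    interpret cA: nu_algebra R ?A by (rule sm_alg[OF cA])
    fix \<phi> assume "\<phi> \<in> carrier (mat_alg Z A)"
    then have "\<phi> n \<in> carrier A" for n using A.fin_fun_carrier by (simp add: mat_alg_simps)
    then show "inv_into (carrier A) ?c \<circ> (?c \<circ> \<phi>) = \<phi>"
      using copy_map_inv[OF sm_small[OF A]] by auto
  next
    interpret cA: nu_algebra R ?A by (rule sm_alg[OF cA])
    fix \<phi> assume "\<phi> \<in> carrier (mat_alg Z ?A)"
    then have "\<phi> n \<in> carrier ?A" for n using cA.fin_fun_carrier by (simp add: mat_alg_simps)
    then have "\<phi> n \<in> ?c ` carrier A" for n by (simp add: copy_alg_simps(1))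
    then show "?c \<circ> (inv_into (carrier A) ?c \<circ> \<phi>) = \<phi>" by (auto simp: f_inv_into_f)
  qed
  have 3: "J (mat_alg Z A) (mat_alg Z ?A) ((\<circ>) ?c) \<cdot>\<^bsub>kk\<^esub> J A (mat_alg Z A) (corner A z) =
      J ?A (mat_alg Z ?A) (corner ?A z) \<cdot>\<^bsub>kk\<^esub> J A ?A ?c"
    unfolding J_comp[OF A mA mcA k[OF A] h, symmetric] J_comp[OF A cA mcA c k[OF cA], symmetric]
    by (rule J_cong) (simp add: corner_natural[OF sm_alg[OF A] sm_alg[OF cA] c])
  show ?thesis
    by (rule iso_comp_square'[OF J_Hom[OF A mA k[OF A]] J_Hom[OF mA mcA h]
        J_Hom[OF A cA c] J_Hom[OF cA mcA k[OF cA]] 3 2 J_bij[OF A cA c b] 1])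
qed

section \<open>Homotopies and matrix units in kk\<close>

text \<open>Both evaluations are left inverse to the inclusion of constants, whose image in kk is
  invertible by homotopy invariance. Cancelling it shows that the evaluations have the same
  image.\<close>

lemma J_homotopy:
  assumes A: "sm A" and B: "sm B" and h: "nu_hom R A (poly_alg B) h"
  shows "J A B (\<lambda>a. h a 0) = J A B (\<lambda>a. eval_one B (h a))"
proof -
  interpret B: nu_algebra R B by (rule sm_alg[OF B])
  note P = sm_poly[OF B] and e = B.nu_hom_eval_zero B.nu_hom_eval_one and k = B.nu_hom_poly_const
  have "J B B ((\<lambda>\<phi>. \<phi> 0) \<circ> poly_const B) = J B B (eval_one B \<circ> poly_const B)"
    by (rule J_cong) (simp add: poly_const_fsingle B.eval_one_fsingle, simp add: fsingle_def)
  then have "J (poly_alg B) B (\<lambda>\<phi>. \<phi> 0) \<cdot>\<^bsub>kk\<^esub> J B (poly_alg B) (poly_const B) =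
      J (poly_alg B) B (eval_one B) \<cdot>\<^bsub>kk\<^esub> J B (poly_alg B) (poly_const B)"
    using J_comp[OF B P B k e(1)] J_comp[OF B P B k e(2)] by simp
  then have "J (poly_alg B) B (\<lambda>\<phi>. \<phi> 0) = J (poly_alg B) B (eval_one B)"
    by (rule kk.iso_arrow_epi[OF J_poly_const_iso[OF B] J_Hom[OF B P k] J_Hom[OF P B e(1)] J_Hom[OF P B e(2)]])
  then show ?thesis
    using J_comp[OF A P B h e(1)] J_comp[OF A P B h e(2)] by (simp add: o_def)
qed

text \<open>Condition \<open>x\<close> is the vanishing of (w - u)(a) (w - u)(b), under which the
  segment from \<open>u\<close> to \<open>w\<close> is a homomorphism to polynomials by
  \<open>line_mult\<close>.\<close>

lemma J_segment:
  assumes A: "sm A" and B: "sm B" and u: "nu_hom R A B u" and w: "nu_hom R A B w"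
    and x: "\<And>a b. \<lbrakk>a \<in> carrier A; b \<in> carrier A\<rbrakk> \<Longrightarrow>
      u a \<otimes>\<^bsub>B\<^esub> w b \<oplus>\<^bsub>B\<^esub> w a \<otimes>\<^bsub>B\<^esub> u b = u a \<otimes>\<^bsub>B\<^esub> u b \<oplus>\<^bsub>B\<^esub> w a \<otimes>\<^bsub>B\<^esub> w b"
  shows "J A B u = J A B w"
proof -
  interpret B: nu_algebra R B by (rule sm_alg[OF B])
  have h: "nu_hom R A (poly_alg B) (\<lambda>a. line B (u a) (w a))"
    using B.lin_map_line[OF nu_homD(1)[OF u] nu_homD(1)[OF w]] B.line_mult x nu_homD[OF u] nu_homD[OF w]
    by (intro nu_homI) simp_all
  have "J A B u = J A B (\<lambda>a. line B (u a) (w a) 0)" by (rule J_cong) (simp add: line_def)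
  also have "\<dots> = J A B (\<lambda>a. eval_one B (line B (u a) (w a)))" by (rule J_homotopy[OF A B h])
  also have "\<dots> = J A B w" by (rule J_cong) (use B.eval_one_line nu_homD(3)[OF u] nu_homD(3)[OF w] in simp)
  finally show ?thesis .
qed

text \<open>For \<open>\<R>\<close> the mixed products are only controlled on composable generators.\<close>

lemma J_segment_\<R>:
  assumes C: "lin_category R C" and A: "sm (\<R>_alg R C)" and B: "sm B"
    and u: "nu_hom R (\<R>_alg R C) B u" and w: "nu_hom R (\<R>_alg R C) B w"
    and x: "\<And>x y z f g. \<lbrakk>x \<in> LOb C; y \<in> LOb C; z \<in> LOb C; f \<in> carrier (LHom C x y); g \<in> carrier (LHom C y z)\<rbrakk> \<Longrightarrow>
      u (\<R>_gen R C y z g) \<otimes>\<^bsub>B\<^esub> w (\<R>_gen R C x y f) \<oplus>\<^bsub>B\<^esub> w (\<R>_gen R C y z g) \<otimes>\<^bsub>B\<^esub> u (\<R>_gen R C x y f) =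
      u (\<R>_gen R C y z g) \<otimes>\<^bsub>B\<^esub> u (\<R>_gen R C x y f) \<oplus>\<^bsub>B\<^esub> w (\<R>_gen R C y z g) \<otimes>\<^bsub>B\<^esub> w (\<R>_gen R C x y f)"
  shows "J (\<R>_alg R C) B u = J (\<R>_alg R C) B w"
proof -
  interpret B: nu_algebra R B by (rule sm_alg[OF B])
  interpret C: lin_category R C by fact
  let ?A = "\<R>_alg R C"
  note P = nu_algebra_poly[OF sm_alg[OF B]]
  define \<theta> where "\<theta> x y f = line B (u (\<R>_gen R C x y f)) (w (\<R>_gen R C x y f))" for x y f
  have l: "lin_map R (LHom C x y) (poly_alg B) (\<theta> x y)" if "x \<in> LOb C" "y \<in> LOb C" for x y
    using B.lin_map_line[OF lin_map_comp[OF C.lin_map_\<R>_gen[OF that] nu_homD(1)[OF u]]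
        lin_map_comp[OF C.lin_map_\<R>_gen[OF that] nu_homD(1)[OF w]]] by (simp add: \<theta>_def[abs_def])
  have m: "\<theta> x z (LComp C x y z g f) = \<theta> y z g \<otimes>\<^bsub>poly_alg B\<^esub> \<theta> x y f"
    if o: "x \<in> LOb C" "y \<in> LOb C" "z \<in> LOb C" "f \<in> carrier (LHom C x y)" "g \<in> carrier (LHom C y z)" for x y z f g
  proof -
    note c = C.\<R>_gen_closed[OF o(1,2,4)] C.\<R>_gen_closed[OF o(2,3,5)]
    show ?thesis unfolding \<theta>_def C.\<R>_gen_comp[OF o, symmetric]
      using B.line_mult[OF _ _ _ _ x[OF o]] nu_homD(3)[OF u] nu_homD(3)[OF w] c nu_homD(2)[OF u] nu_homD(2)[OF w]
          by simp
  qed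
  obtain h where h: "nu_hom R ?A (poly_alg B) h"
    "\<And>x y f. \<lbrakk>x \<in> LOb C; y \<in> LOb C; f \<in> carrier (LHom C x y)\<rbrakk> \<Longrightarrow> h (\<R>_gen R C x y f) = \<theta> x y f"
    using C.\<R>_lift[OF P, of \<theta>] l m by blast
  note e = nu_hom_comp[OF h(1) B.nu_hom_eval_zero] nu_hom_comp[OF h(1) B.nu_hom_eval_one]
  have "h a 0 = u a" if "a \<in> carrier ?A" for a
    using C.\<R>_hom_eqI[OF sm_alg[OF B] e(1) u _ that] h(2) by (simp add: \<theta>_def line_def)
  moreover have "eval_one B (h a) = w a" if "a \<in> carrier ?A" for a
  proof -
    have "eval_one B (\<theta> x y f) = w (\<R>_gen R C x y f)" if "x \<in> LOb C" "y \<in> LOb C" "f \<in> carrier (LHom C x y)" for x y f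
      unfolding \<theta>_def using B.eval_one_line nu_homD(3)[OF u] nu_homD(3)[OF w] C.\<R>_gen_closed[OF that] by simp
    then show ?thesis using C.\<R>_hom_eqI[OF sm_alg[OF B] e(2) w _ that] h(2) by simp
  qed
  ultimately show ?thesis
    using J_homotopy[OF A B h(1)] J_cong[of ?A "\<lambda>a. h a 0" u B] J_cong[of ?A "\<lambda>a. eval_one B (h a)" w B] by simp
qed

text \<open>Two corners of a \<open>2 \<times> 2\<close> system of matrix units are joined by three segments, through the sums
  of the two columns.\<close>

lemma J_matrix_units:
  fixes a :: "bool \<Rightarrow> bool \<Rightarrow> 'b \<Rightarrow> 'c"
  assumes A: "sm A" and B: "sm B" and l: "\<And>i k. lin_map R A B (a i k)"
    and m: "\<And>i k k' n x y. \<lbrakk>x \<in> carrier A; y \<in> carrier A\<rbrakk> \<Longrightarrow>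
      a i k x \<otimes>\<^bsub>B\<^esub> a k' n y = (if k = k' then a i n (x \<otimes>\<^bsub>A\<^esub> y) else \<zero>\<^bsub>B\<^esub>)"
  shows "J A B (a False False) = J A B (a True True)"
proof -
  interpret A: nu_algebra R A by (rule sm_alg[OF A])
  interpret B: nu_algebra R B by (rule sm_alg[OF B])
  define c where "c n x = a False n x \<oplus>\<^bsub>B\<^esub> a True n x" for n x
  note cl = lin_mapD(1)[OF l]
  have mu: "c i x \<otimes>\<^bsub>B\<^esub> c n y = c n (x \<otimes>\<^bsub>A\<^esub> y)" "a n n x \<otimes>\<^bsub>B\<^esub> c n y = a n n (x \<otimes>\<^bsub>A\<^esub> y)"
    "c n x \<otimes>\<^bsub>B\<^esub> a n n y = c n (x \<otimes>\<^bsub>A\<^esub> y)" "a n n x \<otimes>\<^bsub>B\<^esub> a n n y = a n n (x \<otimes>\<^bsub>A\<^esub> y)"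
    if "x \<in> carrier A" "y \<in> carrier A" for x y i n
    using B.matrix_unit_columns[where p = "\<lambda>i k. a i k y" and q = "\<lambda>i k. a i k x" and r = "\<lambda>i k. a i k (x \<otimes>\<^bsub>A\<^esub> y)"]
      that cl m by (simp_all add: c_def A.mult_closed)
  have hc: "nu_hom R A B (c n)" for n
    using mu(1) lin_mapD[OF l] by (intro nu_homI lin_mapI) (simp_all add: c_def B.smult_r_distr B.M.a_ac)
  have ha: "nu_hom R A B (a n n)" for n using mu(4) l by (intro nu_homI) simp_all
  have ac: "J A B (a n n) = J A B (c n)" for n
    by (rule J_segment[OF A B ha hc]) (use mu in simp)
  have "J A B (c False) = J A B (c True)"
    by (rule J_segment[OF A B hc hc]) (use mu nu_homD(3)[OF hc] in \<open>simp add: A.mult_closed B.M.a_comm\<close>)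
  then show ?thesis using ac by simp
qed

text \<open>The same three segments as in \<open>J_matrix_units\<close>, with the system given on
  arrows of \<open>C\<close>. The column sums respect composition of arrows by
  \<open>matrix_unit_columns\<close> and thus extend to homomorphisms \<open>h n\<close> out of
  \<open>\<R>(C)\<close>.\<close>

lemma J_matrix_units_\<R>:
  fixes a :: "bool \<Rightarrow> bool \<Rightarrow> 'c \<Rightarrow> 'c \<Rightarrow> 'b \<Rightarrow> 'e" and C :: "('k, 'c, 'b) lincat"
  assumes C: "lin_category R C" and A: "sm (\<R>_alg R C)" and B: "sm B"
    and l: "\<And>i k x y. \<lbrakk>x \<in> LOb C; y \<in> LOb C\<rbrakk> \<Longrightarrow> lin_map R (LHom C x y) B (a i k x y)"
    and m: "\<And>i k k' n x y z f g. \<lbrakk>x \<in> LOb C; y \<in> LOb C; z \<in> LOb C; f \<in> carrier (LHom C x y); g \<in> carrier (LHom C y z)\<rbrakk>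
        \<Longrightarrow>
      a i k y z g \<otimes>\<^bsub>B\<^esub> a k' n x y f = (if k = k' then a i n x z (LComp C x y z g f) else \<zero>\<^bsub>B\<^esub>)"
    and u: "nu_hom R (\<R>_alg R C) B u"
      "\<And>x y f. \<lbrakk>x \<in> LOb C; y \<in> LOb C; f \<in> carrier (LHom C x y)\<rbrakk> \<Longrightarrow> u (\<R>_gen R C x y f) = a False False x y f"
    and w: "nu_hom R (\<R>_alg R C) B w"
      "\<And>x y f. \<lbrakk>x \<in> LOb C; y \<in> LOb C; f \<in> carrier (LHom C x y)\<rbrakk> \<Longrightarrow> w (\<R>_gen R C x y f) = a True True x y f"
  shows "J (\<R>_alg R C) B u = J (\<R>_alg R C) B w"
proof -
  interpret C: lin_category R C by fact
  interpret B: nu_algebra R B by (rule sm_alg[OF B])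
  define c where "c n x y f = a False n x y f \<oplus>\<^bsub>B\<^esub> a True n x y f" for n x y f
  have mu: "c i y z g \<otimes>\<^bsub>B\<^esub> c n x y f = c n x z (LComp C x y z g f)"
    "a n n y z g \<otimes>\<^bsub>B\<^esub> c n x y f = a n n x z (LComp C x y z g f)"
    "c n y z g \<otimes>\<^bsub>B\<^esub> a n n x y f = c n x z (LComp C x y z g f)"
    "a n n y z g \<otimes>\<^bsub>B\<^esub> a n n x y f = a n n x z (LComp C x y z g f)"
    "c n x z (LComp C x y z g f) \<in> carrier B"
    if o: "x \<in> LOb C" "y \<in> LOb C" "z \<in> LOb C" "f \<in> carrier (LHom C x y)" "g \<in> carrier (LHom C y z)" for x y z f g i n
    using B.matrix_unit_columns[where p = "\<lambda>i k. a i k x y f" and q = "\<lambda>i k. a i k y z g"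
          and r = "\<lambda>i k. a i k x z (LComp C x y z g f)"]
      lin_mapD(1)[OF l[OF o(1,2)] o(4)] lin_mapD(1)[OF l[OF o(2,3)] o(5)]
      lin_mapD(1)[OF l[OF o(1,3)] C.LComp_closed[OF o]] m[OF o] by (simp_all add: c_def)
  have lc: "lin_map R (LHom C x y) B (c n x y)" if "x \<in> LOb C" "y \<in> LOb C" for x y n
    using lin_mapD[OF l[OF that]] by (intro lin_mapI) (simp_all add: c_def B.smult_r_distr B.M.a_ac)
  have ex: "\<exists>h. nu_hom R (\<R>_alg R C) B h \<and>
      (\<forall>x\<in>LOb C. \<forall>y\<in>LOb C. \<forall>f\<in>carrier (LHom C x y). h (\<R>_gen R C x y f) = c n x y f)" for n
    using C.\<R>_lift[OF sm_alg[OF B], of "c n"] lc mu(1) by metis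
  obtain h where h: "\<And>n. nu_hom R (\<R>_alg R C) B (h n)"
    "\<And>n x y f. \<lbrakk>x \<in> LOb C; y \<in> LOb C; f \<in> carrier (LHom C x y)\<rbrakk> \<Longrightarrow> h n (\<R>_gen R C x y f) = c n x y f"
  proof -
    from ex have "\<forall>n. \<exists>h. nu_hom R (\<R>_alg R C) B h \<and>
      (\<forall>x\<in>LOb C. \<forall>y\<in>LOb C. \<forall>f\<in>carrier (LHom C x y). h (\<R>_gen R C x y f) = c n x y f)" by blast
    then show ?thesis using that unfolding choice_iff by blast
  qed
  have "J (\<R>_alg R C) B u = J (\<R>_alg R C) B (h False)"
    by (rule J_segment_\<R>[OF C A B u(1) h(1)]) (simp add: u(2) h(2) mu)
  also have "\<dots> = J (\<R>_alg R C) B (h True)"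
    by (rule J_segment_\<R>[OF C A B h(1) h(1)]) (simp add: h(2) mu B.M.a_comm)
  also have "\<dots> = J (\<R>_alg R C) B w"
    by (rule J_segment_\<R>[OF C A B w(1) h(1), symmetric]) (simp add: w(2) h(2) mu)
  finally show ?thesis .
qed

section \<open>Corners in matrix algebras of every small size\<close>

text \<open>The free index \<open>z\<close> leaves room for one more corner beside the copy of
  \<open>X\<close>, so that both can be compared inside one matrix algebra over
  \<open>Z\<close>.\<close>

lemma embed_Z:
  assumes "X \<lesssim> Z"
  obtains z e where "z \<in> Z" "inj_on e X" "e ` X \<subseteq> Z - {z}"
proof -
  obtain z where z: "z \<in> Z" using Z_infinite by fastforce
  have "Z \<approx> Z - {z}"
    using infinite_insert_eqpoll[of "Z - {z}" z] Z_infinite z by (simp add: insert_absorb eqpoll_sym)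
  then have "X \<lesssim> Z - {z}" using assms lepoll_trans2 by blast
  with z that show ?thesis by (auto simp: lepoll_def)
qed

text \<open>Two-of-six for the maps from \<open>D\<close> to matrices over \<open>X\<close>, on to
  matrices over \<open>Z\<close> by relabelling along \<open>e\<close>, and then to matrices over
  \<open>Z\<close> with entries in matrices over \<open>X\<close> by the corner \<open>x0\<close> in
  each entry. The first two compose to a corner over \<open>Z\<close>, invertible by stability. The
  last two compose to a map that matrix units join to the corner at \<open>z\<close>.\<close>

lemma J_corner_iso_small:
  fixes D :: "('k, 'd) module" and X :: "'y set"
  assumes D: "sm D" and X: "X \<lesssim> Z" and x0: "x0 \<in> X"
  shows "iso_arrow kk (J D (mat_alg X D) (corner D x0))"
proof -
  obtain z e where z: "z \<in> Z" and e: "inj_on e X" "e ` X \<subseteq> Z - {z}" using embed_Z[OF X] .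
  have eZ: "e x \<in> Z" "e x \<noteq> z" if "x \<in> X" for x using that e(2) by auto
  have ee: "e x = e y \<longleftrightarrow> x = y" if "x \<in> X" "y \<in> X" for x y using that e(1) by (auto dest: inj_onD)
  let ?M = "mat_alg X D"
  have M: "sm ?M" using sm_mat[OF D lepoll_trans[OF X Z_small]] .
  note ZD = sm_mat[OF D Z_small] and ZM = sm_mat[OF M Z_small]
  interpret D: nu_algebra R D by (rule sm_alg[OF D])
  interpret M: nu_algebra R ?M by (rule sm_alg[OF M])
  interpret ZD: nu_algebra R "mat_alg Z D" by (rule sm_alg[OF ZD])
  interpret ZM: nu_algebra R "mat_alg Z ?M" by (rule sm_alg[OF ZM])
  note mm = mat_fsingle_mult[OF sm_alg[OF D], where X = X]
  have \<rho>': "lin_map R D (mat_alg Z D) (fsingle D (e x, e y))" if "x \<in> X" "y \<in> X" for x y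
    using lin_map_fsingle_mat[OF sm_alg[OF D] eZ(1) eZ(1)] that by blast
  have "\<exists>\<rho>. lin_map R ?M (mat_alg Z D) \<rho> \<and>
      (\<forall>x\<in>X. \<forall>y\<in>X. \<forall>a\<in>carrier D. \<rho> (fsingle D (x, y) a) = fsingle D (e x, e y) a)"
    by (rule lin_map_mat_ext[OF sm_alg[OF D] sm_alg[OF ZD]]) (rule \<rho>')
  then obtain \<rho> where \<rho>l: "lin_map R ?M (mat_alg Z D) \<rho>"
    and \<rho>s: "\<And>x y a. \<lbrakk>x \<in> X; y \<in> X; a \<in> carrier D\<rbrakk> \<Longrightarrow> \<rho> (fsingle D (x, y) a) = fsingle D (e x, e y) a"
    by blast
  have \<rho>h: "nu_hom R ?M (mat_alg Z D) \<rho>"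
  proof (rule nu_homI[OF \<rho>l], rule mat_mult_eqI[OF sm_alg[OF D] sm_alg[OF ZD] \<rho>l \<rho>l \<rho>l])
    fix x y z w a b assume "x \<in> X" "y \<in> X" "z \<in> X" "w \<in> X" "a \<in> carrier D" "b \<in> carrier D"
    then show "\<rho> (fsingle D (x, y) a \<otimes>\<^bsub>?M\<^esub> fsingle D (z, w) b) =
        \<rho> (fsingle D (x, y) a) \<otimes>\<^bsub>mat_alg Z D\<^esub> \<rho> (fsingle D (z, w) b)"
      using lin_map_zero[OF M.module_axioms ZD.module_axioms \<rho>l]
      by (simp add: mm \<rho>s mat_fsingle_mult[OF sm_alg[OF D]] eZ ee D.mult_closed)
  qed
  note ch = nu_hom_corner[OF sm_alg[OF D] x0]
  note hc = nu_hom_mat_map[OF sm_alg[OF D] sm_alg[OF M] ch, of Z]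
  \<comment> \<open>Two injections of \<open>X\<close> into \<open>Z \<times> X\<close> with
    disjoint images: for \<open>i\<close> false, x goes to (z, x); for \<open>i\<close> true, to (e
    x, x0). The matrix units \<open>a i k\<close> relabel rows along the first choice
    \<open>i\<close> and columns along the second choice \<open>k\<close>; the diagonal ones are the
    corner at \<open>z\<close> and the composite of \<open>\<rho>\<close> with the entrywise corner
    at \<open>x0\<close>.\<close>
  define pos where "pos i x = (if i then e x else z)" for i x
  define idx where "idx i x = (if i then x0 else x)" for i and x :: 'y
  have pos: "pos i x \<in> Z" "pos i x = pos k y \<longleftrightarrow> i = k \<and> (i \<longrightarrow> x = y)" if "x \<in> X" "y \<in> X" for i k x y
    using eZ[OF that(1)] eZ[OF that(2)] ee[OF that] z by (auto simp: pos_def)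
  have idx: "idx i x \<in> X" if "x \<in> X" for i x using x0 that by (simp add: idx_def)
  define \<theta> where "\<theta> i k x y d = fsingle ?M (pos i x, pos k y) (fsingle D (idx i x, idx k y) d)" for i k x y d
  have \<theta>l: "lin_map R D (mat_alg Z ?M) (\<theta> i k x y)" if "x \<in> X" "y \<in> X" for i k x y
    using lin_map_comp[OF lin_map_fsingle_mat[OF sm_alg[OF D] idx[OF that(1)] idx[OF that(2)]]
        lin_map_fsingle_mat[OF sm_alg[OF M] pos(1)[OF that(1,1)] pos(1)[OF that(2,2)]]]
    by (simp add: \<theta>_def[abs_def] o_def)
  have "\<exists>f. lin_map R ?M (mat_alg Z ?M) f \<and> (\<forall>x\<in>X. \<forall>y\<in>X. \<forall>d\<in>carrier D. f (fsingle D (x, y) d) = \<theta> i k x y d)" for i k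
    by (rule lin_map_mat_ext[OF sm_alg[OF D] sm_alg[OF ZM] \<theta>l])
  then obtain a where al: "\<And>i k. lin_map R ?M (mat_alg Z ?M) (a i k)"
    and as: "\<And>i k x y d. \<lbrakk>x \<in> X; y \<in> X; d \<in> carrier D\<rbrakk> \<Longrightarrow>
      a i k (fsingle D (x, y) d) = fsingle ?M (pos i x, pos k y) (fsingle D (idx i x, idx k y) d)"
    unfolding \<theta>_def by metis
  have am: "a i k M1 \<otimes>\<^bsub>mat_alg Z ?M\<^esub> a k' n M2 = (if k = k' then a i n (M1 \<otimes>\<^bsub>?M\<^esub> M2) else \<zero>\<^bsub>mat_alg Z ?M\<^esub>)"
    if "M1 \<in> carrier ?M" "M2 \<in> carrier ?M" for i k k' n M1 M2
  proof -
    \<comment> \<open>The expected product is expressed by one linear map in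
      \<open>M1 \<otimes> M2\<close>, so that \<open>mat_mult_eqI\<close> handles equal and
      different indices together.\<close>
    define h where "h N = (if k = k' then a i n N else \<zero>\<^bsub>mat_alg Z ?M\<^esub>)" for N
    have h: "lin_map R ?M (mat_alg Z ?M) h"
      using al[of i n] ZM.smult_r_null by (cases "k = k'") (auto simp: h_def[abs_def] lin_map_def)
    have h0: "h \<zero>\<^bsub>?M\<^esub> = \<zero>\<^bsub>mat_alg Z ?M\<^esub>" using lin_map_zero[OF M.module_axioms ZM.module_axioms h] .
    have "h (M1 \<otimes>\<^bsub>?M\<^esub> M2) = a i k M1 \<otimes>\<^bsub>mat_alg Z ?M\<^esub> a k' n M2"
    proof (rule mat_mult_eqI[OF sm_alg[OF D] sm_alg[OF ZM] al al h _ that])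
      fix x y x' y' c b assume pq: "x \<in> X" "y \<in> X" "x' \<in> X" "y' \<in> X" "c \<in> carrier D" "b \<in> carrier D"
      \<comment> \<open>For \<open>k = k'\<close> the inner indices y and x' are compared by the
        outer matrices if \<open>k\<close> is true, since then the inner positions are both x0, and
        by the inner matrices if \<open>k\<close> is false, since then the outer positions are both
        z.\<close>
      have *: "a i k (fsingle D (x, y) c) \<otimes>\<^bsub>mat_alg Z ?M\<^esub> a k' n (fsingle D (x', y') b) =
         (if k = k' \<and> (k \<longrightarrow> y = x') then fsingle ?M (pos i x, pos n y')
            (fsingle D (idx i x, idx k y) c \<otimes>\<^bsub>?M\<^esub> fsingle D (idx k' x', idx n y') b) else \<zero>\<^bsub>mat_alg Z ?M\<^esub>)"
        using pq by (simp add: as mat_fsingle_mult[OF sm_alg[OF M]] pos idx fsingle_mat_closed[OF sm_alg[OF D]])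
      show "h (fsingle D (x, y) c \<otimes>\<^bsub>?M\<^esub> fsingle D (x', y') b) =
          a i k (fsingle D (x, y) c) \<otimes>\<^bsub>mat_alg Z ?M\<^esub> a k' n (fsingle D (x', y') b)"
        unfolding * using pq h0
        by (auto simp: mm idx x0 as D.mult_closed h_def idx_def mat_alg_simps(3)[of Z ?M, symmetric])
    qed
    then show ?thesis by (simp add: h_def)
  qed
  have "J ?M (mat_alg Z ?M) (a False False) = J ?M (mat_alg Z ?M) (a True True)"
    by (rule J_matrix_units[where a = a, OF M ZM]) (use al am in auto)
  moreover have "J ?M (mat_alg Z ?M) (a False False) = J ?M (mat_alg Z ?M) (corner ?M z)"
  proof (rule J_cong)
    fix N assume "N \<in> carrier ?M"
    then show "a False False N = corner ?M z N"
      by (rule mat_lin_eqI[OF sm_alg[OF D] sm_alg[OF ZM] al nu_homD(1)[OF nu_hom_corner[OF sm_alg[OF M] z]], rotated])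
        (simp add: as corner_fsingle pos_def idx_def)
  qed
  moreover have "J ?M (mat_alg Z ?M) (a True True) = J ?M (mat_alg Z ?M) ((\<circ>) (corner D x0) \<circ> \<rho>)"
  proof (rule J_cong)
    fix N assume "N \<in> carrier ?M"
    then show "a True True N = ((\<circ>) (corner D x0) \<circ> \<rho>) N"
      by (rule mat_lin_eqI[OF sm_alg[OF D] sm_alg[OF ZM] al lin_map_comp[OF \<rho>l nu_homD(1)[OF hc]], rotated])
        (simp add: as \<rho>s pos_def idx_def comp_fsingle[OF D.module_axioms M.module_axioms nu_homD(1)[OF ch]]
            corner_fsingle)
  qed
  ultimately have "iso_arrow kk (J ?M (mat_alg Z ?M) ((\<circ>) (corner D x0) \<circ> \<rho>))"
    using J_corner_iso[OF M z] by simp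
  then have 1: "iso_arrow kk (J (mat_alg Z D) (mat_alg Z ?M) ((\<circ>) (corner D x0)) \<cdot>\<^bsub>kk\<^esub> J ?M (mat_alg Z D) \<rho>)"
    using J_comp[OF M ZD ZM \<rho>h hc] by simp
  have "J D (mat_alg Z D) (\<rho> \<circ> corner D x0) = J D (mat_alg Z D) (corner D (e x0))"
    by (rule J_cong) (simp add: corner_fsingle \<rho>s x0)
  then have 2: "iso_arrow kk (J ?M (mat_alg Z D) \<rho> \<cdot>\<^bsub>kk\<^esub> J D ?M (corner D x0))"
    using J_comp[OF D M ZD ch \<rho>h] J_corner_iso[OF D eZ(1)[OF x0]] by simp
  show ?thesis
    by (rule kk.iso_arrow_two_of_six[OF J_Hom[OF D M ch] J_Hom[OF M ZD \<rho>h] J_Hom[OF ZD ZM hc] 2 1])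
qed

end

section \<open>The linear category \<open>B \<rtimes> G/H\<close>\<close>

lemma (in group) l_inv_assoc: "\<lbrakk>x \<in> carrier G; y \<in> carrier G\<rbrakk> \<Longrightarrow> inv x \<otimes> (x \<otimes> y) = y"
  by (simp add: m_assoc[symmetric])

lemma (in group) r_inv_assoc: "\<lbrakk>x \<in> carrier G; y \<in> carrier G\<rbrakk> \<Longrightarrow> x \<otimes> (inv x \<otimes> y) = y"
  by (simp add: m_assoc[symmetric])

locale crossed_coset = g_algebra R G B + subgroup H G
  for R :: "('k, 'r) ring_scheme" and G :: "('g, 's) monoid_scheme" and B :: "('k, 'a, 'g) galg" and H
begin

abbreviation "cosets \<equiv> (\<lambda>u. u <#\<^bsub>G\<^esub> H) ` carrier G"

abbreviation "quo x y \<equiv> y <#>\<^bsub>G\<^esub> set_inv\<^bsub>G\<^esub> x"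

lemma crossed_cat_simps:
  "LOb (crossed_cat G H B) = cosets"
  "LHom (crossed_cat G H B) x y = fs_alg (quo x y) B undefined"
  "LComp (crossed_cat G H B) x y z = crossed_mult G B"
  by (simp_all add: crossed_cat_def)

lemma quo_iff: "k \<in> quo x y \<longleftrightarrow> (\<exists>a\<in>x. \<exists>b\<in>y. k = b \<otimes>\<^bsub>G\<^esub> inv\<^bsub>G\<^esub> a)"
  unfolding set_mult_def SET_INV_def by blast

lemma coset_iff: "k \<in> u <#\<^bsub>G\<^esub> H \<longleftrightarrow> (\<exists>h\<in>H. k = u \<otimes>\<^bsub>G\<^esub> h)"
  unfolding l_coset_def by blast

lemma coset_carrier: "\<lbrakk>x \<in> cosets; a \<in> x\<rbrakk> \<Longrightarrow> a \<in> carrier G"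
  by (auto simp: coset_iff)

lemma coset_self: "u \<in> carrier G \<Longrightarrow> u \<in> u <#\<^bsub>G\<^esub> H"
  using one_closed by (auto simp: coset_iff intro!: bexI[of _ "\<one>\<^bsub>G\<^esub>"])

lemma coset_mult: "\<lbrakk>x \<in> cosets; a \<in> x; h \<in> H\<rbrakk> \<Longrightarrow> a \<otimes>\<^bsub>G\<^esub> h \<in> x"
  by (auto simp: coset_iff m_assoc intro!: bexI[of _ "_ \<otimes>\<^bsub>G\<^esub> _"])

lemma coset_diff: "\<lbrakk>x \<in> cosets; a \<in> x; b \<in> x\<rbrakk> \<Longrightarrow> inv\<^bsub>G\<^esub> a \<otimes>\<^bsub>G\<^esub> b \<in> H"
proof -
  assume "x \<in> cosets" "a \<in> x" "b \<in> x"
  then obtain u h k where "u \<in> carrier G" "h \<in> H" "k \<in> H" "a = u \<otimes>\<^bsub>G\<^esub> h" "b = u \<otimes>\<^bsub>G\<^esub> k"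
    by (auto simp: coset_iff)
  then have "inv\<^bsub>G\<^esub> a \<otimes>\<^bsub>G\<^esub> b = inv\<^bsub>G\<^esub> h \<otimes>\<^bsub>G\<^esub> k"
    by (simp add: inv_mult_group m_assoc l_inv_assoc)
  then show ?thesis using \<open>h \<in> H\<close> \<open>k \<in> H\<close> by simp
qed

lemma quo_carrier:
  assumes "x \<in> cosets" "y \<in> cosets"
  shows "quo x y \<subseteq> carrier G"
proof
  fix k assume "k \<in> quo x y"
  then obtain a b where "a \<in> x" "b \<in> y" "k = b \<otimes>\<^bsub>G\<^esub> inv\<^bsub>G\<^esub> a" unfolding quo_iff by blast
  then show "k \<in> carrier G" using coset_carrier[OF assms(1), of a] coset_carrier[OF assms(2), of b] by simp
qed

lemma quo_mult:
  assumes "x \<in> cosets" "y \<in> cosets" "z \<in> cosets"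
  shows "quo y z <#>\<^bsub>G\<^esub> quo x y \<subseteq> quo x z"
proof
  fix k assume "k \<in> quo y z <#>\<^bsub>G\<^esub> quo x y"
  then obtain a b b' c where k: "a \<in> x" "b \<in> y" "b' \<in> y" "c \<in> z"
    "k = (c \<otimes>\<^bsub>G\<^esub> inv\<^bsub>G\<^esub> b') \<otimes>\<^bsub>G\<^esub> (b \<otimes>\<^bsub>G\<^esub> inv\<^bsub>G\<^esub> a)"
    unfolding set_mult_def[of G "quo y z"] by (auto simp: quo_iff)
  note G = coset_carrier[OF assms(1) k(1)] coset_carrier[OF assms(2) k(2)] coset_carrier[OF assms(2) k(3)]
    coset_carrier[OF assms(3) k(4)]
  have "c \<otimes>\<^bsub>G\<^esub> (inv\<^bsub>G\<^esub> b' \<otimes>\<^bsub>G\<^esub> b) \<in> z" using coset_mult[OF assms(3) k(4)] coset_diff[OF assms(2) k(3,2)] by blast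
  moreover have "k = c \<otimes>\<^bsub>G\<^esub> (inv\<^bsub>G\<^esub> b' \<otimes>\<^bsub>G\<^esub> b) \<otimes>\<^bsub>G\<^esub> inv\<^bsub>G\<^esub> a" using k(5) G by (simp add: m_assoc)
  ultimately show "k \<in> quo x z" using k(1) unfolding quo_iff by blast
qed

text \<open>The endomorphisms of the object uH are supported on the set product of uH with its
  inverse. Its equality with the conjugate subgroup makes \<open>B \<rtimes> uHu^-1\<close> the
  endomorphism algebra of that object on the nose.\<close>

lemma conj_subgroup_eq_quo:
  assumes u: "u \<in> carrier G"
  shows "conj_subgroup G H u = quo (u <#\<^bsub>G\<^esub> H) (u <#\<^bsub>G\<^esub> H)"
proof
  show "conj_subgroup G H u \<subseteq> quo (u <#\<^bsub>G\<^esub> H) (u <#\<^bsub>G\<^esub> H)"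
  proof
    fix k assume "k \<in> conj_subgroup G H u"
    then obtain b where "b \<in> u <#\<^bsub>G\<^esub> H" "k = b \<otimes>\<^bsub>G\<^esub> inv\<^bsub>G\<^esub> u" unfolding conj_subgroup_def r_coset_def by blast
    then show "k \<in> quo (u <#\<^bsub>G\<^esub> H) (u <#\<^bsub>G\<^esub> H)" unfolding quo_iff using coset_self[OF u] by blast
  qed
  show "quo (u <#\<^bsub>G\<^esub> H) (u <#\<^bsub>G\<^esub> H) \<subseteq> conj_subgroup G H u"
  proof
    fix k assume "k \<in> quo (u <#\<^bsub>G\<^esub> H) (u <#\<^bsub>G\<^esub> H)"
    then obtain h h' where h: "h \<in> H" "h' \<in> H" "k = u \<otimes>\<^bsub>G\<^esub> h \<otimes>\<^bsub>G\<^esub> inv\<^bsub>G\<^esub> (u \<otimes>\<^bsub>G\<^esub> h')"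
      by (auto simp: quo_iff coset_iff)
    then have "k = u \<otimes>\<^bsub>G\<^esub> (h \<otimes>\<^bsub>G\<^esub> inv\<^bsub>G\<^esub> h') \<otimes>\<^bsub>G\<^esub> inv\<^bsub>G\<^esub> u" using u by (simp add: inv_mult_group m_assoc)
    moreover have "h \<otimes>\<^bsub>G\<^esub> inv\<^bsub>G\<^esub> h' \<in> H" using h by simp
    ultimately show "k \<in> conj_subgroup G H u"
      unfolding conj_subgroup_def r_coset_def using coset_iff[of "u \<otimes>\<^bsub>G\<^esub> (h \<otimes>\<^bsub>G\<^esub> inv\<^bsub>G\<^esub> h')" u] by auto
  qed
qed

lemma conj_subgroup_subgroup:
  assumes u: "u \<in> carrier G"
  shows "subgroup (conj_subgroup G H u) G"
proof -
  let ?x = "u <#\<^bsub>G\<^esub> H"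
  have x: "?x \<in> cosets" using u by blast
  show ?thesis unfolding conj_subgroup_eq_quo[OF u]
  proof (rule subgroupI)
    show "quo ?x ?x \<subseteq> carrier G" using quo_carrier[OF x x] .
    have "u \<otimes>\<^bsub>G\<^esub> inv\<^bsub>G\<^esub> u \<in> quo ?x ?x" unfolding quo_iff using coset_self[OF u] by blast
    then show "quo ?x ?x \<noteq> {}" by blast
    fix k assume k: "k \<in> quo ?x ?x"
    then obtain a b where ab: "a \<in> ?x" "b \<in> ?x" "k = b \<otimes>\<^bsub>G\<^esub> inv\<^bsub>G\<^esub> a" unfolding quo_iff by blast
    have "inv\<^bsub>G\<^esub> k = a \<otimes>\<^bsub>G\<^esub> inv\<^bsub>G\<^esub> b"
      unfolding ab(3) using coset_carrier[OF x ab(1)] coset_carrier[OF x ab(2)] by (simp add: inv_mult_group)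
    with ab(1,2) show "inv\<^bsub>G\<^esub> k \<in> quo ?x ?x" unfolding quo_iff by blast
    fix l assume "l \<in> quo ?x ?x"
    with k have "k \<otimes>\<^bsub>G\<^esub> l \<in> quo ?x ?x <#>\<^bsub>G\<^esub> quo ?x ?x" unfolding set_mult_def[of G "quo ?x ?x"] by blast
    then show "k \<otimes>\<^bsub>G\<^esub> l \<in> quo ?x ?x" by (rule subsetD[OF quo_mult[OF x x x]])
  qed
qed

lemma conj_subgroup_one: "conj_subgroup G H \<one>\<^bsub>G\<^esub> = H"
proof -
  have "\<one>\<^bsub>G\<^esub> <#\<^bsub>G\<^esub> H = H" unfolding l_coset_def by auto
  then show ?thesis unfolding conj_subgroup_def r_coset_def by auto
qed

text \<open>Every Hom module of \<open>crossed_cat\<close> consists of functions on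
  \<open>carrier G\<close> with restricted support, and composition is the product of
  \<open>B \<rtimes> G\<close>. Identities between composites are therefore proved in
  \<open>BG\<close>, once for all objects.\<close>

sublocale W: twisted_convolution R B "carrier G" "crossed_mult G B" "\<lambda>s t. Some (s \<otimes>\<^bsub>G\<^esub> t)" "gact B"
  by (rule crossed_convolution[OF g_algebra_axioms]) (rule subgroup_self)

abbreviation "BG \<equiv> fs_alg (carrier G) B (crossed_mult G B)"

lemma fin_fun_G: "\<lbrakk>\<phi> \<in> fin_fun S B; S \<subseteq> carrier G\<rbrakk> \<Longrightarrow> \<phi> \<in> fin_fun (carrier G) B"
  using fin_fun_mono by fastforce

lemma crossed_mult_support:
  assumes \<phi>: "\<phi> \<in> fin_fun S B" "S \<subseteq> carrier G" and \<psi>: "\<psi> \<in> fin_fun T B" "T \<subseteq> carrier G"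
  shows "crossed_mult G B \<phi> \<psi> \<in> fin_fun (S <#>\<^bsub>G\<^esub> T) B"
proof (rule fin_fun_restrict_support[OF W.m_closed[OF fin_fun_G[OF \<phi>] fin_fun_G[OF \<psi>]]])
  fix k assume k: "k \<notin> S <#>\<^bsub>G\<^esub> T"
  show "crossed_mult G B \<phi> \<psi> k = \<zero>\<^bsub>B\<^esub>"
  proof (cases "k \<in> carrier G")
    case True
    have "\<phi> g \<otimes>\<^bsub>B\<^esub> gact B g (\<psi> (inv\<^bsub>G\<^esub> g \<otimes>\<^bsub>G\<^esub> k)) = \<zero>\<^bsub>B\<^esub>" if "\<phi> g \<noteq> \<zero>\<^bsub>B\<^esub>" for g
    proof -
      have g: "g \<in> S" "g \<in> carrier G" using that fin_fun_support[OF \<phi>(1)] \<phi>(2) by auto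
      have "k = g \<otimes>\<^bsub>G\<^esub> (inv\<^bsub>G\<^esub> g \<otimes>\<^bsub>G\<^esub> k)" using g True by (simp add: m_assoc[symmetric])
      then have "inv\<^bsub>G\<^esub> g \<otimes>\<^bsub>G\<^esub> k \<notin> T" using k g unfolding set_mult_def by blast
      then have "\<psi> (inv\<^bsub>G\<^esub> g \<otimes>\<^bsub>G\<^esub> k) = \<zero>\<^bsub>B\<^esub>" using \<psi>(1) by (auto simp: fin_fun_def)
      then show ?thesis using g fin_fun_carrier[OF \<phi>(1)] by (simp add: mult_zero_right)
    qed
    then have "(\<Oplus>\<^bsub>B\<^esub>g\<in>{g. \<phi> g \<noteq> \<zero>\<^bsub>B\<^esub>}. \<phi> g \<otimes>\<^bsub>B\<^esub> gact B g (\<psi> (inv\<^bsub>G\<^esub> g \<otimes>\<^bsub>G\<^esub> k))) = \<zero>\<^bsub>B\<^esub>"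
      by (intro add.finprod_one_eqI) blast
    then show ?thesis by (simp add: crossed_mult_def)
  qed (simp add: crossed_mult_def)
qed simp

lemma lin_category_crossed: "lin_category R (crossed_cat G H B)"
proof (intro lin_category.intro lin_category_axioms.intro)
  show "cring R" by (rule is_cring)
  show "Module.module R (LHom (crossed_cat G H B) x y)" for x y
    unfolding crossed_cat_simps by (rule module_fs_alg) (rule module_axioms)
  fix x y z f g assume "x \<in> LOb (crossed_cat G H B)" "y \<in> LOb (crossed_cat G H B)" "z \<in> LOb (crossed_cat G H B)"
    "f \<in> carrier (LHom (crossed_cat G H B) x y)" "g \<in> carrier (LHom (crossed_cat G H B) y z)"
  then have o: "x \<in> cosets" "y \<in> cosets" "z \<in> cosets" "f \<in> fin_fun (quo x y) B" "g \<in> fin_fun (quo y z) B"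
    unfolding crossed_cat_simps by simp_all
  then show "LComp (crossed_cat G H B) x y z g f \<in> carrier (LHom (crossed_cat G H B) x z)"
    unfolding crossed_cat_simps fs_alg_simps
    using fin_fun_mono[OF crossed_mult_support[OF o(5) quo_carrier[OF o(2,3)] o(4) quo_carrier[OF o(1,2)]]
        quo_mult[OF o(1-3)]] by simp
qed

text \<open>The map \<open>\<phi> \<mapsto> g \<phi> h\<close>, where \<open>g\<close> and \<open>h\<close> act as multipliers of \<open>B \<rtimes> G\<close>.\<close>

definition trans :: "'g \<Rightarrow> 'g \<Rightarrow> ('g \<Rightarrow> 'a) \<Rightarrow> 'g \<Rightarrow> 'a" where
  "trans g h \<phi> = (\<lambda>k. if k \<in> carrier G then gact B g (\<phi> (inv\<^bsub>G\<^esub> g \<otimes>\<^bsub>G\<^esub> k \<otimes>\<^bsub>G\<^esub> inv\<^bsub>G\<^esub> h)) else \<zero>\<^bsub>B\<^esub>)"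

lemma trans_fsingle:
  assumes "g \<in> carrier G" "h \<in> carrier G" "k \<in> carrier G" "b \<in> carrier B"
  shows "trans g h (fsingle B k b) = fsingle B (g \<otimes>\<^bsub>G\<^esub> k \<otimes>\<^bsub>G\<^esub> h) (gact B g b)"
proof -
  have "inv\<^bsub>G\<^esub> g \<otimes>\<^bsub>G\<^esub> l \<otimes>\<^bsub>G\<^esub> inv\<^bsub>G\<^esub> h = k \<longleftrightarrow> l = g \<otimes>\<^bsub>G\<^esub> k \<otimes>\<^bsub>G\<^esub> h" if "l \<in> carrier G" for l
    using assms that by (simp add: inv_solve_right' inv_solve_left' m_assoc)
  then show ?thesis using assms by (auto simp: trans_def fsingle_def)
qed

lemma trans_closed:
  assumes g: "g \<in> carrier G" "h \<in> carrier G" and \<phi>: "\<phi> \<in> fin_fun S B" and S: "S \<subseteq> carrier G"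
    and T: "\<And>k. k \<in> S \<Longrightarrow> g \<otimes>\<^bsub>G\<^esub> k \<otimes>\<^bsub>G\<^esub> h \<in> T"
  shows "trans g h \<phi> \<in> fin_fun T B"
  using \<phi>
proof (induction rule: fin_fun_induct)
  case zero
  have "trans g h (\<lambda>x. \<zero>\<^bsub>B\<^esub>) = (\<lambda>x. \<zero>\<^bsub>B\<^esub>)" using g by (auto simp: trans_def)
  then show ?case using zero_fin_fun by simp
next
  case (single s a)
  then show ?case
    using trans_fsingle[OF g, of s a] subsetD[OF S single(1)] fsingle_closed[OF T[OF single(1)], of "gact B g a"] g
        by simp
next
  case (add \<phi> \<psi>)
  have "trans g h (\<lambda>x. \<phi> x \<oplus>\<^bsub>B\<^esub> \<psi> x) = (\<lambda>x. trans g h \<phi> x \<oplus>\<^bsub>B\<^esub> trans g h \<psi> x)"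
    using g fin_fun_carrier[OF add(1)] fin_fun_carrier[OF add(2)] by (auto simp: trans_def gact_add)
  then show ?case using add_fin_fun add by simp
qed

lemma lin_map_trans:
  assumes g: "g \<in> carrier G" "h \<in> carrier G" and S: "S \<subseteq> carrier G"
    and T: "\<And>k. k \<in> S \<Longrightarrow> g \<otimes>\<^bsub>G\<^esub> k \<otimes>\<^bsub>G\<^esub> h \<in> T"
  shows "lin_map R (fs_alg S B m) (fs_alg T B m') (trans g h)"
proof (intro lin_mapI; unfold fs_alg_simps)
  fix \<phi> assume \<phi>: "\<phi> \<in> fin_fun S B"
  show "trans g h \<phi> \<in> fin_fun T B" by (rule trans_closed[OF g \<phi> S T])
  show "trans g h (\<lambda>x. \<phi> x \<oplus>\<^bsub>B\<^esub> \<psi> x) = (\<lambda>x. trans g h \<phi> x \<oplus>\<^bsub>B\<^esub> trans g h \<psi> x)" if "\<psi> \<in> fin_fun S B" for \<psi>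
    using g fin_fun_carrier[OF \<phi>] fin_fun_carrier[OF that] by (auto simp: trans_def gact_add)
  show "trans g h (\<lambda>x. r \<odot>\<^bsub>B\<^esub> \<phi> x) = (\<lambda>x. r \<odot>\<^bsub>B\<^esub> trans g h \<phi> x)" if "r \<in> carrier R" for r
    using g fin_fun_carrier[OF \<phi>] that nu_homD(5)[OF gact_nu_hom[OF g(1)]] by (auto simp: trans_def)
qed

text \<open>The inner multipliers \<open>h\<close> and its inverse cancel between the two factors.
  On one-point functions this is the cancellation in the group index, together with the fact that g
  s h acts on the translate of b by the inverse of h as g s acts on b.\<close>

lemma trans_mult:
  assumes G: "g \<in> carrier G" "h \<in> carrier G" "l \<in> carrier G"
    and \<phi>: "\<phi> \<in> fin_fun (carrier G) B" and \<psi>: "\<psi> \<in> fin_fun (carrier G) B"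
  shows "trans g l (crossed_mult G B \<phi> \<psi>) = crossed_mult G B (trans g h \<phi>) (trans (inv\<^bsub>G\<^esub> h) l \<psi>)"
proof -
  note l = lin_map_trans[OF _ _ order_refl, where T = "carrier G" and m = "crossed_mult G B"
      and m' = "crossed_mult G B"]
  have "trans g l (crossed_mult G B \<phi> \<psi>) = trans g h \<phi> \<otimes>\<^bsub>BG\<^esub> trans (inv\<^bsub>G\<^esub> h) l \<psi>"
  proof (rule fs_mult_eqI[OF module_axioms W.nu_algebra_fs_alg W.nu_algebra_fs_alg l l l _ \<phi> \<psi>])
    fix s a t b assume st: "s \<in> carrier G" "a \<in> carrier B" "t \<in> carrier G" "b \<in> carrier B"
    have 1: "g \<otimes>\<^bsub>G\<^esub> s \<otimes>\<^bsub>G\<^esub> h \<otimes>\<^bsub>G\<^esub> (inv\<^bsub>G\<^esub> h \<otimes>\<^bsub>G\<^esub> t \<otimes>\<^bsub>G\<^esub> l) = g \<otimes>\<^bsub>G\<^esub> (s \<otimes>\<^bsub>G\<^esub> t) \<otimes>\<^bsub>G\<^esub> l"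
      using G st by (simp add: m_assoc r_inv_assoc)
    have "gact B (g \<otimes>\<^bsub>G\<^esub> s \<otimes>\<^bsub>G\<^esub> h) (gact B (inv\<^bsub>G\<^esub> h) b) = gact B g (gact B s b)"
      using G st by (simp add: gact_mult[symmetric] m_assoc)
    then have 2: "gact B g a \<otimes>\<^bsub>B\<^esub> gact B (g \<otimes>\<^bsub>G\<^esub> s \<otimes>\<^bsub>G\<^esub> h) (gact B (inv\<^bsub>G\<^esub> h) b) = gact B g (a \<otimes>\<^bsub>B\<^esub> gact B s b)"
      using G st nu_homD(2)[OF gact_nu_hom] by simp
    show "trans g l (crossed_mult G B (fsingle B s a) (fsingle B t b)) =
        trans g h (fsingle B s a) \<otimes>\<^bsub>BG\<^esub> trans (inv\<^bsub>G\<^esub> h) l (fsingle B t b)"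
      using G st by (simp add: trans_fsingle W.m_fsingle mult_closed 1 2)
  qed (use G in simp_all)
  then show ?thesis by simp
qed

lemma trans_one:
  assumes "\<phi> \<in> fin_fun (carrier G) B"
  shows "trans \<one>\<^bsub>G\<^esub> \<one>\<^bsub>G\<^esub> \<phi> = \<phi>"
proof
  fix k show "trans \<one>\<^bsub>G\<^esub> \<one>\<^bsub>G\<^esub> \<phi> k = \<phi> k"
    using fin_fun_carrier[OF assms] assms by (auto simp: trans_def gact_one fin_fun_def)
qed

end


section \<open>The inclusion of an object is an isomorphism in \<open>kk\<close>\<close>

lemma lin_category_alg:
  assumes "nu_algebra R D"
  shows "lin_category R (alg_lincat D)"
proof -
  interpret D: nu_algebra R D by fact
  show ?thesis
    by (intro lin_category.intro lin_category_axioms.intro)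
      (simp_all add: alg_lincat_def D.is_cring D.module_axioms D.mult_closed)
qed

context stable_functor
begin

lemma sm_crossed:
  assumes "g_algebra R G B" "subgroup L G" "carrier G \<lesssim> U" "carrier B \<lesssim> U"
  shows "sm (crossed G L B)"
proof (rule smI[OF nu_algebra_crossed[OF assms(1,2)]])
  have "L \<lesssim> U" using lepoll_trans[OF subset_imp_lepoll[OF subgroup.subset[OF assms(2)]] assms(3)] .
  then show "carrier (crossed G L B) \<lesssim> U" using lepoll_fin_fun[OF universe _ assms(4)] by (simp add: crossed_def)
qed

lemma sm_\<R>_crossed:
  assumes B: "crossed_coset R G B H" and "carrier R \<lesssim> U" "carrier G \<lesssim> U" "carrier B \<lesssim> U"
  shows "sm (\<R>_alg R (crossed_cat G H B))"
proof -
  interpret B: crossed_coset R G B H by fact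
  interpret C: lin_category R "crossed_cat G H B" by (rule B.lin_category_crossed)
  show ?thesis
  proof (rule smI[OF C.nu_algebra_\<R>], rule C.lepoll_\<R>[OF universe assms(2) _ lepoll_fin_fun[OF universe assms(3,4)]])
    show "LOb (crossed_cat G H B) \<lesssim> U"
      unfolding B.crossed_cat_simps using lepoll_trans[OF image_lepoll assms(3)] .
    fix x y assume "x \<in> LOb (crossed_cat G H B)" "y \<in> LOb (crossed_cat G H B)"
    then show "carrier (LHom (crossed_cat G H B) x y) \<subseteq> fin_fun (carrier G) B"
      unfolding B.crossed_cat_simps fs_alg_simps using B.fin_fun_G B.quo_carrier by blast
  qed
qed

text \<open>Two-of-six for \<open>\<nu>\<close>, the map \<open>p\<close> from
  \<open>\<R>(C)\<close> to matrices over the endomorphism algebra, and \<open>\<nu>\<close> applied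
  to matrix entries. The composite of \<open>p\<close> with \<open>\<nu>\<close> is a corner. The
  composite of the entrywise \<open>\<nu>\<close> with \<open>p\<close> is joined to the corner at
  the free index \<open>z\<close> by matrix units that are prescribed on generators of
  \<open>\<R>(C)\<close>.\<close>

lemma J_object_inclusion_iso:
  assumes B: "crossed_coset R G B H" and small: "carrier R \<lesssim> U" "carrier G \<lesssim> U" "carrier B \<lesssim> U"
    and GZ: "carrier G \<lesssim> Z" and u: "u \<in> carrier G"
  defines "C \<equiv> crossed_cat G H B" and "D \<equiv> crossed G (conj_subgroup G H u) B" and "x0 \<equiv> u <#\<^bsub>G\<^esub> H"
  shows "nu_hom R D (\<R>_alg R C) (\<R>_gen R C x0 x0)"
    and "iso_arrow kk (J D (\<R>_alg R C) (\<R>_gen R C x0 x0))"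
proof -
  interpret B: crossed_coset R G B H by fact
  interpret C: lin_category R C unfolding C_def by (rule B.lin_category_crossed)
  note L = B.conj_subgroup_subgroup[OF u] and Lq = B.conj_subgroup_eq_quo[OF u, folded x0_def]
  let ?E = "\<R>_alg R C"
  have E: "sm ?E" unfolding C_def by (rule sm_\<R>_crossed[OF B small])
  have D: "sm D" unfolding D_def by (rule sm_crossed[OF B.g_algebra_axioms L small(2,3)])
  interpret E: nu_algebra R ?E by (rule sm_alg[OF E])
  interpret D: nu_algebra R D by (rule sm_alg[OF D])
  note ZE = sm_mat[OF E Z_small] and ZD = sm_mat[OF D Z_small]
  interpret ZE: nu_algebra R "mat_alg Z ?E" by (rule sm_alg[OF ZE])
  interpret ZD: nu_algebra R "mat_alg Z D" by (rule sm_alg[OF ZD])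
  note Cs = B.crossed_cat_simps[folded C_def]
  have x0: "x0 \<in> B.cosets" using u by (simp add: x0_def)
  have Dc: "carrier D = fin_fun (B.quo x0 x0) B" by (simp add: D_def crossed_def Lq)
  have Dm: "mult D = crossed_mult G B" by (simp add: D_def crossed_def)
  \<comment> \<open>\<open>D\<close> and the Hom module at \<open>x0\<close> are different records,
    with different product fields, but agree as modules; linearity is carried across on the source
    and on the target side.\<close>
  have Dl: "lin_map R D F f \<longleftrightarrow> lin_map R (LHom C x0 x0) F f" for F :: "('k, 'q) module" and f
    by (simp add: lin_map_def Cs D_def crossed_def Lq)
  have toD: "lin_map R F D f \<longleftrightarrow> lin_map R F (LHom C x0 x0) f" for F :: "('k, 'q) module" and f
    by (simp add: lin_map_def Cs D_def crossed_def Lq)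
  let ?\<nu> = "\<R>_gen R C x0 x0"
  show \<nu>: "nu_hom R D ?E ?\<nu>"
    using C.lin_map_\<R>_gen[of x0 x0] C.\<R>_gen_comp[of x0 x0 x0] x0
    by (intro nu_homI) (simp_all add: Dl Cs Dc Dm)
  obtain z e where z: "z \<in> Z" and e: "inj_on e B.cosets" "e ` B.cosets \<subseteq> Z - {z}"
    using embed_Z[OF lepoll_trans[OF image_lepoll GZ]] .
  have eZ: "e x \<in> Z" "e x \<noteq> z" if "x \<in> B.cosets" for x using that e(2) by auto
  have ee: "e x = e y \<longleftrightarrow> x = y" if "x \<in> B.cosets" "y \<in> B.cosets" for x y using that e(1) by (auto dest: inj_onD)
  \<comment> \<open>elements \<open>\<tau> x\<close> with \<open>\<tau> x x0 = x\<close>, acting as isomorphisms from \<open>x0\<close> to \<open>x\<close>\<close>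
  define \<tau> where "\<tau> x = (if x = x0 then \<one>\<^bsub>G\<^esub> else (SOME v. v \<in> x) \<otimes>\<^bsub>G\<^esub> inv\<^bsub>G\<^esub> u)" for x
  have \<tau>: "\<tau> x \<in> carrier G" "\<tau> x \<otimes>\<^bsub>G\<^esub> u \<in> x" if x: "x \<in> B.cosets" for x
  proof -
    have "\<exists>v. v \<in> x" using x B.coset_self by blast
    then have "(SOME v. v \<in> x) \<in> x" by (rule someI_ex)
    then have v: "(SOME v. v \<in> x) \<in> x" "(SOME v. v \<in> x) \<in> carrier G" using B.coset_carrier[OF x] by auto
    show "\<tau> x \<in> carrier G" using v u by (simp add: \<tau>_def)
    show "\<tau> x \<otimes>\<^bsub>G\<^esub> u \<in> x" using v u B.coset_self[OF u] by (auto simp: \<tau>_def B.m_assoc x0_def)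
  qed
  \<comment> \<open>The index \<open>i\<close> decides whether an object x stays itself, at matrix
    position \<open>z\<close>, or is replaced by \<open>x0\<close>, at position \<open>e x\<close>.
    The multiplier \<open>\<gamma> i x\<close> leads from the replacement \<open>s i x\<close> back
    to x, so \<open>T i n x y\<close> turns arrows from x to y into arrows from \<open>s n x\<close>
    to \<open>s i y\<close>.\<close>
  define \<gamma> where "\<gamma> i x = (if i then \<tau> x else \<one>\<^bsub>G\<^esub>)" for i x
  define s where "s i x = (if i then x0 else x)" for i x
  define pos where "pos i x = (if i then e x else z)" for i x
  have \<gamma>: "\<gamma> i x \<in> carrier G" if "x \<in> B.cosets" for i x using \<tau>[OF that] by (simp add: \<gamma>_def)
  have sc: "s i x \<in> B.cosets" if "x \<in> B.cosets" for i x using that x0 by (simp add: s_def)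
  have pos: "pos i x \<in> Z" "pos i x = pos k x \<longleftrightarrow> i = k" if "x \<in> B.cosets" for i k x
    using eZ[OF that] z by (auto simp: pos_def)
  have \<gamma>s: "inv\<^bsub>G\<^esub> (\<gamma> i x) \<otimes>\<^bsub>G\<^esub> b \<in> s i x" if x: "x \<in> B.cosets" and b: "b \<in> x" for i x b
  proof (cases i)
    case True
    have bG: "b \<in> carrier G" using B.coset_carrier[OF x b] .
    have "inv\<^bsub>G\<^esub> (\<tau> x \<otimes>\<^bsub>G\<^esub> u) \<otimes>\<^bsub>G\<^esub> b \<in> H" using B.coset_diff[OF x \<tau>(2)[OF x] b] .
    then have "u \<otimes>\<^bsub>G\<^esub> (inv\<^bsub>G\<^esub> (\<tau> x \<otimes>\<^bsub>G\<^esub> u) \<otimes>\<^bsub>G\<^esub> b) \<in> x0" unfolding x0_def B.coset_iff by blast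
    moreover have "u \<otimes>\<^bsub>G\<^esub> (inv\<^bsub>G\<^esub> (\<tau> x \<otimes>\<^bsub>G\<^esub> u) \<otimes>\<^bsub>G\<^esub> b) = inv\<^bsub>G\<^esub> (\<tau> x) \<otimes>\<^bsub>G\<^esub> b"
      using u \<tau>(1)[OF x] bG by (simp add: B.inv_mult_group B.m_assoc[symmetric])
    ultimately show ?thesis using True by (simp add: \<gamma>_def s_def)
  next
    case False
    then show ?thesis using b B.coset_carrier[OF x b] by (simp add: \<gamma>_def s_def)
  qed
  have \<gamma>quo: "inv\<^bsub>G\<^esub> (\<gamma> i y) \<otimes>\<^bsub>G\<^esub> k \<otimes>\<^bsub>G\<^esub> \<gamma> n x \<in> B.quo (s n x) (s i y)"
    if x: "x \<in> B.cosets" and y: "y \<in> B.cosets" and k: "k \<in> B.quo x y" for i n x y k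
  proof -
    obtain a b where ab: "a \<in> x" "b \<in> y" "k = b \<otimes>\<^bsub>G\<^esub> inv\<^bsub>G\<^esub> a" using k unfolding B.quo_iff by blast
    note G = B.coset_carrier[OF x ab(1)] B.coset_carrier[OF y ab(2)] \<gamma>[OF x, of n] \<gamma>[OF y, of i]
    have "inv\<^bsub>G\<^esub> (\<gamma> i y) \<otimes>\<^bsub>G\<^esub> k \<otimes>\<^bsub>G\<^esub> \<gamma> n x = (inv\<^bsub>G\<^esub> (\<gamma> i y) \<otimes>\<^bsub>G\<^esub> b) \<otimes>\<^bsub>G\<^esub> inv\<^bsub>G\<^esub> (inv\<^bsub>G\<^esub> (\<gamma> n x) \<otimes>\<^bsub>G\<^esub> a)"
      unfolding ab(3) using G by (simp add: B.inv_mult_group B.m_assoc)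
    then show ?thesis unfolding B.quo_iff using \<gamma>s[OF x ab(1)] \<gamma>s[OF y ab(2)] by blast
  qed
  define T where "T i n x y = B.trans (inv\<^bsub>G\<^esub> (\<gamma> i y)) (\<gamma> n x)" for i n x y
  have Tl': "lin_map R (LHom C x y) (LHom C (s n x) (s i y)) (T i n x y)"
    if "x \<in> B.cosets" "y \<in> B.cosets" for i n x y
    unfolding Cs T_def
    by (rule B.lin_map_trans) (use \<gamma> that B.quo_carrier \<gamma>quo in auto)
  have TD: "lin_map R (LHom C x y) D (T True True x y)" if "x \<in> B.cosets" "y \<in> B.cosets" for x y
    using Tl'[OF that, of True True] unfolding toD s_def by simp
  have Tm: "T i n x w (crossed_mult G B g f) = crossed_mult G B (T i k y w g) (T k n x y f)"
    if o: "x \<in> B.cosets" "y \<in> B.cosets" "w \<in> B.cosets" and f: "f \<in> fin_fun (B.quo x y) B"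
        and g: "g \<in> fin_fun (B.quo y w) B"
    for i k n x y w f g
    unfolding T_def
    using B.trans_mult[OF B.inv_closed[OF \<gamma>[OF o(3)]] \<gamma>[OF o(2)] \<gamma>[OF o(1)]
        B.fin_fun_G[OF g B.quo_carrier[OF o(2,3)]] B.fin_fun_G[OF f B.quo_carrier[OF o(1,2)]]] .
  define a where "a i n x y f = fsingle ?E (pos i y, pos n x) (\<R>_gen R C (s n x) (s i y) (T i n x y f))" for i n x y f
  have al: "lin_map R (LHom C x y) (mat_alg Z ?E) (a i n x y)" if "x \<in> B.cosets" "y \<in> B.cosets" for i n x y
  proof -
    note 1 = lin_map_comp[OF Tl'[OF that] C.lin_map_\<R>_gen[unfolded Cs(1), OF sc[OF that(1)] sc[OF that(2)]]]
    show ?thesis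
      using lin_map_comp[OF 1 lin_map_fsingle_mat[OF sm_alg[OF E] pos(1)[OF that(2)] pos(1)[OF that(1)]]]
      by (simp add: a_def[abs_def] o_def)
  qed
  have am: "a i k y w g \<otimes>\<^bsub>mat_alg Z ?E\<^esub> a k' n x y f = (if k = k' then a i n x w (crossed_mult G B g f) else \<zero>\<^bsub>mat_alg
      Z ?E\<^esub>)"
    if o: "x \<in> B.cosets" "y \<in> B.cosets" "w \<in> B.cosets" and f: "f \<in> fin_fun (B.quo x y) B"
        and g: "g \<in> fin_fun (B.quo y w) B"
    for i k k' n x y w f g
  proof -
    have Tf: "T k n x y f \<in> carrier (LHom C (s n x) (s k y))" for k
      using lin_mapD(1)[OF Tl'[OF o(1,2)]] f by (simp add: Cs)
    have Tg: "T i k y w g \<in> carrier (LHom C (s k y) (s i w))"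
      using lin_mapD(1)[OF Tl'[OF o(2,3)]] g by (simp add: Cs)
    note cl = C.\<R>_gen_closed[unfolded Cs(1), OF sc[OF o(1)] sc[OF o(2)] Tf]
      C.\<R>_gen_closed[unfolded Cs(1), OF sc[OF o(2)] sc[OF o(3)] Tg]
    have "\<R>_gen R C (s k y) (s i w) (T i k y w g) \<otimes>\<^bsub>?E\<^esub> \<R>_gen R C (s n x) (s k y) (T k n x y f) =
        \<R>_gen R C (s n x) (s i w) (T i n x w (crossed_mult G B g f))"
      using C.\<R>_gen_comp[unfolded Cs(1), OF sc[OF o(1)] sc[OF o(2)] sc[OF o(3)] Tf Tg] Tm[OF o f g]
      by (simp add: Cs)
    \<comment> \<open>For \<open>k = k'\<close> the entries are composable and
      \<open>\<R>_gen_comp\<close> applies. For \<open>k \<noteq> k'\<close> they need not be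
      composable, and nothing is known about their product in \<open>\<R>(C)\<close>; the matrix
      product vanishes because the positions at y differ.\<close>
    then show ?thesis unfolding a_def
      using mat_fsingle_mult[OF sm_alg[OF E] pos(1)[OF o(3)] pos(1)[OF o(2)] pos(1)[OF o(2)] pos(1)[OF o(1)] cl(2)
          cl(1)]
        pos(2)[OF o(2)] by (cases "k = k'") simp_all
  qed
  define b where "b x y f = fsingle D (e y, e x) (T True True x y f)" for x y f
  have bl: "lin_map R (LHom C x y) (mat_alg Z D) (b x y)" if "x \<in> B.cosets" "y \<in> B.cosets" for x y
    using lin_map_comp[OF TD[OF that] lin_map_fsingle_mat[OF sm_alg[OF D] eZ(1)[OF that(2)] eZ(1)[OF that(1)]]]
    by (simp add: b_def[abs_def] o_def)
  have bm: "b x w (crossed_mult G B g f) = b y w g \<otimes>\<^bsub>mat_alg Z D\<^esub> b x y f"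
    if o: "x \<in> B.cosets" "y \<in> B.cosets" "w \<in> B.cosets" and f: "f \<in> fin_fun (B.quo x y) B"
        and g: "g \<in> fin_fun (B.quo y w) B"
    for x y w f g
  proof -
    have "T True True x y f \<in> carrier D" "T True True y w g \<in> carrier D"
      using lin_mapD(1)[OF TD[OF o(1,2)]] lin_mapD(1)[OF TD[OF o(2,3)]] f g by (simp_all add: Cs)
    then show ?thesis unfolding b_def
      using mat_fsingle_mult[OF sm_alg[OF D] eZ(1)[OF o(3)] eZ(1)[OF o(2)] eZ(1)[OF o(2)] eZ(1)[OF o(1)]]
        Tm[OF o f g, of True True True] by (simp add: Dm)
  qed
  have "\<exists>p. nu_hom R ?E (mat_alg Z D) p \<and>
      (\<forall>x\<in>B.cosets. \<forall>y\<in>B.cosets. \<forall>f\<in>carrier (LHom C x y). p (\<R>_gen R C x y f) = b x y f)"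
  proof (rule C.\<R>_lift[OF sm_alg[OF ZD], of b])
    show "lin_map R (LHom C x y) (mat_alg Z D) (b x y)" if "x \<in> LOb C" "y \<in> LOb C" for x y
      using bl that by (simp add: Cs)
    show "b x w (LComp C x y w f g) = b y w f \<otimes>\<^bsub>mat_alg Z D\<^esub> b x y g"
      if "x \<in> LOb C" "y \<in> LOb C" "w \<in> LOb C" "g \<in> carrier (LHom C x y)" "f \<in> carrier (LHom C y w)" for x y w f g
      using bm[of x y w g f] that by (simp add: Cs)
  qed (auto simp: Cs)
  then obtain p where p: "nu_hom R ?E (mat_alg Z D) p"
    "\<And>x y f. \<lbrakk>x \<in> B.cosets; y \<in> B.cosets; f \<in> carrier (LHom C x y)\<rbrakk> \<Longrightarrow> p (\<R>_gen R C x y f) = b x y f" by blast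
  have "J D (mat_alg Z D) (p \<circ> ?\<nu>) = J D (mat_alg Z D) (corner D (e x0))"
  proof (rule J_cong)
    fix f assume "f \<in> carrier D"
    then have f: "f \<in> fin_fun (B.quo x0 x0) B" by (simp add: Dc)
    \<comment> \<open>This is where the choice of the unit for \<open>\<tau> x0\<close> enters:
      without it the composite would be a corner only up to a conjugation.\<close>
    have "T True True x0 x0 f = f"
      using B.trans_one[OF B.fin_fun_G[OF f B.quo_carrier[OF x0 x0]]] by (simp add: T_def \<gamma>_def \<tau>_def)
    then show "(p \<circ> ?\<nu>) f = corner D (e x0) f" using p(2)[OF x0 x0] f by (simp add: Cs b_def corner_fsingle)
  qed
  then have 1: "iso_arrow kk (J ?E (mat_alg Z D) p \<cdot>\<^bsub>kk\<^esub> J D ?E ?\<nu>)"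
    using J_comp[OF D E ZD \<nu> p(1)] J_corner_iso[OF D eZ(1)[OF x0]] by simp
  note \<nu>Z = nu_hom_mat_map[OF sm_alg[OF D] sm_alg[OF E] \<nu>, of Z]
  have "J ?E (mat_alg Z ?E) (corner ?E z) = J ?E (mat_alg Z ?E) ((\<circ>) ?\<nu> \<circ> p)"
  proof (rule J_matrix_units_\<R>[OF C.lin_category_axioms E ZE, of a])
    show "lin_map R (LHom C x y) (mat_alg Z ?E) (a i k x y)" if "x \<in> LOb C" "y \<in> LOb C" for i k x y
      using al that by (simp add: Cs)
    show "a i k y w g \<otimes>\<^bsub>mat_alg Z ?E\<^esub> a k' n x y f = (if k = k' then a i n x w (LComp C x y w g f) else \<zero>\<^bsub>mat_alg Z
        ?E\<^esub>)"
      if "x \<in> LOb C" "y \<in> LOb C" "w \<in> LOb C" "f \<in> carrier (LHom C x y)" "g \<in> carrier (LHom C y w)"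
          for i k k' n x y w f g
      using am[of x y w f g] that by (simp add: Cs)
    show "corner ?E z (\<R>_gen R C x y f) = a False False x y f"
      if "x \<in> LOb C" "y \<in> LOb C" "f \<in> carrier (LHom C x y)" for x y f
    proof -
      have "x \<in> B.cosets" "y \<in> B.cosets" "f \<in> fin_fun (B.quo x y) B" using that by (simp_all add: Cs)
      then show ?thesis using B.trans_one[OF B.fin_fun_G[OF _ B.quo_carrier]]
        by (simp add: a_def corner_fsingle pos_def s_def T_def \<gamma>_def)
    qed
    show "((\<circ>) ?\<nu> \<circ> p) (\<R>_gen R C x y f) = a True True x y f"
      if "x \<in> LOb C" "y \<in> LOb C" "f \<in> carrier (LHom C x y)" for x y f
      using p(2)[of x y f] that comp_fsingle[OF D.module_axioms E.module_axioms nu_homD(1)[OF \<nu>]]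
      by (simp add: Cs b_def a_def pos_def s_def)
  qed (rule nu_hom_corner[OF sm_alg[OF E] z] nu_hom_comp[OF p(1) \<nu>Z])+
  then have 2: "iso_arrow kk (J (mat_alg Z D) (mat_alg Z ?E) ((\<circ>) ?\<nu>) \<cdot>\<^bsub>kk\<^esub> J ?E (mat_alg Z D) p)"
    using J_comp[OF E ZD ZE p(1) \<nu>Z] J_corner_iso[OF E z] by simp
  show "iso_arrow kk (J D ?E ?\<nu>)"
    by (rule kk.iso_arrow_two_of_six[OF J_Hom[OF D E \<nu>] J_Hom[OF E ZD p(1)] J_Hom[OF ZD ZE \<nu>Z] 1 2])
qed

end

section \<open>Matrices of scalars acting on matrices\<close>

text \<open>Row- and column-finite scalar matrices are not elements of the matrix algebra over
  \<open>A\<close>, as they may have infinite support and \<open>A\<close> has no unit. They act on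
  it as multipliers, from the left by \<open>lmul\<close> and from the right by \<open>rmul\<close>;
  the matrices of a representation are of this kind.\<close>

definition finite_matrix :: "('k, 'r) ring_scheme \<Rightarrow> 'x set \<Rightarrow> ('x \<Rightarrow> 'x \<Rightarrow> 'k) \<Rightarrow> bool" where
  "finite_matrix R X P \<longleftrightarrow> (\<forall>x\<in>X. \<forall>y\<in>X. P x y \<in> carrier R) \<and>
     (\<forall>x\<in>X. finite {y\<in>X. P x y \<noteq> \<zero>\<^bsub>R\<^esub>} \<and> finite {y\<in>X. P y x \<noteq> \<zero>\<^bsub>R\<^esub>})"

definition lmul :: "('k, 'r) ring_scheme \<Rightarrow> ('k, 'a, 'z) module_scheme \<Rightarrow> 'x set \<Rightarrow> ('x \<Rightarrow> 'x \<Rightarrow> 'k) \<Rightarrow>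
    ('x \<times> 'x \<Rightarrow> 'a) \<Rightarrow> 'x \<times> 'x \<Rightarrow> 'a" where
  "lmul R A X P M = (\<lambda>(x, y). if x \<in> X
     then \<Oplus>\<^bsub>A\<^esub>u\<in>{u\<in>X. P x u \<noteq> \<zero>\<^bsub>R\<^esub>}. P x u \<odot>\<^bsub>A\<^esub> M (u, y) else \<zero>\<^bsub>A\<^esub>)"

definition rmul :: "('k, 'r) ring_scheme \<Rightarrow> ('k, 'a, 'z) module_scheme \<Rightarrow> 'x set \<Rightarrow> ('x \<Rightarrow> 'x \<Rightarrow> 'k) \<Rightarrow>
    ('x \<times> 'x \<Rightarrow> 'a) \<Rightarrow> 'x \<times> 'x \<Rightarrow> 'a" where
  "rmul R A X P M = (\<lambda>(x, y). if y \<in> X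
     then \<Oplus>\<^bsub>A\<^esub>v\<in>{v\<in>X. P v y \<noteq> \<zero>\<^bsub>R\<^esub>}. P v y \<odot>\<^bsub>A\<^esub> M (x, v) else \<zero>\<^bsub>A\<^esub>)"

lemma finite_matrixD:
  assumes "finite_matrix R X P" "x \<in> X" "y \<in> X"
  shows "P x y \<in> carrier R" "finite {y\<in>X. P x y \<noteq> \<zero>\<^bsub>R\<^esub>}" "finite {y\<in>X. P y x \<noteq> \<zero>\<^bsub>R\<^esub>}"
  using assms by (simp_all add: finite_matrix_def)

lemma (in Module.module) lin_map_smult: "r \<in> carrier R \<Longrightarrow> lin_map R M M (\<lambda>b. r \<odot>\<^bsub>M\<^esub> b)"
  by (intro lin_mapI) (auto simp: smult_r_distr smult_assoc1[symmetric] m_comm)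

lemma (in Module.module) lin_map_scalar: "a \<in> carrier M \<Longrightarrow> lin_map R (reg_mod R) M (\<lambda>r. r \<odot>\<^bsub>M\<^esub> a)"
  by (intro lin_mapI) (auto simp: smult_l_distr smult_assoc1)

locale matrix_action = nu_algebra R A for R :: "('k, 'r) ring_scheme" and A :: "('k, 'a, 'z) module_scheme" +
  fixes X :: "'x set"
begin

abbreviation "L P \<equiv> lmul R A X P"
abbreviation "Rt P \<equiv> rmul R A X P"
abbreviation "MX \<equiv> mat_alg X A"

lemma lmul_fsingle:
  assumes P: "finite_matrix R X P" and p: "p \<in> X" "q \<in> X" "a \<in> carrier A"
  shows "L P (fsingle A (p, q) a) (x, y) = (if x \<in> X \<and> y = q then P x p \<odot>\<^bsub>A\<^esub> a else \<zero>\<^bsub>A\<^esub>)"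
proof (cases "x \<in> X")
  case True
  note fm = finite_matrixD[OF P True]
  have "L P (fsingle A (p, q) a) (x, y) = (if p \<in> {u\<in>X. P x u \<noteq> \<zero>\<^bsub>R\<^esub>}
      then P x p \<odot>\<^bsub>A\<^esub> fsingle A (p, q) a (p, y) else \<zero>\<^bsub>A\<^esub>)"
    unfolding lmul_def prod.case if_P[OF True]
    by (rule finsum_single) (use fm p in \<open>auto simp: fsingle_def\<close>)
  then show ?thesis using True p fm(1)[OF p(1)] by (auto simp: fsingle_def)
qed (simp add: lmul_def)

lemma rmul_fsingle:
  assumes P: "finite_matrix R X P" and p: "p \<in> X" "q \<in> X" "a \<in> carrier A"
  shows "Rt P (fsingle A (p, q) a) (x, y) = (if x = p \<and> y \<in> X then P q y \<odot>\<^bsub>A\<^esub> a else \<zero>\<^bsub>A\<^esub>)"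
proof (cases "y \<in> X")
  case True
  note fm = finite_matrixD[OF P _ True] finite_matrixD[OF P True]
  have "Rt P (fsingle A (p, q) a) (x, y) = (if q \<in> {v\<in>X. P v y \<noteq> \<zero>\<^bsub>R\<^esub>}
      then P q y \<odot>\<^bsub>A\<^esub> fsingle A (p, q) a (x, q) else \<zero>\<^bsub>A\<^esub>)"
    unfolding rmul_def prod.case if_P[OF True]
    by (rule finsum_single) (use fm p in \<open>auto simp: fsingle_def\<close>)
  then show ?thesis using True p fm(1)[OF p(2)] by (auto simp: fsingle_def)
qed (simp add: rmul_def)

lemma lmul_add:
  assumes P: "finite_matrix R X P" and MN: "M \<in> carrier MX" "N \<in> carrier MX"
  shows "L P (\<lambda>x. M x \<oplus>\<^bsub>A\<^esub> N x) = (\<lambda>x. L P M x \<oplus>\<^bsub>A\<^esub> L P N x)"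
proof
  fix xy :: "'x \<times> 'x" obtain x y where xy: "xy = (x, y)" by fastforce
  have c: "M q \<in> carrier A" "N q \<in> carrier A" for q using MN fin_fun_carrier by (simp_all add: mat_alg_simps)
  have "(\<Oplus>\<^bsub>A\<^esub>u\<in>{u\<in>X. P x u \<noteq> \<zero>\<^bsub>R\<^esub>}. P x u \<odot>\<^bsub>A\<^esub> (M (u, y) \<oplus>\<^bsub>A\<^esub> N (u, y))) =
      (\<Oplus>\<^bsub>A\<^esub>u\<in>{u\<in>X. P x u \<noteq> \<zero>\<^bsub>R\<^esub>}. P x u \<odot>\<^bsub>A\<^esub> M (u, y) \<oplus>\<^bsub>A\<^esub> P x u \<odot>\<^bsub>A\<^esub> N (u, y))" if "x \<in> X"
    using c finite_matrixD(1)[OF P that] by (intro finsum_cong') (auto simp: smult_r_distr)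
  also have "\<dots> = (\<Oplus>\<^bsub>A\<^esub>u\<in>{u\<in>X. P x u \<noteq> \<zero>\<^bsub>R\<^esub>}. P x u \<odot>\<^bsub>A\<^esub> M (u, y)) \<oplus>\<^bsub>A\<^esub>
      (\<Oplus>\<^bsub>A\<^esub>u\<in>{u\<in>X. P x u \<noteq> \<zero>\<^bsub>R\<^esub>}. P x u \<odot>\<^bsub>A\<^esub> N (u, y))" if "x \<in> X"
    using c finite_matrixD(1)[OF P that] by (intro finsum_addf) auto
  finally show "L P (\<lambda>x. M x \<oplus>\<^bsub>A\<^esub> N x) xy = L P M xy \<oplus>\<^bsub>A\<^esub> L P N xy"
    unfolding xy lmul_def by simp
qed

lemma rmul_add:
  assumes P: "finite_matrix R X P" and MN: "M \<in> carrier MX" "N \<in> carrier MX"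
  shows "Rt P (\<lambda>x. M x \<oplus>\<^bsub>A\<^esub> N x) = (\<lambda>x. Rt P M x \<oplus>\<^bsub>A\<^esub> Rt P N x)"
proof
  fix xy :: "'x \<times> 'x" obtain x y where xy: "xy = (x, y)" by fastforce
  have c: "M q \<in> carrier A" "N q \<in> carrier A" for q using MN fin_fun_carrier by (simp_all add: mat_alg_simps)
  have "(\<Oplus>\<^bsub>A\<^esub>u\<in>{u\<in>X. P u y \<noteq> \<zero>\<^bsub>R\<^esub>}. P u y \<odot>\<^bsub>A\<^esub> (M (x, u) \<oplus>\<^bsub>A\<^esub> N (x, u))) =
      (\<Oplus>\<^bsub>A\<^esub>u\<in>{u\<in>X. P u y \<noteq> \<zero>\<^bsub>R\<^esub>}. P u y \<odot>\<^bsub>A\<^esub> M (x, u) \<oplus>\<^bsub>A\<^esub> P u y \<odot>\<^bsub>A\<^esub> N (x, u))" if "y \<in> X"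
    using c finite_matrixD(1)[OF P _ that] by (intro finsum_cong') (auto simp: smult_r_distr)
  also have "\<dots> = (\<Oplus>\<^bsub>A\<^esub>u\<in>{u\<in>X. P u y \<noteq> \<zero>\<^bsub>R\<^esub>}. P u y \<odot>\<^bsub>A\<^esub> M (x, u)) \<oplus>\<^bsub>A\<^esub>
      (\<Oplus>\<^bsub>A\<^esub>u\<in>{u\<in>X. P u y \<noteq> \<zero>\<^bsub>R\<^esub>}. P u y \<odot>\<^bsub>A\<^esub> N (x, u))" if "y \<in> X"
    using c finite_matrixD(1)[OF P _ that] by (intro finsum_addf) auto
  finally show "Rt P (\<lambda>x. M x \<oplus>\<^bsub>A\<^esub> N x) xy = Rt P M xy \<oplus>\<^bsub>A\<^esub> Rt P N xy"
    unfolding xy rmul_def by simp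
qed

lemma lmul_smult:
  assumes P: "finite_matrix R X P" and M: "M \<in> carrier MX" and r: "r \<in> carrier R"
  shows "L P (\<lambda>x. r \<odot>\<^bsub>A\<^esub> M x) = (\<lambda>x. r \<odot>\<^bsub>A\<^esub> L P M x)"
proof
  fix xy :: "'x \<times> 'x" obtain x y where xy: "xy = (x, y)" by fastforce
  have c: "M q \<in> carrier A" for q using M fin_fun_carrier by (simp add: mat_alg_simps)
  have "(\<Oplus>\<^bsub>A\<^esub>u\<in>{u\<in>X. P x u \<noteq> \<zero>\<^bsub>R\<^esub>}. P x u \<odot>\<^bsub>A\<^esub> (r \<odot>\<^bsub>A\<^esub> M (u, y))) =
      r \<odot>\<^bsub>A\<^esub> (\<Oplus>\<^bsub>A\<^esub>u\<in>{u\<in>X. P x u \<noteq> \<zero>\<^bsub>R\<^esub>}. P x u \<odot>\<^bsub>A\<^esub> M (u, y))" if x: "x \<in> X"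
    using lin_map_finsum[OF module_axioms module_axioms lin_map_smult[OF r] finite_matrixD(2)[OF P x x],
        of "\<lambda>u. P x u \<odot>\<^bsub>A\<^esub> M (u, y)"] c finite_matrixD(1)[OF P x] r
    by (auto simp: smult_assoc1[symmetric] m_comm intro!: finsum_cong')
  then show "L P (\<lambda>x. r \<odot>\<^bsub>A\<^esub> M x) xy = r \<odot>\<^bsub>A\<^esub> L P M xy"
    unfolding xy lmul_def using r by simp
qed

lemma rmul_smult:
  assumes P: "finite_matrix R X P" and M: "M \<in> carrier MX" and r: "r \<in> carrier R"
  shows "Rt P (\<lambda>x. r \<odot>\<^bsub>A\<^esub> M x) = (\<lambda>x. r \<odot>\<^bsub>A\<^esub> Rt P M x)"
proof
  fix xy :: "'x \<times> 'x" obtain x y where xy: "xy = (x, y)" by fastforce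
  have c: "M q \<in> carrier A" for q using M fin_fun_carrier by (simp add: mat_alg_simps)
  have "(\<Oplus>\<^bsub>A\<^esub>u\<in>{u\<in>X. P u y \<noteq> \<zero>\<^bsub>R\<^esub>}. P u y \<odot>\<^bsub>A\<^esub> (r \<odot>\<^bsub>A\<^esub> M (x, u))) =
      r \<odot>\<^bsub>A\<^esub> (\<Oplus>\<^bsub>A\<^esub>u\<in>{u\<in>X. P u y \<noteq> \<zero>\<^bsub>R\<^esub>}. P u y \<odot>\<^bsub>A\<^esub> M (x, u))" if y: "y \<in> X"
    using lin_map_finsum[OF module_axioms module_axioms lin_map_smult[OF r] finite_matrixD(3)[OF P y y],
        of "\<lambda>u. P u y \<odot>\<^bsub>A\<^esub> M (x, u)"] c finite_matrixD(1)[OF P _ y] r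
    by (auto simp: smult_assoc1[symmetric] m_comm intro!: finsum_cong')
  then show "Rt P (\<lambda>x. r \<odot>\<^bsub>A\<^esub> M x) xy = r \<odot>\<^bsub>A\<^esub> Rt P M xy"
    unfolding xy rmul_def using r by simp
qed

text \<open>Row finiteness makes the sums defining left multiplication finite, and column finiteness
  keeps the result finitely supported: the matrix unit at (p, q) is spread along column p of
  \<open>P\<close>. For right multiplication the roles are exchanged.\<close>

lemma matrix_action_closed:
  assumes P: "finite_matrix R X P" and M: "M \<in> carrier MX"
  shows "L P M \<in> carrier MX" "Rt P M \<in> carrier MX"
proof -
  have M': "M \<in> fin_fun (X \<times> X) A" using M by (simp add: mat_alg_simps)
  have "L P M \<in> fin_fun (X \<times> X) A \<and> Rt P M \<in> fin_fun (X \<times> X) A"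
    using M'
  proof (induction rule: fin_fun_induct)
    case zero
    have "L P (\<lambda>x. \<zero>\<^bsub>A\<^esub>) = (\<lambda>x. \<zero>\<^bsub>A\<^esub>)" "Rt P (\<lambda>x. \<zero>\<^bsub>A\<^esub>) = (\<lambda>x. \<zero>\<^bsub>A\<^esub>)"
      using finite_matrixD(1)[OF P] by (auto simp: lmul_def rmul_def fun_eq_iff intro!: add.finprod_one_eqI)
    then show ?case using zero_fin_fun by simp
  next
    case (single s a)
    obtain p q where s: "s = (p, q)" "p \<in> X" "q \<in> X" using single(1) by auto
    note l = lmul_fsingle[OF P s(2,3) single(2)] and r = rmul_fsingle[OF P s(2,3) single(2)]
    have "{xy. L P (fsingle A (p, q) a) xy \<noteq> \<zero>\<^bsub>A\<^esub>} \<subseteq> (\<lambda>x. (x, q)) ` {x\<in>X. P x p \<noteq> \<zero>\<^bsub>R\<^esub>}"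
      using single(2) by (auto simp: l split: if_splits)
    then have 1: "finite {xy. L P (fsingle A (p, q) a) xy \<noteq> \<zero>\<^bsub>A\<^esub>}"
      by (rule finite_subset) (use finite_matrixD(3)[OF P s(2,2)] in simp)
    have "{xy. Rt P (fsingle A (p, q) a) xy \<noteq> \<zero>\<^bsub>A\<^esub>} \<subseteq> (\<lambda>y. (p, y)) ` {y\<in>X. P q y \<noteq> \<zero>\<^bsub>R\<^esub>}"
      using single(2) by (auto simp: r split: if_splits)
    then have 2: "finite {xy. Rt P (fsingle A (p, q) a) xy \<noteq> \<zero>\<^bsub>A\<^esub>}"
      by (rule finite_subset) (use finite_matrixD(2)[OF P s(3,3)] in simp)
    show ?case unfolding s(1) fin_fun_def
      using 1 2 s(2,3) single(2) finite_matrixD(1)[OF P] by (auto simp: l r)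
  next
    case (add \<phi> \<psi>)
    then show ?case
      using lmul_add[OF P, of \<phi> \<psi>] rmul_add[OF P, of \<phi> \<psi>] by (simp add: mat_alg_simps add_fin_fun)
  qed
  then show "L P M \<in> carrier MX" "Rt P M \<in> carrier MX" by (simp_all add: mat_alg_simps)
qed

lemma lin_map_lmul: "finite_matrix R X P \<Longrightarrow> lin_map R MX MX (L P)"
  by (intro lin_mapI) (simp_all add: matrix_action_closed lmul_add lmul_smult mat_alg_simps(4,5))

lemma lin_map_rmul: "finite_matrix R X P \<Longrightarrow> lin_map R MX MX (Rt P)"
  by (intro lin_mapI) (simp_all add: matrix_action_closed rmul_add rmul_smult mat_alg_simps(4,5))

lemma nu_algebra_MX: "nu_algebra R MX"
  by (rule nu_algebra_mat) (rule nu_algebra_axioms)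

lemma lmul_lmul:
  assumes P: "finite_matrix R X P" and Q: "finite_matrix R X Q" and PQ: "finite_matrix R X PQ"
    and pq: "\<And>x z. \<lbrakk>x \<in> X; z \<in> X\<rbrakk> \<Longrightarrow> PQ x z = (\<Oplus>\<^bsub>R\<^esub>y\<in>{y\<in>X. P x y \<noteq> \<zero>\<^bsub>R\<^esub>}. P x y \<otimes>\<^bsub>R\<^esub> Q y z)"
    and M: "M \<in> carrier MX"
  shows "L P (L Q M) = L PQ M"
proof -
  interpret A': nu_algebra R "reg_mod R" by (rule nu_algebra_reg_mod) (rule is_cring)
  have "(L P \<circ> L Q) M = L PQ M"
  proof (rule mat_lin_eqI[OF nu_algebra_axioms nu_algebra_MX lin_map_comp[OF lin_map_lmul[OF Q] lin_map_lmul[OF P]]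
      lin_map_lmul[OF PQ] _ M])
    fix p q a assume s: "p \<in> X" "q \<in> X" "a \<in> carrier A"
    have "L P (L Q (fsingle A (p, q) a)) (x, y) = L PQ (fsingle A (p, q) a) (x, y)" for x y
    proof (cases "x \<in> X \<and> y = q")
      case True
      let ?F = "{u\<in>X. P x u \<noteq> \<zero>\<^bsub>R\<^esub>}"
      have "L P (L Q (fsingle A (p, q) a)) (x, y) = (\<Oplus>\<^bsub>A\<^esub>u\<in>?F. P x u \<odot>\<^bsub>A\<^esub> L Q (fsingle A (p, q) a) (u, y))"
        using True by (simp add: lmul_def[of R A X P])
      also have "\<dots> = (\<Oplus>\<^bsub>A\<^esub>u\<in>?F. ((\<lambda>r. r \<odot>\<^bsub>A\<^esub> a) \<circ> (\<lambda>u. P x u \<otimes>\<^bsub>R\<^esub> Q u p)) u)"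
        using True s finite_matrixD(1)[OF P] finite_matrixD(1)[OF Q]
        by (intro finsum_cong') (auto simp: lmul_fsingle[OF Q s] smult_assoc1)
      also have "\<dots> = PQ x p \<odot>\<^bsub>A\<^esub> a"
        using lin_map_finsum[OF A'.module_axioms module_axioms lin_map_scalar[OF s(3)] finite_matrixD(2)[OF P, of x
            x],
            of "\<lambda>u. P x u \<otimes>\<^bsub>R\<^esub> Q u p"] pq[of x p] True s finite_matrixD(1)[OF P] finite_matrixD(1)[OF Q]
        by (simp add: Pi_iff o_def)
      finally show ?thesis using True by (simp add: lmul_fsingle[OF PQ s])
    next
      case False
      have "L P (L Q (fsingle A (p, q) a)) (x, y) = \<zero>\<^bsub>A\<^esub>"
        unfolding lmul_def[of R A X P] using False finite_matrixD(1)[OF P]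
        by (auto simp: lmul_fsingle[OF Q s] intro!: add.finprod_one_eqI)
      then show ?thesis using False by (auto simp: lmul_fsingle[OF PQ s])
    qed
    then show "(L P \<circ> L Q) (fsingle A (p, q) a) = L PQ (fsingle A (p, q) a)" by auto
  qed
  then show ?thesis by simp
qed

lemma rmul_rmul:
  assumes P: "finite_matrix R X P" and Q: "finite_matrix R X Q" and PQ: "finite_matrix R X PQ"
    and pq: "\<And>x z. \<lbrakk>x \<in> X; z \<in> X\<rbrakk> \<Longrightarrow> PQ x z = (\<Oplus>\<^bsub>R\<^esub>y\<in>{y\<in>X. P x y \<noteq> \<zero>\<^bsub>R\<^esub>}. P x y \<otimes>\<^bsub>R\<^esub> Q y z)"
    and M: "M \<in> carrier MX"
  shows "Rt Q (Rt P M) = Rt PQ M"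
proof -
  interpret A': nu_algebra R "reg_mod R" by (rule nu_algebra_reg_mod) (rule is_cring)
  have "(Rt Q \<circ> Rt P) M = Rt PQ M"
  proof (rule mat_lin_eqI[OF nu_algebra_axioms nu_algebra_MX lin_map_comp[OF lin_map_rmul[OF P] lin_map_rmul[OF Q]]
      lin_map_rmul[OF PQ] _ M])
    fix p q a assume s: "p \<in> X" "q \<in> X" "a \<in> carrier A"
    have "Rt Q (Rt P (fsingle A (p, q) a)) (x, y) = Rt PQ (fsingle A (p, q) a) (x, y)" for x y
    proof (cases "x = p \<and> y \<in> X")
      case True
      let ?E = "{u\<in>X. Q u y \<noteq> \<zero>\<^bsub>R\<^esub>}" and ?E' = "{u\<in>X. P q u \<noteq> \<zero>\<^bsub>R\<^esub>}"
      \<comment> \<open>Right multiplication produces a sum over the column support of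
        \<open>Q\<close>, whereas the product formula sums over the row support of \<open>P\<close>.
        Both are compared with the sum over the union, where the additional terms vanish.\<close>
      have F: "finite (?E \<union> ?E')" using finite_matrixD(3)[OF Q, of y y] finite_matrixD(2)[OF P s(2,2)] True by simp
      note c = finite_matrixD(1)[OF P] finite_matrixD(1)[OF Q]
      have "Rt Q (Rt P (fsingle A (p, q) a)) (x, y) = (\<Oplus>\<^bsub>A\<^esub>u\<in>?E. Q u y \<odot>\<^bsub>A\<^esub> Rt P (fsingle A (p, q) a) (x, u))"
        using True by (simp add: rmul_def[of R A X Q])
      also have "\<dots> = (\<Oplus>\<^bsub>A\<^esub>u\<in>?E. ((\<lambda>r. r \<odot>\<^bsub>A\<^esub> a) \<circ> (\<lambda>u. P q u \<otimes>\<^bsub>R\<^esub> Q u y)) u)"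
        using True s c by (intro finsum_cong') (auto simp: rmul_fsingle[OF P s] smult_assoc1[symmetric] m_comm)
      also have "\<dots> = (\<Oplus>\<^bsub>A\<^esub>u\<in>?E \<union> ?E'. ((\<lambda>r. r \<odot>\<^bsub>A\<^esub> a) \<circ> (\<lambda>u. P q u \<otimes>\<^bsub>R\<^esub> Q u y)) u)"
        by (rule finsum_superset[OF F]) (use True s c in auto)
      also have "\<dots> = (\<Oplus>\<^bsub>A\<^esub>u\<in>?E'. ((\<lambda>r. r \<odot>\<^bsub>A\<^esub> a) \<circ> (\<lambda>u. P q u \<otimes>\<^bsub>R\<^esub> Q u y)) u)"
        by (rule finsum_superset[OF F, symmetric]) (use True s c in auto)
      also have "\<dots> = PQ q y \<odot>\<^bsub>A\<^esub> a"
        using lin_map_finsum[OF A'.module_axioms module_axioms lin_map_scalar[OF s(3)] finite_matrixD(2)[OF P s(2,2)],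
            of "\<lambda>u. P q u \<otimes>\<^bsub>R\<^esub> Q u y"] pq[of q y] True s c by (simp add: Pi_iff o_def)
      finally show ?thesis using True by (simp add: rmul_fsingle[OF PQ s])
    next
      case False
      have "Rt Q (Rt P (fsingle A (p, q) a)) (x, y) = \<zero>\<^bsub>A\<^esub>"
        unfolding rmul_def[of R A X Q] using False finite_matrixD(1)[OF Q]
        by (auto simp: rmul_fsingle[OF P s] intro!: add.finprod_one_eqI)
      then show ?thesis using False by (auto simp: rmul_fsingle[OF PQ s])
    qed
    then show "(Rt Q \<circ> Rt P) (fsingle A (p, q) a) = Rt PQ (fsingle A (p, q) a)" by auto
  qed
  then show ?thesis by simp
qed

lemma lmul_rmul:
  assumes P: "finite_matrix R X P" and Q: "finite_matrix R X Q" and M: "M \<in> carrier MX"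
  shows "L P (Rt Q M) = Rt Q (L P M)"
proof -
  have "(L P \<circ> Rt Q) M = (Rt Q \<circ> L P) M"
  proof (rule mat_lin_eqI[OF nu_algebra_axioms nu_algebra_MX lin_map_comp[OF lin_map_rmul[OF Q] lin_map_lmul[OF P]]
        lin_map_comp[OF lin_map_lmul[OF P] lin_map_rmul[OF Q]] _ M])
    fix p q a assume s: "p \<in> X" "q \<in> X" "a \<in> carrier A"
    note c = finite_matrixD(1)[OF P] finite_matrixD(1)[OF Q]
    have "L P (Rt Q (fsingle A (p, q) a)) (x, y) = (if x \<in> X \<and> y \<in> X then P x p \<odot>\<^bsub>A\<^esub> (Q q y \<odot>\<^bsub>A\<^esub> a) else \<zero>\<^bsub>A\<^esub>)"
        for x y
    proof (cases "x \<in> X")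
      case True
      have "L P (Rt Q (fsingle A (p, q) a)) (x, y) = (if p \<in> {u\<in>X. P x u \<noteq> \<zero>\<^bsub>R\<^esub>}
          then P x p \<odot>\<^bsub>A\<^esub> Rt Q (fsingle A (p, q) a) (p, y) else \<zero>\<^bsub>A\<^esub>)"
        unfolding lmul_def[of R A X P] prod.case if_P[OF True]
        by (rule finsum_single) (use c True s finite_matrixD(2)[OF P True True] in \<open>auto simp: rmul_fsingle[OF Q s]\<close>)
      then show ?thesis using True s c by (auto simp: rmul_fsingle[OF Q s])
    qed (simp add: lmul_def[of R A X P])
    moreover have "Rt Q (L P (fsingle A (p, q) a)) (x, y) = (if x \<in> X \<and> y \<in> X then Q q y \<odot>\<^bsub>A\<^esub> (P x p \<odot>\<^bsub>A\<^esub> a) else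
        \<zero>\<^bsub>A\<^esub>)" for x y
    proof (cases "y \<in> X")
      case True
      have "Rt Q (L P (fsingle A (p, q) a)) (x, y) = (if q \<in> {v\<in>X. Q v y \<noteq> \<zero>\<^bsub>R\<^esub>}
          then Q q y \<odot>\<^bsub>A\<^esub> L P (fsingle A (p, q) a) (x, q) else \<zero>\<^bsub>A\<^esub>)"
        unfolding rmul_def[of R A X Q] prod.case if_P[OF True]
        by (rule finsum_single) (use c True s finite_matrixD(3)[OF Q True True] in \<open>auto simp: lmul_fsingle[OF P s]\<close>)
      then show ?thesis using True s c by (auto simp: lmul_fsingle[OF P s])
    qed (simp add: rmul_def[of R A X Q])
    ultimately show "(L P \<circ> Rt Q) (fsingle A (p, q) a) = (Rt Q \<circ> L P) (fsingle A (p, q) a)"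
      using s c by (auto simp: fun_eq_iff smult_assoc1[symmetric] m_comm)
  qed
  then show ?thesis by simp
qed

lemma mult_at:
  "\<lbrakk>p \<in> X; q \<in> X; a \<in> carrier A; N \<in> carrier MX\<rbrakk> \<Longrightarrow>
    (fsingle A (p, q) a \<otimes>\<^bsub>MX\<^esub> N) (x, z) = (if x = p then a \<otimes>\<^bsub>A\<^esub> N (q, z) else \<zero>\<^bsub>A\<^esub>)"
  "\<lbrakk>p \<in> X; q \<in> X; a \<in> carrier A; N \<in> carrier MX\<rbrakk> \<Longrightarrow>
    (N \<otimes>\<^bsub>MX\<^esub> fsingle A (p, q) a) (x, z) = (if z = q then N (x, p) \<otimes>\<^bsub>A\<^esub> a else \<zero>\<^bsub>A\<^esub>)"
  using mat_mult_fsingle_left[of "(p, q)" X a N x z] mat_mult_fsingle_right[of "(p, q)" X a N x z]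
  unfolding mat_alg_simps by simp_all

lemma fsingle_MX: "\<lbrakk>p \<in> X; q \<in> X; a \<in> carrier A\<rbrakk> \<Longrightarrow> fsingle A (p, q) a \<in> carrier MX"
  by (rule fsingle_mat_closed) (rule nu_algebra_axioms)

lemma lmul_mult:
  assumes P: "finite_matrix R X P" and MN: "M \<in> carrier MX" "N \<in> carrier MX"
  shows "L P (M \<otimes>\<^bsub>MX\<^esub> N) = L P M \<otimes>\<^bsub>MX\<^esub> N"
proof -
  note lM = mat_mult_eqI[OF nu_algebra_axioms nu_algebra_MX lin_map_lmul[OF P] lin_map_id lin_map_lmul[OF P] _ MN]
  have "L P (M \<otimes>\<^bsub>MX\<^esub> N) = L P M \<otimes>\<^bsub>MX\<^esub> id N"
  proof (rule lM)
    fix x y z w a b assume s: "x \<in> X" "y \<in> X" "z \<in> X" "w \<in> X" "a \<in> carrier A" "b \<in> carrier A"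
    note m = matrix_action_closed[OF P fsingle_MX[OF s(1,2,5)]]
    have "L P (fsingle A (x, y) a \<otimes>\<^bsub>MX\<^esub> fsingle A (z, w) b) (u, v) = (L P (fsingle A (x, y) a) \<otimes>\<^bsub>MX\<^esub> fsingle A (z, w)
        b) (u, v)" for u v
      unfolding mult_at(2)[OF s(3,4,6) m(1)] lmul_fsingle[OF P s(1,2,5)] mat_fsingle_mult[OF nu_algebra_axioms s]
      using s finite_matrixD(1)[OF P] lin_map_zero[OF nu_algebra_module[OF nu_algebra_MX] nu_algebra_module[OF
          nu_algebra_MX] lin_map_lmul[OF P]]
      by (auto simp: lmul_fsingle[OF P] mult_closed smult_mult_left mult_zero_left mat_alg_simps(3))
    then show "L P (fsingle A (x, y) a \<otimes>\<^bsub>MX\<^esub> fsingle A (z, w) b) = L P (fsingle A (x, y) a) \<otimes>\<^bsub>MX\<^esub> id (fsingle A (z, w)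
        b)"
      by auto
  qed
  then show ?thesis by simp
qed

lemma rmul_mult:
  assumes P: "finite_matrix R X P" and MN: "M \<in> carrier MX" "N \<in> carrier MX"
  shows "Rt P (M \<otimes>\<^bsub>MX\<^esub> N) = M \<otimes>\<^bsub>MX\<^esub> Rt P N"
proof -
  note lM = mat_mult_eqI[OF nu_algebra_axioms nu_algebra_MX lin_map_id lin_map_rmul[OF P] lin_map_rmul[OF P] _ MN]
  have "Rt P (M \<otimes>\<^bsub>MX\<^esub> N) = id M \<otimes>\<^bsub>MX\<^esub> Rt P N"
  proof (rule lM)
    fix x y z w a b assume s: "x \<in> X" "y \<in> X" "z \<in> X" "w \<in> X" "a \<in> carrier A" "b \<in> carrier A"
    note m = matrix_action_closed[OF P fsingle_MX[OF s(3,4,6)]]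
    have "Rt P (fsingle A (x, y) a \<otimes>\<^bsub>MX\<^esub> fsingle A (z, w) b) (u, v) = (fsingle A (x, y) a \<otimes>\<^bsub>MX\<^esub> Rt P (fsingle A (z, w)
        b)) (u, v)" for u v
      unfolding mult_at(1)[OF s(1,2,5) m(2)] rmul_fsingle[OF P s(3,4,6)] mat_fsingle_mult[OF nu_algebra_axioms s]
      using s finite_matrixD(1)[OF P] lin_map_zero[OF nu_algebra_module[OF nu_algebra_MX] nu_algebra_module[OF
          nu_algebra_MX] lin_map_rmul[OF P]]
      by (auto simp: rmul_fsingle[OF P] mult_closed smult_mult_right mult_zero_right mat_alg_simps(3))
    then show "Rt P (fsingle A (x, y) a \<otimes>\<^bsub>MX\<^esub> fsingle A (z, w) b) = id (fsingle A (x, y) a) \<otimes>\<^bsub>MX\<^esub> Rt P (fsingle A (z,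
        w) b)"
      by auto
  qed
  then show ?thesis by simp
qed

text \<open>Associativity with the scalar matrix in the middle. With \<open>lmul_mult\<close> and
  \<open>rmul_mult\<close> it says that left and right multiplication by \<open>P\<close> form a
  multiplier of the matrix algebra. Both sides are bilinear, so one-point matrices suffice.\<close>

lemma rmul_mult_lmul:
  assumes P: "finite_matrix R X P" and MN: "M \<in> carrier MX" "N \<in> carrier MX"
  shows "Rt P M \<otimes>\<^bsub>MX\<^esub> N = M \<otimes>\<^bsub>MX\<^esub> L P N"
proof -
  interpret MX: nu_algebra R MX by (rule nu_algebra_MX)
  note c = finite_matrixD(1)[OF P]
  have 1: "Rt P M \<otimes>\<^bsub>MX\<^esub> fsingle A (z, w) b = M \<otimes>\<^bsub>MX\<^esub> L P (fsingle A (z, w) b)"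
    if zw: "z \<in> X" "w \<in> X" "b \<in> carrier A" for z w b
  proof -
    note b = fsingle_MX[OF zw] and lb = matrix_action_closed(1)[OF P fsingle_MX[OF zw]]
    have "((\<lambda>x. x \<otimes>\<^bsub>MX\<^esub> fsingle A (z, w) b) \<circ> Rt P) M = (\<lambda>x. x \<otimes>\<^bsub>MX\<^esub> L P (fsingle A (z, w) b)) M"
    proof (rule mat_lin_eqI[OF nu_algebra_axioms nu_algebra_MX lin_map_comp[OF lin_map_rmul[OF P]
        MX.lin_map_mult_right[OF b]]
          MX.lin_map_mult_right[OF lb] _ MN(1)])
      fix x y a assume s: "x \<in> X" "y \<in> X" "a \<in> carrier A"
      note ra = matrix_action_closed(2)[OF P fsingle_MX[OF s]]
      have "(Rt P (fsingle A (x, y) a) \<otimes>\<^bsub>MX\<^esub> fsingle A (z, w) b) (u, v) =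
          (fsingle A (x, y) a \<otimes>\<^bsub>MX\<^esub> L P (fsingle A (z, w) b)) (u, v)" for u v
        unfolding mult_at(2)[OF zw ra] mult_at(1)[OF s lb] rmul_fsingle[OF P s] lmul_fsingle[OF P zw]
        using s zw c by (auto simp: smult_mult_left smult_mult_right mult_zero_left mult_zero_right)
      then show "((\<lambda>x. x \<otimes>\<^bsub>MX\<^esub> fsingle A (z, w) b) \<circ> Rt P) (fsingle A (x, y) a) =
          fsingle A (x, y) a \<otimes>\<^bsub>MX\<^esub> L P (fsingle A (z, w) b)" by auto
    qed
    then show ?thesis by simp
  qed
  note rM = matrix_action_closed(2)[OF P MN(1)]
  have "Rt P M \<otimes>\<^bsub>MX\<^esub> N = ((\<lambda>x. M \<otimes>\<^bsub>MX\<^esub> x) \<circ> L P) N"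
    by (rule mat_lin_eqI[OF nu_algebra_axioms nu_algebra_MX MX.lin_map_mult_left[OF rM]
        lin_map_comp[OF lin_map_lmul[OF P] MX.lin_map_mult_left[OF MN(1)]] _ MN(2)]) (simp add: 1)
  then show ?thesis by simp
qed

end

lemma matrix_action_natural:
  assumes A: "nu_algebra R A" and B: "nu_algebra R B" and f: "lin_map R A B f"
    and P: "finite_matrix R X P" and M: "M \<in> carrier (mat_alg X A)"
  shows "f \<circ> lmul R A X P M = lmul R B X P (f \<circ> M)" "f \<circ> rmul R A X P M = rmul R B X P (f \<circ> M)"
proof -
  interpret A: matrix_action R A X by (rule matrix_action.intro) fact
  interpret B: matrix_action R B X by (rule matrix_action.intro) fact
  note z = lin_map_zero[OF A.module_axioms B.module_axioms f]
  have c: "M q \<in> carrier A" for q using M A.fin_fun_carrier by (simp add: mat_alg_simps)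
  have 1: "f (\<Oplus>\<^bsub>A\<^esub>u\<in>F. r u \<odot>\<^bsub>A\<^esub> m u) = (\<Oplus>\<^bsub>B\<^esub>u\<in>F. r u \<odot>\<^bsub>B\<^esub> f (m u))"
    if "finite F" "\<And>u. u \<in> F \<Longrightarrow> r u \<in> carrier R" "\<And>u. m u \<in> carrier A" for F r and m
    using lin_map_finsum[OF A.module_axioms B.module_axioms f that(1), of "\<lambda>u. r u \<odot>\<^bsub>A\<^esub> m u"] that lin_mapD[OF f]
    by (auto intro!: B.finsum_cong')
  show "f \<circ> lmul R A X P M = lmul R B X P (f \<circ> M)"
  proof
    fix xy show "(f \<circ> lmul R A X P M) xy = lmul R B X P (f \<circ> M) xy"
    proof (cases xy)
      case (Pair x y)
      show ?thesis unfolding Pair lmul_def using 1[OF finite_matrixD(2)[OF P, of x x]] finite_matrixD(1)[OF P, of x] c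
          z by simp
    qed
  qed
  show "f \<circ> rmul R A X P M = rmul R B X P (f \<circ> M)"
  proof
    fix xy show "(f \<circ> rmul R A X P M) xy = rmul R B X P (f \<circ> M) xy"
    proof (cases xy)
      case (Pair x y)
      show ?thesis unfolding Pair rmul_def using 1[OF finite_matrixD(3)[OF P, of y y]] finite_matrixD(1)[OF P, of _ y]
          c z by simp
    qed
  qed
qed

section \<open>\<open>G\<close>-algebra structures on polynomials, copies and endomorphisms\<close>

lemma extend_galg_simps [simp]:
  "carrier (module.extend A (galg.fields a)) = carrier A" "mult (module.extend A (galg.fields a)) = mult A"
  "zero (module.extend A (galg.fields a)) = zero A" "add (module.extend A (galg.fields a)) = add A"
  "smult (module.extend A (galg.fields a)) = smult A" "gact (module.extend A (galg.fields a)) = a"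
  by (simp_all add: module.defs galg.defs)

lemma nu_algebra_extend:
  fixes A :: "('k, 'a) module" and a :: "'g \<Rightarrow> 'a \<Rightarrow> 'a"
  shows "nu_algebra R A \<Longrightarrow> nu_algebra R (module.extend A (galg.fields a))"
  by (rule nu_algebra_transport[where f = id]) (simp_all add: bij_betw_def)

lemma g_algebraI:
  assumes A: "nu_algebra R A" and G: "group G" and h: "\<And>g. g \<in> carrier G \<Longrightarrow> nu_hom R A A (gact A g)"
    and "\<And>a. a \<in> carrier A \<Longrightarrow> gact A \<one>\<^bsub>G\<^esub> a = a"
    and "\<And>g h a. \<lbrakk>g \<in> carrier G; h \<in> carrier G; a \<in> carrier A\<rbrakk> \<Longrightarrow> gact A (g \<otimes>\<^bsub>G\<^esub> h) a = gact A g (gact A h a)"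
  shows "g_algebra R G A"
  using assms restrict_alg_homs[OF A h] by (intro g_algebra.intro g_algebra_axioms.intro) simp_all

lemma equivariantD: "\<lbrakk>equivariant G A B f; g \<in> carrier G; a \<in> carrier A\<rbrakk> \<Longrightarrow> f (gact A g a) = gact B g (f a)"
  by (simp add: equivariant_def)

lemma poly_galg_simps [simp]:
  "carrier (poly_galg A) = carrier (poly_alg A)" "mult (poly_galg A) = mult (poly_alg A)"
  "zero (poly_galg A) = zero (poly_alg A)" "add (poly_galg A) = add (poly_alg A)"
  "smult (poly_galg A) = smult (poly_alg A)" "gact (poly_galg A) = (\<lambda>g \<phi> n. gact A g (\<phi> n))"
  by (simp_all add: poly_galg_def)

lemma g_algebra_poly:
  assumes "g_algebra R G A"
  shows "g_algebra R G (poly_galg A)"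
proof -
  interpret A: g_algebra R G A by fact
  have P: "nu_algebra R (poly_alg A)" by (rule nu_algebra_poly) (rule A.nu_algebra_axioms)
  have P': "nu_algebra R (poly_galg A)" unfolding poly_galg_def by (rule nu_algebra_extend[OF P])
  have c: "\<phi> n \<in> carrier A" if "\<phi> \<in> carrier (poly_alg A)" for \<phi> n
    using that A.fin_fun_carrier by (simp add: A.poly_alg_simps)
  show ?thesis
  proof (rule g_algebraI[OF P' A.group_axioms])
    fix g assume g: "g \<in> carrier G"
    show "nu_hom R (poly_galg A) (poly_galg A) (gact (poly_galg A) g)"
      using nu_hom_poly_map[OF A.nu_algebra_axioms A.nu_algebra_axioms A.gact_nu_hom[OF g]]
      by (simp add: nu_hom_def lin_map_def o_def)
    fix h \<phi> assume "h \<in> carrier G" "\<phi> \<in> carrier (poly_galg A)"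
    then show "gact (poly_galg A) (g \<otimes>\<^bsub>G\<^esub> h) \<phi> = gact (poly_galg A) g (gact (poly_galg A) h \<phi>)"
      using g c by (simp add: A.gact_mult)
  qed (use c in \<open>simp add: A.gact_one\<close>)
qed

lemma copy_galg_simps [simp]:
  "carrier (copy_galg A) = carrier (copy_alg A)" "mult (copy_galg A) = mult (copy_alg A)"
  "zero (copy_galg A) = zero (copy_alg A)" "add (copy_galg A) = add (copy_alg A)"
  "smult (copy_galg A) = smult (copy_alg A)"
  "gact (copy_galg A) = (\<lambda>g x. copy_map (carrier A) (gact A g (inv_into (carrier A) (copy_map (carrier A)) x)))"
  by (simp_all add: copy_galg_def)

lemma g_algebra_copy:
  fixes A :: "('k, 'b, 'g) galg"
  assumes A: "g_algebra R G A" and s: "carrier A \<lesssim> (UNIV :: 'u set)"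
  shows "g_algebra R G (copy_galg A :: ('k, 'u, 'g) galg)"
    and "nu_hom R A (copy_galg A :: ('k, 'u, 'g) galg) (copy_map (carrier A))"
    and "equivariant G A (copy_galg A :: ('k, 'u, 'g) galg) (copy_map (carrier A))"
    and "bij_betw (copy_map (carrier A)) (carrier A) (carrier (copy_galg A :: ('k, 'u, 'g) galg))"
proof -
  interpret A: g_algebra R G A by fact
  let ?A = "copy_galg A :: ('k, 'u, 'g) galg"
  let ?c = "copy_map (carrier A) :: 'b \<Rightarrow> 'u"
  note c = nu_algebra_copy[OF A.nu_algebra_axioms s] and inv = copy_map_inv[OF s]
  have C: "nu_algebra R ?A" unfolding copy_galg_def by (rule nu_algebra_extend) (rule c(1))
  show h: "nu_hom R A ?A ?c" using c(2) by (simp add: nu_hom_def lin_map_def)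
  show b: "bij_betw ?c (carrier A) (carrier ?A)" using bij_copy_map[OF s] by simp
  show "equivariant G A ?A ?c" by (simp add: equivariant_def inv)
  note d = inverse_nu_hom[OF A.nu_algebra_axioms h b]
  show "g_algebra R G ?A"
  proof (rule g_algebraI[OF C A.group_axioms])
    fix g assume g: "g \<in> carrier G"
    show "nu_hom R ?A ?A (gact ?A g)"
      using nu_hom_comp[OF nu_hom_comp[OF d A.gact_nu_hom[OF g]] h] by (simp add: o_def)
    fix k a assume "k \<in> carrier G" "a \<in> carrier ?A"
    then show "gact ?A (g \<otimes>\<^bsub>G\<^esub> k) a = gact ?A g (gact ?A k a)"
      using g by (auto simp: copy_alg_simps inv A.gact_mult)
  next
    fix a assume "a \<in> carrier ?A"
    then show "gact ?A \<one>\<^bsub>G\<^esub> a = a" by (auto simp: copy_alg_simps inv A.gact_one)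
  qed
qed

section \<open>The \<open>G\<close>-algebra \<open>A \<otimes> End(W)\<close> and the removal of its
  inner action\<close>

locale end_rep = g_algebra R G A + matrix_action R A X
  for R :: "('k, 'r) ring_scheme" and G :: "('g, 's) monoid_scheme" and A :: "('k, 'a, 'g) galg" and X :: "'x set" +
  fixes \<rho> :: "'g \<Rightarrow> 'x \<Rightarrow> 'x \<Rightarrow> 'k"
  assumes rep: "is_rep R G X \<rho>"
begin

sublocale MX: nu_algebra R MX by (rule nu_algebra_MX)

lemma fm: "g \<in> carrier G \<Longrightarrow> finite_matrix R X (\<rho> g)"
  using rep by (simp add: is_rep_def finite_matrix_def)

lemma rep_one: "\<lbrakk>x \<in> X; y \<in> X\<rbrakk> \<Longrightarrow> \<rho> \<one>\<^bsub>G\<^esub> x y = (if x = y then \<one>\<^bsub>R\<^esub> else \<zero>\<^bsub>R\<^esub>)"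
  using rep by (simp add: is_rep_def)

lemma rep_mult: "\<lbrakk>g \<in> carrier G; h \<in> carrier G; x \<in> X; z \<in> X\<rbrakk> \<Longrightarrow>
    \<rho> (g \<otimes>\<^bsub>G\<^esub> h) x z = (\<Oplus>\<^bsub>R\<^esub>y\<in>{y\<in>X. \<rho> g x y \<noteq> \<zero>\<^bsub>R\<^esub>}. \<rho> g x y \<otimes>\<^bsub>R\<^esub> \<rho> h y z)"
  using rep by (simp add: is_rep_def)

lemma L_L: "\<lbrakk>g \<in> carrier G; h \<in> carrier G; M \<in> carrier MX\<rbrakk> \<Longrightarrow> L (\<rho> g) (L (\<rho> h) M) = L (\<rho> (g \<otimes>\<^bsub>G\<^esub> h)) M"
  by (rule lmul_lmul) (simp_all add: fm rep_mult)

lemma R_R: "\<lbrakk>g \<in> carrier G; h \<in> carrier G; M \<in> carrier MX\<rbrakk> \<Longrightarrow> Rt (\<rho> h) (Rt (\<rho> g) M) = Rt (\<rho> (g \<otimes>\<^bsub>G\<^esub> h)) M"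
  by (rule rmul_rmul) (simp_all add: fm rep_mult)

lemma L_one:
  assumes M: "M \<in> carrier MX"
  shows "L (\<rho> \<one>\<^bsub>G\<^esub>) M = M"
proof -
  have "L (\<rho> \<one>\<^bsub>G\<^esub>) M = id M"
    by (rule mat_lin_eqI[OF nu_algebra_axioms nu_algebra_MX lin_map_lmul[OF fm[OF one_closed]] lin_map_id _ M])
      (auto simp: fun_eq_iff lmul_fsingle[OF fm[OF one_closed]] rep_one, auto simp: fsingle_def)
  then show ?thesis by simp
qed

lemma R_one:
  assumes M: "M \<in> carrier MX"
  shows "Rt (\<rho> \<one>\<^bsub>G\<^esub>) M = M"
proof -
  have "Rt (\<rho> \<one>\<^bsub>G\<^esub>) M = id M"
    by (rule mat_lin_eqI[OF nu_algebra_axioms nu_algebra_MX lin_map_rmul[OF fm[OF one_closed]] lin_map_id _ M])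
      (auto simp: fun_eq_iff rmul_fsingle[OF fm[OF one_closed]] rep_one, auto simp: fsingle_def)
  then show ?thesis by simp
qed

text \<open>Conjugation by \<open>\<rho> g\<close> after the entrywise action on \<open>A\<close>,
  written with multipliers. In this form the laws of an action follow from the multiplier laws;
  \<open>end_gact\<close> identifies it with the explicit sum in \<open>end_galg\<close>.\<close>

definition cact :: "'g \<Rightarrow> ('x \<times> 'x \<Rightarrow> 'a) \<Rightarrow> 'x \<times> 'x \<Rightarrow> 'a" where
  "cact g M = L (\<rho> g) (Rt (\<rho> (inv\<^bsub>G\<^esub> g)) (gact A g \<circ> M))"

lemma map_gact: "g \<in> carrier G \<Longrightarrow> nu_hom R MX MX ((\<circ>) (gact A g))"
  by (rule nu_hom_mat_map) (simp_all add: nu_algebra_axioms gact_nu_hom)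

lemma map_gact_closed: "\<lbrakk>g \<in> carrier G; M \<in> carrier MX\<rbrakk> \<Longrightarrow> gact A g \<circ> M \<in> carrier MX"
  using nu_homD(3)[OF map_gact] .

lemmas L_closed = matrix_action_closed(1)[OF fm]
lemmas R_closed = matrix_action_closed(2)[OF fm]

lemma lin_map_cact: "g \<in> carrier G \<Longrightarrow> lin_map R MX MX (cact g)"
  using lin_map_comp[OF nu_homD(1)[OF map_gact] lin_map_comp[OF lin_map_rmul[OF fm] lin_map_lmul[OF fm]], of g
      "inv\<^bsub>G\<^esub> g" g]
  by (simp add: cact_def[abs_def] o_def)

text \<open>The right multiplier of the first factor is the inverse of the left multiplier of the
  second, so the two cancel across the product once \<open>rmul_mult_lmul\<close> has moved one over
  to the other.\<close>

lemma nu_hom_cact: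
  assumes g: "g \<in> carrier G"
  shows "nu_hom R MX MX (cact g)"
proof (rule nu_homI[OF lin_map_cact[OF g]])
  fix M N assume MN: "M \<in> carrier MX" "N \<in> carrier MX"
  let ?M = "gact A g \<circ> M" and ?N = "gact A g \<circ> N"
  note c = map_gact_closed[OF g MN(1)] map_gact_closed[OF g MN(2)]
  have gi: "inv\<^bsub>G\<^esub> g \<in> carrier G" using g by simp
  have "cact g M \<otimes>\<^bsub>MX\<^esub> cact g N = Rt (\<rho> (inv\<^bsub>G\<^esub> g)) (L (\<rho> g) ?M) \<otimes>\<^bsub>MX\<^esub> L (\<rho> g) (Rt (\<rho> (inv\<^bsub>G\<^esub> g)) ?N)"
    using g gi c by (simp add: cact_def lmul_rmul[OF fm fm])
  also have "\<dots> = L (\<rho> g) ?M \<otimes>\<^bsub>MX\<^esub> L (\<rho> (inv\<^bsub>G\<^esub> g)) (L (\<rho> g) (Rt (\<rho> (inv\<^bsub>G\<^esub> g)) ?N))"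
    using g gi c by (simp add: rmul_mult_lmul[OF fm] L_closed R_closed)
  also have "\<dots> = L (\<rho> g) ?M \<otimes>\<^bsub>MX\<^esub> Rt (\<rho> (inv\<^bsub>G\<^esub> g)) ?N"
    using g gi c by (simp add: L_L R_closed L_one)
  also have "\<dots> = cact g (M \<otimes>\<^bsub>MX\<^esub> N)"
    using g gi c nu_homD(2)[OF map_gact[OF g] MN]
    by (simp add: cact_def rmul_mult[OF fm] lmul_mult[OF fm] R_closed)
  finally show "cact g (M \<otimes>\<^bsub>MX\<^esub> N) = cact g M \<otimes>\<^bsub>MX\<^esub> cact g N" by simp
qed

lemma map_gact_L: "\<lbrakk>g \<in> carrier G; h \<in> carrier G; M \<in> carrier MX\<rbrakk> \<Longrightarrow>
    gact A g \<circ> L (\<rho> h) M = L (\<rho> h) (gact A g \<circ> M)"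
  by (rule matrix_action_natural(1)[OF nu_algebra_axioms nu_algebra_axioms nu_homD(1)[OF gact_nu_hom] fm])

lemma map_gact_R: "\<lbrakk>g \<in> carrier G; h \<in> carrier G; M \<in> carrier MX\<rbrakk> \<Longrightarrow>
    gact A g \<circ> Rt (\<rho> h) M = Rt (\<rho> h) (gact A g \<circ> M)"
  by (rule matrix_action_natural(2)[OF nu_algebra_axioms nu_algebra_axioms nu_homD(1)[OF gact_nu_hom] fm])

lemma mat_value: "M \<in> carrier MX \<Longrightarrow> M p \<in> carrier A"
  using fin_fun_carrier by (simp add: mat_alg_simps)

lemma cact_mult:
  assumes g: "g \<in> carrier G" and h: "h \<in> carrier G" and M: "M \<in> carrier MX"
  shows "cact (g \<otimes>\<^bsub>G\<^esub> h) M = cact g (cact h M)"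
proof -
  have gi: "inv\<^bsub>G\<^esub> g \<in> carrier G" "inv\<^bsub>G\<^esub> h \<in> carrier G" using g h by simp_all
  have ghM: "gact A (g \<otimes>\<^bsub>G\<^esub> h) \<circ> M = gact A g \<circ> (gact A h \<circ> M)"
    using g h mat_value[OF M] by (simp add: fun_eq_iff gact_mult)
  let ?N = "gact A g \<circ> (gact A h \<circ> M)"
  have N: "?N \<in> carrier MX" "gact A h \<circ> M \<in> carrier MX" using g h M by (simp_all add: map_gact_closed)
  have "cact g (cact h M) = L (\<rho> g) (Rt (\<rho> (inv\<^bsub>G\<^esub> g)) (L (\<rho> h) (Rt (\<rho> (inv\<^bsub>G\<^esub> h)) ?N)))"
    using g h gi N by (simp add: cact_def map_gact_L map_gact_R R_closed)
  also have "\<dots> = L (\<rho> g) (L (\<rho> h) (Rt (\<rho> (inv\<^bsub>G\<^esub> g)) (Rt (\<rho> (inv\<^bsub>G\<^esub> h)) ?N)))"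
    using g h gi N lmul_rmul[OF fm[OF h] fm[OF gi(1)] R_closed[OF gi(2) N(1)]] by simp
  also have "\<dots> = L (\<rho> (g \<otimes>\<^bsub>G\<^esub> h)) (Rt (\<rho> (inv\<^bsub>G\<^esub> h \<otimes>\<^bsub>G\<^esub> inv\<^bsub>G\<^esub> g)) ?N)"
    using g h gi N by (simp add: R_R L_L R_closed)
  finally show ?thesis using g h by (simp add: cact_def ghM inv_mult_group)
qed

lemma cact_one: "M \<in> carrier MX \<Longrightarrow> cact \<one>\<^bsub>G\<^esub> M = M"
proof -
  assume M: "M \<in> carrier MX"
  have "gact A \<one>\<^bsub>G\<^esub> \<circ> M = M" using mat_value[OF M] by (simp add: fun_eq_iff gact_one)
  then show ?thesis using M by (simp add: cact_def R_one L_one)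
qed

text \<open>At a position inside \<open>X\<close> both expressions are linear in \<open>M\<close>,
  so they are compared on one-point matrices, where the sums collapse to one term. Outside
  \<open>X\<close> the explicit formula has the default value zero, and so has
  \<open>cact g M\<close>, being a matrix over \<open>X\<close>.\<close>

lemma end_gact:
  assumes g: "g \<in> carrier G" and M: "M \<in> carrier MX"
  shows "gact (end_galg G R X \<rho> A) g M = cact g M"
proof
  fix xy show "gact (end_galg G R X \<rho> A) g M xy = cact g M xy"
  proof (cases xy)
    case (Pair x y)
    have gi: "inv\<^bsub>G\<^esub> g \<in> carrier G" using g by simp
    note fg = finite_matrixD(1)[OF fm[OF g]] and fgi = finite_matrixD(1)[OF fm[OF gi]]
    show ?thesis
    proof (cases "x \<in> X \<and> y \<in> X")
      case True
      define \<theta> where "\<theta> q a = (\<rho> g x (fst q) \<otimes>\<^bsub>R\<^esub> \<rho> (inv\<^bsub>G\<^esub> g) (snd q) y) \<odot>\<^bsub>A\<^esub> gact A g a" for q a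
      have \<theta>: "lin_map R A A (\<theta> q)" if "q \<in> X \<times> X" for q
        using lin_map_comp[OF nu_homD(1)[OF gact_nu_hom[OF g]] lin_map_smult[of
            "\<rho> g x (fst q) \<otimes>\<^bsub>R\<^esub> \<rho> (inv\<^bsub>G\<^esub> g) (snd q) y"]]
          that True fg fgi by (auto simp: \<theta>_def[abs_def] o_def)
      have 1: "lin_map R MX A (fs_ext A A \<theta>)"
        unfolding mat_alg_def by (rule lin_map_fs_ext[OF module_axioms module_axioms \<theta>])
      have 2: "lin_map R MX A (\<lambda>M. cact g M (x, y))"
        using lin_mapD[OF lin_map_cact[OF g]] mat_value by (intro lin_mapI) (simp_all add: mat_alg_simps(4,5))
      have "gact (end_galg G R X \<rho> A) g M (x, y) = fs_ext A A \<theta> M"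
        using True by (simp add: end_galg_def fs_ext_def \<theta>_def)
      also have "\<dots> = cact g M (x, y)"
      proof (rule mat_lin_eqI[OF nu_algebra_axioms nu_algebra_axioms 1 2 _ M])
        fix p q a assume s: "p \<in> X" "q \<in> X" "a \<in> carrier A"
        have "gact A g \<circ> fsingle A (p, q) a = fsingle A (p, q) (gact A g a)"
          using comp_fsingle[OF module_axioms module_axioms nu_homD(1)[OF gact_nu_hom[OF g]]] .
        moreover have "Rt (\<rho> (inv\<^bsub>G\<^esub> g)) (fsingle A (p, q) b) \<in> carrier MX" if "b \<in> carrier A" for b
          using R_closed[OF gi fsingle_MX[OF s(1,2) that]] .
        ultimately have "cact g (fsingle A (p, q) a) (x, y) =
            (Rt (\<rho> (inv\<^bsub>G\<^esub> g)) (L (\<rho> g) (fsingle A (p, q) (gact A g a)))) (x, y)"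
          using lmul_rmul[OF fm[OF g] fm[OF gi] fsingle_MX[OF s(1,2)]] s g by (simp add: cact_def)
        also have "\<dots> = (if q \<in> {v\<in>X. \<rho> (inv\<^bsub>G\<^esub> g) v y \<noteq> \<zero>\<^bsub>R\<^esub>} then
            \<rho> (inv\<^bsub>G\<^esub> g) q y \<odot>\<^bsub>A\<^esub> L (\<rho> g) (fsingle A (p, q) (gact A g a)) (x, q) else \<zero>\<^bsub>A\<^esub>)"
          unfolding rmul_def[of R A X "\<rho> (inv\<^bsub>G\<^esub> g)"] prod.case if_P[OF conjunct2[OF True]]
          by (rule finsum_single)
            (use True s g fg fgi finite_matrixD(3)[OF fm[OF gi], of y y] in \<open>auto simp: lmul_fsingle[OF fm[OF g]]\<close>)
        also have "\<dots> = \<theta> (p, q) a"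
          using True s g fg fgi by (auto simp: lmul_fsingle[OF fm[OF g]] \<theta>_def smult_assoc1[symmetric] m_comm)
        finally show "fs_ext A A \<theta> (fsingle A (p, q) a) = cact g (fsingle A (p, q) a) (x, y)"
          using fs_ext_fsingle[OF module_axioms module_axioms \<theta>, where s = "(p, q)"] s by simp
      qed
      finally show ?thesis using Pair by simp
    next
      case False
      have "cact g M \<in> fin_fun (X \<times> X) A"
        using lin_mapD(1)[OF lin_map_cact[OF g] M] by (simp add: mat_alg_simps)
      then show ?thesis using False Pair by (auto simp: end_galg_def fin_fun_def)
    qed
  qed
qed

abbreviation "E \<equiv> end_galg G R X \<rho> A"

lemma end_simps [simp]:
  "carrier E = carrier MX" "mult E = mult MX" "zero E = zero MX" "add E = add MX" "smult E = smult MX"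
  by (simp_all add: end_galg_def)

lemma g_algebra_end: "g_algebra R G E"
proof (rule g_algebraI)
  show "nu_algebra R E" unfolding end_galg_def by (rule nu_algebra_extend) (rule nu_algebra_MX)
  show "group G" by (rule group_axioms)
  fix g assume g: "g \<in> carrier G"
  have "nu_hom R E E (cact g)" using nu_hom_cact[OF g] by (simp add: nu_hom_def lin_map_def)
  then show "nu_hom R E E (gact E g)"
    using nu_hom_cong[OF \<open>nu_algebra R E\<close>, of "gact E g" "cact g" E] end_gact[OF g] by simp
  fix h M assume "h \<in> carrier G" "M \<in> carrier E"
  then show "gact E (g \<otimes>\<^bsub>G\<^esub> h) M = gact E g (gact E h M)"
    using g lin_mapD(1)[OF lin_map_cact] by (simp add: end_gact cact_mult)
next
  fix M assume "M \<in> carrier E"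
  then show "gact E \<one>\<^bsub>G\<^esub> M = M" by (simp add: end_gact cact_one)
qed

text \<open>On \<open>A \<otimes> End(W)\<close> the action of \<open>H\<close> is the action on \<open>A\<close> followed by an inner one, which the
  isomorphism \<open>M \<rtimes> h \<mapsto> M \<rho>(h) \<rtimes> h\<close> to \<open>M\<^sub>X (A \<rtimes> H)\<close> removes.\<close>

lemma twist:
  assumes H: "subgroup H G"
  obtains \<tau> where "nu_hom R (crossed G H E) (mat_alg X (crossed G H A)) \<tau>"
    "bij_betw \<tau> (carrier (crossed G H E)) (carrier (mat_alg X (crossed G H A)))"
    "\<And>h M. \<lbrakk>h \<in> H; M \<in> carrier MX\<rbrakk> \<Longrightarrow> \<tau> (fsingle E h M) = fsingle A h \<circ> Rt (\<rho> h) M"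
proof -
  interpret H: subgroup H G by fact
  interpret E: g_algebra R G E by (rule g_algebra_end)
  let ?D = "crossed G H A" and ?C = "crossed G H E"
  have D: "nu_algebra R ?D" by (rule nu_algebra_crossed[OF g_algebra_axioms H])
  have C: "nu_algebra R ?C" by (rule nu_algebra_crossed[OF g_algebra_end H])
  have MD: "nu_algebra R (mat_alg X ?D)" by (rule nu_algebra_mat[OF D])
  interpret D: nu_algebra R ?D by (rule D)
  interpret C: nu_algebra R ?C by (rule C)
  interpret MD: nu_algebra R "mat_alg X ?D" by (rule MD)
  interpret cA: twisted_convolution R A H "crossed_mult G A" "\<lambda>s t. Some (s \<otimes>\<^bsub>G\<^esub> t)" "gact A"
    by (rule crossed_convolution[OF g_algebra_axioms H])
  interpret cE: twisted_convolution R E H "crossed_mult G E" "\<lambda>s t. Some (s \<otimes>\<^bsub>G\<^esub> t)" "gact E"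
    by (rule crossed_convolution[OF g_algebra_end H])
  have sA: "lin_map R A ?D (fsingle A h)" if "h \<in> H" for h
    unfolding crossed_def by (rule lin_map_fsingle[OF module_axioms that])
  have sE: "lin_map R MX ?C (fsingle E h)" if "h \<in> H" for h
  proof -
    have "lin_map R E ?C (fsingle E h)" unfolding crossed_def by (rule lin_map_fsingle[OF E.module_axioms that])
    then show ?thesis by (simp add: lin_map_def)
  qed
  have emb: "lin_map R MX (mat_alg X ?D) ((\<circ>) (fsingle A h))" if "h \<in> H" for h
    unfolding mat_alg_def by (rule lin_map_fs_map[OF module_axioms D.module_axioms sA[OF that]])
  have embs: "fsingle A h \<circ> fsingle A p a = fsingle ?D p (fsingle A h a)" if "h \<in> H" for h p a
    by (rule comp_fsingle[OF module_axioms D.module_axioms sA[OF that]])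
  define \<theta> where "\<theta> h M = fsingle A h \<circ> Rt (\<rho> h) M" for h M
  have \<theta>': "lin_map R MX (mat_alg X ?D) (\<theta> h)" if "h \<in> H" for h
    using lin_map_comp[OF lin_map_rmul[OF fm] emb[OF that], of h] that by (simp add: \<theta>_def[abs_def] o_def)
  then have \<theta>: "lin_map R E (mat_alg X ?D) (\<theta> h)" if "h \<in> H" for h using that by (simp add: lin_map_def)
  define \<tau> where "\<tau> = fs_ext E (mat_alg X ?D) \<theta>"
  have \<tau>s: "\<tau> (fsingle E h M) = \<theta> h M" if "h \<in> H" "M \<in> carrier MX" for h M
    unfolding \<tau>_def using fs_ext_fsingle[OF E.module_axioms MD.module_axioms \<theta> that(1)] that(2) by simp
  have \<tau>l: "lin_map R ?C (mat_alg X ?D) \<tau>"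
    unfolding \<tau>_def crossed_def[of G H E] by (rule lin_map_fs_ext[OF E.module_axioms MD.module_axioms \<theta>])
  \<comment> \<open>Matrices concentrated in the degrees h and k multiply in matrices over
    \<open>A \<rtimes> H\<close> as the crossed product prescribes: the action of h is applied to
    the second one, and the degree becomes hk.\<close>
  have embm: "(fsingle A h \<circ> M) \<otimes>\<^bsub>mat_alg X ?D\<^esub> (fsingle A k \<circ> N) = fsingle A (h \<otimes>\<^bsub>G\<^esub> k) \<circ> (M \<otimes>\<^bsub>MX\<^esub> (gact A h \<circ> N))"
    if hk: "h \<in> H" "k \<in> H" and MN: "M \<in> carrier MX" "N \<in> carrier MX" for h k M N
  proof -
    have h: "h \<in> carrier G" "h \<otimes>\<^bsub>G\<^esub> k \<in> H" using hk by simp_all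
    let ?F = "\<lambda>M. fsingle A h \<circ> M" and ?K = "\<lambda>M. fsingle A k \<circ> M" and ?g = "\<lambda>M. gact A h \<circ> M"
    \<comment> \<open>both sides are bilinear in \<open>M\<close> and \<open>N\<close>\<close>
    have N1: "(fsingle A h \<circ> M) \<otimes>\<^bsub>mat_alg X ?D\<^esub> (fsingle A k \<circ> fsingle A (z, w) b) =
        fsingle A (h \<otimes>\<^bsub>G\<^esub> k) \<circ> (M \<otimes>\<^bsub>MX\<^esub> (gact A h \<circ> fsingle A (z, w) b))"
      if zw: "z \<in> X" "w \<in> X" "b \<in> carrier A" for z w b
    proof -
      note N = fsingle_MX[OF zw]
      note r = MD.lin_map_mult_right[OF lin_mapD(1)[OF emb[OF hk(2)] N]]
        MX.lin_map_mult_right[OF map_gact_closed[OF h(1) N]]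
      have "((\<lambda>x. x \<otimes>\<^bsub>mat_alg X ?D\<^esub> ?K (fsingle A (z, w) b)) \<circ> ?F) M =
          ((\<lambda>M. fsingle A (h \<otimes>\<^bsub>G\<^esub> k) \<circ> M) \<circ> (\<lambda>x. x \<otimes>\<^bsub>MX\<^esub> ?g (fsingle A (z, w) b))) M"
      proof (rule mat_lin_eqI[OF nu_algebra_axioms MD lin_map_comp[OF emb[OF hk(1)] r(1)] lin_map_comp[OF r(2) emb[OF
          h(2)]] _ MN(1)])
        fix x y a assume s: "x \<in> X" "y \<in> X" "a \<in> carrier A"
        have 1: "gact A h \<circ> fsingle A (z, w) b = fsingle A (z, w) (gact A h b)"
          by (rule comp_fsingle[OF module_axioms module_axioms nu_homD(1)[OF gact_nu_hom[OF h(1)]]])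
        have 2: "fsingle A h a \<otimes>\<^bsub>?D\<^esub> fsingle A k b = fsingle A (h \<otimes>\<^bsub>G\<^esub> k) (a \<otimes>\<^bsub>A\<^esub> gact A h b)"
          using cA.m_fsingle[OF hk(1) s(3) hk(2) zw(3)] by (simp add: crossed_def)
        note c = lin_mapD(1)[OF sA[OF hk(1)] s(3)] lin_mapD(1)[OF sA[OF hk(2)] zw(3)]
        show "((\<lambda>x. x \<otimes>\<^bsub>mat_alg X ?D\<^esub> ?K (fsingle A (z, w) b)) \<circ> ?F) (fsingle A (x, y) a) =
          ((\<lambda>M. fsingle A (h \<otimes>\<^bsub>G\<^esub> k) \<circ> M) \<circ> (\<lambda>x. x \<otimes>\<^bsub>MX\<^esub> ?g (fsingle A (z, w) b))) (fsingle A (x, y) a)"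
          using s zw h hk lin_map_zero[OF MX.module_axioms MD.module_axioms emb[OF h(2)]]
          by (simp add: 1 2 embs mat_fsingle_mult[OF D _ _ _ _ c] mat_fsingle_mult[OF nu_algebra_axioms])
      qed
      then show ?thesis by simp
    qed
    note l = MD.lin_map_mult_left[OF lin_mapD(1)[OF emb[OF hk(1)] MN(1)]] MX.lin_map_mult_left[OF MN(1)]
    have "((\<lambda>x. ?F M \<otimes>\<^bsub>mat_alg X ?D\<^esub> x) \<circ> ?K) N =
        ((\<lambda>M. fsingle A (h \<otimes>\<^bsub>G\<^esub> k) \<circ> M) \<circ> ((\<lambda>x. M \<otimes>\<^bsub>MX\<^esub> x) \<circ> ?g)) N"
      by (rule mat_lin_eqI[OF nu_algebra_axioms MD lin_map_comp[OF emb[OF hk(2)] l(1)]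
            lin_map_comp[OF lin_map_comp[OF nu_homD(1)[OF map_gact[OF h(1)]] l(2)] emb[OF h(2)]] _ MN(2)]) (simp add:
            N1)
    then show ?thesis by simp
  qed
  have \<tau>h: "nu_hom R ?C (mat_alg X ?D) \<tau>"
    unfolding crossed_def[of G H E]
  proof (rule nu_hom_fsI[OF E.module_axioms cE.nu_algebra_fs_alg MD \<tau>l[unfolded crossed_def[of G H E]]])
    fix h M k N assume s: "h \<in> H" "M \<in> carrier E" "k \<in> H" "N \<in> carrier E"
    then have MN: "M \<in> carrier MX" "N \<in> carrier MX" and g: "h \<in> carrier G" "k \<in> carrier G" "inv\<^bsub>G\<^esub> h \<in> carrier G"
        "h \<otimes>\<^bsub>G\<^esub> k \<in> carrier G" "h \<otimes>\<^bsub>G\<^esub> k \<in> H" by simp_all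
    let ?N = "gact A h \<circ> N"
    have N: "?N \<in> carrier MX" using map_gact_closed[OF g(1) MN(2)] .
    have hN: "gact E h N = L (\<rho> h) (Rt (\<rho> (inv\<^bsub>G\<^esub> h)) ?N)" using end_gact[OF g(1) MN(2)] by (simp add: cact_def)
    have hNc: "gact E h N \<in> carrier MX" unfolding hN using L_closed[OF g(1) R_closed[OF g(3) N]] .
    have k: "inv\<^bsub>G\<^esub> h \<otimes>\<^bsub>G\<^esub> (h \<otimes>\<^bsub>G\<^esub> k) = k" using l_inv_assoc[OF g(1,2)] .
    \<comment> \<open>The twisted product carries \<open>\<rho>\<close> of the inverse of h from the
      action on N, followed by \<open>\<rho>\<close> of hk from the definition of \<tau>. Together
      they are \<open>\<rho> k\<close>, and the remaining \<open>\<rho> h\<close> moves over to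
      M.\<close>
    have "\<tau> (crossed_mult G E (fsingle E h M) (fsingle E k N)) = \<theta> (h \<otimes>\<^bsub>G\<^esub> k) (M \<otimes>\<^bsub>MX\<^esub> gact E h N)"
      using cE.m_fsingle[OF s] \<tau>s[OF g(5) MX.mult_closed[OF MN(1) hNc]] by simp
    also have "\<dots> = fsingle A (h \<otimes>\<^bsub>G\<^esub> k) \<circ> (M \<otimes>\<^bsub>MX\<^esub> Rt (\<rho> (h \<otimes>\<^bsub>G\<^esub> k)) (gact E h N))"
      unfolding \<theta>_def by (simp only: rmul_mult[OF fm[OF g(4)] MN(1) hNc])
    also have "Rt (\<rho> (h \<otimes>\<^bsub>G\<^esub> k)) (gact E h N) = L (\<rho> h) (Rt (\<rho> (h \<otimes>\<^bsub>G\<^esub> k)) (Rt (\<rho> (inv\<^bsub>G\<^esub> h)) ?N))"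
      unfolding hN using lmul_rmul[OF fm[OF g(1)] fm[OF g(4)] R_closed[OF g(3) N]] by simp
    also have "\<dots> = L (\<rho> h) (Rt (\<rho> k) ?N)" unfolding R_R[OF g(3,4) N] k ..
    also have "M \<otimes>\<^bsub>MX\<^esub> L (\<rho> h) (Rt (\<rho> k) ?N) = Rt (\<rho> h) M \<otimes>\<^bsub>MX\<^esub> (gact A h \<circ> Rt (\<rho> k) N)"
      unfolding map_gact_R[OF g(1,2) MN(2)] using rmul_mult_lmul[OF fm[OF g(1)] MN(1) R_closed[OF g(2) N]] by simp
    also have "fsingle A (h \<otimes>\<^bsub>G\<^esub> k) \<circ> \<dots> = \<theta> h M \<otimes>\<^bsub>mat_alg X ?D\<^esub> \<theta> k N"
      unfolding \<theta>_def by (rule embm[OF s(1,3) R_closed[OF g(1) MN(1)] R_closed[OF g(2) MN(2)], symmetric])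
    finally show "\<tau> (crossed_mult G E (fsingle E h M) (fsingle E k N)) = \<tau> (fsingle E h M) \<otimes>\<^bsub>mat_alg X ?D\<^esub> \<tau> (fsingle
        E k N)"
      using s MN \<tau>s by simp
  qed
  \<comment> \<open>The inverse of \<tau> undoes the right multiplication in each degree h. Its
    source is built as matrices over a crossed product, so it is defined first on the coefficients
    at a matrix position (p, q) and then assembled over all positions.\<close>
  define \<eta> where "\<eta> p q = fs_ext A ?C (\<lambda>h a. fsingle E h (Rt (\<rho> (inv\<^bsub>G\<^esub> h)) (fsingle A (p, q) a)))" for p q
  have \<eta>': "lin_map R A ?C (\<lambda>a. fsingle E h (Rt (\<rho> (inv\<^bsub>G\<^esub> h)) (fsingle A (p, q) a)))"
    if "p \<in> X" "q \<in> X" "h \<in> H" for p q h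
    using lin_map_comp[OF lin_map_comp[OF lin_map_fsingle_mat[OF nu_algebra_axioms that(1,2)] lin_map_rmul[OF fm]]
        sE[OF that(3)], of "inv\<^bsub>G\<^esub> h"]
      that(3) by (simp add: o_def)
  have \<eta>: "lin_map R ?D ?C (\<eta> p q)" if "p \<in> X" "q \<in> X" for p q
    unfolding \<eta>_def crossed_def[of G H A] by (rule lin_map_fs_ext[OF module_axioms C.module_axioms \<eta>'[OF that]])
  have "\<exists>\<sigma>. lin_map R (mat_alg X ?D) ?C \<sigma> \<and>
      (\<forall>p\<in>X. \<forall>q\<in>X. \<forall>d\<in>carrier ?D. \<sigma> (fsingle ?D (p, q) d) = \<eta> p q d)"
    by (rule lin_map_mat_ext[OF D C]) (rule \<eta>)
  then obtain \<sigma> where \<sigma>l: "lin_map R (mat_alg X ?D) ?C \<sigma>"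
    and \<sigma>s: "\<And>p q d. \<lbrakk>p \<in> X; q \<in> X; d \<in> carrier ?D\<rbrakk> \<Longrightarrow> \<sigma> (fsingle ?D (p, q) d) = \<eta> p q d"
    by blast
  have \<sigma>e: "\<sigma> (fsingle A h \<circ> M) = fsingle E h (Rt (\<rho> (inv\<^bsub>G\<^esub> h)) M)" if h: "h \<in> H" and M: "M \<in> carrier MX" for h M
  proof -
    have hi: "inv\<^bsub>G\<^esub> h \<in> carrier G" using h by simp
    have "(\<sigma> \<circ> (\<lambda>M. fsingle A h \<circ> M)) M = (fsingle E h \<circ> Rt (\<rho> (inv\<^bsub>G\<^esub> h))) M"
    proof (rule mat_lin_eqI[OF nu_algebra_axioms C lin_map_comp[OF emb[OF h] \<sigma>l] lin_map_comp[OF lin_map_rmul[OF fm[OF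
        hi]] sE[OF h]] _ M])
      fix p q a assume s: "p \<in> X" "q \<in> X" "a \<in> carrier A"
      show "(\<sigma> \<circ> (\<lambda>M. fsingle A h \<circ> M)) (fsingle A (p, q) a) = (fsingle E h \<circ> Rt (\<rho> (inv\<^bsub>G\<^esub> h))) (fsingle A (p, q) a)"
        using \<sigma>s[OF s(1,2) lin_mapD(1)[OF sA[OF h] s(3)]] fs_ext_fsingle[OF module_axioms C.module_axioms \<eta>'[OF
            s(1,2)] h s(3)]
        by (simp add: embs[OF h] \<eta>_def)
    qed
    then show ?thesis by simp
  qed
  have "\<sigma> (\<tau> \<phi>) = \<phi>" if "\<phi> \<in> carrier ?C" for \<phi>
  proof -
    have "(\<sigma> \<circ> \<tau>) \<phi> = id \<phi>"
    proof (rule lin_map_fs_eqI[where f = "\<sigma> \<circ> \<tau>" and g = id, OF E.module_axioms C.module_axioms])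
      show "lin_map R (fs_alg H E (crossed_mult G E)) ?C (\<sigma> \<circ> \<tau>)" "lin_map R (fs_alg H E (crossed_mult G E)) ?C id"
        using lin_map_comp[OF \<tau>l \<sigma>l] lin_map_id unfolding crossed_def[of G H E] by blast+
      show "\<phi> \<in> fin_fun H E" using that by (simp add: crossed_def)
      fix h M assume s: "h \<in> H" "M \<in> carrier E"
      then have M: "M \<in> carrier MX" and h: "h \<in> carrier G" "inv\<^bsub>G\<^esub> h \<in> carrier G" by simp_all
      show "(\<sigma> \<circ> \<tau>) (fsingle E h M) = id (fsingle E h M)"
        using \<tau>s[OF s(1) M] \<sigma>e[OF s(1) R_closed[OF h(1) M]] R_R[OF h M] R_one[OF M] h by (simp add: \<theta>_def)
    qed
    then show ?thesis by simp
  qed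
  moreover have "\<tau> (\<sigma> N) = N" if "N \<in> carrier (mat_alg X ?D)" for N
  proof -
    have "(\<tau> \<circ> \<sigma>) N = id N"
    proof (rule mat_lin_eqI[OF D MD lin_map_comp[OF \<sigma>l \<tau>l] lin_map_id _ that])
      fix p q d assume s: "p \<in> X" "q \<in> X" "d \<in> carrier ?D"
      have f: "lin_map R ?D (mat_alg X ?D) (fsingle ?D (p, q))" by (rule lin_map_fsingle_mat[OF D s(1,2)])
      have "(\<tau> \<circ> \<sigma> \<circ> fsingle ?D (p, q)) d = fsingle ?D (p, q) d"
      proof (rule lin_map_fs_eqI[where f = "\<tau> \<circ> \<sigma> \<circ> fsingle ?D (p, q)"
          and g = "fsingle ?D (p, q)", OF module_axioms MD.module_axioms])
        show "lin_map R (fs_alg H A (crossed_mult G A)) (mat_alg X ?D) (\<tau> \<circ> \<sigma> \<circ> fsingle ?D (p, q))"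
          "lin_map R (fs_alg H A (crossed_mult G A)) (mat_alg X ?D) (fsingle ?D (p, q))"
          using lin_map_comp[OF f lin_map_comp[OF \<sigma>l \<tau>l]] f by (simp_all add: crossed_def o_assoc)
        show "d \<in> fin_fun H A" using s(3) by (simp add: crossed_def)
        fix h a assume h: "h \<in> H" and a: "a \<in> carrier A"
        have g: "h \<in> carrier G" "inv\<^bsub>G\<^esub> h \<in> carrier G" using h by simp_all
        note M = fsingle_MX[OF s(1,2) a]
        have "\<sigma> (fsingle ?D (p, q) (fsingle A h a)) = fsingle E h (Rt (\<rho> (inv\<^bsub>G\<^esub> h)) (fsingle A (p, q) a))"
          using \<sigma>e[OF h M] by (simp add: embs[OF h])
        then show "(\<tau> \<circ> \<sigma> \<circ> fsingle ?D (p, q)) (fsingle A h a) = fsingle ?D (p, q) (fsingle A h a)"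
          using \<tau>s[OF h R_closed[OF g(2) M]] R_R[OF g(2,1) M] R_one[OF M] g by (simp add: \<theta>_def embs[OF h])
      qed
      then show "(\<tau> \<circ> \<sigma>) (fsingle ?D (p, q) d) = id (fsingle ?D (p, q) d)" by simp
    qed
    then show ?thesis by simp
  qed
  ultimately have "bij_betw \<tau> (carrier ?C) (carrier (mat_alg X ?D))"
    using lin_mapD(1)[OF \<tau>l] lin_mapD(1)[OF \<sigma>l] by (intro bij_betw_byWitness[where f' = \<sigma>]) auto
  with \<tau>h show ?thesis
    by (rule that) (simp add: \<tau>s \<theta>_def)
qed

end

section \<open>Functoriality of crossed products\<close>

lemma GAlg_simps:
  "A \<in> Ob (GAlg R G) \<longleftrightarrow> g_algebra R G A"
  "(A, B, f) \<in> Arr (GAlg R G) \<longleftrightarrow>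
     g_algebra R G A \<and> g_algebra R G B \<and> f \<in> alg_homs R A B \<and> equivariant G A B f"
  "Dom (GAlg R G) (A, B, f) = A" "Cod (GAlg R G) (A, B, f) = B"
  "Id (GAlg R G) A = (A, A, restrict id (carrier A))"
  "Comp (GAlg R G) (B', C, g) (A, B, f) = (A, C, compose (carrier A) g f)"
  by (simp_all add: GAlg_def concrete_cat_simps)

text \<open>Equivariant homomorphisms without extensionality and between arbitrary element types,
  since polynomial and endomorphism algebras are used before they are copied into the
  universe.\<close>

definition g_hom :: "('k, 'r) ring_scheme \<Rightarrow> ('g, 's) monoid_scheme \<Rightarrow> ('k, 'a, 'g) galg \<Rightarrow> ('k, 'b, 'g) galg \<Rightarrow>
    ('a \<Rightarrow> 'b) \<Rightarrow> bool" where
  "g_hom R G A B f \<longleftrightarrow> g_algebra R G A \<and> g_algebra R G B \<and> nu_hom R A B f \<and> equivariant G A B f"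

lemma g_homD:
  "g_hom R G A B f \<Longrightarrow> g_algebra R G A" "g_hom R G A B f \<Longrightarrow> g_algebra R G B"
  "g_hom R G A B f \<Longrightarrow> nu_hom R A B f" "g_hom R G A B f \<Longrightarrow> equivariant G A B f"
  by (simp_all add: g_hom_def)

lemma GAlg_g_hom: "(A, B, f) \<in> Arr (GAlg R G) \<Longrightarrow> g_hom R G A B f"
  by (simp add: g_hom_def GAlg_simps alg_homs_nu_hom)

lemma g_hom_nu_hom_crossed:
  "\<lbrakk>g_hom R G A B f; subgroup L G\<rbrakk> \<Longrightarrow> nu_hom R (crossed G L A) (crossed G L B) ((\<circ>) f)"
  using nu_hom_crossed_map[OF g_homD(1,2) _ g_homD(3,4)] by blast

lemma g_algebra_nu: "g_algebra R G A \<Longrightarrow> nu_algebra R A"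
  by (simp add: g_algebra_def)

lemma \<R>_map_crossed:
  fixes A :: "('k, 'a, 'g) galg" and B :: "('k, 'b, 'g) galg"
  assumes f: "g_hom R G A B f" and H: "subgroup H G"
  defines "Rf \<equiv> \<R>_map R (crossed_cat G H A) (crossed_cat G H B) id (\<lambda>x y. (\<circ>) f)"
  shows "nu_hom R (\<R>_alg R (crossed_cat G H A)) (\<R>_alg R (crossed_cat G H B)) Rf"
    and "\<lbrakk>x \<in> LOb (crossed_cat G H A); y \<in> LOb (crossed_cat G H A); \<phi> \<in> carrier (LHom (crossed_cat G H A) x y)\<rbrakk> \<Longrightarrow>
      Rf (\<R>_gen R (crossed_cat G H A) x y \<phi>) = \<R>_gen R (crossed_cat G H B) x y (f \<circ> \<phi>)"
proof -
  interpret A: crossed_coset R G A H by (rule crossed_coset.intro[OF g_homD(1)[OF f] H])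
  interpret B: crossed_coset R G B H by (rule crossed_coset.intro[OF g_homD(2)[OF f] H])
  have l: "lin_map R (LHom (crossed_cat G H A) x y) (LHom (crossed_cat G H B) (id x) (id y)) ((\<circ>) f)" for x y
    unfolding A.crossed_cat_simps B.crossed_cat_simps id_apply
    by (rule lin_map_fs_map[OF A.module_axioms B.module_axioms nu_homD(1)[OF g_homD(3)[OF f]]])
  have m: "f \<circ> crossed_mult G A \<phi> \<psi> = crossed_mult G B (f \<circ> \<phi>) (f \<circ> \<psi>)"
    if "\<phi> \<in> fin_fun (carrier G) A" "\<psi> \<in> fin_fun (carrier G) A" for \<phi> \<psi>
    using nu_homD(2)[OF g_hom_nu_hom_crossed[OF f A.subgroup_self]] that by (simp add: crossed_def)
  note p = \<R>_map_props[where F = id and \<theta> = "\<lambda>x y. (\<circ>) f", OF A.lin_category_crossed B.lin_category_crossed]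
  have 1: "id x \<in> LOb (crossed_cat G H B)" if "x \<in> LOb (crossed_cat G H A)" for x
    using that by (simp add: A.crossed_cat_simps B.crossed_cat_simps)
  have 2: "f \<circ> LComp (crossed_cat G H A) x y z g \<phi> = LComp (crossed_cat G H B) (id x) (id y) (id z) (f \<circ> g) (f \<circ> \<phi>)"
    if o: "x \<in> LOb (crossed_cat G H A)" "y \<in> LOb (crossed_cat G H A)" "z \<in> LOb (crossed_cat G H A)"
      "\<phi> \<in> carrier (LHom (crossed_cat G H A) x y)" "g \<in> carrier (LHom (crossed_cat G H A) y z)" for x y z \<phi> g
  proof -
    have o': "x \<in> A.cosets" "y \<in> A.cosets" "z \<in> A.cosets" "\<phi> \<in> fin_fun (A.quo x y) A" "g \<in> fin_fun (A.quo y z) A"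
      using o by (simp_all add: A.crossed_cat_simps)
    show ?thesis
      using m[OF A.fin_fun_G[OF o'(5) A.quo_carrier[OF o'(2,3)]] A.fin_fun_G[OF o'(4) A.quo_carrier[OF o'(1,2)]]]
      by (simp add: A.crossed_cat_simps B.crossed_cat_simps)
  qed
  show "nu_hom R (\<R>_alg R (crossed_cat G H A)) (\<R>_alg R (crossed_cat G H B)) Rf"
    unfolding Rf_def by (rule p(1)[OF 1 l 2])
  show "Rf (\<R>_gen R (crossed_cat G H A) x y \<phi>) = \<R>_gen R (crossed_cat G H B) x y (f \<circ> \<phi>)"
    if "x \<in> LOb (crossed_cat G H A)" "y \<in> LOb (crossed_cat G H A)" "\<phi> \<in> carrier (LHom (crossed_cat G H A) x y)"
    unfolding Rf_def using p(2)[OF 1 l 2 that] by simp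
qed

locale crossed_functor = stable_functor R U Z kk j
  for R :: "('k, 'r) ring_scheme" and U :: "'u set" and Z :: "'x set" and kk :: "('o, 'm) tricat"
    and j :: "(('k, 'u) module, (('k, 'u) module, 'u) carr, 'o, 'm) func" +
  fixes G :: "('g, 's) monoid_scheme" and H :: "'g set"
  assumes G: "group G" and H: "subgroup H G"
    and R_small: "carrier R \<lesssim> U" and G_small: "carrier G \<lesssim> U" and G_Z: "carrier G \<lesssim> Z"
begin

lemma small_carrier: "carrier (A :: ('k, 'u, 'g) galg) \<lesssim> U"
  unfolding U by (rule small_universe)

lemma crossed_cosetI: "g_algebra R G A \<Longrightarrow> crossed_coset R G A H"
  by (rule crossed_coset.intro[OF _ H])

abbreviation "Rc A \<equiv> \<R>_alg R (crossed_cat G H A)"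

abbreviation "Rm A B f \<equiv> \<R>_map R (crossed_cat G H A) (crossed_cat G H B) id (\<lambda>x y. (\<circ>) f)"

abbreviation "incl u A \<equiv> \<R>_gen R (crossed_cat G H A) (u <#\<^bsub>G\<^esub> H) (u <#\<^bsub>G\<^esub> H)"

abbreviation "conjH u \<equiv> conj_subgroup G H u"

lemma subgroup_conjH: "\<lbrakk>g_algebra R G (A :: ('k, 'b, 'g) galg); u \<in> carrier G\<rbrakk> \<Longrightarrow> subgroup (conjH u) G"
  by (rule crossed_coset.conj_subgroup_subgroup[OF crossed_cosetI[of A]])

lemma conjH_one: "g_algebra R G (A :: ('k, 'b, 'g) galg) \<Longrightarrow> conjH \<one>\<^bsub>G\<^esub> = H"
  by (rule crossed_coset.conj_subgroup_one[OF crossed_cosetI[of A]])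

lemma sm_crossed_product: "\<lbrakk>g_algebra R G A; subgroup L G; carrier A \<lesssim> U\<rbrakk> \<Longrightarrow> sm (crossed G L A)"
  by (rule sm_crossed) (simp_all add: G_small)

lemma sm_Rc: "\<lbrakk>g_algebra R G A; carrier A \<lesssim> U\<rbrakk> \<Longrightarrow> sm (Rc A)"
  by (rule sm_\<R>_crossed) (simp_all add: crossed_cosetI R_small G_small)

text \<open>\<open>\<R>_can\<close> sends an element to the corresponding generator, on which
  \<open>\<R>_map\<close> is known; so the composite defining \<nu> is just the generator map at the
  object uH.\<close>

lemma nu_eq:
  fixes A :: "('k, 'u, 'g) galg"
  assumes A: "g_algebra R G A" and u: "u \<in> carrier G"
  shows "nu R G H j u A = J (crossed G (conjH u) A) (Rc A) (incl u A)"
proof -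
  interpret A: crossed_coset R G A H by (rule crossed_cosetI[OF A])
  let ?D = "crossed G (conjH u) A" and ?C = "crossed_cat G H A" and ?x = "u <#\<^bsub>G\<^esub> H"
  have D: "nu_algebra R ?D" by (rule nu_algebra_crossed[OF A subgroup_conjH[OF A u]])
  have x: "?x \<in> LOb ?C" using u by (simp add: A.crossed_cat_simps)
  have DL: "lin_map R ?D (LHom ?C ?x ?x) id"
    by (simp add: lin_map_def crossed_def A.crossed_cat_simps A.conj_subgroup_eq_quo[OF u])
  have "\<R>_map R (alg_lincat ?D) ?C (\<lambda>_. ?x) (\<lambda>_ _. id) (\<R>_gen R (alg_lincat ?D) () () a) = incl u A a"
    if "a \<in> carrier ?D" for a
    using \<R>_map_props(2)[where F = "\<lambda>_. ?x" and \<theta> = "\<lambda>_ _. id", OF lin_category_alg[OF D] A.lin_category_crossed, of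
        "()" "()" a]
      x DL that by (simp add: alg_lincat_def A.crossed_cat_simps) (simp add: crossed_def)
  then show ?thesis
    unfolding nu_def nu_arr_def J_def Let_def
    by (intro arg_cong[where f = "on_arr j"] copy_arr_cong) (simp add: \<R>_can_def)
qed

lemma incl_props:
  fixes A :: "('k, 'b, 'g) galg"
  assumes A: "g_algebra R G A" and s: "carrier A \<lesssim> U" and u: "u \<in> carrier G"
  shows "nu_hom R (crossed G (conjH u) A) (Rc A) (incl u A)"
    and "iso_arrow kk (J (crossed G (conjH u) A) (Rc A) (incl u A))"
  using J_object_inclusion_iso[OF crossed_cosetI[OF A] R_small G_small s G_Z u] .

lemma incl_natural:
  assumes f: "g_hom R G A B f" and s: "carrier A \<lesssim> U" "carrier B \<lesssim> U" and u: "u \<in> carrier G"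
  shows "J (Rc A) (Rc B) (Rm A B f) \<cdot>\<^bsub>kk\<^esub> J (crossed G (conjH u) A) (Rc A) (incl u A) =
    J (crossed G (conjH u) B) (Rc B) (incl u B) \<cdot>\<^bsub>kk\<^esub> J (crossed G (conjH u) A) (crossed G (conjH u) B) ((\<circ>) f)"
proof -
  interpret A: crossed_coset R G A H by (rule crossed_cosetI[OF g_homD(1)[OF f]])
  note gA = g_homD(1)[OF f] and gB = g_homD(2)[OF f]
  note sA = sm_crossed_product[OF gA subgroup_conjH[OF gA u] s(1)]
      and sB = sm_crossed_product[OF gB subgroup_conjH[OF gA u] s(2)]
  note h = \<R>_map_crossed[OF f H]
  show ?thesis
    unfolding J_comp[OF sA sm_Rc[OF gA s(1)] sm_Rc[OF gB s(2)] incl_props(1)[OF gA s(1) u] h(1), symmetric]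
      J_comp[OF sA sB sm_Rc[OF gB s(2)] g_hom_nu_hom_crossed[OF f subgroup_conjH[OF gA u]] incl_props(1)[OF gB s(2)
          u], symmetric]
    by (rule J_cong)
      (use u h(2) in \<open>simp add: A.crossed_cat_simps A.conj_subgroup_eq_quo crossed_def\<close>)
qed

lemma on_arr_\<R>_crossed: "on_arr j (on_arr (\<R>_crossed R G H) (A, B, f)) = J (Rc A) (Rc B) (Rm A B f)"
  by (simp add: \<R>_crossed_def J_def)

text \<open>The induced homomorphisms are determined by their values on generators, so identities
  and composites need to be compared only there, up to the restrictions that make arrows
  extensional.\<close>

lemma is_functor_\<R>_crossed:
  assumes cat: "category (GAlg R G :: (('k, 'u, 'g) galg, (('k, 'u, 'g) galg, 'u) carr) cat)"
  shows "is_functor (GAlg R G :: (('k, 'u, 'g) galg, (('k, 'u, 'g) galg, 'u) carr) cat) (Alg R) (\<R>_crossed R G H)"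
  unfolding is_functor_def
proof (intro conjI ballI impI cat)
  show "category (Alg R :: (('k, 'u) module, (('k, 'u) module, 'u) carr) cat)" using j by (simp add: is_functor_def)
  note sR = sm_Rc[OF _ small_carrier]
  fix A :: "('k, 'u, 'g) galg" assume "A \<in> Ob (GAlg R G)"
  then have A: "g_algebra R G A" by (simp add: GAlg_simps)
  interpret A: crossed_coset R G A H by (rule crossed_cosetI[OF A])
  interpret C: lin_category R "crossed_cat G H A" by (rule A.lin_category_crossed)
  show "on_ob (\<R>_crossed R G H) A \<in> Ob (Alg R)"
    using sm_alg[OF sm_copy[OF sR[OF A]]] by (simp add: \<R>_crossed_def Alg_simps)
  have id: "g_hom R G A A (restrict id (carrier A))"
    unfolding g_hom_def using A nu_hom_cong[OF g_algebra_nu[OF A], of "restrict id (carrier A)" id A]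
    by (auto simp: nu_hom_id equivariant_def)
  note h = \<R>_map_crossed[OF id H]
  have "Rm A A (restrict id (carrier A)) a = id a" if "a \<in> carrier (Rc A)" for a
  proof (rule C.\<R>_hom_eqI[OF sm_alg[OF sR[OF A]] h(1) nu_hom_id _ that])
    fix x y \<phi> assume o: "x \<in> LOb (crossed_cat G H A)" "y \<in> LOb (crossed_cat G H A)"
        "\<phi> \<in> carrier (LHom (crossed_cat G H A) x y)"
    then have "\<phi> n \<in> carrier A" for n using A.fin_fun_carrier by (simp add: A.crossed_cat_simps)
    then have "restrict id (carrier A) \<circ> \<phi> = \<phi>" by auto
    then show "Rm A A (restrict id (carrier A)) (\<R>_gen R (crossed_cat G H A) x y \<phi>) = id (\<R>_gen R (crossed_cat G H A)
        x y \<phi>)"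
      using h(2)[OF o] by simp
  qed
  then show "on_arr (\<R>_crossed R G H) (Id (GAlg R G) A) = Id (Alg R) (on_ob (\<R>_crossed R G H) A)"
    unfolding GAlg_simps \<R>_crossed_def func.simps prod.case copy_arr_id[OF sm_small[OF sR[OF A]], of R, symmetric]
    by (rule copy_arr_cong)
next
  note sR = sm_Rc[OF _ small_carrier]
  fix f :: "(('k, 'u, 'g) galg, 'u) carr" assume f: "f \<in> Arr (GAlg R G)"
  then obtain A B f' where f': "f = (A, B, f')" "g_hom R G A B f'" using GAlg_g_hom by (cases f) blast
  note fA = g_homD(1)[OF f'(2)] and fB = g_homD(2)[OF f'(2)] and h = \<R>_map_crossed[OF f'(2) H]
  show "on_arr (\<R>_crossed R G H) f \<in>
      Hom (Alg R) (on_ob (\<R>_crossed R G H) (Dom (GAlg R G) f)) (on_ob (\<R>_crossed R G H) (Cod (GAlg R G) f))"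
    using copy_arr_Hom[OF sm_alg[OF sR[OF fA]] sm_alg[OF sR[OF fB]] sm_small[OF sR[OF fA]] sm_small[OF sR[OF fB]]
        h(1)]
    by (simp add: f'(1) GAlg_simps \<R>_crossed_def)
  fix g :: "(('k, 'u, 'g) galg, 'u) carr" assume g: "g \<in> Arr (GAlg R G)" "Cod (GAlg R G) f = Dom (GAlg R G) g"
  moreover obtain B' C g' where "g = (B', C, g')" by (cases g)
  ultimately have g': "g = (B, C, g')" "g_hom R G B C g'"
    using GAlg_g_hom[of B' C g' R G] by (simp_all add: f'(1) GAlg_simps)
  note gC = g_homD(2)[OF g'(2)] and k = \<R>_map_crossed[OF g'(2) H]
  interpret A: crossed_coset R G A H by (rule crossed_cosetI[OF fA])
  interpret B: crossed_coset R G B H by (rule crossed_cosetI[OF fB])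
  interpret C: lin_category R "crossed_cat G H A" by (rule A.lin_category_crossed)
  let ?gf = "compose (carrier A) g' f'"
  have gf: "g_hom R G A C ?gf"
    unfolding g_hom_def using fA gC nu_hom_comp[OF g_homD(3)[OF f'(2)] g_homD(3)[OF g'(2)]]
      nu_hom_cong[OF g_algebra_nu[OF fA], of ?gf "g' \<circ> f'" C]
      g_homD(4)[OF f'(2)] g_homD(4)[OF g'(2)] nu_homD(3)[OF g_homD(3)[OF f'(2)]]
    by (auto simp: equivariant_def compose_def)
  note l = \<R>_map_crossed[OF gf H]
  have "Rm A C ?gf a = (Rm B C g' \<circ> Rm A B f') a" if "a \<in> carrier (Rc A)" for a
  proof (rule C.\<R>_hom_eqI[OF sm_alg[OF sR[OF gC]] l(1) nu_hom_comp[OF h(1) k(1)] _ that])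
    fix x y \<phi> assume o: "x \<in> LOb (crossed_cat G H A)" "y \<in> LOb (crossed_cat G H A)"
        "\<phi> \<in> carrier (LHom (crossed_cat G H A) x y)"
    then have c: "\<phi> n \<in> carrier A" for n using A.fin_fun_carrier by (simp add: A.crossed_cat_simps)
    have o': "x \<in> LOb (crossed_cat G H B)" "y \<in> LOb (crossed_cat G H B)"
        "f' \<circ> \<phi> \<in> carrier (LHom (crossed_cat G H B) x y)"
      using o lin_mapD(1)[OF lin_map_fs_map[OF A.module_axioms B.module_axioms nu_homD(1)[OF g_homD(3)[OF f'(2)]]],
          of \<phi> "A.quo x y" undefined undefined]
      by (simp_all add: A.crossed_cat_simps B.crossed_cat_simps)
    have "?gf \<circ> \<phi> = g' \<circ> (f' \<circ> \<phi>)" using c by (auto simp: compose_def)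
    then show "Rm A C ?gf (\<R>_gen R (crossed_cat G H A) x y \<phi>) = (Rm B C g' \<circ> Rm A B f') (\<R>_gen R (crossed_cat G H A) x
        y \<phi>)"
      using h(2)[OF o] k(2)[OF o'] l(2)[OF o] by simp
  qed
  then have 1: "copy_arr (Rc A) (Rc C) (Rm A C ?gf) = copy_arr (Rc A) (Rc C) (Rm B C g' \<circ> Rm A B f')"
    by (rule copy_arr_cong)
  show "on_arr (\<R>_crossed R G H) (g \<cdot>\<^bsub>GAlg R G\<^esub> f) = on_arr (\<R>_crossed R G H) g \<cdot>\<^bsub>Alg R\<^esub> on_arr (\<R>_crossed R G H) f"
    using copy_arr_Comp[OF sm_small[OF sR[OF fA]] sm_small[OF sR[OF fB]] nu_homD(3)[OF h(1)], where R = R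
        and C = "Rc C" and g = "Rm B C g'"] 1
    by (simp add: f'(1) g'(1) GAlg_simps \<R>_crossed_def)
qed

end

section \<open>Conjugation\<close>

lemma trans_natural:
  assumes f: "g_hom R G A B f" and H: "subgroup H G" and u: "g \<in> carrier G" and \<phi>: "\<And>k. \<phi> k \<in> carrier A"
  shows "f \<circ> crossed_coset.trans G A g h \<phi> = crossed_coset.trans G B g h (f \<circ> \<phi>)"
proof -
  interpret A: crossed_coset R G A H by (rule crossed_coset.intro[OF g_homD(1)[OF f] H])
  interpret B: crossed_coset R G B H by (rule crossed_coset.intro[OF g_homD(2)[OF f] H])
  show ?thesis
    using equivariantD[OF g_homD(4)[OF f] u \<phi>] lin_map_zero[OF A.module_axioms B.module_axioms nu_homD(1)[OF
        g_homD(3)[OF f]]]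
    by (auto simp: A.trans_def B.trans_def)
qed

context crossed_functor
begin

abbreviation "tr A u \<equiv> crossed_coset.trans G A u (inv\<^bsub>G\<^esub> u)"

lemma nu_hom_tr:
  assumes A: "g_algebra R G A" and u: "u \<in> carrier G"
  shows "nu_hom R (crossed G H A) (crossed G (conjH u) A) (tr A u)"
proof -
  interpret A: crossed_coset R G A H by (rule crossed_cosetI[OF A])
  have 1: "u \<otimes>\<^bsub>G\<^esub> k \<otimes>\<^bsub>G\<^esub> inv\<^bsub>G\<^esub> u \<in> conjH u" if "k \<in> H" for k
    using that by (auto simp: conj_subgroup_def l_coset_def r_coset_def)
  note c = A.fin_fun_G[OF _ A.subset]
  have "tr A u (crossed_mult G A \<phi> \<psi>) = crossed_mult G A (tr A u \<phi>) (tr A u \<psi>)"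
    if "\<phi> \<in> fin_fun H A" "\<psi> \<in> fin_fun H A" for \<phi> \<psi>
    using A.trans_mult[of u "inv\<^bsub>G\<^esub> u" "inv\<^bsub>G\<^esub> u", OF _ _ _ c[OF that(1)] c[OF that(2)]] u by simp
  moreover have "lin_map R (crossed G H A) (crossed G (conjH u) A) (tr A u)"
    unfolding crossed_def by (rule A.lin_map_trans) (use u 1 A.subset in auto)
  ultimately show ?thesis by (intro nu_homI) (simp_all add: crossed_def)
qed

text \<open>The two maps \<open>A \<rtimes> H \<rightarrow> \<R>(A \<rtimes> G/H)\<close> differ by the invertible arrow \<open>u : H \<rightarrow> uH\<close>, which is only
  a multiplier of \<open>\<R>(A \<rtimes> G/H)\<close>; hence the detour through two different corners.\<close>

lemma incl_conj:
  fixes A :: "('k, 'b, 'g) galg"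
  assumes A: "g_algebra R G A" and s: "carrier A \<lesssim> U" and u: "u \<in> carrier G"
  shows "J (crossed G (conjH u) A) (Rc A) (incl u A) \<cdot>\<^bsub>kk\<^esub> J (crossed G H A) (crossed G (conjH u) A) (tr A u) =
    J (crossed G H A) (Rc A) (incl \<one>\<^bsub>G\<^esub> A)"
proof -
  interpret A: crossed_coset R G A H by (rule crossed_cosetI[OF A])
  let ?C = "crossed_cat G H A" and ?D = "crossed G H A" and ?E = "Rc A" and ?Du = "crossed G (conjH u) A"
  interpret C: lin_category R ?C by (rule A.lin_category_crossed)
  note Cs = A.crossed_cat_simps
  have D: "sm ?D" by (rule sm_crossed_product[OF A H s])
  have Du: "sm ?Du" by (rule sm_crossed_product[OF A subgroup_conjH[OF A u] s])
  have E: "sm ?E" by (rule sm_Rc[OF A s])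
  have ME: "sm (mat_alg Z ?E)" by (rule sm_mat[OF E Z_small])
  interpret E: nu_algebra R ?E by (rule sm_alg[OF E])
  obtain z0 where z0: "z0 \<in> Z" using Z_infinite by fastforce
  obtain z1 where z1: "z1 \<in> Z" "z1 \<noteq> z0"
    using infinite_imp_nonempty[OF infinite_remove[OF Z_infinite, of z0]] by blast
  define p where "p i = (if i then z1 else z0)" for i
  define \<gamma> where "\<gamma> i = (if i then u else \<one>\<^bsub>G\<^esub>)" for i
  define c where "c i = \<gamma> i <#\<^bsub>G\<^esub> H" for i
  have p: "p i \<in> Z" "p i = p k \<longleftrightarrow> i = k" for i k using z0 z1 by (auto simp: p_def)
  have \<gamma>: "\<gamma> i \<in> carrier G" for i using u by (simp add: \<gamma>_def)
  have c: "c i \<in> A.cosets" for i using \<gamma> by (simp add: c_def)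
  have q: "\<gamma> i \<otimes>\<^bsub>G\<^esub> h \<otimes>\<^bsub>G\<^esub> inv\<^bsub>G\<^esub> (\<gamma> k) \<in> A.quo (c k) (c i)" if "h \<in> H" for h i k
    unfolding A.quo_iff c_def using A.coset_self[OF \<gamma>[of k]] A.coset_iff that by blast
  \<comment> \<open>\<open>T i k\<close> turns an element of \<open>A \<rtimes> H\<close> into an
    arrow from the k-th to the i-th of the cosets H and uH. Placed at matrix position (i, k), these
    are matrix units of maps whose diagonal members are the two inclusions, each followed by its own
    corner.\<close>
  define T where "T i k = A.trans (\<gamma> i) (inv\<^bsub>G\<^esub> (\<gamma> k))" for i k
  have Tl: "lin_map R ?D (LHom ?C (c k) (c i)) (T i k)" for i k
    unfolding Cs T_def crossed_def by (rule A.lin_map_trans) (use \<gamma> q A.subset in auto)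
  note Tc = lin_mapD(1)[OF Tl]
  have Tm: "T i n (crossed_mult G A x y) = crossed_mult G A (T i k x) (T k n y)"
    if "x \<in> carrier ?D" "y \<in> carrier ?D" for i k n x y
  proof -
    have "x \<in> fin_fun H A" "y \<in> fin_fun H A" using that by (simp_all add: crossed_def)
    then show ?thesis unfolding T_def
      using A.trans_mult[of "\<gamma> i" "inv\<^bsub>G\<^esub> (\<gamma> k)" "inv\<^bsub>G\<^esub> (\<gamma> n)", OF _ _ _ A.fin_fun_G[OF _ A.subset] A.fin_fun_G[OF _
          A.subset]] \<gamma>
      by simp
  qed
  define a where "a i k x = fsingle ?E (p i, p k) (\<R>_gen R ?C (c k) (c i) (T i k x))" for i k x
  have al: "lin_map R ?D (mat_alg Z ?E) (a i k)" for i k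
    using lin_map_comp[OF lin_map_comp[OF Tl C.lin_map_\<R>_gen[unfolded Cs(1), OF c c]] lin_map_fsingle_mat[OF sm_alg[OF
        E] p(1) p(1)]]
    by (simp add: a_def[abs_def] o_def)
  have am: "a i k x \<otimes>\<^bsub>mat_alg Z ?E\<^esub> a k' n y = (if k = k' then a i n (x \<otimes>\<^bsub>?D\<^esub> y) else \<zero>\<^bsub>mat_alg Z ?E\<^esub>)"
    if xy: "x \<in> carrier ?D" "y \<in> carrier ?D" for i k k' n x y
  proof -
    note cl = C.\<R>_gen_closed[unfolded Cs(1), OF c c Tc]
    have "\<R>_gen R ?C (c k) (c i) (T i k x) \<otimes>\<^bsub>?E\<^esub> \<R>_gen R ?C (c n) (c k) (T k n y) = \<R>_gen R ?C (c n) (c i) (T i n (x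
        \<otimes>\<^bsub>?D\<^esub> y))"
      using C.\<R>_gen_comp[unfolded Cs(1), OF c c c Tc[OF xy(2)] Tc[OF xy(1)]] Tm[OF xy, of i n k]
      by (simp add: Cs(3)) (simp add: crossed_def)
    then show ?thesis unfolding a_def
      using mat_fsingle_mult[OF sm_alg[OF E] p(1) p(1) p(1) p(1) cl[OF xy(1)] cl[OF xy(2)]] p(2)
          by (cases "k = k'") simp_all
  qed
  have 1: "J ?D (mat_alg Z ?E) (a False False) = J ?D (mat_alg Z ?E) (a True True)"
    by (rule J_matrix_units[where a = a, OF D ME]) (use al am in auto)
  \<comment> \<open>A second system of matrix units, now on \<open>\<R>(A \<rtimes> G/H)\<close>
    itself, identifies the two corners. After that a single invertible corner can be
    cancelled.\<close>
  define b where "b i k x = fsingle ?E (p i, p k) x" for i k x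
  have bl: "lin_map R ?E (mat_alg Z ?E) (b i k)" for i k
    using lin_map_fsingle_mat[OF sm_alg[OF E] p(1) p(1)] by (simp add: b_def[abs_def])
  have bm: "b i k x \<otimes>\<^bsub>mat_alg Z ?E\<^esub> b k' n y = (if k = k' then b i n (x \<otimes>\<^bsub>?E\<^esub> y) else \<zero>\<^bsub>mat_alg Z ?E\<^esub>)"
    if "x \<in> carrier ?E" "y \<in> carrier ?E" for i k k' n x y
    unfolding b_def using mat_fsingle_mult[OF sm_alg[OF E] p(1) p(1) p(1) p(1) that] p(2) by (cases "k = k'") simp_all
  have "J ?E (mat_alg Z ?E) (b False False) = J ?E (mat_alg Z ?E) (b True True)"
    by (rule J_matrix_units[where a = b, OF E ME]) (use bl bm in auto)
  moreover have "b i i x = corner ?E (p i) x" for i x by (simp add: b_def corner_fsingle)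
  then have "b i i = corner ?E (p i)" for i by blast
  ultimately have 2: "J ?E (mat_alg Z ?E) (corner ?E (p False)) = J ?E (mat_alg Z ?E) (corner ?E (p True))" by simp
  have u1: "\<one>\<^bsub>G\<^esub> \<in> carrier G" by simp
  note i1 = incl_props(1)[OF A s u1, unfolded conjH_one[OF A]] and iu = incl_props(1)[OF A s u]
      and t = nu_hom_tr[OF A u]
  note k = nu_hom_corner[OF sm_alg[OF E] p(1)]
  have "J ?D (mat_alg Z ?E) (a False False) = J ?D (mat_alg Z ?E) (corner ?E (p False) \<circ> incl \<one>\<^bsub>G\<^esub> A)"
  proof (rule J_cong)
    fix x assume "x \<in> carrier ?D"
    then have "x \<in> fin_fun (carrier G) A" using A.fin_fun_G[OF _ A.subset] by (simp add: crossed_def)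
    then show "a False False x = (corner ?E (p False) \<circ> incl \<one>\<^bsub>G\<^esub> A) x"
      using A.trans_one by (simp add: a_def corner_fsingle T_def \<gamma>_def c_def)
  qed
  moreover have "J ?D (mat_alg Z ?E) (a True True) = J ?D (mat_alg Z ?E) (corner ?E (p True) \<circ> (incl u A \<circ> tr A u))"
    by (rule J_cong) (simp add: a_def corner_fsingle T_def \<gamma>_def c_def)
  ultimately have "J ?E (mat_alg Z ?E) (corner ?E (p True)) \<cdot>\<^bsub>kk\<^esub> J ?D ?E (incl u A \<circ> tr A u) =
      J ?E (mat_alg Z ?E) (corner ?E (p True)) \<cdot>\<^bsub>kk\<^esub> J ?D ?E (incl \<one>\<^bsub>G\<^esub> A)"
    using 1 2 J_comp[OF D E ME i1 k] J_comp[OF D E ME nu_hom_comp[OF t iu] k] by simp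
  then have "J ?D ?E (incl u A \<circ> tr A u) = J ?D ?E (incl \<one>\<^bsub>G\<^esub> A)"
    by (rule kk.iso_arrow_mono[OF J_corner_iso[OF E p(1)] J_Hom[OF E ME k] J_Hom[OF D E nu_hom_comp[OF t iu]] J_Hom[OF
        D E i1]])
  then show ?thesis using J_comp[OF D Du E t iu] by simp
qed

end

section \<open>Extensions and boundary maps\<close>

text \<open>Linearly split extensions, the kind collected in \<open>Alg_ext\<close>, for algebras of
  any element type. Surjectivity of \<open>p\<close> is contained in the existence of the
  section.\<close>

definition split_ext ::
  "('k, 'r) ring_scheme \<Rightarrow> ('k, 'a, 'x) module_scheme \<Rightarrow> ('k, 'b, 'y) module_scheme \<Rightarrow> ('k, 'c, 'z) module_scheme \<Rightarrow>
   ('a \<Rightarrow> 'b) \<Rightarrow> ('b \<Rightarrow> 'c) \<Rightarrow> bool" where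
  "split_ext R A B C i p \<longleftrightarrow> nu_hom R A B i \<and> nu_hom R B C p \<and> inj_on i (carrier A) \<and>
     i ` carrier A = {b \<in> carrier B. p b = \<zero>\<^bsub>C\<^esub>} \<and>
     (\<exists>s. lin_map R C B s \<and> (\<forall>c\<in>carrier C. p (s c) = c))"

lemma split_ext_crossed:
  assumes i: "g_hom R G A B i" and p: "g_hom R G B C p" and L: "subgroup L G" and e: "split_ext R A B C i p"
  shows "split_ext R (crossed G L A) (crossed G L B) (crossed G L C) ((\<circ>) i) ((\<circ>) p)"
proof -
  interpret A: g_algebra R G A by (rule g_homD(1)[OF i])
  interpret B: g_algebra R G B by (rule g_homD(2)[OF i])
  interpret C: g_algebra R G C by (rule g_homD(2)[OF p])
  note [simp] = crossed_def
  have inj: "inj_on i (carrier A)" and ex: "i ` carrier A = {b \<in> carrier B. p b = \<zero>\<^bsub>C\<^esub>}"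
    using e by (simp_all add: split_ext_def)
  obtain s where s: "lin_map R C B s" "\<And>c. c \<in> carrier C \<Longrightarrow> p (s c) = c" using e by (auto simp: split_ext_def)
  note ni = g_hom_nu_hom_crossed[OF i L] and np = g_hom_nu_hom_crossed[OF p L]
  have iz: "i \<zero>\<^bsub>A\<^esub> = \<zero>\<^bsub>B\<^esub>" by (rule lin_map_zero[OF A.module_axioms B.module_axioms nu_homD(1)[OF g_homD(3)[OF i]]])
  have "inj_on ((\<circ>) i) (carrier (crossed G L A))"
  proof (rule inj_onI)
    fix \<phi> \<psi> assume f: "\<phi> \<in> carrier (crossed G L A)" "\<psi> \<in> carrier (crossed G L A)" "i \<circ> \<phi> = i \<circ> \<psi>"
    have "\<phi> k = \<psi> k" for k
      using fun_cong[OF f(3), of k] A.fin_fun_carrier[of \<phi> L k] A.fin_fun_carrier[of \<psi> L k] f(1,2)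
        inj_onD[OF inj, of "\<phi> k" "\<psi> k"] by simp
    then show "\<phi> = \<psi>" by blast
  qed
  moreover have "(\<circ>) i ` carrier (crossed G L A) = {\<phi> \<in> carrier (crossed G L B). p \<circ> \<phi> = \<zero>\<^bsub>crossed G L C\<^esub>}" (is
      "?I = ?K")
  proof
    show "?I \<subseteq> ?K"
    proof
      fix \<psi> assume "\<psi> \<in> ?I"
      then obtain \<phi> where f: "\<phi> \<in> carrier (crossed G L A)" "\<psi> = i \<circ> \<phi>" by blast
      have "p (i (\<phi> k)) = \<zero>\<^bsub>C\<^esub>" for k using ex A.fin_fun_carrier f(1) by fastforce
      then show "\<psi> \<in> ?K" using nu_homD(3)[OF ni f(1)] unfolding f(2) by auto
    qed
    show "?K \<subseteq> ?I"
    proof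
      fix \<psi> assume "\<psi> \<in> ?K"
      then have f: "\<psi> \<in> fin_fun L B" "\<And>k. p (\<psi> k) = \<zero>\<^bsub>C\<^esub>" by (auto simp: fun_eq_iff)
      then have r: "\<psi> k \<in> i ` carrier A" for k using ex B.fin_fun_carrier by simp
      let ?\<phi> = "\<lambda>k. inv_into (carrier A) i (\<psi> k)"
      \<comment> \<open>The coefficientwise preimage has finite support because zero is lifted to
        zero.\<close>
      have z: "inv_into (carrier A) i \<zero>\<^bsub>B\<^esub> = \<zero>\<^bsub>A\<^esub>" using inv_into_f_f[OF inj A.zero_closed] iz by simp
      have "{k. ?\<phi> k \<noteq> \<zero>\<^bsub>A\<^esub>} \<subseteq> {k. \<psi> k \<noteq> \<zero>\<^bsub>B\<^esub>}" using z by auto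
      then have "?\<phi> \<in> fin_fun L A"
        using f(1) z inv_into_into[OF r] by (auto simp: fin_fun_def intro: finite_subset)
      moreover have "i \<circ> ?\<phi> = \<psi>" using f_inv_into_f[OF r] by auto
      ultimately show "\<psi> \<in> ?I" by (auto intro!: image_eqI[of \<psi> _ ?\<phi>])
    qed
  qed
  moreover have "lin_map R (crossed G L C) (crossed G L B) ((\<circ>) s)"
    unfolding crossed_def by (rule lin_map_fs_map[OF C.module_axioms B.module_axioms s(1)])
  moreover have "p \<circ> (s \<circ> \<phi>) = \<phi>" if "\<phi> \<in> carrier (crossed G L C)" for \<phi>
  proof -
    have "\<phi> k \<in> carrier C" for k using that C.fin_fun_carrier[of \<phi> L k] by simp
    then show ?thesis by (auto simp: s(2))
  qed
  ultimately show ?thesis using ni np unfolding split_ext_def by blast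
qed

lemma (in stable_functor) copy_arr_Comp_sm:
  assumes "sm A" "sm B" "nu_hom R A B f"
  shows "Comp (Alg R) (copy_arr B C g) (copy_arr A B f :: (('k, 'u) module, 'u) carr) = copy_arr A C (g \<circ> f)"
  by (rule copy_arr_Comp[OF sm_small[OF assms(1)] sm_small[OF assms(2)] nu_homD(3)[OF assms(3)]])

lemma (in stable_functor) split_ext_Alg_ext:
  assumes A: "sm A" and B: "sm B" and C: "sm C" and e: "split_ext R A B C i p"
  shows "(copy_arr A B i, copy_arr B C p) \<in> (Alg_ext R :: ((('k, 'u) module, 'u) carr \<times> (('k, 'u) module, 'u) carr)
      set)"
proof -
  note h = e[unfolded split_ext_def]
  obtain s where s: "lin_map R C B s" "\<And>c. c \<in> carrier C \<Longrightarrow> p (s c) = c" using h by blast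
  note hi = conjunct1[OF h] and hp = conjunct1[OF conjunct2[OF h]]
  have inj: "inj_on i (carrier A)" and ex: "i ` carrier A = {b \<in> carrier B. p b = \<zero>\<^bsub>C\<^esub>}" using h by blast+
  let ?A = "copy_alg A :: ('k, 'u) module" and ?B = "copy_alg B :: ('k, 'u) module"
      and ?C = "copy_alg C :: ('k, 'u) module"
  let ?a = "copy_map (carrier A) :: _ \<Rightarrow> 'u" and ?b = "copy_map (carrier B) :: _ \<Rightarrow> 'u"
      and ?c = "copy_map (carrier C) :: _ \<Rightarrow> 'u"
  note inv = copy_map_inv[OF sm_small[OF A]] copy_map_inv[OF sm_small[OF B]] copy_map_inv[OF sm_small[OF C]]
  note injc = inj_on_eq_iff[OF inj_on_copy_map[OF sm_small[OF B]]] inj_on_eq_iff[OF inj_on_copy_map[OF sm_small[OF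
      C]]]
  interpret C: nu_algebra R C by (rule sm_alg[OF C])
  have fi: "copy_fun A B i (?a x) = ?b (i x)" if "x \<in> carrier A" for x using that inv by (simp add: copy_fun_def)
  have fp: "copy_fun B C p (?b x) = ?c (p x)" if "x \<in> carrier B" for x using that inv by (simp add: copy_fun_def)
  note cl = nu_homD(3)[OF hi] nu_homD(3)[OF hp] lin_mapD(1)[OF s(1)]
  have 1: "inj_on (copy_fun A B i) (carrier ?A)"
  proof (rule inj_onI)
    fix x y assume "x \<in> carrier ?A" "y \<in> carrier ?A" "copy_fun A B i x = copy_fun A B i y"
    then obtain x' y' where xy: "x' \<in> carrier A" "x = ?a x'" "y' \<in> carrier A" "y = ?a y'" "?b (i x') = ?b (i y')"
      by (auto simp: copy_alg_simps fi)
    then have "i x' = i y'" using cl injc by simp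
    then show "x = y" using inj_onD[OF inj _ xy(1,3)] xy by simp
  qed
  have 2: "copy_fun A B i ` carrier ?A = {b \<in> carrier ?B. copy_fun B C p b = \<zero>\<^bsub>?C\<^esub>}"
  proof -
    have "copy_fun A B i ` carrier ?A = ?b ` i ` carrier A" by (force simp: copy_alg_simps fi image_iff)
    also have "\<dots> = {b \<in> carrier ?B. copy_fun B C p b = \<zero>\<^bsub>?C\<^esub>}"
      unfolding ex using cl injc by (auto simp: copy_alg_simps fp)
    finally show ?thesis .
  qed
  have p: "p ` carrier B = carrier C" using cl s(2) by force
  have 3: "copy_fun B C p ` carrier ?B = carrier ?C"
  proof -
    have "copy_fun B C p ` carrier ?B = ?c ` p ` carrier B" by (force simp: copy_alg_simps fp image_iff)
    then show ?thesis by (simp add: p copy_alg_simps)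
  qed
  let ?s = "?b \<circ> (s \<circ> inv_into (carrier C) ?c)"
  have "lin_map R ?C ?B ?s"
    using lin_map_comp[OF lin_map_comp[OF nu_homD(1)[OF inverse_nu_hom[OF sm_alg[OF C] nu_algebra_copy(2)[OF sm_alg[OF
        C] sm_small[OF C]]
      bij_copy_map[OF sm_small[OF C]]]] s(1)] nu_homD(1)[OF nu_algebra_copy(2)[OF sm_alg[OF B] sm_small[OF B]]]] .
  then have "restrict ?s (carrier ?C) \<in> linear_maps R ?C ?B"
    by (rule restrict_linear_maps[OF nu_algebra_module[OF sm_alg[OF sm_copy[OF C]]]])
  moreover have "copy_fun B C p (restrict ?s (carrier ?C) c) = c" if "c \<in> carrier ?C" for c
    using that cl s(2) inv by (auto simp: copy_alg_simps fp)
  ultimately have 4: "\<exists>s\<in>linear_maps R ?C ?B. \<forall>c\<in>carrier ?C. copy_fun B C p (s c) = c" by blast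
  note Hi = copy_arr_Hom[OF sm_alg[OF A] sm_alg[OF B] sm_small[OF A] sm_small[OF B] hi]
    and Hp = copy_arr_Hom[OF sm_alg[OF B] sm_alg[OF C] sm_small[OF B] sm_small[OF C] hp]
  show ?thesis
    unfolding Alg_ext_def
    using Hom_Arr[OF Hi] Hom_Arr[OF Hp] Hom_Dom[OF Hp] Hom_Cod[OF Hp] 1 2 3 4
    by (simp add: copy_arr_def short_exact_def)
qed

lemma GAlg_ext_split:
  assumes "(i, p) \<in> GAlg_ext R G"
  obtains A B C f g where "i = (A, B, f)" "p = (B, C, g)" "g_hom R G A B f" "g_hom R G B C g" "split_ext R A B C f g"
proof -
  obtain A B f where i: "i = (A, B, f)" by (cases i)
  obtain B' C g where p: "p = (B', C, g)" by (cases p)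
  have "i \<in> Arr (GAlg R G) \<and> p \<in> Arr (GAlg R G) \<and> short_exact i p \<and>
     (\<exists>s\<in>linear_maps R (Cod (GAlg R G) p) (Dom (GAlg R G) p).
        equivariant G (Cod (GAlg R G) p) (Dom (GAlg R G) p) s \<and>
        (\<forall>c\<in>carrier (Cod (GAlg R G) p). fn p (s c) = c))"
    using assms by (simp only: GAlg_ext_def mem_Collect_eq prod.case)
  then have a: "(A, B, f) \<in> Arr (GAlg R G)" "(B', C, g) \<in> Arr (GAlg R G)" "short_exact (A, B, f) (B', C, g)"
    and s: "\<exists>s\<in>linear_maps R C B'. \<forall>c\<in>carrier C. g (s c) = c"
    unfolding i p GAlg_simps(3,4) snd_conv by blast+
  have B: "B' = B" using a(3) by (simp add: short_exact_def)
  note f = GAlg_g_hom[OF a(1)] and g = GAlg_g_hom[OF a(2)[unfolded B]]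
  obtain t where t: "t \<in> linear_maps R C B" "\<forall>c\<in>carrier C. g (t c) = c" using s unfolding B by blast
  have "split_ext R A B C f g"
    using a(3) t(2) linear_maps_lin_map[OF t(1)] g_homD(3)[OF f] g_homD(3)[OF g]
    by (auto simp: split_ext_def short_exact_def)
  with that i p B f g show ?thesis by blast
qed

section \<open>Boundary maps of crossed products of extensions\<close>

locale crossed_excisive = crossed_functor R U Z kk j G H
  for R :: "('k, 'r) ring_scheme" and U :: "'u set" and Z :: "'x set" and kk :: "('o, 'm) tricat"
    and j :: "(('k, 'u) module, (('k, 'u) module, 'u) carr, 'o, 'm) func"
    and G :: "('g, 's) monoid_scheme" and H :: "'g set" +
  fixes d :: "(('k, 'u) module, 'u) carr \<times> (('k, 'u) module, 'u) carr \<Rightarrow> 'm"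
  assumes tri: "triangulated kk" and exc: "excisive (Alg R) (Alg_ext R) kk j d"
begin

sublocale tri: triangulated kk by (rule tri)

lemma Loop_Hom: "f \<in> Hom kk X Y \<Longrightarrow> \<Omega>\<^sub>a kk f \<in> Hom kk (\<Omega>\<^sub>o kk X) (\<Omega>\<^sub>o kk Y)"
  by (rule is_functor_Hom[OF tri.Loop_functor])

lemma Loop_Comp: "\<lbrakk>f \<in> Hom kk X Y; g \<in> Hom kk Y W\<rbrakk> \<Longrightarrow> \<Omega>\<^sub>a kk (g \<cdot>\<^bsub>kk\<^esub> f) = \<Omega>\<^sub>a kk g \<cdot>\<^bsub>kk\<^esub> \<Omega>\<^sub>a kk f"
  by (rule is_functor_Comp[OF tri.Loop_functor])

lemma Loop_iso: "iso_arrow kk f \<Longrightarrow> iso_arrow kk (\<Omega>\<^sub>a kk f)"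
  by (rule iso_arrow_functor[OF tri.Loop_functor])

text \<open>The boundary map of an extension of small algebras, taken through copies as for
  \<open>J\<close>; it extends excision of \<open>j\<close> beyond algebras living in the
  universe.\<close>

definition bd :: "('k, 'b) module \<Rightarrow> ('k, 'c) module \<Rightarrow> ('k, 'e) module \<Rightarrow> ('b \<Rightarrow> 'c) \<Rightarrow> ('c \<Rightarrow> 'e) \<Rightarrow> 'm" where
  "bd A B C i p = d (copy_arr A B i, copy_arr B C p)"

lemma bd_Hom_Tri:
  assumes "sm A" "sm B" "sm C" "split_ext R A B C i p"
  shows "bd A B C i p \<in> Hom kk (\<Omega>\<^sub>o kk (JO C)) (JO A)" "(bd A B C i p, J A B i, J B C p) \<in> Tri kk"
proof -
  have "\<forall>(i, p)\<in>Alg_ext R. d (i, p) \<in> Hom kk (\<Omega>\<^sub>o kk (on_ob j (Cod (Alg R) p))) (on_ob j (Dom (Alg R) i)) \<and>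
        (d (i, p), on_arr j i, on_arr j p) \<in> Tri kk"
    using exc unfolding excisive_def by blast
  from bspec[OF this split_ext_Alg_ext[OF assms]]
  show "bd A B C i p \<in> Hom kk (\<Omega>\<^sub>o kk (JO C)) (JO A)" "(bd A B C i p, J A B i, J B C p) \<in> Tri kk"
    by (simp_all add: bd_def J_def JO_def) (simp add: copy_arr_def Alg_simps)
qed

lemma bd_natural:
  assumes s: "sm A" "sm B" "sm C" "split_ext R A B C i p" and s': "sm A'" "sm B'" "sm C'" "split_ext R A' B' C' i' p'"
    and f: "nu_hom R A A' f" and g: "nu_hom R B B' g" and h: "nu_hom R C C' h"
    and eq: "\<And>a. a \<in> carrier A \<Longrightarrow> i' (f a) = g (i a)" "\<And>b. b \<in> carrier B \<Longrightarrow> p' (g b) = h (p b)"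
  shows "J A A' f \<cdot>\<^bsub>kk\<^esub> bd A B C i p = bd A' B' C' i' p' \<cdot>\<^bsub>kk\<^esub> \<Omega>\<^sub>a kk (J C C' h)"
proof -
  have i: "nu_hom R A B i" "nu_hom R B C p" "nu_hom R A' B' i'" "nu_hom R B' C' p'"
    using s(4) s'(4) by (simp_all add: split_ext_def)
  note hom = copy_arr_Hom[OF sm_alg sm_alg sm_small sm_small]
  have "\<forall>(i, p)\<in>Alg_ext R. \<forall>(i', p')\<in>Alg_ext R. \<forall>a b c.
        a \<in> Hom (Alg R) (Dom (Alg R) i) (Dom (Alg R) i') \<and> b \<in> Hom (Alg R) (Cod (Alg R) i) (Cod (Alg R) i') \<and>
        c \<in> Hom (Alg R) (Cod (Alg R) p) (Cod (Alg R) p') \<and> i' \<cdot>\<^bsub>Alg R\<^esub> a = b \<cdot>\<^bsub>Alg R\<^esub> i \<and> p' \<cdot>\<^bsub>Alg R\<^esub> b = c \<cdot>\<^bsub>Alg R\<^esub> p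
            \<longrightarrow>
        on_arr j a \<cdot>\<^bsub>kk\<^esub> d (i, p) = d (i', p') \<cdot>\<^bsub>kk\<^esub> \<Omega>\<^sub>a kk (on_arr j c)"
    using exc unfolding excisive_def by blast
  from bspec[OF bspec[OF this split_ext_Alg_ext[OF s], unfolded prod.case] split_ext_Alg_ext[OF s'], unfolded
      prod.case,
      rule_format, of "(copy_arr A A' f :: (('k, 'u) module, 'u) carr)"
          "(copy_arr B B' g :: (('k, 'u) module, 'u) carr)" "(copy_arr C C' h :: (('k, 'u) module, 'u) carr)"]
  show ?thesis
    unfolding J_def bd_def
  proof (elim meta_mp, intro conjI)
    show "(copy_arr A A' f :: (('k, 'u) module, 'u) carr) \<in> Hom (Alg R) (Dom (Alg R) ((copy_arr A B i :: (('k, 'u)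
        module, 'u) carr))) (Dom (Alg R) ((copy_arr A' B' i' :: (('k, 'u) module, 'u) carr)))"
      using hom[OF s(1) s'(1) s(1) s'(1) f] by (simp add: copy_arr_def Alg_simps)
    show "(copy_arr B B' g :: (('k, 'u) module, 'u) carr) \<in> Hom (Alg R) (Cod (Alg R) ((copy_arr A B i :: (('k, 'u)
        module, 'u) carr))) (Cod (Alg R) ((copy_arr A' B' i' :: (('k, 'u) module, 'u) carr)))"
      using hom[OF s(2) s'(2) s(2) s'(2) g] by (simp add: copy_arr_def Alg_simps)
    show "(copy_arr C C' h :: (('k, 'u) module, 'u) carr) \<in> Hom (Alg R) (Cod (Alg R) ((copy_arr B C p :: (('k, 'u)
        module, 'u) carr))) (Cod (Alg R) ((copy_arr B' C' p' :: (('k, 'u) module, 'u) carr)))"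
      using hom[OF s(3) s'(3) s(3) s'(3) h] by (simp add: copy_arr_def Alg_simps)
    show "(copy_arr A' B' i' :: (('k, 'u) module, 'u) carr) \<cdot>\<^bsub>Alg R\<^esub> (copy_arr A A' f :: (('k, 'u) module, 'u) carr) =
        (copy_arr B B' g :: (('k, 'u) module, 'u) carr) \<cdot>\<^bsub>Alg R\<^esub> (copy_arr A B i :: (('k, 'u) module, 'u) carr)"
      unfolding copy_arr_Comp_sm[OF s(1) s'(1) f] copy_arr_Comp_sm[OF s(1,2) i(1)]
          by (rule copy_arr_cong) (simp add: eq)
    show "(copy_arr B' C' p' :: (('k, 'u) module, 'u) carr) \<cdot>\<^bsub>Alg R\<^esub> (copy_arr B B' g :: (('k, 'u) module, 'u) carr) =
        (copy_arr C C' h :: (('k, 'u) module, 'u) carr) \<cdot>\<^bsub>Alg R\<^esub> (copy_arr B C p :: (('k, 'u) module, 'u) carr)"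
      unfolding copy_arr_Comp_sm[OF s(2) s'(2) g] copy_arr_Comp_sm[OF s(2,3) i(2)]
          by (rule copy_arr_cong) (simp add: eq)
  qed
qed

lemma crossed_ext_eq:
  "d (crossed_ext G L ((A, B, i), (B, C, p))) =
    bd (crossed G L A) (crossed G L B) (crossed G L C) ((\<circ>) i) ((\<circ>) p)"
  by (simp add: crossed_ext_def crossed_arr_def bd_def)

abbreviation "inc u A \<equiv> J (crossed G (conjH u) A) (Rc A) (incl u A)"

abbreviation "cbd L A B C i p \<equiv> bd (crossed G L A) (crossed G L B) (crossed G L C) ((\<circ>) i) ((\<circ>) p)"

end

section \<open>Excision for \<open>\<R>(- \<rtimes> G/H)\<close>\<close>

lemma excisiveI:
  assumes "is_functor C T F"
    and "\<And>i p. (i, p) \<in> E \<Longrightarrow> d (i, p) \<in> Hom T (\<Omega>\<^sub>o T (on_ob F (Cod C p))) (on_ob F (Dom C i)) \<and>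
      (d (i, p), on_arr F i, on_arr F p) \<in> Tri T"
    and "\<And>i p i' p' a b c. \<lbrakk>(i, p) \<in> E; (i', p') \<in> E; a \<in> Hom C (Dom C i) (Dom C i');
      b \<in> Hom C (Cod C i) (Cod C i'); c \<in> Hom C (Cod C p) (Cod C p');
      i' \<cdot>\<^bsub>C\<^esub> a = b \<cdot>\<^bsub>C\<^esub> i; p' \<cdot>\<^bsub>C\<^esub> b = c \<cdot>\<^bsub>C\<^esub> p\<rbrakk> \<Longrightarrow>
      on_arr F a \<cdot>\<^bsub>T\<^esub> d (i, p) = d (i', p') \<cdot>\<^bsub>T\<^esub> \<Omega>\<^sub>a T (on_arr F c)"
  shows "excisive C E T F d"
  unfolding excisive_def using assms(1) by (auto simp: assms(2,3))

context crossed_excisive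
begin

abbreviation "inc1 A \<equiv> J (crossed G H A) (Rc A) (incl \<one>\<^bsub>G\<^esub> A)"

abbreviation "cmap L A B f \<equiv> J (crossed G L A) (crossed G L B) ((\<circ>) f)"

abbreviation "RJ A B f \<equiv> J (Rc A) (Rc B) (Rm A B f)"

lemma one_G: "\<one>\<^bsub>G\<^esub> \<in> carrier G"
  using G by (simp add: group.is_monoid monoid.one_closed)

context
  fixes A :: "('k, 'u, 'g) galg"
  assumes A: "g_algebra R G A"
begin

lemmas sX = sm_crossed_product[OF A _ small_carrier]
lemmas sXH = sX[OF H]
lemmas sR = sm_Rc[OF A small_carrier]

lemma inc1_props:
  "nu_hom R (crossed G H A) (Rc A) (incl \<one>\<^bsub>G\<^esub> A)" "iso_arrow kk (inc1 A)"
      "inc1 A \<in> Hom kk (JO (crossed G H A)) (JO (Rc A))"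
  using incl_props[OF A small_carrier one_G] J_Hom[OF sXH sR] by (simp_all add: conjH_one[OF A])

lemma nu_one: "nu R G H j \<one>\<^bsub>G\<^esub> A = inc1 A"
  using nu_eq[OF A one_G] by (simp add: conjH_one[OF A])

lemma inc_props:
  assumes u: "u \<in> carrier G"
  shows "iso_arrow kk (inc u A)" "inc u A \<in> Hom kk (JO (crossed G (conjH u) A)) (JO (Rc A))"
    and "J (crossed G H A) (crossed G (conjH u) A) (tr A u) \<in> Hom kk (JO (crossed G H A)) (JO (crossed G (conjH u)
        A))"
    and "iso_arrow kk (J (crossed G H A) (crossed G (conjH u) A) (tr A u))"
proof -
  note L = subgroup_conjH[OF A u]
  show i: "iso_arrow kk (inc u A)" by (rule incl_props(2)[OF A small_carrier u])
  show h: "inc u A \<in> Hom kk (JO (crossed G (conjH u) A)) (JO (Rc A))"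
    by (rule J_Hom[OF sX[OF L] sR incl_props(1)[OF A small_carrier u]])
  show t: "J (crossed G H A) (crossed G (conjH u) A) (tr A u) \<in> Hom kk (JO (crossed G H A)) (JO (crossed G (conjH u)
      A))"
    by (rule J_Hom[OF sXH sX[OF L] nu_hom_tr[OF A u]])
  \<comment> \<open>By \<open>incl_conj\<close> the conjugation sits between two invertible maps, so
    it is invertible by two-of-three.\<close>
  show "iso_arrow kk (J (crossed G H A) (crossed G (conjH u) A) (tr A u))"
    using kk.iso_arrow_Comp_cancel_left[OF t h i] incl_conj[OF A small_carrier u] inc1_props(2) by simp
qed

end

context
  fixes A B :: "('k, 'u, 'g) galg" and f
  assumes f: "g_hom R G A B f"
begin

lemma cmap_Hom: "subgroup L G \<Longrightarrow> cmap L A B f \<in> Hom kk (JO (crossed G L A)) (JO (crossed G L B))"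
  by (rule J_Hom[OF sX[OF g_homD(1)[OF f]] sX[OF g_homD(2)[OF f]] g_hom_nu_hom_crossed[OF f]])

lemma RJ_Hom: "RJ A B f \<in> Hom kk (JO (Rc A)) (JO (Rc B))"
  by (rule J_Hom[OF sR[OF g_homD(1)[OF f]] sR[OF g_homD(2)[OF f]] \<R>_map_crossed(1)[OF f H]])

lemma inc1_natural: "RJ A B f \<cdot>\<^bsub>kk\<^esub> inc1 A = inc1 B \<cdot>\<^bsub>kk\<^esub> cmap H A B f"
  using incl_natural[OF f small_carrier small_carrier one_G] by (simp add: conjH_one[OF g_homD(1)[OF f]])

end

context
  fixes A B C :: "('k, 'u, 'g) galg" and i p
  assumes i: "g_hom R G A B i" and p: "g_hom R G B C p" and e: "split_ext R A B C i p"
begin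

lemma cbd_Hom_Tri:
  assumes L: "subgroup L G"
  shows "cbd L A B C i p \<in> Hom kk (\<Omega>\<^sub>o kk (JO (crossed G L C))) (JO (crossed G L A))"
    "(cbd L A B C i p, cmap L A B i, cmap L B C p) \<in> Tri kk"
  using bd_Hom_Tri[OF sX[OF g_homD(1)[OF i] L] sX[OF g_homD(2)[OF i] L] sX[OF g_homD(2)[OF p] L]
      split_ext_crossed[OF i p L e]] .

text \<open>The second statement characterises the boundary map without an inverse, \<Omega> of the
  inclusion being invertible. In this form it is used for the square, the triangle and
  naturality.\<close>

lemma boundary:
  defines "\<beta> \<equiv> crossed_boundary R G H kk j d ((A, B, i), (B, C, p))"
  shows "\<beta> \<in> Hom kk (\<Omega>\<^sub>o kk (JO (Rc C))) (JO (Rc A))" "\<beta> \<cdot>\<^bsub>kk\<^esub> \<Omega>\<^sub>a kk (inc1 C) = inc1 A \<cdot>\<^bsub>kk\<^esub> cbd H A B C i p"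
proof -
  note a = inc1_props[OF g_homD(1)[OF i]] and c = inc1_props[OF g_homD(2)[OF p]]
  note h = kk.Comp_Hom[OF cbd_Hom_Tri(1)[OF H] a(3)]
  have eq: "\<beta> = (inc1 A \<cdot>\<^bsub>kk\<^esub> cbd H A B C i p) \<cdot>\<^bsub>kk\<^esub> inv_arr kk (\<Omega>\<^sub>a kk (inc1 C))"
    by (simp add: \<beta>_def crossed_boundary_def GAlg_simps crossed_ext_eq nu_one[OF g_homD(1)[OF i]] nu_one[OF
        g_homD(2)[OF p]])
  show "\<beta> \<in> Hom kk (\<Omega>\<^sub>o kk (JO (Rc C))) (JO (Rc A))"
    unfolding eq by (rule kk.Comp_Hom[OF kk.inv_arrD(1)[OF Loop_iso[OF c(2)] Loop_Hom[OF c(3)]] h])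
  show "\<beta> \<cdot>\<^bsub>kk\<^esub> \<Omega>\<^sub>a kk (inc1 C) = inc1 A \<cdot>\<^bsub>kk\<^esub> cbd H A B C i p"
    unfolding eq by (rule kk.Comp_inv_arr_cancel'[OF Loop_iso[OF c(2)] Loop_Hom[OF c(3)] h])
qed

text \<open>Conjugation by \<open>u\<close> is a morphism of extensions from the crossed product
  with \<open>H\<close> to the one with \<open>uHu^-1\<close>, and \<open>incl_conj\<close> turns
  the inclusion at uH into the one at H after precomposition with it. So the two sides agree after
  composition with the loop of the conjugation on \<open>C\<close>, which is invertible and is
  cancelled.\<close>

lemma boundary_square:
  assumes u: "u \<in> carrier G"
  shows "inc u A \<cdot>\<^bsub>kk\<^esub> cbd (conjH u) A B C i p =
    crossed_boundary R G H kk j d ((A, B, i), (B, C, p)) \<cdot>\<^bsub>kk\<^esub> \<Omega>\<^sub>a kk (inc u C)"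
proof -
  let ?\<beta> = "crossed_boundary R G H kk j d ((A, B, i), (B, C, p))" and ?L = "conjH u"
  let ?t = "\<lambda>A. J (crossed G H A) (crossed G ?L A) (tr A u)"
  note gA = g_homD(1)[OF i] and gB = g_homD(2)[OF i] and gC = g_homD(2)[OF p]
  note L = subgroup_conjH[OF gA u]
  note a = inc_props[OF gA u] and c = inc_props[OF gC u] and t = nu_hom_tr[OF _ u]
  note cH = cbd_Hom_Tri(1)[OF H] and cL = cbd_Hom_Tri(1)[OF L]
  have nat: "f (tr X u \<phi> k) = tr Y u (\<lambda>x. f (\<phi> x)) k" if "g_hom R G X Y f" "\<phi> \<in> carrier (crossed G H X)"
    for X Y :: "('k, 'u, 'g) galg" and f \<phi> k
  proof -
    interpret X: g_algebra R G X by (rule g_homD(1)[OF that(1)])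
    have "\<phi> k \<in> carrier X" for k using that(2) X.fin_fun_carrier[of \<phi> H k] by (simp add: crossed_def)
    from fun_cong[OF trans_natural[where h = "inv\<^bsub>G\<^esub> u", OF that(1) H u this]] show ?thesis by (simp add: o_def)
  qed
  have 1: "?t A \<cdot>\<^bsub>kk\<^esub> cbd H A B C i p = cbd ?L A B C i p \<cdot>\<^bsub>kk\<^esub> \<Omega>\<^sub>a kk (?t C)"
    by (rule bd_natural[OF sX[OF gA H] sX[OF gB H] sX[OF gC H] split_ext_crossed[OF i p H e]
          sX[OF gA L] sX[OF gB L] sX[OF gC L] split_ext_crossed[OF i p L e] t[OF gA] t[OF gB] t[OF gC]])
      (use nat[OF i] nat[OF p] in \<open>simp_all add: fun_eq_iff o_def\<close>)
  have "(?\<beta> \<cdot>\<^bsub>kk\<^esub> \<Omega>\<^sub>a kk (inc u C)) \<cdot>\<^bsub>kk\<^esub> \<Omega>\<^sub>a kk (?t C) = ?\<beta> \<cdot>\<^bsub>kk\<^esub> \<Omega>\<^sub>a kk (inc u C \<cdot>\<^bsub>kk\<^esub> ?t C)"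
    unfolding Loop_Comp[OF c(3,2)] by (rule kk.Comp_assoc[OF Loop_Hom[OF c(3)] Loop_Hom[OF c(2)] boundary(1)])
  also have "\<dots> = inc1 A \<cdot>\<^bsub>kk\<^esub> cbd H A B C i p"
    unfolding incl_conj[OF gC small_carrier u] by (rule boundary(2))
  also have "\<dots> = (inc u A \<cdot>\<^bsub>kk\<^esub> ?t A) \<cdot>\<^bsub>kk\<^esub> cbd H A B C i p"
    unfolding incl_conj[OF gA small_carrier u] ..
  also have "\<dots> = inc u A \<cdot>\<^bsub>kk\<^esub> (cbd ?L A B C i p \<cdot>\<^bsub>kk\<^esub> \<Omega>\<^sub>a kk (?t C))"
    unfolding 1[symmetric] by (rule kk.Comp_assoc[OF cH a(3,2)])
  also have "\<dots> = (inc u A \<cdot>\<^bsub>kk\<^esub> cbd ?L A B C i p) \<cdot>\<^bsub>kk\<^esub> \<Omega>\<^sub>a kk (?t C)"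
    by (rule kk.Comp_assoc[OF Loop_Hom[OF c(3)] cL a(2), symmetric])
  finally show ?thesis
    by (rule kk.iso_arrow_epi[OF Loop_iso[OF c(4)] Loop_Hom[OF c(3)] kk.Comp_Hom[OF Loop_Hom[OF c(2)] boundary(1)]
        kk.Comp_Hom[OF cL a(2)], symmetric])
qed

text \<open>The triangle of the extension crossed with \<open>H\<close> is distinguished, and the
  inclusions at the trivial coset carry it isomorphically to this one.\<close>

lemma boundary_Tri: "(crossed_boundary R G H kk j d ((A, B, i), (B, C, p)), RJ A B i, RJ B C p) \<in> Tri kk"
proof -
  note a = inc1_props[OF g_homD(1)[OF i]] and b = inc1_props[OF g_homD(2)[OF i]]
      and c = inc1_props[OF g_homD(2)[OF p]]
  note m = cmap_Hom[OF i H] cmap_Hom[OF p H]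
  show ?thesis
  proof (rule tri.Tri_iso[OF cbd_Hom_Tri(2)[OF H] a(2) b(2) c(2)])
    show "inc1 A \<cdot>\<^bsub>kk\<^esub> cbd H A B C i p = crossed_boundary R G H kk j d ((A, B, i), (B, C, p)) \<cdot>\<^bsub>kk\<^esub> \<Omega>\<^sub>a kk (inc1 C)"
      using boundary(2) ..
    show "inc1 B \<cdot>\<^bsub>kk\<^esub> cmap H A B i = RJ A B i \<cdot>\<^bsub>kk\<^esub> inc1 A" "inc1 C \<cdot>\<^bsub>kk\<^esub> cmap H B C p = RJ B C p \<cdot>\<^bsub>kk\<^esub> inc1 B"
      using inc1_natural[OF i] inc1_natural[OF p] by simp_all
    show "crossed_boundary R G H kk j d ((A, B, i), (B, C, p)) \<in> Hom kk (\<Omega>\<^sub>o kk (Cod kk (inc1 C))) (Cod kk (inc1 A))"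
      using boundary(1) Hom_Cod[OF a(3)] Hom_Cod[OF c(3)] by simp
  qed (use Hom_Dom[OF a(3)] Hom_Dom[OF b(3)] Hom_Dom[OF c(3)] Hom_Dom[OF m(1)] Hom_Dom[OF m(2)] Hom_Cod[OF m(2)]
      RJ_Hom[OF i] RJ_Hom[OF p] Hom_Cod[OF a(3)] Hom_Cod[OF b(3)] Hom_Cod[OF c(3)] in simp_all)
qed

end

text \<open>Naturality holds for the extensions crossed with \<open>H\<close>. It is transported
  along the inclusions at the trivial coset; the loop of the inclusion for \<open>C\<close> is
  cancelled at the end.\<close>

lemma boundary_natural:
  fixes A B C A' B' C' :: "('k, 'u, 'g) galg"
  assumes i: "g_hom R G A B i" and p: "g_hom R G B C p" and e: "split_ext R A B C i p"
    and i': "g_hom R G A' B' i'" and p': "g_hom R G B' C' p'" and e': "split_ext R A' B' C' i' p'"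
    and f: "g_hom R G A A' f" and g: "g_hom R G B B' g" and h: "g_hom R G C C' h"
    and eq: "\<And>a. a \<in> carrier A \<Longrightarrow> i' (f a) = g (i a)" "\<And>b. b \<in> carrier B \<Longrightarrow> p' (g b) = h (p b)"
  shows "RJ A A' f \<cdot>\<^bsub>kk\<^esub> crossed_boundary R G H kk j d ((A, B, i), (B, C, p)) =
    crossed_boundary R G H kk j d ((A', B', i'), (B', C', p')) \<cdot>\<^bsub>kk\<^esub> \<Omega>\<^sub>a kk (RJ C C' h)"
proof -
  let ?\<beta> = "crossed_boundary R G H kk j d ((A, B, i), (B, C, p))"
  let ?\<beta>' = "crossed_boundary R G H kk j d ((A', B', i'), (B', C', p'))"
  note a = inc1_props[OF g_homD(1)[OF f]] and a' = inc1_props[OF g_homD(2)[OF f]]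
    and c = inc1_props[OF g_homD(1)[OF h]] and c' = inc1_props[OF g_homD(2)[OF h]]
  note b = boundary[OF i p e] and b' = boundary[OF i' p' e']
  note cb = cbd_Hom_Tri(1)[OF i p e H] and cb' = cbd_Hom_Tri(1)[OF i' p' e' H]
  note Rf = RJ_Hom[OF f] and Rh = RJ_Hom[OF h] and mf = cmap_Hom[OF f H] and mh = cmap_Hom[OF h H]
  have 1: "cmap H A A' f \<cdot>\<^bsub>kk\<^esub> cbd H A B C i p = cbd H A' B' C' i' p' \<cdot>\<^bsub>kk\<^esub> \<Omega>\<^sub>a kk (cmap H C C' h)"
  proof (rule bd_natural[OF sXH sXH sXH split_ext_crossed[OF i p H e] sXH sXH sXH split_ext_crossed[OF i' p' H e']
        g_hom_nu_hom_crossed[OF f H] g_hom_nu_hom_crossed[OF g H] g_hom_nu_hom_crossed[OF h H]])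
    interpret A: g_algebra R G A by (rule g_homD(1)[OF i])
    fix \<phi> assume "\<phi> \<in> carrier (crossed G H A)"
    then have "\<phi> k \<in> carrier A" for k using A.fin_fun_carrier[of \<phi> H k] by (simp add: crossed_def)
    then show "i' \<circ> (f \<circ> \<phi>) = g \<circ> (i \<circ> \<phi>)" by (simp add: fun_eq_iff eq)
  next
    interpret B: g_algebra R G B by (rule g_homD(2)[OF i])
    fix \<phi> assume "\<phi> \<in> carrier (crossed G H B)"
    then have "\<phi> k \<in> carrier B" for k using B.fin_fun_carrier[of \<phi> H k] by (simp add: crossed_def)
    then show "p' \<circ> (g \<circ> \<phi>) = h \<circ> (p \<circ> \<phi>)" by (simp add: fun_eq_iff eq)
  qed (use i i' p p' in \<open>auto simp: g_hom_def\<close>)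
  have "(RJ A A' f \<cdot>\<^bsub>kk\<^esub> ?\<beta>) \<cdot>\<^bsub>kk\<^esub> \<Omega>\<^sub>a kk (inc1 C) = RJ A A' f \<cdot>\<^bsub>kk\<^esub> (inc1 A \<cdot>\<^bsub>kk\<^esub> cbd H A B C i p)"
    using kk.Comp_assoc[OF Loop_Hom[OF c(3)] b(1) Rf] b(2) by simp
  also have "\<dots> = (inc1 A' \<cdot>\<^bsub>kk\<^esub> cmap H A A' f) \<cdot>\<^bsub>kk\<^esub> cbd H A B C i p"
    using kk.Comp_assoc[OF cb a(3) Rf] inc1_natural[OF f] by simp
  also have "\<dots> = inc1 A' \<cdot>\<^bsub>kk\<^esub> (cbd H A' B' C' i' p' \<cdot>\<^bsub>kk\<^esub> \<Omega>\<^sub>a kk (cmap H C C' h))"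
    using kk.Comp_assoc[OF cb mf a'(3)] 1 by simp
  also have "\<dots> = (?\<beta>' \<cdot>\<^bsub>kk\<^esub> \<Omega>\<^sub>a kk (inc1 C')) \<cdot>\<^bsub>kk\<^esub> \<Omega>\<^sub>a kk (cmap H C C' h)"
    using kk.Comp_assoc[OF Loop_Hom[OF mh] cb' a'(3)] b'(2) by simp
  also have "\<dots> = ?\<beta>' \<cdot>\<^bsub>kk\<^esub> \<Omega>\<^sub>a kk (RJ C C' h \<cdot>\<^bsub>kk\<^esub> inc1 C)"
    using kk.Comp_assoc[OF Loop_Hom[OF mh] Loop_Hom[OF c'(3)] b'(1)] Loop_Comp[OF mh c'(3)] inc1_natural[OF h] by simp
  also have "\<dots> = (?\<beta>' \<cdot>\<^bsub>kk\<^esub> \<Omega>\<^sub>a kk (RJ C C' h)) \<cdot>\<^bsub>kk\<^esub> \<Omega>\<^sub>a kk (inc1 C)"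
    using kk.Comp_assoc[OF Loop_Hom[OF c(3)] Loop_Hom[OF Rh] b'(1)] Loop_Comp[OF c(3) Rh] by simp
  finally show ?thesis
    by (rule kk.iso_arrow_epi[OF Loop_iso[OF c(2)] Loop_Hom[OF c(3)] kk.Comp_Hom[OF b(1) Rf] kk.Comp_Hom[OF
        Loop_Hom[OF Rh] b'(1)]])
qed

lemma excisive_crossed:
  assumes cat: "category (GAlg R G :: (('k, 'u, 'g) galg, (('k, 'u, 'g) galg, 'u) carr) cat)"
  shows "excisive (GAlg R G) (GAlg_ext R G) kk (j \<circ>\<^sub>F \<R>_crossed R G H) (crossed_boundary R G H kk j d)"
proof -
  let ?F = "j \<circ>\<^sub>F \<R>_crossed R G H"
  have F: "on_ob ?F A = JO (Rc A)" "on_arr ?F (A, B, f) = RJ A B f" for A B :: "('k, 'u, 'g) galg" and f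
    using on_arr_\<R>_crossed[of A B f] by (simp_all add: func_comp_def JO_def \<R>_crossed_def)
  show ?thesis
  proof (rule excisiveI)
    show "is_functor (GAlg R G) kk ?F" by (rule is_functor_func_comp[OF is_functor_\<R>_crossed[OF cat] j])
  next
    fix i p :: "(('k, 'u, 'g) galg, 'u) carr" assume "(i, p) \<in> GAlg_ext R G"
    then obtain A B C f g where [simp]: "i = (A, B, f)" "p = (B, C, g)"
      and s: "g_hom R G A B f" "g_hom R G B C g" "split_ext R A B C f g" by (rule GAlg_ext_split)
    show "crossed_boundary R G H kk j d (i, p) \<in>
        Hom kk (\<Omega>\<^sub>o kk (on_ob ?F (Cod (GAlg R G) p))) (on_ob ?F (Dom (GAlg R G) i)) \<and>
        (crossed_boundary R G H kk j d (i, p), on_arr ?F i, on_arr ?F p) \<in> Tri kk"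
      using boundary(1)[OF s] boundary_Tri[OF s] by (simp add: F GAlg_simps)
    fix i' p' a b c :: "(('k, 'u, 'g) galg, 'u) carr" assume "(i', p') \<in> GAlg_ext R G"
    then obtain A' B' C' f' g' where [simp]: "i' = (A', B', f')" "p' = (B', C', g')"
      and s': "g_hom R G A' B' f'" "g_hom R G B' C' g'" "split_ext R A' B' C' f' g'" by (rule GAlg_ext_split)
    assume h: "a \<in> Hom (GAlg R G) (Dom (GAlg R G) i) (Dom (GAlg R G) i')"
      "b \<in> Hom (GAlg R G) (Cod (GAlg R G) i) (Cod (GAlg R G) i')"
      "c \<in> Hom (GAlg R G) (Cod (GAlg R G) p) (Cod (GAlg R G) p')"
      and eq: "i' \<cdot>\<^bsub>GAlg R G\<^esub> a = b \<cdot>\<^bsub>GAlg R G\<^esub> i" "p' \<cdot>\<^bsub>GAlg R G\<^esub> b = c \<cdot>\<^bsub>GAlg R G\<^esub> p"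
    have h: "a \<in> Hom (GAlg R G) A A'" "b \<in> Hom (GAlg R G) B B'" "c \<in> Hom (GAlg R G) C C'"
      using h by (simp_all add: GAlg_simps(3,4))
    have ex: "\<exists>k. m = (X, Y, k) \<and> g_hom R G X Y k" if "m \<in> Hom (GAlg R G) X Y"
      for m and X Y :: "('k, 'u, 'g) galg"
      using that GAlg_g_hom[of X Y _ R G] by (cases m) (auto simp: Hom_def GAlg_simps(3,4))
    obtain k l n where [simp]: "a = (A, A', k)" "b = (B, B', l)" "c = (C, C', n)"
      and kln: "g_hom R G A A' k" "g_hom R G B B' l" "g_hom R G C C' n"
      using ex[OF h(1)] ex[OF h(2)] ex[OF h(3)] by blast
    have q: "compose (carrier A) f' k = compose (carrier A) l f" "compose (carrier B) g' l = compose (carrier B) n g"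
      using eq by (simp_all add: GAlg_simps)
    have "f' (k x) = l (f x)" if "x \<in> carrier A" for x using fun_cong[OF q(1), of x] that by (simp add: compose_eq)
    moreover have "g' (l x) = n (g x)" if "x \<in> carrier B" for x using fun_cong[OF q(2), of x] that
        by (simp add: compose_eq)
    ultimately show "on_arr ?F a \<cdot>\<^bsub>kk\<^esub> crossed_boundary R G H kk j d (i, p) =
        crossed_boundary R G H kk j d (i', p') \<cdot>\<^bsub>kk\<^esub> \<Omega>\<^sub>a kk (on_arr ?F c)"
      using boundary_natural[OF s s' kln] by (simp add: F)
  qed
qed

end

section \<open>Homotopy invariance of \<open>\<R>(- \<rtimes> G/H)\<close>\<close>

lemma g_hom_comp: "\<lbrakk>g_hom R G A B f; g_hom R G B C g\<rbrakk> \<Longrightarrow> g_hom R G A C (g \<circ> f)"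
  unfolding g_hom_def using nu_hom_comp nu_homD(3) by (fastforce simp: equivariant_def)

lemma g_hom_inverse:
  assumes f: "g_hom R G A B f" and b: "bij_betw f (carrier A) (carrier B)"
  shows "g_hom R G B A (inv_into (carrier A) f)"
proof -
  interpret A: g_algebra R G A by (rule g_homD(1)[OF f])
  have "inv_into (carrier A) f (gact B g y) = gact A g (inv_into (carrier A) f y)"
    if gy: "g \<in> carrier G" "y \<in> carrier B" for g y
  proof -
    obtain a where a: "a \<in> carrier A" "y = f a" using gy(2) b by (auto simp: bij_betw_def)
    note i = inv_into_f_f[OF bij_betw_imp_inj_on[OF b]]
    show ?thesis using equivariantD[OF g_homD(4)[OF f] gy(1) a(1)] i[OF A.gact_closed[OF gy(1) a(1)]] i[OF a(1)] a(2)
        by simp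
  qed
  then show ?thesis
    unfolding g_hom_def equivariant_def
    using g_homD(1,2)[OF f] inverse_nu_hom[OF g_algebra_nu[OF g_homD(1)[OF f]] g_homD(3)[OF f] b] by blast
qed

lemma g_hom_cong:
  assumes f: "g_hom R G A B f" and eq: "\<And>a. a \<in> carrier A \<Longrightarrow> f a = g a"
  shows "g_hom R G A B g"
proof -
  interpret A: g_algebra R G A by (rule g_homD(1)[OF f])
  have "nu_hom R A B g" using nu_hom_cong[where f = f and g = g, OF A.nu_algebra_axioms eq] g_homD(3)[OF f] by blast
  moreover have "equivariant G A B g"
    using equivariantD[OF g_homD(4)[OF f]] eq by (simp add: equivariant_def)
  ultimately show ?thesis using g_homD(1,2)[OF f] by (simp add: g_hom_def)
qed

lemma g_hom_copy:
  fixes A :: "('k, 'b, 'g) galg"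
  assumes "g_algebra R G A" "carrier A \<lesssim> (UNIV :: 'u set)"
  shows "g_hom R G A (copy_galg A :: ('k, 'u, 'g) galg) (copy_map (carrier A))"
  using g_algebra_copy[OF assms] assms(1) by (simp add: g_hom_def)

section \<open>Exchanging polynomials and crossed products\<close>

text \<open>The isomorphism of \<open>A[t] \<rtimes> H\<close> with
  \<open>(A \<rtimes> H)[t]\<close>, both being finitely supported functions of a group element and
  an exponent. It is its own inverse.\<close>

definition flip :: "('x \<Rightarrow> 'y \<Rightarrow> 'a) \<Rightarrow> 'y \<Rightarrow> 'x \<Rightarrow> 'a" where
  "flip \<phi> = (\<lambda>y x. \<phi> x y)"

text \<open>Finitely many rows are nonzero and each has finite support, so only finitely many
  columns are nonzero. \<open>B\<close> and \<open>C\<close> are described only by carrier and zero,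
  which lets the statement be used in both directions.\<close>

lemma fin_fun_flip:
  assumes \<phi>: "\<phi> \<in> fin_fun S B" and B: "carrier B = fin_fun T A" "zero B = (\<lambda>_. \<zero>\<^bsub>A\<^esub>)"
    and C: "carrier C = fin_fun S A" "zero C = (\<lambda>_. \<zero>\<^bsub>A\<^esub>)" and A: "\<zero>\<^bsub>A\<^esub> \<in> carrier A"
  shows "flip \<phi> \<in> fin_fun T C"
proof -
  have f: "\<phi> x \<in> fin_fun T A" for x
    using \<phi> A by (cases "x \<in> S") (auto simp: fin_fun_def B)
  have z: "\<phi> x y = \<zero>\<^bsub>A\<^esub>" if "x \<notin> S \<or> y \<notin> T" for x y
    using that \<phi> f[of x] by (auto simp: fin_fun_def B)
  have s: "finite {x. \<phi> x \<noteq> (\<lambda>_. \<zero>\<^bsub>A\<^esub>)}" using fin_fun_finite[OF \<phi>] by (simp add: B)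
  have c: "\<phi> x y \<in> carrier A" for x y using f[of x] A by (cases "y \<in> T") (auto simp: fin_fun_def)
  have "{x. \<phi> x y \<noteq> \<zero>\<^bsub>A\<^esub>} \<subseteq> {x. \<phi> x \<noteq> (\<lambda>_. \<zero>\<^bsub>A\<^esub>)}" for y by auto
  then have "finite {x. \<phi> x y \<noteq> \<zero>\<^bsub>A\<^esub>}" for y by (rule finite_subset[OF _ s])
  then have 1: "flip \<phi> y \<in> fin_fun S A" for y
    using c z by (simp add: fin_fun_def flip_def)
  have "{y. flip \<phi> y \<noteq> (\<lambda>_. \<zero>\<^bsub>A\<^esub>)} \<subseteq> (\<Union>x\<in>{x. \<phi> x \<noteq> (\<lambda>_. \<zero>\<^bsub>A\<^esub>)}. {y. \<phi> x y \<noteq> \<zero>\<^bsub>A\<^esub>})"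
    by (auto simp: flip_def fun_eq_iff)
  moreover have "finite (\<Union>x\<in>{x. \<phi> x \<noteq> (\<lambda>_. \<zero>\<^bsub>A\<^esub>)}. {y. \<phi> x y \<noteq> \<zero>\<^bsub>A\<^esub>})"
    by (rule finite_UN_I[OF s]) (rule fin_fun_finite[OF f])
  ultimately have "finite {y. flip \<phi> y \<noteq> (\<lambda>_. \<zero>\<^bsub>A\<^esub>)}" by (rule finite_subset)
  then show ?thesis using 1 z unfolding fin_fun_def[of T C] C by (simp add: flip_def)
qed

lemma flip_crossed_poly:
  fixes A :: "('k, 'a, 'g) galg"
  assumes A: "g_algebra R G A" and H: "subgroup H G"
  shows "nu_hom R (crossed G H (poly_galg A)) (poly_alg (crossed G H A)) flip"
    and "bij_betw flip (carrier (crossed G H (poly_galg A))) (carrier (poly_alg (crossed G H A)))"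
proof -
  interpret A: g_algebra R G A by (rule A)
  interpret H: subgroup H G by (rule H)
  let ?P = "poly_galg A" and ?D = "crossed G H A"
  let ?C = "crossed G H ?P" and ?Q = "poly_alg ?D"
  interpret P: g_algebra R G ?P by (rule g_algebra_poly[OF A])
  interpret D: nu_algebra R ?D by (rule nu_algebra_crossed[OF A H])
  interpret Q: nu_algebra R ?Q by (rule nu_algebra_poly[OF D.nu_algebra_axioms])
  interpret cA: twisted_convolution R A H "crossed_mult G A" "\<lambda>s t. Some (s \<otimes>\<^bsub>G\<^esub> t)" "gact A"
    by (rule crossed_convolution[OF A H])
  interpret cP: twisted_convolution R ?P H "crossed_mult G ?P" "\<lambda>s t. Some (s \<otimes>\<^bsub>G\<^esub> t)" "gact ?P"
    by (rule crossed_convolution[OF g_algebra_poly[OF A] H])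
  have D: "carrier ?D = fin_fun H A" "zero ?D = (\<lambda>_. \<zero>\<^bsub>A\<^esub>)" "mult ?D = crossed_mult G A"
    "add ?D = (\<lambda>\<phi> \<psi> x. \<phi> x \<oplus>\<^bsub>A\<^esub> \<psi> x)" "smult ?D = (\<lambda>r \<phi> x. r \<odot>\<^bsub>A\<^esub> \<phi> x)"
    by (simp_all add: crossed_def)
  have C: "carrier ?C = fin_fun H ?P" by (simp add: crossed_def)
  have Pc: "carrier ?P = fin_fun UNIV A" "zero ?P = (\<lambda>_. \<zero>\<^bsub>A\<^esub>)" by (simp_all add: A.poly_alg_simps)
  have cl: "flip \<phi> \<in> carrier ?Q" if "\<phi> \<in> carrier ?C" for \<phi>
    unfolding D.poly_alg_simps by (rule fin_fun_flip[OF that[unfolded C] Pc D(1,2) A.zero_closed])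
  have cl': "flip \<phi> \<in> carrier ?C" if "\<phi> \<in> carrier ?Q" for \<phi>
    unfolding C by (rule fin_fun_flip[OF that[unfolded D.poly_alg_simps] D(1,2) Pc A.zero_closed])
  show "bij_betw flip (carrier ?C) (carrier ?Q)"
    by (rule bij_betw_byWitness[where f' = flip]) (use cl cl' in \<open>auto simp: flip_def\<close>)
  have l: "lin_map R ?C ?Q flip"
    using cl by (intro lin_mapI) (auto simp: D.poly_alg_simps D A.poly_alg_simps crossed_def[of G H ?P] flip_def)
  have s: "flip (fsingle ?P g p) = (\<lambda>n. fsingle A g (p n))" for g p
    by (auto simp: flip_def fsingle_def A.poly_alg_simps fun_eq_iff)
  have sl: "lin_map R A ?D (fsingle A g)" if "g \<in> H" for g
    unfolding crossed_def by (rule lin_map_fsingle[OF A.module_axioms that])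
  show "nu_hom R ?C ?Q flip" unfolding crossed_def[of G H ?P]
  proof (rule nu_hom_fsI[OF P.module_axioms cP.nu_algebra_fs_alg Q.nu_algebra_axioms l[unfolded crossed_def[of G H
      ?P]]])
    fix g p h q assume a: "g \<in> H" "p \<in> carrier ?P" "h \<in> H" "q \<in> carrier ?P"
    then have gh: "g \<in> carrier G" "g \<otimes>\<^bsub>G\<^esub> h \<in> H" by simp_all
    have pq: "p n \<in> carrier A" "q n \<in> carrier A" for n using a A.fin_fun_carrier[of p UNIV] A.fin_fun_carrier[of q
        UNIV] unfolding Pc by blast+
    \<comment> \<open>The coefficient of t^n on both sides. The group acts on polynomials
      coefficient by coefficient, so placing a coefficient in degree gh commutes with the Cauchy
      sum.\<close>
    have "fsingle A (g \<otimes>\<^bsub>G\<^esub> h) (\<Oplus>\<^bsub>A\<^esub>i\<in>{..n}. p i \<otimes>\<^bsub>A\<^esub> gact A g (q (n - i))) =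
        (\<Oplus>\<^bsub>?D\<^esub>i\<in>{..n}. fsingle A g (p i) \<otimes>\<^bsub>?D\<^esub> fsingle A h (q (n - i)))" for n
    proof -
      have "fsingle A (g \<otimes>\<^bsub>G\<^esub> h) (\<Oplus>\<^bsub>A\<^esub>i\<in>{..n}. p i \<otimes>\<^bsub>A\<^esub> gact A g (q (n - i))) =
          (\<Oplus>\<^bsub>?D\<^esub>i\<in>{..n}. fsingle A (g \<otimes>\<^bsub>G\<^esub> h) (p i \<otimes>\<^bsub>A\<^esub> gact A g (q (n - i))))"
        using lin_map_finsum[OF A.module_axioms D.module_axioms sl[OF gh(2)], of "{..n}"
            "\<lambda>i. p i \<otimes>\<^bsub>A\<^esub> gact A g (q (n - i))"]
          pq gh A.mult_closed by (simp add: o_def)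
      also have "\<dots> = (\<Oplus>\<^bsub>?D\<^esub>i\<in>{..n}. fsingle A g (p i) \<otimes>\<^bsub>?D\<^esub> fsingle A h (q (n - i)))"
        by (rule D.finsum_cong') (use cA.m_fsingle[OF a(1) pq(1) a(3) pq(2)] pq gh lin_mapD(1)[OF sl] a A.mult_closed
            D.mult_closed
            in \<open>auto simp: D(3)\<close>)
      finally show ?thesis .
    qed
    moreover have "gact ?P g q = (\<lambda>n. gact A g (q n))" by simp
    ultimately show "flip (crossed_mult G ?P (fsingle ?P g p) (fsingle ?P h q)) = flip (fsingle ?P g p) \<otimes>\<^bsub>?Q\<^esub> flip
        (fsingle ?P h q)"
      using cP.m_fsingle[OF a] by (simp add: s poly_alg_def)
  qed
qed

context crossed_excisive
begin

lemma J_crossed_bij: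
  fixes X :: "('k, 'b, 'g) galg" and Y :: "('k, 'u, 'g) galg"
  assumes X: "carrier X \<lesssim> U" and c: "g_hom R G X Y c" "bij_betw c (carrier X) (carrier Y)"
  shows "iso_arrow kk (J (crossed G H X) (crossed G H Y) ((\<circ>) c))"
proof -
  note h = g_hom_nu_hom_crossed[OF _ H]
  show ?thesis
  proof (rule J_iso[OF sm_crossed_product[OF g_homD(1)[OF c(1)] H X] sXH[OF g_homD(2)[OF c(1)]] h[OF c(1)] h[OF
      g_hom_inverse[OF c]]])
    interpret X: g_algebra R G X by (rule g_homD(1)[OF c(1)])
    interpret Y: g_algebra R G Y by (rule g_homD(2)[OF c(1)])
    fix \<phi> assume "\<phi> \<in> carrier (crossed G H X)"
    then have "\<phi> k \<in> carrier X" for k using X.fin_fun_carrier[of \<phi> H k] by (simp add: crossed_def)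
    then show "inv_into (carrier X) c \<circ> (c \<circ> \<phi>) = \<phi>"
      using inv_into_f_f[OF bij_betw_imp_inj_on[OF c(2)]] by (simp add: fun_eq_iff)
  next
    interpret Y: g_algebra R G Y by (rule g_homD(2)[OF c(1)])
    fix \<phi> assume "\<phi> \<in> carrier (crossed G H Y)"
    then have "\<phi> k \<in> carrier Y" for k using Y.fin_fun_carrier[of \<phi> H k] by (simp add: crossed_def)
    then have "\<phi> k \<in> c ` carrier X" for k using c(2) by (simp add: bij_betw_def)
    then show "c \<circ> (inv_into (carrier X) c \<circ> \<phi>) = \<phi>" by (simp add: fun_eq_iff f_inv_into_f)
  qed
qed

text \<open>Reduces invertibility after \<open>\<R>(- \<rtimes> G/H)\<close> to invertibility after
  crossing with \<open>H\<close>. The algebras \<open>P\<close> and \<open>Q\<close> may live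
  outside the universe; \<open>A\<close> and \<open>B\<close> are isomorphic models inside it. The
  inclusion at the trivial coset changes \<open>\<R>(- \<rtimes> G/H)\<close> into the crossed
  product, and \<open>a\<close>, \<open>b\<close> change the models.\<close>

lemma RJ_isoI:
  fixes A B :: "('k, 'u, 'g) galg" and P :: "('k, 'b, 'g) galg" and Q :: "('k, 'c, 'g) galg"
  assumes P: "carrier P \<lesssim> U" and Q: "carrier Q \<lesssim> U"
    and a: "g_hom R G P A a" "bij_betw a (carrier P) (carrier A)"
        and b: "g_hom R G Q B b" "bij_betw b (carrier Q) (carrier B)"
    and f: "g_hom R G P Q f" and eq: "\<And>x. x \<in> carrier P \<Longrightarrow> F (a x) = b (f x)"
    and iso: "iso_arrow kk (J (crossed G H P) (crossed G H Q) ((\<circ>) f))"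
  shows "iso_arrow kk (RJ A B F)"
proof -
  note a' = g_hom_inverse[OF a] and b' = g_hom_inverse[OF b]
  have F: "g_hom R G A B F"
  proof (rule g_hom_cong[OF g_hom_comp[OF g_hom_comp[OF a' f] b(1)]])
    fix y assume "y \<in> carrier A"
    then obtain x where "x \<in> carrier P" "y = a x" using a(2) by (auto simp: bij_betw_def)
    then show "(b \<circ> (f \<circ> inv_into (carrier P) a)) y = F y"
      using eq inv_into_f_f[OF bij_betw_imp_inj_on[OF a(2)]] by simp
  qed
  note sP = sm_crossed_product[OF g_homD(1)[OF f] H P] and sQ = sm_crossed_product[OF g_homD(2)[OF f] H Q]
  note sA = sXH[OF g_homD(1)[OF F]] and sB = sXH[OF g_homD(2)[OF F]]
  note h = g_hom_nu_hom_crossed[OF _ H]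
  have "cmap H A B F \<cdot>\<^bsub>kk\<^esub> J (crossed G H P) (crossed G H A) ((\<circ>) a) =
      J (crossed G H Q) (crossed G H B) ((\<circ>) b) \<cdot>\<^bsub>kk\<^esub> J (crossed G H P) (crossed G H Q) ((\<circ>) f)"
    unfolding J_comp[OF sP sA sB h[OF a(1)] h[OF F], symmetric] J_comp[OF sP sQ sB h[OF f] h[OF b(1)], symmetric]
  proof (rule J_cong)
    interpret P: g_algebra R G P by (rule g_homD(1)[OF f])
    fix \<phi> assume "\<phi> \<in> carrier (crossed G H P)"
    then have "\<phi> k \<in> carrier P" for k using P.fin_fun_carrier[of \<phi> H k] by (simp add: crossed_def)
    then show "((\<circ>) F \<circ> (\<circ>) a) \<phi> = ((\<circ>) b \<circ> (\<circ>) f) \<phi>" using eq by (simp add: fun_eq_iff)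
  qed
  from iso_comp_square[OF J_Hom[OF sP sA h[OF a(1)]] J_Hom[OF sA sB h[OF F]] J_Hom[OF sP sQ h[OF f]] J_Hom[OF sQ sB
      h[OF b(1)]]
      this J_crossed_bij[OF P a] iso J_crossed_bij[OF Q b]]
  have "iso_arrow kk (cmap H A B F)" .
  then have "iso_arrow kk (RJ A B F \<cdot>\<^bsub>kk\<^esub> inc1 A)"
    unfolding inc1_natural[OF F]
    by (rule kk.iso_arrow_Comp[OF cmap_Hom[OF F H] _ inc1_props(3)[OF g_homD(2)[OF F]] inc1_props(2)[OF g_homD(2)[OF
        F]]])
  then show ?thesis
    by (rule kk.iso_arrow_Comp_cancel_right[OF inc1_props(3)[OF g_homD(1)[OF F]] inc1_props(2)[OF g_homD(1)[OF F]]
        RJ_Hom[OF F]])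
qed

lemma on_arr_comp_\<R>_crossed: "on_arr (j \<circ>\<^sub>F \<R>_crossed R G H) (A, B, f) = RJ A B f"
  using on_arr_\<R>_crossed[of A B f] by (simp add: func_comp_def)

lemma G_homotopy_invariant_crossed: "G_homotopy_invariant R G kk (j \<circ>\<^sub>F \<R>_crossed R G H)"
  unfolding G_homotopy_invariant_def
proof
  fix A :: "('k, 'u, 'g) galg" assume "A \<in> Ob (GAlg R G)"
  then have A: "g_algebra R G A" by (simp add: GAlg_simps)
  interpret A: g_algebra R G A by (rule A)
  let ?P = "poly_galg A" and ?D = "crossed G H A"
  have P: "g_algebra R G ?P" by (rule g_algebra_poly[OF A])
  have Pu: "carrier ?P \<lesssim> U" 
    using lepoll_fin_fun[OF universe small_nat small_carrier[of A]] by (simp add: A.poly_alg_simps)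
  have k: "g_hom R G A ?P (poly_const A)"
    using A P A.nu_hom_poly_const by (auto simp: g_hom_def equivariant_def poly_const_def fun_eq_iff nu_hom_def
        lin_map_def)
  note D = sXH[OF A] and C = sm_crossed_product[OF P H Pu]
  note kD = nu_algebra.nu_hom_poly_const[OF sm_alg[OF D]] and kC = g_hom_nu_hom_crossed[OF k H]
  note fl = flip_crossed_poly[OF A H]
  \<comment> \<open>After exchanging variables, the crossed inclusion of constants is the inclusion
    of constants for \<open>A \<rtimes> H\<close>, so homotopy invariance of \<open>j\<close>
    applies.\<close>
  have "J ?D (poly_alg ?D) (flip \<circ> (\<circ>) (poly_const A)) = J ?D (poly_alg ?D) (poly_const ?D)"
    by (rule J_cong) (auto simp: flip_def poly_const_def crossed_def fun_eq_iff)
  then have "iso_arrow kk (J (crossed G H ?P) (poly_alg ?D) flip \<cdot>\<^bsub>kk\<^esub> J ?D (crossed G H ?P) ((\<circ>) (poly_const A)))"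
    using J_comp[OF D C sm_poly[OF D] kC fl(1)] J_poly_const_iso[OF D] by simp
  then have "iso_arrow kk (J ?D (crossed G H ?P) ((\<circ>) (poly_const A)))"
    by (rule kk.iso_arrow_Comp_cancel_left[OF J_Hom[OF D C kC] J_Hom[OF C sm_poly[OF D] fl(1)] J_bij[OF C sm_poly[OF
        D] fl]])
  note iso = this
  have id: "g_hom R G A A id" "bij_betw id (carrier A) (carrier A)"
    using A by (simp_all add: g_hom_def nu_hom_id equivariant_def)
  have Pu': "carrier ?P \<lesssim> (UNIV :: 'u set)" using Pu by (simp only: U)
  have "iso_arrow kk (RJ A (copy_galg ?P :: ('k, 'u, 'g) galg) (restrict (copy_map (carrier ?P) \<circ> poly_const A)
      (carrier A)))"
  proof (rule RJ_isoI[OF small_carrier Pu id g_hom_copy[OF P Pu'] g_algebra_copy(4)[OF P Pu'] k])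
    show "iso_arrow kk (J ?D (crossed G H ?P) ((\<circ>) (poly_const A)))" by (rule iso)
  qed simp
  then show "iso_arrow kk (on_arr (j \<circ>\<^sub>F \<R>_crossed R G H) (into_gcopy A ?P (poly_const A)))"
    unfolding into_gcopy_def on_arr_comp_\<R>_crossed .
qed

end

section \<open>\<open>G\<close>-stability of \<open>\<R>(- \<rtimes> G/H)\<close>\<close>

lemma end_incl_eq: "end_incl A M q = (case q of (Inl x, Inl y) \<Rightarrow> M (x, y) | _ \<Rightarrow> \<zero>\<^bsub>A\<^esub>)"
proof (cases q)
  case (Pair u v)
  then show ?thesis by (cases u; cases v) simp_all
qed

lemma end_incl_fsingle:
  fixes x y :: 'x
  shows "end_incl A (fsingle A (x, y) a) = fsingle A (Inl x :: 'x + 'y, Inl y) a"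
proof
  fix q :: "('x + 'y) \<times> ('x + 'y)"
  obtain u v where "q = (u, v)" by (cases q)
  then show "end_incl A (fsingle A (x, y) a) q = fsingle A (Inl x, Inl y) a q"
    by (cases u; cases v) (auto simp: fsingle_def)
qed

lemma end_incl_closed:
  assumes A: "\<zero>\<^bsub>A\<^esub> \<in> carrier A" and M: "M \<in> fin_fun (X \<times> X) A"
  shows "end_incl A M \<in> fin_fun ((Inl ` X \<union> Inr ` Y) \<times> (Inl ` X \<union> Inr ` Y)) A"
proof -
  have "{q. end_incl A M q \<noteq> \<zero>\<^bsub>A\<^esub>} \<subseteq> map_prod Inl Inl ` {q. M q \<noteq> \<zero>\<^bsub>A\<^esub>}"
  proof
    fix q assume q: "q \<in> {q. end_incl A M q \<noteq> \<zero>\<^bsub>A\<^esub>}"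
    obtain u v where uv: "q = (u, v)" by (cases q)
    then show "q \<in> map_prod Inl Inl ` {q. M q \<noteq> \<zero>\<^bsub>A\<^esub>}"
      using q by (cases u; cases v) (auto simp: image_iff)
  qed
  moreover have c: "M q \<in> carrier A" for q
    using M A unfolding fin_fun_def mem_Collect_eq by metis
  ultimately have f: "finite {q. end_incl A M q \<noteq> \<zero>\<^bsub>A\<^esub>}" using fin_fun_finite[OF M] finite_surj by blast
  have "end_incl A M (u, v) \<in> carrier A \<and>
      ((u, v) \<notin> (Inl ` X \<union> Inr ` Y) \<times> (Inl ` X \<union> Inr ` Y) \<longrightarrow> end_incl A M (u, v) = \<zero>\<^bsub>A\<^esub>)" for u v
    using M A c by (cases u; cases v) (auto simp: fin_fun_def image_iff)
  then show ?thesis using f by (simp add: fin_fun_def)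
qed

lemma lin_map_end_incl:
  assumes A: "nu_algebra R A"
  shows "lin_map R (mat_alg X A) (mat_alg (Inl ` X \<union> Inr ` Y) A) (end_incl A)"
proof (intro lin_mapI; unfold mat_alg_simps)
  interpret A: nu_algebra R A by (rule A)
  fix M assume "M \<in> fin_fun (X \<times> X) A"
  then show "end_incl A M \<in> fin_fun ((Inl ` X \<union> Inr ` Y) \<times> (Inl ` X \<union> Inr ` Y)) A"
      by (rule end_incl_closed[OF A.zero_closed])
qed (use nu_algebra_module[OF A] in \<open>auto simp: fun_eq_iff end_incl_eq module.smult_r_null
      abelian_monoid.l_zero[OF abelian_group.axioms(1)[OF module_abelian_group]] abelian_monoid.zero_closed[OF
          abelian_group.axioms(1)[OF module_abelian_group]] split: sum.split\<close>)

lemma nu_hom_end_incl: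
  assumes A: "nu_algebra R A"
  shows "nu_hom R (mat_alg X A) (mat_alg (Inl ` X \<union> Inr ` Y) A) (end_incl A)"
proof (rule nu_homI[OF lin_map_end_incl[OF A]])
  interpret A: nu_algebra R A by (rule A)
  let ?M = "mat_alg X A" and ?W = "Inl ` X \<union> Inr ` Y"
  let ?N = "mat_alg ?W A"
  have N: "nu_algebra R ?N" "nu_algebra R ?M" by (rule nu_algebra_mat[OF A])+
  note l = lin_map_end_incl[OF A, of X Y]
  note z = lin_map_zero[OF nu_algebra_module[OF N(2)] nu_algebra_module[OF N(1)] l]
  fix M1 M2 assume M: "M1 \<in> carrier ?M" "M2 \<in> carrier ?M"
  show "end_incl A (M1 \<otimes>\<^bsub>?M\<^esub> M2) = end_incl A M1 \<otimes>\<^bsub>?N\<^esub> end_incl A M2"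
  proof (rule mat_mult_eqI[OF A N(1) l l l _ M])
    fix x y z w a b assume s: "x \<in> X" "y \<in> X" "z \<in> X" "w \<in> X" "a \<in> carrier A" "b \<in> carrier A"
    then have s': "Inl x \<in> ?W" "Inl y \<in> ?W" "Inl z \<in> ?W" "Inl w \<in> ?W" by simp_all
    show "end_incl A (fsingle A (x, y) a \<otimes>\<^bsub>?M\<^esub> fsingle A (z, w) b) =
        end_incl A (fsingle A (x, y) a) \<otimes>\<^bsub>?N\<^esub> end_incl A (fsingle A (z, w) b)"
      unfolding end_incl_fsingle mat_fsingle_mult[OF A s] mat_fsingle_mult[OF A s' s(5,6)]
      using z by (simp add: end_incl_fsingle)
  qed
qed

section \<open>Sums of representations and the inclusion of a block\<close>

locale rep_pair = g_algebra R G A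
  for R :: "('k, 'r) ring_scheme" and G :: "('g, 's) monoid_scheme" and A :: "('k, 'a, 'g) galg" +
  fixes X :: "'x set" and Y :: "'y set" and \<rho> \<sigma>
  assumes \<rho>: "is_rep R G X \<rho>" and \<sigma>: "is_rep R G Y \<sigma>"
begin

abbreviation "W \<equiv> Inl ` X \<union> Inr ` Y"
abbreviation "\<omega> \<equiv> rep_sum R \<rho> \<sigma>"

lemma Collect_W: "{w \<in> W. P w} = Inl ` {x \<in> X. P (Inl x)} \<union> Inr ` {y \<in> Y. P (Inr y)}"
  by auto

text \<open>The matrices are block diagonal: a row is supported in its own block, so the sum for a
  product is reindexed over that block, and if the column lies in the other block every term is a
  product with zero.\<close>

lemma is_rep_sum: "is_rep R G W \<omega>"
  unfolding is_rep_def
proof (intro conjI ballI)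
  fix g u v assume "g \<in> carrier G" "u \<in> W" "v \<in> W"
  then show "\<omega> g u v \<in> carrier R" using \<rho> \<sigma> by (auto simp: is_rep_def)
next
  fix g u assume "g \<in> carrier G" "u \<in> W"
  then show "finite {v \<in> W. \<omega> g u v \<noteq> \<zero>\<^bsub>R\<^esub>}" "finite {v \<in> W. \<omega> g v u \<noteq> \<zero>\<^bsub>R\<^esub>}"
    unfolding Collect_W using \<rho> \<sigma> by (auto simp: is_rep_def)
next
  fix u v assume "u \<in> W" "v \<in> W"
  moreover have "\<rho> \<one>\<^bsub>G\<^esub> x y = (if x = y then \<one>\<^bsub>R\<^esub> else \<zero>\<^bsub>R\<^esub>)" if "x \<in> X" "y \<in> X" for x y
    using \<rho> that by (simp add: is_rep_def)
  moreover have "\<sigma> \<one>\<^bsub>G\<^esub> x y = (if x = y then \<one>\<^bsub>R\<^esub> else \<zero>\<^bsub>R\<^esub>)" if "x \<in> Y" "y \<in> Y" for x y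
    using \<sigma> that by (simp add: is_rep_def)
  ultimately show "\<omega> \<one>\<^bsub>G\<^esub> u v = (if u = v then \<one>\<^bsub>R\<^esub> else \<zero>\<^bsub>R\<^esub>)"
    by (auto split: if_splits)
next
  fix g h u w assume gh: "g \<in> carrier G" "h \<in> carrier G" and uw: "u \<in> W" "w \<in> W"
  have c: "\<rho> g x y \<in> carrier R" if "g \<in> carrier G" "x \<in> X" "y \<in> X" for g x y using \<rho> that by (auto simp: is_rep_def)
  have d: "\<sigma> g x y \<in> carrier R" if "g \<in> carrier G" "x \<in> Y" "y \<in> Y" for g x y using \<sigma> that by (auto simp: is_rep_def)
  have m: "\<rho> (g \<otimes>\<^bsub>G\<^esub> h) x z = (\<Oplus>\<^bsub>R\<^esub>y\<in>{y\<in>X. \<rho> g x y \<noteq> \<zero>\<^bsub>R\<^esub>}. \<rho> g x y \<otimes>\<^bsub>R\<^esub> \<rho> h y z)" if "x \<in> X" "z \<in> X" for x z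
    using \<rho> gh that by (auto simp: is_rep_def)
  have n: "\<sigma> (g \<otimes>\<^bsub>G\<^esub> h) x z = (\<Oplus>\<^bsub>R\<^esub>y\<in>{y\<in>Y. \<sigma> g x y \<noteq> \<zero>\<^bsub>R\<^esub>}. \<sigma> g x y \<otimes>\<^bsub>R\<^esub> \<sigma> h y z)" if "x \<in> Y" "z \<in> Y" for x z
    using \<sigma> gh that by (auto simp: is_rep_def)
  have z: "(\<Oplus>\<^bsub>R\<^esub>y\<in>{y\<in>X. \<rho> g x y \<noteq> \<zero>\<^bsub>R\<^esub>}. \<rho> g x y \<otimes>\<^bsub>R\<^esub> \<zero>\<^bsub>R\<^esub>) = \<zero>\<^bsub>R\<^esub>" if "x \<in> X" for x
    using c[OF gh(1) that] by (intro R.add.finprod_one_eqI) auto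
  have z': "(\<Oplus>\<^bsub>R\<^esub>y\<in>{y\<in>Y. \<sigma> g x y \<noteq> \<zero>\<^bsub>R\<^esub>}. \<sigma> g x y \<otimes>\<^bsub>R\<^esub> \<zero>\<^bsub>R\<^esub>) = \<zero>\<^bsub>R\<^esub>" if "x \<in> Y" for x
    using d[OF gh(1) that] by (intro R.add.finprod_one_eqI) auto
  note e = R.add.finprod_reindex[symmetric]
  show "\<omega> (g \<otimes>\<^bsub>G\<^esub> h) u w = (\<Oplus>\<^bsub>R\<^esub>v\<in>{v \<in> W. \<omega> g u v \<noteq> \<zero>\<^bsub>R\<^esub>}. \<omega> g u v \<otimes>\<^bsub>R\<^esub> \<omega> h v w)"
  proof (cases u)
    case (Inl x)
    then have x: "x \<in> X" using uw by auto
    have "(\<Oplus>\<^bsub>R\<^esub>v\<in>Inl ` {y \<in> X. \<rho> g x y \<noteq> \<zero>\<^bsub>R\<^esub>}. \<omega> g u v \<otimes>\<^bsub>R\<^esub> \<omega> h v w) =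
        (\<Oplus>\<^bsub>R\<^esub>y\<in>{y \<in> X. \<rho> g x y \<noteq> \<zero>\<^bsub>R\<^esub>}. \<omega> g u (Inl y) \<otimes>\<^bsub>R\<^esub> \<omega> h (Inl y) w)"
      by (rule R.add.finprod_reindex) (use Inl x uw gh c in \<open>auto simp: Pi_def\<close>)
    also have "\<dots> = \<omega> (g \<otimes>\<^bsub>G\<^esub> h) u w"
      using uw x Inl m z by (cases w) auto
    finally show ?thesis unfolding Collect_W using Inl by simp
  next
    case (Inr x)
    then have x: "x \<in> Y" using uw by auto
    have "(\<Oplus>\<^bsub>R\<^esub>v\<in>Inr ` {y \<in> Y. \<sigma> g x y \<noteq> \<zero>\<^bsub>R\<^esub>}. \<omega> g u v \<otimes>\<^bsub>R\<^esub> \<omega> h v w) =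
        (\<Oplus>\<^bsub>R\<^esub>y\<in>{y \<in> Y. \<sigma> g x y \<noteq> \<zero>\<^bsub>R\<^esub>}. \<omega> g u (Inr y) \<otimes>\<^bsub>R\<^esub> \<omega> h (Inr y) w)"
      by (rule R.add.finprod_reindex) (use Inr x uw gh d in \<open>auto simp: Pi_def\<close>)
    also have "\<dots> = \<omega> (g \<otimes>\<^bsub>G\<^esub> h) u w"
      using uw x Inr n z' by (cases w) auto
    finally show ?thesis unfolding Collect_W using Inr by simp
  qed
qed

sublocale X: end_rep R G A X \<rho>
  by (intro end_rep.intro end_rep_axioms.intro matrix_action.intro g_algebra_axioms nu_algebra_axioms \<rho>)

sublocale W: end_rep R G A W \<omega>
  by (intro end_rep.intro end_rep_axioms.intro matrix_action.intro g_algebra_axioms nu_algebra_axioms is_rep_sum)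

abbreviation "\<iota> \<equiv> end_incl A :: ('x \<times> 'x \<Rightarrow> 'a) \<Rightarrow> ('x + 'y) \<times> ('x + 'y) \<Rightarrow> 'a"

lemmas \<iota>_lin = lin_map_end_incl[OF nu_algebra_axioms, of X Y]

text \<open>\<open>\<omega> g\<close> restricts to \<open>\<rho> g\<close> on the first block and
  mixes no blocks, so the block inclusion commutes with the multipliers. This gives both its
  equivariance and its compatibility with the twists.\<close>

lemma end_incl_action:
  assumes g: "g \<in> carrier G" and M: "M \<in> carrier X.MX"
  shows "\<iota> (X.L (\<rho> g) M) = W.L (\<omega> g) (\<iota> M)" "\<iota> (X.Rt (\<rho> g) M) = W.Rt (\<omega> g) (\<iota> M)"
proof -
  have "(\<iota> \<circ> X.L (\<rho> g)) M = (W.L (\<omega> g) \<circ> \<iota>) M"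
  proof (rule mat_lin_eqI[OF nu_algebra_axioms W.nu_algebra_MX lin_map_comp[OF X.lin_map_lmul[OF X.fm[OF g]] \<iota>_lin]
        lin_map_comp[OF \<iota>_lin W.lin_map_lmul[OF W.fm[OF g]]] _ M])
    fix x y a assume s: "x \<in> X" "y \<in> X" "a \<in> carrier A"
    then have s': "Inl x \<in> W" "Inl y \<in> W" by simp_all
    have "\<iota> (X.L (\<rho> g) (fsingle A (x, y) a)) (u, v) = W.L (\<omega> g) (fsingle A (Inl x, Inl y) a) (u, v)" for u v
      unfolding W.lmul_fsingle[OF W.fm[OF g] s' s(3)]
      using s by (cases u; cases v) (auto simp: X.lmul_fsingle[OF X.fm[OF g] s])
    then show "(\<iota> \<circ> X.L (\<rho> g)) (fsingle A (x, y) a) = (W.L (\<omega> g) \<circ> \<iota>) (fsingle A (x, y) a)"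
      by (auto simp: end_incl_fsingle)
  qed
  then show "\<iota> (X.L (\<rho> g) M) = W.L (\<omega> g) (\<iota> M)" by simp
  have "(\<iota> \<circ> X.Rt (\<rho> g)) M = (W.Rt (\<omega> g) \<circ> \<iota>) M"
  proof (rule mat_lin_eqI[OF nu_algebra_axioms W.nu_algebra_MX lin_map_comp[OF X.lin_map_rmul[OF X.fm[OF g]] \<iota>_lin]
        lin_map_comp[OF \<iota>_lin W.lin_map_rmul[OF W.fm[OF g]]] _ M])
    fix x y a assume s: "x \<in> X" "y \<in> X" "a \<in> carrier A"
    then have s': "Inl x \<in> W" "Inl y \<in> W" by simp_all
    have "\<iota> (X.Rt (\<rho> g) (fsingle A (x, y) a)) (u, v) = W.Rt (\<omega> g) (fsingle A (Inl x, Inl y) a) (u, v)" for u v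
      unfolding W.rmul_fsingle[OF W.fm[OF g] s' s(3)]
      using s by (cases u; cases v) (auto simp: X.rmul_fsingle[OF X.fm[OF g] s])
    then show "(\<iota> \<circ> X.Rt (\<rho> g)) (fsingle A (x, y) a) = (W.Rt (\<omega> g) \<circ> \<iota>) (fsingle A (x, y) a)"
      by (auto simp: end_incl_fsingle)
  qed
  then show "\<iota> (X.Rt (\<rho> g) M) = W.Rt (\<omega> g) (\<iota> M)" by simp
qed

lemma end_incl_comp:
  assumes "f \<zero>\<^bsub>A\<^esub> = \<zero>\<^bsub>B\<^esub>"
  shows "f \<circ> \<iota> M = end_incl B (f \<circ> M)"
proof
  fix q :: "('x + 'y) \<times> ('x + 'y)"
  obtain u v where "q = (u, v)" by (cases q)
  then show "(f \<circ> \<iota> M) q = end_incl B (f \<circ> M) q" using assms by (cases u; cases v) simp_all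
qed

lemma g_hom_end_incl: "g_hom R G X.E W.E \<iota>"
proof -
  have "\<iota> (gact X.E g M) = gact W.E g (\<iota> M)" if g: "g \<in> carrier G" and M: "M \<in> carrier X.MX" for g M
  proof -
    have gi: "inv\<^bsub>G\<^esub> g \<in> carrier G" using g by simp
    note gM = X.map_gact_closed[OF g M] and i = lin_mapD(1)[OF \<iota>_lin]
    show ?thesis
      unfolding X.end_gact[OF g M] W.end_gact[OF g i[OF M]] X.cact_def W.cact_def
        end_incl_action(1)[OF g X.R_closed[OF gi gM]] end_incl_action(2)[OF gi gM]
        end_incl_comp[where f = "gact A g" and B = A, OF gact_zero[OF g]] ..
  qed
  moreover have "nu_hom R X.E W.E \<iota>" using nu_hom_end_incl[OF nu_algebra_axioms, of X Y]
      by (simp add: nu_hom_def lin_map_def)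
  ultimately show ?thesis using X.g_algebra_end W.g_algebra_end by (simp add: g_hom_def equivariant_def)
qed

end

text \<open>The disjoint union embeds into bool \<times> Z, whose first factor is absorbed because
  \<open>Z\<close> is infinite.\<close>

lemma (in stable_functor) lepoll_Plus_Z:
  assumes "X \<lesssim> Z" "Y \<lesssim> Z"
  shows "Inl ` X \<union> Inr ` Y \<lesssim> Z"
proof -
  obtain e f where e: "inj_on e X" "e ` X \<subseteq> Z" and f: "inj_on f Y" "f ` Y \<subseteq> Z" using assms by (auto simp: lepoll_def)
  let ?h = "case_sum (\<lambda>x. (True, e x)) (\<lambda>y. (False, f y))"
  have "inj_on ?h (Inl ` X \<union> Inr ` Y)" 
    by (rule inj_onI) (auto simp: inj_on_eq_iff[OF e(1)] inj_on_eq_iff[OF f(1)])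
  moreover have "?h ` (Inl ` X \<union> Inr ` Y) \<subseteq> (UNIV :: bool set) \<times> Z" using e f by auto
  ultimately have "Inl ` X \<union> Inr ` Y \<lesssim> (UNIV :: bool set) \<times> Z" unfolding lepoll_def by blast
  also have "\<dots> \<lesssim> Z"
    by (rule lepoll_Times_infinite[OF Z_infinite finite_lepoll_infinite[OF Z_infinite] lepoll_refl]) simp
  finally show ?thesis .
qed

context crossed_excisive
begin

text \<open>The isomorphisms of \<open>twist\<close> turn the crossed block inclusion into the
  inclusion of matrices over \<open>X\<close> into matrices over the sum, with entries in
  \<open>A \<rtimes> H\<close>. That map sends the corner at x0 to the corner at
  \<open>Inl x0\<close>, and both corners are invertible by \<open>J_corner_iso_small\<close>;
  two-of-three does the rest.\<close>

lemma J_end_incl_iso: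
  fixes A :: "('k, 'u, 'g) galg" and X :: "'y set" and Y :: "'z set"
  assumes A: "g_algebra R G A" and X: "X \<noteq> {}" "X \<lesssim> Z" and Y: "Y \<lesssim> Z"
    and \<rho>: "is_rep R G X \<rho>" and \<sigma>: "is_rep R G Y \<sigma>"
  shows "iso_arrow kk (J (crossed G H (end_galg G R X \<rho> A))
    (crossed G H (end_galg G R (Inl ` X \<union> Inr ` Y) (rep_sum R \<rho> \<sigma>) A)) ((\<circ>) (end_incl A)))"
proof -
  interpret rep_pair R G A X Y \<rho> \<sigma> by (intro rep_pair.intro rep_pair_axioms.intro A \<rho> \<sigma>)
  let ?D = "crossed G H A" and ?C = "crossed G H X.E" and ?C' = "crossed G H W.E"
  have W: "W \<lesssim> Z" by (rule lepoll_Plus_Z[OF X(2) Y])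
  have XU: "X \<lesssim> U" "W \<lesssim> U" using lepoll_trans[OF X(2) Z_small] lepoll_trans[OF W Z_small] .
  have As: "sm (mat_alg S A)" if "S \<lesssim> U" for S :: "'q set"
  proof (rule smI)
    show "nu_algebra R (mat_alg S A)" by (rule nu_algebra_mat) (rule nu_algebra_axioms)
    show "carrier (mat_alg S A) \<lesssim> U"
      unfolding mat_alg_simps by (rule lepoll_fin_fun[OF universe lepoll_Times_infinite[OF universe that that]
          small_carrier])
  qed
  have D: "sm ?D" by (rule sXH[OF A])
  have C: "sm ?C" and C': "sm ?C'"
    using sm_crossed_product[OF X.g_algebra_end H] sm_crossed_product[OF W.g_algebra_end H] As[OF XU(1)] As[OF XU(2)]
    by (simp_all add: sm_def)
  have MX: "sm (mat_alg X ?D)" and MW: "sm (mat_alg W ?D)" using sm_mat[OF D] XU by blast+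
  interpret H: subgroup H G by (rule H)
  interpret D: nu_algebra R ?D by (rule sm_alg[OF D])
  interpret E: g_algebra R G X.E by (rule X.g_algebra_end)
  interpret E': g_algebra R G W.E by (rule W.g_algebra_end)
  interpret MW: nu_algebra R "mat_alg W ?D" by (rule sm_alg[OF MW])
  obtain \<tau> where \<tau>: "nu_hom R ?C (mat_alg X ?D) \<tau>" "bij_betw \<tau> (carrier ?C) (carrier (mat_alg X ?D))"
    "\<And>h M. \<lbrakk>h \<in> H; M \<in> carrier X.MX\<rbrakk> \<Longrightarrow> \<tau> (fsingle X.E h M) = fsingle A h \<circ> X.Rt (\<rho> h) M"
    by (rule X.twist[OF H]) (rule that)
  obtain \<tau>' where \<tau>': "nu_hom R ?C' (mat_alg W ?D) \<tau>'" "bij_betw \<tau>' (carrier ?C') (carrier (mat_alg W ?D))"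
    "\<And>h M. \<lbrakk>h \<in> H; M \<in> carrier W.MX\<rbrakk> \<Longrightarrow> \<tau>' (fsingle W.E h M) = fsingle A h \<circ> W.Rt (\<omega> h) M"
    by (rule W.twist[OF H]) (rule that)
  note \<iota> = g_hom_nu_hom_crossed[OF g_hom_end_incl H]
  note \<iota>D = nu_hom_end_incl[OF sm_alg[OF D], of X Y]
  obtain x0 where x0: "x0 \<in> X" using X(1) by blast
  have x0': "Inl x0 \<in> W" using x0 by simp
  note c = nu_hom_corner[OF sm_alg[OF D] x0] and c' = nu_hom_corner[OF sm_alg[OF D] x0']
  have "J ?D (mat_alg W ?D) (end_incl ?D \<circ> corner ?D x0) = J ?D (mat_alg W ?D) (corner ?D (Inl x0))"
    by (rule J_cong) (simp add: corner_fsingle end_incl_fsingle)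
  then have "iso_arrow kk (J (mat_alg X ?D) (mat_alg W ?D) (end_incl ?D) \<cdot>\<^bsub>kk\<^esub> J ?D (mat_alg X ?D) (corner ?D x0))"
    using J_comp[OF D MX MW c \<iota>D] J_corner_iso_small[OF D W x0'] by simp
  then have iso: "iso_arrow kk (J (mat_alg X ?D) (mat_alg W ?D) (end_incl ?D))"
    by (rule kk.iso_arrow_Comp_cancel_right[OF J_Hom[OF D MX c] J_corner_iso_small[OF D X(2) x0] J_Hom[OF MX MW \<iota>D]])
  have "(\<tau>' \<circ> (\<circ>) \<iota>) \<phi> = (end_incl ?D \<circ> \<tau>) \<phi>" if "\<phi> \<in> carrier ?C" for \<phi>
  proof (rule lin_map_fs_eqI[where f = "\<tau>' \<circ> (\<circ>) \<iota>" and g = "end_incl ?D \<circ> \<tau>", OF E.module_axioms MW.module_axioms])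
    show "lin_map R (fs_alg H X.E (crossed_mult G X.E)) (mat_alg W ?D) (\<tau>' \<circ> (\<circ>) \<iota>)"
      using lin_map_comp[OF nu_homD(1)[OF \<iota>] nu_homD(1)[OF \<tau>'(1)]] unfolding crossed_def[of G H X.E] .
    show "lin_map R (fs_alg H X.E (crossed_mult G X.E)) (mat_alg W ?D) (end_incl ?D \<circ> \<tau>)"
      using lin_map_comp[OF nu_homD(1)[OF \<tau>(1)] nu_homD(1)[OF \<iota>D]] unfolding crossed_def[of G H X.E] .
    show "\<phi> \<in> fin_fun H X.E" using that by (simp add: crossed_def)
    fix h M assume h: "h \<in> H" and "M \<in> carrier X.E"
    then have M: "M \<in> carrier X.MX" by simp
    have g: "h \<in> carrier G" using h by simp
    have "lin_map R A ?D (fsingle A h)" unfolding crossed_def by (rule lin_map_fsingle[OF module_axioms h])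
    then have "fsingle A h \<zero>\<^bsub>A\<^esub> = \<zero>\<^bsub>?D\<^esub>" by (rule lin_map_zero[OF module_axioms D.module_axioms])
    note i = end_incl_comp[where f = "fsingle A h" and B = ?D, OF this]
    have "\<iota> \<circ> fsingle X.E h M = fsingle W.E h (\<iota> M)"
      by (rule comp_fsingle[OF E.module_axioms E'.module_axioms nu_homD(1)[OF g_homD(3)[OF g_hom_end_incl]]])
    \<comment> \<open>Compatibility of the two twists on a matrix in degree h: right multiplication
      by \<open>\<omega> h\<close> on the included block is right multiplication by
      \<open>\<rho> h\<close> before inclusion.\<close>
    then have "(\<tau>' \<circ> (\<circ>) \<iota>) (fsingle X.E h M) = fsingle A h \<circ> W.Rt (\<omega> h) (\<iota> M)"
      using \<tau>'(3)[OF h lin_mapD(1)[OF \<iota>_lin M]] by simp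
    also have "\<dots> = end_incl ?D (fsingle A h \<circ> X.Rt (\<rho> h) M)"
      unfolding end_incl_action(2)[OF g M, symmetric] by (rule i)
    also have "\<dots> = (end_incl ?D \<circ> \<tau>) (fsingle X.E h M)" using \<tau>(3)[OF h M] by simp
    finally show "(\<tau>' \<circ> (\<circ>) \<iota>) (fsingle X.E h M) = (end_incl ?D \<circ> \<tau>) (fsingle X.E h M)" .
  qed
  then have "J ?C (mat_alg W ?D) (\<tau>' \<circ> (\<circ>) \<iota>) = J ?C (mat_alg W ?D) (end_incl ?D \<circ> \<tau>)" by (rule J_cong)
  then have "J ?C' (mat_alg W ?D) \<tau>' \<cdot>\<^bsub>kk\<^esub> J ?C ?C' ((\<circ>) \<iota>) =
      J (mat_alg X ?D) (mat_alg W ?D) (end_incl ?D) \<cdot>\<^bsub>kk\<^esub> J ?C (mat_alg X ?D) \<tau>"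
    using J_comp[OF C C' MW \<iota> \<tau>'(1)] J_comp[OF C MX MW \<tau>(1) \<iota>D] by simp
  from iso_comp_square'[OF J_Hom[OF C C' \<iota>] J_Hom[OF C' MW \<tau>'(1)] J_Hom[OF C MX \<tau>(1)] J_Hom[OF MX MW \<iota>D] this
      J_bij[OF C' MW \<tau>'(1,2)] J_bij[OF C MX \<tau>(1,2)] iso]
  show ?thesis .
qed

text \<open>The bound \<open>Z\<close> on the bases keeps the endomorphism algebras small, so that
  \<open>RJ_isoI\<close> compares their copies with the originals and only
  \<open>J_end_incl_iso\<close> remains.\<close>

lemma G_stable_crossed:
  assumes Z: "\<And>X :: (nat \<times> 'g) set. X \<lesssim> (UNIV :: nat set) \<times> carrier G \<Longrightarrow> X \<lesssim> Z"
  shows "G_stable R G kk (j \<circ>\<^sub>F \<R>_crossed R G H)"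
  unfolding G_stable_def
proof (intro ballI allI impI, elim conjE)
  fix A :: "('k, 'u, 'g) galg" and X Y :: "(nat \<times> 'g) set" and \<rho> \<sigma>
  assume "A \<in> Ob (GAlg R G)" and "X \<noteq> {}" "X \<lesssim> (UNIV :: nat set) \<times> carrier G" "Y \<lesssim> (UNIV :: nat set) \<times> carrier G"
    and \<rho>: "is_rep R G X \<rho>" and \<sigma>: "is_rep R G Y \<sigma>"
  then have A: "g_algebra R G A" and X: "X \<noteq> {}" "X \<lesssim> Z" and Y: "Y \<lesssim> Z" using Z by (simp_all add: GAlg_simps)
  interpret rep_pair R G A X Y \<rho> \<sigma> by (intro rep_pair.intro rep_pair_axioms.intro A \<rho> \<sigma>)
  have W: "W \<lesssim> Z" by (rule lepoll_Plus_Z[OF X(2) Y])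
  have s: "carrier (mat_alg S A) \<lesssim> U" if "S \<lesssim> Z" for S :: "'q set"
    unfolding mat_alg_simps
    by (rule lepoll_fin_fun[OF universe lepoll_Times_infinite[OF universe] small_carrier]) (rule lepoll_trans[OF that
        Z_small])+
  have sX: "carrier X.E \<lesssim> U" and sW: "carrier W.E \<lesssim> U" using s[OF X(2)] s[OF W] by simp_all
  note sX' = sX[unfolded U] and sW' = sW[unfolded U]
  let ?X = "copy_galg X.E :: ('k, 'u, 'g) galg" and ?W = "copy_galg W.E :: ('k, 'u, 'g) galg"
  have "iso_arrow kk (RJ ?X ?W (copy_fun X.E W.E \<iota>))"
  proof (rule RJ_isoI[OF sX sW g_hom_copy[OF X.g_algebra_end sX'] g_algebra_copy(4)[OF X.g_algebra_end sX']
        g_hom_copy[OF W.g_algebra_end sW'] g_algebra_copy(4)[OF W.g_algebra_end sW'] g_hom_end_incl])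
    fix M assume "M \<in> carrier X.E"
    then show "copy_fun X.E W.E \<iota> (copy_map (carrier X.E) M :: 'u) = (copy_map (carrier W.E) (\<iota> M) :: 'u)"
      using copy_map_inv[OF sX'] by (simp add: copy_fun_def)
  qed (rule J_end_incl_iso[OF A X Y \<rho> \<sigma>])
  then show "iso_arrow kk (on_arr (j \<circ>\<^sub>F \<R>_crossed R G H) (copy_garr X.E W.E \<iota>))"
    unfolding copy_garr_def on_arr_comp_\<R>_crossed .
qed

end

section \<open>Application of the universal property of \<open>jG\<close>\<close>

theorem proposition4p17:
  fixes R :: "('k, 'r) ring_scheme" and G :: "('g, 's) monoid_scheme" and H :: "'g set"
    and kk kkG :: "('o, 'm) tricat"
    and j :: "(('k, 'u) module, (('k, 'u) module, 'u) carr, 'o, 'm) func"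
    and d :: "(('k, 'u) module, 'u) carr \<times> (('k, 'u) module, 'u) carr \<Rightarrow> 'm"
    and jG :: "(('k, 'u, 'g) galg, (('k, 'u, 'g) galg, 'u) carr, 'o, 'm) func"
    and dG :: "(('k, 'u, 'g) galg, 'u) carr \<times> (('k, 'u, 'g) galg, 'u) carr \<Rightarrow> 'm"
  assumes "cring R" and "group G" and "subgroup H G"
    and "infinite (UNIV :: 'u set)"
    and "carrier R \<lesssim> (UNIV :: 'u set)" and "carrier G \<lesssim> (UNIV :: 'u set)"
    and "is_kk R G kk j d" and "is_kkG R G kkG jG dG"
  shows "(\<exists>F \<phi>.
        triangulated_extension (GAlg R G) (GAlg_ext R G) kkG jG dG
          kk (j \<circ>\<^sub>F \<R>_crossed R G H) (crossed_boundary R G H kk j d) F \<phi> \<and>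
        (\<forall>F' \<phi>'.
          triangulated_extension (GAlg R G) (GAlg_ext R G) kkG jG dG
            kk (j \<circ>\<^sub>F \<R>_crossed R G H) (crossed_boundary R G H kk j d) F' \<phi>' \<longrightarrow>
          func_eq kkG F' F \<and> (\<forall>X\<in>Ob kkG. \<phi>' X = \<phi> X)))
    \<and> (\<forall>(i, p)\<in>GAlg_ext R G. \<forall>u\<in>carrier G.
        let A = Dom (GAlg R G) i; C = Cod (GAlg R G) p; L = conj_subgroup G H u in
        iso_arrow kk (nu R G H j u A) \<and> iso_arrow kk (\<Omega>\<^sub>a kk (nu R G H j u C)) \<and>
        nu R G H j u A \<cdot>\<^bsub>kk\<^esub> d (crossed_ext G L (i, p)) =
          crossed_boundary R G H kk j d (i, p) \<cdot>\<^bsub>kk\<^esub> \<Omega>\<^sub>a kk (nu R G H j u C))"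
proof -
  let ?U = "UNIV :: 'u set" and ?Z = "(UNIV :: nat set) \<times> carrier G"
  interpret G: group G by fact
  \<comment> \<open>\<open>?Z\<close> indexes the matrices in the stability of \<open>j\<close>. It
    has to fit into the universe, so that matrix algebras have copies, and to be infinite, so that
    an index can be left free.\<close>
  have Z: "?Z \<lesssim> ?U"
    using lepoll_Times_infinite[OF assms(4) _ assms(6)] assms(4) infinite_le_lepoll by blast
  have Zi: "infinite ?Z" using finite_cartesian_productD1[of "UNIV :: nat set" "carrier G"] G.one_closed by blast
  have GZ: "carrier G \<lesssim> ?Z" unfolding lepoll_def by (rule exI[of _ "Pair 0"]) (auto simp: inj_on_def)
  note kk = assms(7)[unfolded is_kk_def universal_excisive_def] and kkG = assms(8)[unfolded is_kkG_def
      universal_excisive_def]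
  have tri: "triangulated kk" and exc: "excisive (Alg R) (Alg_ext R) kk j d"
    and inv: "homotopy_invariant R kk j" "matrix_stable R ?Z kk j"
    using kk by blast+
  have j: "is_functor (Alg R) kk j" using exc by (simp add: excisive_def)
  interpret crossed_excisive R ?U ?Z kk j G H d
    by (intro crossed_excisive.intro crossed_functor.intro stable_functor.intro crossed_excisive_axioms.intro
        crossed_functor_axioms.intro) (fact assms refl Z Zi GZ tri exc inv j)+
  have "excisive (GAlg R G) (GAlg_ext R G) kkG jG dG" using kkG by blast
  \<comment> \<open>Excisive functors are functors between categories, so the hypothesis on
    \<open>jG\<close> already contains that \<open>GAlg R G\<close> is a category.\<close>
  then have cat: "category (GAlg R G :: (('k, 'u, 'g) galg, (('k, 'u, 'g) galg, 'u) carr) cat)"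
    by (simp add: excisive_def is_functor_def)
  \<comment> \<open>Existence and uniqueness of the triangulated functor, with its comparison
    isomorphism, both come from this instance. Its premises are excision, homotopy invariance and
    \<open>G\<close>-stability of the composite of \<open>j\<close> with
    \<open>\<R>(- \<rtimes> G/H)\<close>.\<close>
  note univ = conjunct2[OF conjunct2[OF conjunct2[OF kkG]], rule_format,
      of kk "j \<circ>\<^sub>F \<R>_crossed R G H" "crossed_boundary R G H kk j d"]
  have 1: "\<exists>F \<phi>. triangulated_extension (GAlg R G) (GAlg_ext R G) kkG jG dG
          kk (j \<circ>\<^sub>F \<R>_crossed R G H) (crossed_boundary R G H kk j d) F \<phi> \<and>
        (\<forall>F' \<phi>'. triangulated_extension (GAlg R G) (GAlg_ext R G) kkG jG dG
            kk (j \<circ>\<^sub>F \<R>_crossed R G H) (crossed_boundary R G H kk j d) F' \<phi>' \<longrightarrow>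
          func_eq kkG F' F \<and> (\<forall>X\<in>Ob kkG. \<phi>' X = \<phi> X))"
    by (rule univ) (intro conjI tri excisive_crossed[OF cat] G_homotopy_invariant_crossed G_stable_crossed)
  have "let A = Dom (GAlg R G) i; C = Cod (GAlg R G) p; L = conj_subgroup G H u in
        iso_arrow kk (nu R G H j u A) \<and> iso_arrow kk (\<Omega>\<^sub>a kk (nu R G H j u C)) \<and>
        nu R G H j u A \<cdot>\<^bsub>kk\<^esub> d (crossed_ext G L (i, p)) =
          crossed_boundary R G H kk j d (i, p) \<cdot>\<^bsub>kk\<^esub> \<Omega>\<^sub>a kk (nu R G H j u C)"
    if e: "(i, p) \<in> GAlg_ext R G" and u: "u \<in> carrier G" for i p u
  proof -
    obtain A B C f g where [simp]: "i = (A, B, f)" "p = (B, C, g)"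
      and s: "g_hom R G A B f" "g_hom R G B C g" "split_ext R A B C f g" by (rule GAlg_ext_split[OF e])
    note A = g_homD(1)[OF s(1)] and C = g_homD(2)[OF s(2)]
    show ?thesis
      using inc_props(1)[OF A u] Loop_iso[OF inc_props(1)[OF C u]] boundary_square[OF s u]
      by (simp add: Let_def GAlg_simps nu_eq[OF A u] nu_eq[OF C u] crossed_ext_eq)
  qed
  with 1 show ?thesis by blast
qed

end
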